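(* Let $M$ be a manifold with base point $m_0$ such that $\pi_1(M)=\pi_1(M,m_0)$ has no element of order 2 or 3, and let $\alpha:\pi_1(M)^3\to\pi_2(M)=\pi_2(M,m_0)$ be the map $\alpha(g,h,k)=y((ghk)^{-1},(hk)^{-1},k^{-1})$ defined in the context. Then the element $[\alpha]\in HS^3(\pi_1(M),\pi_2(M))$ is an invariant of the space $M$; that is, $\alpha\in ZS^3(\pi_1(M),\pi_2(M))$ and the class $[\alpha]$ depends only on $(M,m_0)$, not on the choices of the section $s$ and of the elements $x(g,h)$ used to define $\alpha$.
   Context: **$\Gamma(M)$.** The product $gh$ in $\pi_1(M)$ is "$g$ followed by $h$". Fix a section $s$ assigning to each class in $\pi_1(M)$ a loop at $m_0$ representing it, such that $s(\alpha^{-1})$ is the reverse path $t\mapsto s(\alpha)(1-t)$ and $s(1)$ is the constant loop. We identify $\alpha\in\pi_1(M)$ with the loop $s(\alpha)$; thus $\beta\alpha$ as a loop means the chosen representative of the product. Let $\Delta_2=\{(x_0,x_1,x_2): x_i\ge 0,\ \sum x_i=1\}$ with vertices $[0],[1],[2]$, and similarly $\Delta_3$. For a map $a$ on a simplex, $a_{|[i,j]}$ is the path obtained by restricting $a$ to the edge traversed from $[i]$ to $[j]$; for $\omega$ on $\Delta_3$, $\omega_{|[i,j,l]}$ is the composite of $\omega$ with the affine map $\Delta_2\to\Delta_3$ sending $[0],[1],[2]$ to $[i],[j],[l]$. $\Gamma(\alpha,\beta)$ is the set of homotopy classes, relative to $\partial\Delta_2$, of continuous maps $a:\Delta_2\to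 M$ with $a_{|[1,0]}=\alpha$, $a_{|[2,1]}=\beta$, $a_{|[2,0]}=\beta\alpha$. The operations are $P:\Gamma(\alpha,\beta)\to\Gamma(\beta,(\beta\alpha)^{-1})$, $P(a)=a\circ p$, $p(x_0,x_1,x_2)=(x_2,x_0,x_1)$; $Q:\Gamma(\alpha,\beta)\to\Gamma(\alpha^{-1},\beta\alpha)$, $Q(a)=a\circ q$, $q(x_0,x_1,x_2)=(x_1,x_0,x_2)$; and, for $a\in\Gamma(\alpha,\beta^{-1})$, $b\in\Gamma(\beta,\gamma^{-1})$, $c\in\Gamma(\beta^{-1}\alpha,\gamma^{-1}\beta)$, $m(a,b,c)=\omega_{|[1,2,3]}\in\Gamma(\alpha,\gamma^{-1})$, where $\omega:\Delta_3\to M$ is any map with $\omega_{|[1,2,0]}=a$, $\omega_{|[0,2,3]}=b$, $\omega_{|[1,0,3]}=c$. **The cochain $\alpha$.** The group $\pi_2(M)$ (written additively) acts simply transitively on each $\Gamma(g,h)$ by gluing a sphere at the corner $[0]$: for $v\in\pi_2(M)$ and $z\in\Gamma(g,h)$, $z+v$ is the class of the composite of the pinch map $\Delta_2\to\Delta_2\vee S^2$ (the wedge at the vertex $[0]$) with $z$ on $\Delta_2$ and $v$ on $S^2$, with the orientation of $\Delta_2$ given by the vertex order. Choose an element $x(g,h)\in\Gamma(g,h)$ for all $g,h\in\pi_1(M)$ such that $P(x(g,h^{-1}))=x(h^{-1},g^{-1}h)$ and $Q(x(g,h^{-1}))=x(g^{-1},h^{-1}g)$ for all $g,h$ (such a choice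 exists under the hypothesis on $\pi_1(M)$). Define $y(g,h,k)\in\pi_2(M)$ by $$m(x(g,h^{-1}),x(h,k^{-1}),x(h^{-1}g,k^{-1}h))=x(g,k^{-1})+y(g,h,k).$$ Then $\alpha(g,h,k)=y((ghk)^{-1},(hk)^{-1},k^{-1})$. **Symmetric cohomology in degree 3.** For a group $G$ and $G$-module $A$, let $C^n(G,A)$ be the group of all maps $G^n\to A$ with the usual inhomogeneous coboundary $\partial$. $CS^2(G,A)$ is the subgroup of $\sigma\in C^2(G,A)$ with $\sigma(x,y)=-x\sigma(x^{-1},xy)=-\sigma(xy,y^{-1})$. $CS^3(G,A)$ is the subgroup of $\alpha\in C^3(G,A)$ with $\alpha(x,y,z)=-x\alpha(x^{-1},xy,z)=-\alpha(xy,y^{-1},yz)=-\alpha(x,yz,z^{-1})$. $ZS^3(G,A)$ is the group of $\alpha\in CS^3(G,A)$ with $\partial\alpha=0$, $BS^3(G,A)=\partial(CS^2(G,A))$, $HS^3(G,A)=ZS^3(G,A)/BS^3(G,A)$. Here $G=\pi_1(M)$ acts on $A=\pi_2(M)$ in the standard way. *)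

theory Defs
  imports "HOL-Analysis.Analysis" "HOL-Algebra.Multiplicative_Group" "HOL-Homology.Homology"
begin

section \<open>Manifolds\<close>

definition topological_manifold :: "'a topology \<Rightarrow> bool" where
  "topological_manifold X \<longleftrightarrow>
     Hausdorff_space X \<and> second_countable X \<and>
     (\<exists>n. \<forall>x\<in>topspace X. \<exists>U V. openin X U \<and> x \<in> U \<and> openin (Euclidean_space n) V \<and>
        subtopology X U homeomorphic_space subtopology (Euclidean_space n) V)"


section \<open>The fundamental group\<close>

text \<open>Homotopy classes are represented as sets of functions. Library paths are functions on all
  reals whose values outside the unit interval are irrelevant; a class contains every extension.\<close>

type_synonym 'a pathclass = "(real \<Rightarrow> 'a) set"

definition loops :: "'a::topological_space set \<Rightarrow> 'a \<Rightarrow> (real \<Rightarrow> 'a) set" where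
  "loops M m0 = {p. path p \<and> path_image p \<subseteq> M \<and> pathstart p = m0 \<and> pathfinish p = m0}"

definition path_class :: "'a::topological_space set \<Rightarrow> (real \<Rightarrow> 'a) \<Rightarrow> 'a pathclass" where
  "path_class M p = {q. homotopic_paths M p q}"

text \<open>The product is ``first g, then h''.\<close>

definition pi1 :: "'a::topological_space set \<Rightarrow> 'a \<Rightarrow> 'a pathclass monoid" where
  "pi1 M m0 = \<lparr>carrier = path_class M ` loops M m0,
               mult = (\<lambda>g h. \<Union>p\<in>g. \<Union>q\<in>h. path_class M (p +++ q)),
               one = path_class M (\<lambda>_. m0)\<rparr>"


section \<open>The second homotopy group and the action of the fundamental group\<close>

text \<open>Elements are classes of maps of the unit square (positively oriented by its coordinates
  \<open>(s, t)\<close>) sending the boundary to the base point; that is, the sphere is the square with its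
  boundary collapsed. The group is commutative, but is written multiplicatively, as groups are
  in HOL-Algebra.\<close>

type_synonym 'a sphereclass = "(real \<times> real \<Rightarrow> 'a) set"

definition unit_square :: "(real \<times> real) set" where
  "unit_square = {0..1} \<times> {0..1}"

definition square_boundary :: "(real \<times> real) set" where
  "square_boundary = {(s, t) \<in> unit_square. s = 0 \<or> s = 1 \<or> t = 0 \<or> t = 1}"

definition spheroids :: "'a::topological_space set \<Rightarrow> 'a \<Rightarrow> (real \<times> real \<Rightarrow> 'a) set" where
  "spheroids M m0 = {f. continuous_on unit_square f \<and> f ` unit_square \<subseteq> M \<and>
                        (\<forall>z\<in>square_boundary. f z = m0)}"

definition spheroid_class ::
  "'a::topological_space set \<Rightarrow> 'a \<Rightarrow> (real \<times> real \<Rightarrow> 'a) \<Rightarrow> 'a sphereclass" where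
  "spheroid_class M m0 f =
     {g. homotopic_with_canon (\<lambda>k. \<forall>z\<in>square_boundary. k z = m0) unit_square M f g}"

definition spheroid_join :: "(real \<times> real \<Rightarrow> 'a) \<Rightarrow> (real \<times> real \<Rightarrow> 'a) \<Rightarrow> real \<times> real \<Rightarrow> 'a" where
  "spheroid_join f g = (\<lambda>(s, t). if s \<le> 1/2 then f (2 * s, t) else g (2 * s - 1, t))"

definition pi2 :: "'a::topological_space set \<Rightarrow> 'a \<Rightarrow> 'a sphereclass monoid" where
  "pi2 M m0 = \<lparr>carrier = spheroid_class M m0 ` spheroids M m0,
               mult = (\<lambda>v w. \<Union>f\<in>v. \<Union>g\<in>w. spheroid_class M m0 (spheroid_join f g)),
               one = spheroid_class M m0 (\<lambda>_. m0)\<rparr>"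

text \<open>\<open>f\<close> is put on the concentric square of half the size, and every radial segment from the outer
  boundary to that square runs along \<open>p\<close>. With the above product on loops this induces a left
  action.\<close>

definition transport :: "(real \<Rightarrow> 'a) \<Rightarrow> (real \<times> real \<Rightarrow> 'a) \<Rightarrow> real \<times> real \<Rightarrow> 'a" where
  "transport p f = (\<lambda>(s, t).
     let d = max \<bar>s - 1/2\<bar> \<bar>t - 1/2\<bar>
     in if d \<le> 1/4 then f (2 * s - 1/2, 2 * t - 1/2) else p (2 - 4 * d))"

definition pi1_action ::
  "'a::topological_space set \<Rightarrow> 'a \<Rightarrow> 'a pathclass \<Rightarrow> 'a sphereclass \<Rightarrow> 'a sphereclass" where
  "pi1_action M m0 g v = (\<Union>p\<in>g. \<Union>f\<in>v. spheroid_class M m0 (transport p f))"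


section \<open>Sections of the fundamental group\<close>

definition loop_section ::
  "'a::topological_space set \<Rightarrow> 'a \<Rightarrow> ('a pathclass \<Rightarrow> real \<Rightarrow> 'a) \<Rightarrow> bool" where
  "loop_section M m0 s \<longleftrightarrow>
     (\<forall>g\<in>carrier (pi1 M m0). s g \<in> g) \<and>
     (\<forall>g\<in>carrier (pi1 M m0). \<forall>t\<in>{0..1}. s (inv\<^bsub>pi1 M m0\<^esub> g) t = s g (1 - t)) \<and>
     (\<forall>t\<in>{0..1}. s \<one>\<^bsub>pi1 M m0\<^esub> t = m0)"


section \<open>The sets of triangles and the operations on them\<close>

text \<open>Simplices are the singular simplices of HOL-Homology, on the standard simplex in barycentric
  coordinates.\<close>

type_synonym 'a triangleclass = "((nat \<Rightarrow> real) \<Rightarrow> 'a) set"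

definition vertex :: "nat \<Rightarrow> nat \<Rightarrow> real" where
  "vertex i = (\<lambda>k. if k = i then 1 else 0)"

definition bary :: "real \<Rightarrow> real \<Rightarrow> real \<Rightarrow> nat \<Rightarrow> real" where
  "bary a b c = (\<lambda>_. 0)(0 := a, 1 := b, 2 := c)"

definition edge :: "((nat \<Rightarrow> real) \<Rightarrow> 'a) \<Rightarrow> nat \<Rightarrow> nat \<Rightarrow> real \<Rightarrow> 'a" where
  "edge a i j = (\<lambda>t. a (\<lambda>k. (1 - t) * vertex i k + t * vertex j k))"

definition face :: "((nat \<Rightarrow> real) \<Rightarrow> 'a) \<Rightarrow> nat \<Rightarrow> nat \<Rightarrow> nat \<Rightarrow> (nat \<Rightarrow> real) \<Rightarrow> 'a" where
  "face \<omega> i j l = simplex_map 2 \<omega> (oriented_simplex 2 (\<lambda>n. vertex ([i, j, l] ! n)))"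

definition simplex2_boundary :: "(nat \<Rightarrow> real) set" where
  "simplex2_boundary = {z \<in> standard_simplex 2. z 0 = 0 \<or> z 1 = 0 \<or> z 2 = 0}"

definition triangle_class ::
  "'a::topological_space set \<Rightarrow> ((nat \<Rightarrow> real) \<Rightarrow> 'a) \<Rightarrow> 'a triangleclass" where
  "triangle_class M a =
     {b. singular_simplex 2 (top_of_set M) b \<and>
         homotopic_with (\<lambda>k. \<forall>z\<in>simplex2_boundary. k z = a z)
           (subtopology (powertop_real UNIV) (standard_simplex 2)) (top_of_set M) a b}"

definition Gamma ::
  "'a::topological_space set \<Rightarrow> 'a \<Rightarrow> ('a pathclass \<Rightarrow> real \<Rightarrow> 'a) \<Rightarrow>
   'a pathclass \<Rightarrow> 'a pathclass \<Rightarrow> 'a triangleclass set" where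
  "Gamma M m0 s \<alpha> \<beta> = triangle_class M `
     {a. singular_simplex 2 (top_of_set M) a \<and>
         (\<forall>t\<in>{0..1}. edge a 1 0 t = s \<alpha> t \<and> edge a 2 1 t = s \<beta> t \<and>
                      edge a 2 0 t = s (\<beta> \<otimes>\<^bsub>pi1 M m0\<^esub> \<alpha>) t)}"

definition P_op :: "'a::topological_space set \<Rightarrow> 'a triangleclass \<Rightarrow> 'a triangleclass" where
  "P_op M z = (\<Union>a\<in>z. triangle_class M
                 (\<lambda>x\<in>standard_simplex 2. a (bary (x 2) (x 0) (x 1))))"

definition Q_op :: "'a::topological_space set \<Rightarrow> 'a triangleclass \<Rightarrow> 'a triangleclass" where
  "Q_op M z = (\<Union>a\<in>z. triangle_class M
                 (\<lambda>x\<in>standard_simplex 2. a (bary (x 1) (x 0) (x 2))))"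

definition m_op ::
  "'a::topological_space set \<Rightarrow> 'a triangleclass \<Rightarrow> 'a triangleclass \<Rightarrow> 'a triangleclass \<Rightarrow>
   'a triangleclass" where
  "m_op M a b c = triangle_class M (face
     (SOME \<omega>. singular_simplex 3 (top_of_set M) \<omega> \<and>
        face \<omega> 1 2 0 \<in> a \<and> face \<omega> 0 2 3 \<in> b \<and> face \<omega> 1 0 3 \<in> c) 1 2 3)"

text \<open>Gluing a sphere at the corner \<open>[0]\<close>. In the coordinates \<open>(r, u)\<close>, where
  \<open>x = (1 - r) [0] + r ((1 - u) [1] + u [2])\<close>, the disc \<open>r \<le> u (1 - u)\<close> meets the boundary of the
  triangle only at \<open>[0]\<close>. The pinch map collapses the boundary of this disc to \<open>[0]\<close>. The disc, with
  coordinates \<open>(r / (u (1 - u)), u)\<close> in the unit square, becomes the sphere; the orientation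
  \<open>(r, u)\<close> agrees with the vertex order. The rest of the triangle is stretched radially onto the
  whole triangle, fixing the boundary pointwise. At the vertex \<open>[0]\<close> itself (\<open>r = 0\<close>)
  the convention \<open>0 / 0 = 0\<close> gives the base point \<open>f (0, 0)\<close>.\<close>

definition glue ::
  "((nat \<Rightarrow> real) \<Rightarrow> 'a) \<Rightarrow> (real \<times> real \<Rightarrow> 'a) \<Rightarrow> (nat \<Rightarrow> real) \<Rightarrow> 'a" where
  "glue a f = (\<lambda>x\<in>standard_simplex 2.
     let r = 1 - x 0; u = x 2 / r; \<rho> = u * (1 - u)
     in if r \<le> \<rho> then f (r / \<rho>, u)
        else let r' = (r - \<rho>) / (1 - \<rho>) in a (bary (1 - r') (r' * (1 - u)) (r' * u)))"

definition add_sphere ::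
  "'a::topological_space set \<Rightarrow> 'a triangleclass \<Rightarrow> 'a sphereclass \<Rightarrow> 'a triangleclass" where
  "add_sphere M z v = (\<Union>a\<in>z. \<Union>f\<in>v. triangle_class M (glue a f))"


section \<open>The cochain\<close>

definition triangle_choice ::
  "'a::topological_space set \<Rightarrow> 'a \<Rightarrow> ('a pathclass \<Rightarrow> real \<Rightarrow> 'a) \<Rightarrow>
   ('a pathclass \<Rightarrow> 'a pathclass \<Rightarrow> 'a triangleclass) \<Rightarrow> bool" where
  "triangle_choice M m0 s x \<longleftrightarrow>
     (\<forall>g\<in>carrier (pi1 M m0). \<forall>h\<in>carrier (pi1 M m0).
        x g h \<in> Gamma M m0 s g h \<and>
        P_op M (x g (inv\<^bsub>pi1 M m0\<^esub> h))
          = x (inv\<^bsub>pi1 M m0\<^esub> h) (inv\<^bsub>pi1 M m0\<^esub> g \<otimes>\<^bsub>pi1 M m0\<^esub> h) \<and>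
        Q_op M (x g (inv\<^bsub>pi1 M m0\<^esub> h))
          = x (inv\<^bsub>pi1 M m0\<^esub> g) (inv\<^bsub>pi1 M m0\<^esub> h \<otimes>\<^bsub>pi1 M m0\<^esub> g))"

definition y_cochain ::
  "'a::topological_space set \<Rightarrow> 'a \<Rightarrow> ('a pathclass \<Rightarrow> 'a pathclass \<Rightarrow> 'a triangleclass) \<Rightarrow>
   'a pathclass \<Rightarrow> 'a pathclass \<Rightarrow> 'a pathclass \<Rightarrow> 'a sphereclass" where
  "y_cochain M m0 x g h k = (THE v. v \<in> carrier (pi2 M m0) \<and>
     m_op M (x g (inv\<^bsub>pi1 M m0\<^esub> h)) (x h (inv\<^bsub>pi1 M m0\<^esub> k))
       (x (inv\<^bsub>pi1 M m0\<^esub> h \<otimes>\<^bsub>pi1 M m0\<^esub> g) (inv\<^bsub>pi1 M m0\<^esub> k \<otimes>\<^bsub>pi1 M m0\<^esub> h))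
     = add_sphere M (x g (inv\<^bsub>pi1 M m0\<^esub> k)) v)"

definition alpha_cochain ::
  "'a::topological_space set \<Rightarrow> 'a \<Rightarrow> ('a pathclass \<Rightarrow> 'a pathclass \<Rightarrow> 'a triangleclass) \<Rightarrow>
   'a pathclass \<times> 'a pathclass \<times> 'a pathclass \<Rightarrow> 'a sphereclass" where
  "alpha_cochain M m0 x =
     (\<lambda>(g, h, k)\<in>carrier (pi1 M m0) \<times> carrier (pi1 M m0) \<times> carrier (pi1 M m0).
        y_cochain M m0 x (inv\<^bsub>pi1 M m0\<^esub> (g \<otimes>\<^bsub>pi1 M m0\<^esub> h \<otimes>\<^bsub>pi1 M m0\<^esub> k))
                         (inv\<^bsub>pi1 M m0\<^esub> (h \<otimes>\<^bsub>pi1 M m0\<^esub> k))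
                         (inv\<^bsub>pi1 M m0\<^esub> k))"


section \<open>Symmetric cohomology in degree 3\<close>

text \<open>\<open>G\<close> is a group, \<open>A\<close> an abelian group in multiplicative notation, and \<open>act\<close> a left action of
  \<open>G\<close> on \<open>A\<close> by automorphisms.\<close>

definition C2 :: "'g monoid \<Rightarrow> 'm monoid \<Rightarrow> ('g \<times> 'g \<Rightarrow> 'm) monoid" where
  "C2 G A = product_group (carrier G \<times> carrier G) (\<lambda>_. A)"

definition C3 :: "'g monoid \<Rightarrow> 'm monoid \<Rightarrow> ('g \<times> 'g \<times> 'g \<Rightarrow> 'm) monoid" where
  "C3 G A = product_group (carrier G \<times> carrier G \<times> carrier G) (\<lambda>_. A)"

definition C4 :: "'g monoid \<Rightarrow> 'm monoid \<Rightarrow> ('g \<times> 'g \<times> 'g \<times> 'g \<Rightarrow> 'm) monoid" where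
  "C4 G A = product_group (carrier G \<times> carrier G \<times> carrier G \<times> carrier G) (\<lambda>_. A)"

definition coboundary2 ::
  "'g monoid \<Rightarrow> 'm monoid \<Rightarrow> ('g \<Rightarrow> 'm \<Rightarrow> 'm) \<Rightarrow> ('g \<times> 'g \<Rightarrow> 'm) \<Rightarrow> 'g \<times> 'g \<times> 'g \<Rightarrow> 'm" where
  "coboundary2 G A act \<sigma> = (\<lambda>(x, y, z)\<in>carrier G \<times> carrier G \<times> carrier G.
     act x (\<sigma> (y, z)) \<otimes>\<^bsub>A\<^esub> inv\<^bsub>A\<^esub> \<sigma> (x \<otimes>\<^bsub>G\<^esub> y, z) \<otimes>\<^bsub>A\<^esub> \<sigma> (x, y \<otimes>\<^bsub>G\<^esub> z) \<otimes>\<^bsub>A\<^esub> inv\<^bsub>A\<^esub> \<sigma> (x, y))"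

definition coboundary3 ::
  "'g monoid \<Rightarrow> 'm monoid \<Rightarrow> ('g \<Rightarrow> 'm \<Rightarrow> 'm) \<Rightarrow> ('g \<times> 'g \<times> 'g \<Rightarrow> 'm) \<Rightarrow>
   'g \<times> 'g \<times> 'g \<times> 'g \<Rightarrow> 'm" where
  "coboundary3 G A act \<alpha> = (\<lambda>(x, y, z, w)\<in>carrier G \<times> carrier G \<times> carrier G \<times> carrier G.
     act x (\<alpha> (y, z, w)) \<otimes>\<^bsub>A\<^esub> inv\<^bsub>A\<^esub> \<alpha> (x \<otimes>\<^bsub>G\<^esub> y, z, w) \<otimes>\<^bsub>A\<^esub> \<alpha> (x, y \<otimes>\<^bsub>G\<^esub> z, w)
       \<otimes>\<^bsub>A\<^esub> inv\<^bsub>A\<^esub> \<alpha> (x, y, z \<otimes>\<^bsub>G\<^esub> w) \<otimes>\<^bsub>A\<^esub> \<alpha> (x, y, z))"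

definition CS2 :: "'g monoid \<Rightarrow> 'm monoid \<Rightarrow> ('g \<Rightarrow> 'm \<Rightarrow> 'm) \<Rightarrow> ('g \<times> 'g \<Rightarrow> 'm) set" where
  "CS2 G A act = {\<sigma> \<in> carrier (C2 G A). \<forall>x\<in>carrier G. \<forall>y\<in>carrier G.
     \<sigma> (x, y) = inv\<^bsub>A\<^esub> act x (\<sigma> (inv\<^bsub>G\<^esub> x, x \<otimes>\<^bsub>G\<^esub> y)) \<and>
     \<sigma> (x, y) = inv\<^bsub>A\<^esub> \<sigma> (x \<otimes>\<^bsub>G\<^esub> y, inv\<^bsub>G\<^esub> y)}"

definition CS3 :: "'g monoid \<Rightarrow> 'm monoid \<Rightarrow> ('g \<Rightarrow> 'm \<Rightarrow> 'm) \<Rightarrow> ('g \<times> 'g \<times> 'g \<Rightarrow> 'm) set" where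
  "CS3 G A act = {\<alpha> \<in> carrier (C3 G A). \<forall>x\<in>carrier G. \<forall>y\<in>carrier G. \<forall>z\<in>carrier G.
     \<alpha> (x, y, z) = inv\<^bsub>A\<^esub> act x (\<alpha> (inv\<^bsub>G\<^esub> x, x \<otimes>\<^bsub>G\<^esub> y, z)) \<and>
     \<alpha> (x, y, z) = inv\<^bsub>A\<^esub> \<alpha> (x \<otimes>\<^bsub>G\<^esub> y, inv\<^bsub>G\<^esub> y, y \<otimes>\<^bsub>G\<^esub> z) \<and>
     \<alpha> (x, y, z) = inv\<^bsub>A\<^esub> \<alpha> (x, y \<otimes>\<^bsub>G\<^esub> z, inv\<^bsub>G\<^esub> z)}"

definition ZS3 :: "'g monoid \<Rightarrow> 'm monoid \<Rightarrow> ('g \<Rightarrow> 'm \<Rightarrow> 'm) \<Rightarrow> ('g \<times> 'g \<times> 'g \<Rightarrow> 'm) monoid" where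
  "ZS3 G A act = (C3 G A)
     \<lparr>carrier := {\<alpha> \<in> CS3 G A act. coboundary3 G A act \<alpha> = \<one>\<^bsub>C4 G A\<^esub>}\<rparr>"

definition BS3 :: "'g monoid \<Rightarrow> 'm monoid \<Rightarrow> ('g \<Rightarrow> 'm \<Rightarrow> 'm) \<Rightarrow> ('g \<times> 'g \<times> 'g \<Rightarrow> 'm) set" where
  "BS3 G A act = coboundary2 G A act ` CS2 G A act"

definition HS3 ::
  "'g monoid \<Rightarrow> 'm monoid \<Rightarrow> ('g \<Rightarrow> 'm \<Rightarrow> 'm) \<Rightarrow> ('g \<times> 'g \<times> 'g \<Rightarrow> 'm) set monoid" where
  "HS3 G A act = ZS3 G A act Mod BS3 G A act"

definition HS3_class ::
  "'g monoid \<Rightarrow> 'm monoid \<Rightarrow> ('g \<Rightarrow> 'm \<Rightarrow> 'm) \<Rightarrow> ('g \<times> 'g \<times> 'g \<Rightarrow> 'm) \<Rightarrow>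
   ('g \<times> 'g \<times> 'g \<Rightarrow> 'm) set" where
  "HS3_class G A act \<alpha> = BS3 G A act #>\<^bsub>ZS3 G A act\<^esub> \<alpha>"

end

theory Submission
  imports Defs
begin

text \<open>A triple of elements of the fundamental group is a labelling of the edges of a tetrahedron whose
  vertices are group elements: the edge from i to j carries the chosen loop in the class inverse(i) j.
  In these terms the chosen elements x are a choice of one triangle for each triple of labels,
  invariant under translation and under permutation of the vertices, and alpha is the defect of the
  boundary of a tetrahedron from being fillable. Everything then follows from a few properties of the
  relation "these four triangle classes bound a tetrahedron": the first three faces determine
  the fourth, the relation is invariant under vertex permutations, four tetrahedra around
  a vertex give a fifth, and spheres can be moved between faces and corners. Permuting the vertices
  gives the symmetry of alpha, five vertices give the cocycle identity. For two sections the same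
  calculus is applied to two copies of the vertices; pushing the triangles of one choice across the
  prism to the other shows that the two cochains differ by the coboundary of the defect of the prisms.
  The walls of the prism can be chosen compatibly with inversion because the fundamental group has no
  element of order 2, and this makes the bounding cochain symmetric.\<close>

subsection \<open>A calculus of fillers\<close>

text \<open>The algebra of \<open>pi2\<close> is not obtained from explicit homotopies of squares.
  Spheres are identified with triangles whose boundary is constant; associativity, inverses,
  commutativity and the laws of the action of \<open>pi1\<close> then come out of uniqueness of
  fillers and symmetry under vertex permutations. The geometric input about spheres is gluing at one
  corner, its effect on a constant triangle, and one prism. The topological obstacle is that gluing
  divides by quantities that vanish at a corner. Continuity there is checked after composing with a
  surjection from a compact space on which no such quotient is left. \<open>Gamma\<close> prescribes
  edges running from higher to lower vertices, so x(g,h) sits on the triangle i, j, k with g = inv j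
  * i and h = inv k * j. With these labels \<open>P\<close> and \<open>Q\<close> generate all vertex
  permutations, and the arguments of y in alpha are those of the tetrahedron 1, p, pq, pqr. When
  sections are compared, an edge between the two copies carries the first section. Hence one half of
  each wall of the prism can be degenerate, and only the other half involves a chosen
  homotopy.\<close>

text \<open>V is a set of vertex labels, T i j k the set of triangles with these vertices, Tet a0 a1 a2 a3 says
  that the triangles bound a tetrahedron, where the face ai misses the i-th vertex. The maps sa and
  sb exchange the first two and the last two vertices, D i j is the edge from i to j with the first
  vertex doubled, add is the action of spheres at the first corner, and act i j moves
  spheres from the corner j to the corner i. In prism the three tetrahedra cut the prism over the
  edge from i to j along which the sphere moves.\<close>

locale tet_calculus =
  fixes V :: "'v set" and T :: "'v \<Rightarrow> 'v \<Rightarrow> 'v \<Rightarrow> 't set" and U :: "'t set"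
    and sa sb :: "'t \<Rightarrow> 't" and Tet :: "'t \<Rightarrow> 't \<Rightarrow> 't \<Rightarrow> 't \<Rightarrow> bool" and D :: "'v \<Rightarrow> 'v \<Rightarrow> 't"
    and A :: "'m monoid" (structure) and add :: "'t \<Rightarrow> 'm \<Rightarrow> 't" and flip :: "'m \<Rightarrow> 'm"
    and act :: "'v \<Rightarrow> 'v \<Rightarrow> 'm \<Rightarrow> 'm"
  assumes T_U: "a \<in> T i j k \<Longrightarrow> a \<in> U"
    and sa_T: "a \<in> T i j k \<Longrightarrow> i \<in> V \<Longrightarrow> j \<in> V \<Longrightarrow> k \<in> V \<Longrightarrow> sa a \<in> T j i k"
    and sb_T: "a \<in> T i j k \<Longrightarrow> i \<in> V \<Longrightarrow> j \<in> V \<Longrightarrow> k \<in> V \<Longrightarrow> sb a \<in> T i k j"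
    and sa_sa: "a \<in> U \<Longrightarrow> sa (sa a) = a"
    and sb_sb: "a \<in> U \<Longrightarrow> sb (sb a) = a"
    and braid: "a \<in> U \<Longrightarrow> sa (sb (sa a)) = sb (sa (sb a))"
    and Tet_U: "Tet a0 a1 a2 a3 \<Longrightarrow> a0 \<in> U \<and> a1 \<in> U \<and> a2 \<in> U \<and> a3 \<in> U"
    and swap01: "Tet a0 a1 a2 a3 \<Longrightarrow> Tet a1 a0 (sa a2) (sa a3)"
    and swap12: "Tet a0 a1 a2 a3 \<Longrightarrow> Tet (sa a0) a2 a1 (sb a3)"
    and swap23: "Tet a0 a1 a2 a3 \<Longrightarrow> Tet (sb a0) (sb a1) a3 a2"
    and Tet_ex: "a1 \<in> T i k l \<Longrightarrow> a2 \<in> T i j l \<Longrightarrow> a3 \<in> T i j k \<Longrightarrow>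
      i \<in> V \<Longrightarrow> j \<in> V \<Longrightarrow> k \<in> V \<Longrightarrow> l \<in> V \<Longrightarrow> \<exists>a0\<in>T j k l. Tet a0 a1 a2 a3"
    and Tet_un0: "Tet a a1 a2 a3 \<Longrightarrow> Tet b a1 a2 a3 \<Longrightarrow> a = b"
    and cone0: "Tet a123 a023 a013 a012 \<Longrightarrow> Tet a124 a024 a014 a012 \<Longrightarrow> Tet a134 a034 a014 a013
      \<Longrightarrow> Tet a234 a034 a024 a023 \<Longrightarrow> Tet a234 a134 a124 a123"
    and D_T: "i \<in> V \<Longrightarrow> j \<in> V \<Longrightarrow> D i j \<in> T i i j"
    and sa_D: "i \<in> V \<Longrightarrow> sa (D i i) = D i i"
    and sb_D: "i \<in> V \<Longrightarrow> sb (D i i) = D i i"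
    and D_tet: "a \<in> T i j k \<Longrightarrow> i \<in> V \<Longrightarrow> j \<in> V \<Longrightarrow> k \<in> V \<Longrightarrow> Tet a a (D i k) (D i j)"
    and add_T: "a \<in> T i j k \<Longrightarrow> i \<in> V \<Longrightarrow> j \<in> V \<Longrightarrow> k \<in> V \<Longrightarrow> v \<in> carrier A \<Longrightarrow> add a v \<in> T i j k"
    and add12: "Tet a0 a1 a2 a3 \<Longrightarrow> v \<in> carrier A \<Longrightarrow> Tet a0 (add a1 v) (add a2 v) a3"
    and sb_add: "a \<in> U \<Longrightarrow> v \<in> carrier A \<Longrightarrow> sb (add a v) = add (sb a) (flip v)"
    and flip_closed: "v \<in> carrier A \<Longrightarrow> flip v \<in> carrier A"
    and one_cl: "\<one> \<in> carrier A"
    and mult_cl: "v \<in> carrier A \<Longrightarrow> w \<in> carrier A \<Longrightarrow> v \<otimes> w \<in> carrier A"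
    and base_inj: "i \<in> V \<Longrightarrow> v \<in> carrier A \<Longrightarrow> w \<in> carrier A \<Longrightarrow> add (D i i) v = add (D i i) w \<Longrightarrow> v = w"
    and base_surj: "i \<in> V \<Longrightarrow> a \<in> T i i i \<Longrightarrow> \<exists>v\<in>carrier A. a = add (D i i) v"
    and base_one: "i \<in> V \<Longrightarrow> add (D i i) \<one> = D i i"
    and base_mult: "i \<in> V \<Longrightarrow> v \<in> carrier A \<Longrightarrow> w \<in> carrier A \<Longrightarrow>
      add (add (D i i) v) w = add (D i i) (w \<otimes> v)"
    and act_closed: "i \<in> V \<Longrightarrow> j \<in> V \<Longrightarrow> w \<in> carrier A \<Longrightarrow> act i j w \<in> carrier A"
    and prism: "i \<in> V \<Longrightarrow> j \<in> V \<Longrightarrow> w \<in> carrier A \<Longrightarrow>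
      \<exists>w1 w2. Tet (D i j) (D i j) w1 (add (D i i) (act i j w)) \<and>
        Tet (sa (sb (D j i))) w2 w1 (D i j) \<and>
        Tet (add (D j j) w) w2 (sa (sb (D j i))) (sa (sb (D j i)))"
    and V_ne: "V \<noteq> {}"
begin

section \<open>Fillers, uniqueness and cones for every face, by permuting vertices\<close>

lemma swap01_iff: "a2 \<in> U \<Longrightarrow> a3 \<in> U \<Longrightarrow> Tet a0 a1 (sa a2) (sa a3) \<longleftrightarrow> Tet a1 a0 a2 a3"
  using swap01 sa_sa by metis

lemma Tet_un1: "Tet a0 a a2 a3 \<Longrightarrow> Tet a0 b a2 a3 \<Longrightarrow> a = b"
  using swap01 Tet_un0 by blast

lemma Tet_un2: "Tet a0 a1 a a3 \<Longrightarrow> Tet a0 a1 b a3 \<Longrightarrow> a = b"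
  using swap12 Tet_un1 by blast

lemma Tet_un3: "Tet a0 a1 a2 a \<Longrightarrow> Tet a0 a1 a2 b \<Longrightarrow> a = b"
  using swap23 Tet_un2 by blast

lemma Tet_ex1:
  assumes "a0 \<in> T j k l" "a2 \<in> T i j l" "a3 \<in> T i j k" "i \<in> V" "j \<in> V" "k \<in> V" "l \<in> V"
  shows "\<exists>a1\<in>T i k l. Tet a0 a1 a2 a3"
proof -
  obtain a1 where "a1 \<in> T i k l" "Tet a1 a0 (sa a2) (sa a3)"
    using Tet_ex[of a0 j k l "sa a2" i "sa a3"] assms sa_T by blast
  then show ?thesis using swap01_iff assms T_U by blast
qed

lemma Tet_ex2:
  assumes "a0 \<in> T j k l" "a1 \<in> T i k l" "a3 \<in> T i j k" "i \<in> V" "j \<in> V" "k \<in> V" "l \<in> V"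
  shows "\<exists>a2\<in>T i j l. Tet a0 a1 a2 a3"
proof -
  obtain a2 where a2: "a2 \<in> T i j l" "Tet (sa a0) a2 a1 (sb a3)"
    using Tet_ex1[of "sa a0" k j l a1 i "sb a3"] assms sa_T sb_T by blast
  have "Tet a0 a1 a2 a3" using swap12[OF a2(2)] assms T_U by (simp add: sa_sa sb_sb)
  with a2 show ?thesis by blast
qed

lemma Tet_ex3:
  assumes "a0 \<in> T j k l" "a1 \<in> T i k l" "a2 \<in> T i j l" "i \<in> V" "j \<in> V" "k \<in> V" "l \<in> V"
  shows "\<exists>a3\<in>T i j k. Tet a0 a1 a2 a3"
proof -
  obtain a3 where a3: "a3 \<in> T i j k" "Tet (sb a0) (sb a1) a3 a2"
    using Tet_ex2[of "sb a0" j l k "sb a1" i a2] assms sb_T by blast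
  have "Tet a0 a1 a2 a3" using swap23[OF a3(2)] assms T_U by (simp add: sb_sb)
  with a3 show ?thesis by blast
qed

text \<open>Read \<open>aijk\<close> as the faces of a 4-simplex. Exchanging the vertices 0 and 1
  exchanges the tetrahedra that miss them, so \<open>cone0\<close> becomes the same statement with
  the conclusion opposite to vertex 1. The next two lemmas move the conclusion on to vertices 2 and
  3.\<close>

lemma cone1:
  assumes "Tet a123 a023 a013 a012" "Tet a124 a024 a014 a012" "Tet a134 a034 a014 a013"
    "Tet a234 a134 a124 a123"
  shows "Tet a234 a034 a024 a023"
  using cone0[OF swap01[OF assms(1)] swap01[OF assms(2)] swap01[OF assms(3)] assms(4)] .

lemma cone2:
  assumes "Tet a123 a023 a013 a012" "Tet a124 a024 a014 a012" "Tet a234 a034 a024 a023"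
    "Tet a234 a134 a124 a123"
  shows "Tet a134 a034 a014 a013"
  using cone1[OF swap12[OF assms(1)] swap12[OF assms(2)] assms(3) swap01[OF assms(4)]] .

lemma cone3:
  assumes "Tet a123 a023 a013 a012" "Tet a134 a034 a014 a013" "Tet a234 a034 a024 a023"
    "Tet a234 a134 a124 a123"
  shows "Tet a124 a024 a014 a012"
  using cone2[OF swap23[OF assms(1)] assms(2) swap12[OF assms(3)] swap12[OF assms(4)]] .

section \<open>Moving spheres among the three faces that contain the first vertex\<close>

text \<open>Exchanging the last two vertices brings face 3 to place 2, where \<open>add12\<close>
  applies; the reflection \<open>flip\<close> appears because \<open>sb\<close> is applied to face 1
  on the way there and back.\<close>

lemma add13:
  assumes "Tet a0 a1 a2 a3" "v \<in> carrier A"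
  shows "Tet a0 (add a1 (flip v)) a2 (add a3 v)"
proof -
  note U = Tet_U[OF assms(1)]
  have 1: "Tet (sb a0) (add (sb a1) v) (add a3 v) a2"
    by (rule add12[OF swap23[OF assms(1)] assms(2)])
  have "sb (add (sb a1) v) = add a1 (flip v)"
    using sb_add[of "sb a1" v] U Tet_U[OF swap23[OF assms(1)]] assms(2) by (simp add: sb_sb)
  then show ?thesis using swap23[OF 1] U by (simp add: sb_sb)
qed

lemma add23:
  assumes "Tet a0 a1 a2 a3" "v \<in> carrier A"
  shows "Tet a0 a1 (add a2 (flip v)) (add a3 (flip v))"
proof -
  note U = Tet_U[OF assms(1)]
  have 1: "Tet (sa a0) (add a2 (flip v)) a1 (add (sb a3) v)"
    by (rule add13[OF swap12[OF assms(1)] assms(2)])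
  have "sb (add (sb a3) v) = add a3 (flip v)"
    using sb_add[of "sb a3" v] U Tet_U[OF swap12[OF assms(1)]] assms(2) by (simp add: sb_sb)
  then show ?thesis using swap12[OF 1] U by (simp add: sa_sa)
qed

text \<open>On a degenerate triangle fixed by \<open>sb\<close>, the involution \<open>sb\<close>
  acts on the attached sphere alone.\<close>

lemma flip_flip: assumes "v \<in> carrier A" shows "flip (flip v) = v"
proof -
  obtain i where i: "i \<in> V" using V_ne by blast
  have D: "D i i \<in> T i i i" using D_T i by blast
  have "add (D i i) v \<in> U" using add_T[OF D i i i assms] T_U by blast
  then have "add (D i i) v = sb (sb (add (D i i) v))" by (simp add: sb_sb)
  also have "\<dots> = add (D i i) (flip (flip v))"
    using D T_U sb_add assms flip_closed sb_D i by simp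
  finally show ?thesis using base_inj i assms flip_closed by metis
qed

lemma add23':
  assumes "Tet a0 a1 a2 a3" "v \<in> carrier A"
  shows "Tet a0 a1 (add a2 v) (add a3 v)"
  using add23[OF assms(1) flip_closed[OF assms(2)]] assms(2) by (simp add: flip_flip)

section \<open>The action of spheres on triangles is simply transitive\<close>

lemma D_tet': "i \<in> V \<Longrightarrow> j \<in> V \<Longrightarrow> Tet (D i j) (D i j) (D i j) (D i i)"
  using D_tet D_T by blast

text \<open>The degenerate tetrahedron over the edge i, j has \<open>D i i\<close> as face 3 and
  \<open>D i j\<close> as its other faces. Moving spheres between faces 2 and 3 carries each law of
  the action from \<open>D i i\<close> to \<open>D i j\<close>. In the same way \<open>D_tet\<close>
  and \<open>add12\<close> carry it from \<open>D i k\<close> to any triangle.\<close>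

lemma D_one: assumes "i \<in> V" "j \<in> V" shows "add (D i j) \<one> = D i j"
  using add23'[OF D_tet'[OF assms] one_cl] Tet_un2 D_tet'[OF assms] assms base_one by fastforce

lemma D_mult: assumes "i \<in> V" "j \<in> V" "v \<in> carrier A" "w \<in> carrier A"
  shows "add (add (D i j) v) w = add (D i j) (w \<otimes> v)"
proof -
  have "Tet (D i j) (D i j) (add (add (D i j) v) w) (add (add (D i i) v) w)"
    by (intro add23' D_tet' assms)
  moreover have "Tet (D i j) (D i j) (add (D i j) (w \<otimes> v)) (add (D i i) (w \<otimes> v))"
    by (intro add23' D_tet' assms mult_cl)
  ultimately show ?thesis using Tet_un2 base_mult assms by fastforce
qed

lemma D_inj: assumes "i \<in> V" "j \<in> V" "v \<in> carrier A" "w \<in> carrier A" "add (D i j) v = add (D i j) w"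
  shows "v = w"
  using add23'[OF D_tet'[OF assms(1,2)] assms(3)] add23'[OF D_tet'[OF assms(1,2)] assms(4)] assms
   base_inj Tet_un3 by metis

lemma D_surj: assumes "i \<in> V" "j \<in> V" "a \<in> T i i j" shows "\<exists>v\<in>carrier A. a = add (D i j) v"
proof -
  have D: "D i j \<in> T i i j" using D_T assms by blast
  obtain d where d: "d \<in> T i i i" "Tet (D i j) (D i j) a d" using Tet_ex3[OF D D] assms by blast
  then obtain v where "v \<in> carrier A" "d = add (D i i) v" using base_surj assms by blast
  then show ?thesis using add23'[OF D_tet'[OF assms(1,2)]] d Tet_un2 by blast
qed

lemma add_one: assumes "a \<in> T i j k" "i \<in> V" "j \<in> V" "k \<in> V" shows "add a \<one> = a"
  using add12[OF D_tet[OF assms] one_cl] D_tet[OF assms] Tet_un1 D_one assms by metis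

lemma add_mult: assumes "a \<in> T i j k" "i \<in> V" "j \<in> V" "k \<in> V" "v \<in> carrier A" "w \<in> carrier A"
  shows "add (add a v) w = add a (w \<otimes> v)"
proof -
  have "Tet a (add (add a v) w) (add (add (D i k) v) w) (D i j)"
    by (intro add12 D_tet assms)
  moreover have "Tet a (add a (w \<otimes> v)) (add (D i k) (w \<otimes> v)) (D i j)"
    by (intro add12 D_tet assms mult_cl)
  ultimately show ?thesis using Tet_un1 D_mult assms by fastforce
qed

lemma add_inj: assumes "add a v = add a w" "a \<in> T i j k" "i \<in> V" "j \<in> V" "k \<in> V" "v \<in> carrier A" "w \<in> carrier A"
  shows "v = w"
  using add12[OF D_tet[OF assms(2-5)] assms(6)] add12[OF D_tet[OF assms(2-5)] assms(7)] assms
   D_inj Tet_un2 by metis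

lemma add_surj: assumes "a \<in> T i j k" "b \<in> T i j k" "i \<in> V" "j \<in> V" "k \<in> V"
  shows "\<exists>v\<in>carrier A. b = add a v"
proof -
  obtain d where d: "d \<in> T i i k" "Tet a b d (D i j)"
    using Tet_ex2[OF assms(1,2) D_T] assms by blast
  then obtain v where "v \<in> carrier A" "d = add (D i k) v" using D_surj assms by blast
  then show ?thesis using add12[OF D_tet[OF assms(1,3,4,5)]] d Tet_un1 by blast
qed

text \<open>A simply transitive action determines the group laws. For commutativity, the sphere x is
  put on faces 1 and 2 of the constant tetrahedron and y on faces 2 and 3. The order of the two
  additions is visible on face 2 only, and this face is determined by the other three.\<close>

lemma A_comm_group: "comm_group A"
proof -
  obtain i where i: "i \<in> V" using V_ne by blast
  define d where "d = D i i"
  have d: "d \<in> T i i i" using D_T i d_def by blast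
  note inj = add_inj[OF _ d i i i]
  note am = add_mult[OF _ i i i]
  show ?thesis
  proof (rule comm_groupI)
    fix x y z assume x: "x \<in> carrier A" and y: "y \<in> carrier A" and z: "z \<in> carrier A"
    have "add d (x \<otimes> y \<otimes> z) = add (add d z) (x \<otimes> y)" using am[OF d] x y z mult_cl by simp
    also have "\<dots> = add (add (add d z) y) x" using am[OF add_T[OF d i i i z]] x y by simp
    also have "\<dots> = add d (x \<otimes> (y \<otimes> z))" using am[OF d] x y z mult_cl by simp
    finally show "x \<otimes> y \<otimes> z = x \<otimes> (y \<otimes> z)" using inj x y z mult_cl by blast
    have t: "Tet d d d d" using D_tet[OF d i i i] d_def by simp
    have "Tet d (add d x) (add (add d x) y) (add d y)" by (intro add23' add12 t x y)
    moreover have "Tet d (add d x) (add (add d y) x) (add d y)" by (intro add23' add12 t x y)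
    ultimately have "add (add d x) y = add (add d y) x" using Tet_un2 by blast
    then show "x \<otimes> y = y \<otimes> x" using am[OF d] x y inj mult_cl by metis
  next
    fix x assume x: "x \<in> carrier A"
    have "add d (\<one> \<otimes> x) = add d x" using am[OF d x one_cl] add_one[OF add_T[OF d i i i x]] i by simp
    then show "\<one> \<otimes> x = x" using inj x mult_cl one_cl by blast
    obtain v where "v \<in> carrier A" "d = add (add d x) v" using add_surj[OF add_T[OF d i i i x] d i i i] by blast
    then have "add d (v \<otimes> x) = add d \<one>" using am[OF d x] add_one d i by simp
    then show "\<exists>v\<in>carrier A. v \<otimes> x = \<one>" using inj x mult_cl one_cl \<open>v \<in> carrier A\<close> by blast
  qed (use mult_cl one_cl in auto)
qed

sublocale A: comm_group A by (rule A_comm_group)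

text \<open>With v on faces 1 and 2 and its inverse on faces 2 and 3, the two cancel on face 2. What
  remains is the situation of \<open>add13\<close>, which involves \<open>flip\<close>.\<close>

lemma flip_inv: assumes v: "v \<in> carrier A" shows "flip v = inv v"
proof -
  obtain i where i: "i \<in> V" using V_ne by blast
  define d where "d = D i i"
  have d: "d \<in> T i i i" using D_T i d_def by blast
  have t: "Tet d d d d" using D_tet[OF d i i i] d_def by simp
  have "Tet d (add d v) (add (add d v) (inv v)) (add d (inv v))"
    by (intro add23' add12 t v A.inv_closed)
  moreover have "add (add d v) (inv v) = d" using add_mult[OF d i i i v] v add_one d i by simp
  moreover have "Tet d (add d (flip (inv v))) d (add d (inv v))" by (intro add13 t A.inv_closed v)
  ultimately have "add d v = add d (flip (inv v))" using Tet_un1 by metis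
  then have "v = flip (inv v)" using add_inj[OF _ d i i i] v flip_closed by simp
  then show ?thesis using flip_flip v by (metis A.inv_closed)
qed

lemma add13':
  assumes "Tet a0 a1 a2 a3" "v \<in> carrier A"
  shows "Tet a0 (add a1 v) a2 (add a3 (inv v))"
  using add13[OF assms(1) A.inv_closed[OF assms(2)]] assms(2) flip_inv by simp

lemma sb_add': "a \<in> U \<Longrightarrow> v \<in> carrier A \<Longrightarrow> sb (add a v) = add (sb a) (inv v)"
  using sb_add flip_inv by simp

text \<open>Inserting a sphere at the second corner of a triangle is inserting its transport at the first
  corner. By uniqueness of fillers it suffices to see this for one triangle on each edge, and for
  the degenerate triangle the prism provides it.\<close>

lemma sa_add_aux:
  assumes ij: "i \<in> V" "j \<in> V" and w: "w \<in> carrier A"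
  shows "sa (add (sa (sa (sb (D j i)))) w) = add (sa (sb (D j i))) (inv act i j w)"
proof -
  define e where "e = sa (sb (D j i))"
  have e: "e \<in> T i j j" unfolding e_def using sa_T sb_T D_T ij by blast
  have eU: "e \<in> U" "sa e \<in> U" using T_U e sa_T ij by blast+
  define v where "v = act i j w"
  have v: "v \<in> carrier A" unfolding v_def using act_closed ij w by blast
  obtain w1 w2 where t1: "Tet (D i j) (D i j) w1 (add (D i i) v)" and t2: "Tet e w2 w1 (D i j)"
    and t3: "Tet (add (D j j) w) w2 e e"
    using prism[OF ij w] unfolding e_def v_def by blast
  \<comment> \<open>The first two tetrahedra of the prism identify the cutting triangles as
    \<open>D i j\<close> and \<open>e\<close> with the transported sphere at corner i.\<close>
  have "w1 = add (D i j) v" using Tet_un2[OF t1] add23'[OF D_tet'[OF ij] v] by blast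
  then have "w2 = add e v" using Tet_un1[OF t2] add12[OF D_tet[OF e ij ij(2)] v] by blast
  with t3 have t3: "Tet (add (D j j) w) (add e v) e e" by simp
  have e': "sa e \<in> T j i j" using sa_T e ij by blast
  \<comment> \<open>A second tetrahedron with \<open>w\<close> on \<open>D j j\<close>: here the
    sphere is added at the first corner j of \<open>sa e\<close> and then seen through
    \<open>sa\<close>. Comparison with \<open>t3\<close> computes the unknown sphere
    \<open>u\<close>.\<close>
  have "Tet (sa e) (sa e) (D j j) (D j i)" using D_tet[OF e'] ij by blast
  moreover have "sb (D j i) = sa e" unfolding e_def using sa_sa T_U sb_T D_T ij by metis
  ultimately have "Tet e (D j j) (sa e) (sa e)" using swap12 eU(1) sa_sa by metis
  then have "Tet e (add (D j j) w) (add (sa e) w) (sa e)" using add12 w by blast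
  then have "Tet (add (D j j) w) e (sa (add (sa e) w)) e" using swap01 eU sa_sa by metis
  moreover have "sa (add (sa e) w) \<in> T i j j" using add_T[OF e'] sa_T ij w by blast
  then obtain u where u: "u \<in> carrier A" "sa (add (sa e) w) = add e u" using add_surj e ij by blast
  ultimately have "Tet (add (D j j) w) e (add e u) e" by simp
  then have "Tet (add (D j j) w) (add e (inv u)) (add (add e u) (inv u)) e" using add12 u by blast
  moreover have "add (add e u) (inv u) = e" using add_mult[OF e] ij u add_one e by simp
  ultimately have "add e (inv u) = add e v" using t3 Tet_un1 by metis
  then have "inv u = v" using add_inj[OF _ e] ij u v by blast
  then have "u = inv v" using u by auto
  then show ?thesis using u unfolding e_def v_def by simp
qed

lemma sa_add: assumes a: "a \<in> T i j k" and V: "i \<in> V" "j \<in> V" "k \<in> V" and v: "v \<in> carrier A"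
  shows "sa (add a v) = add (sa a) (inv act j i v)"
proof -
  define b where "b = sa a"
  have b: "b \<in> T j i k" "sa b = a" unfolding b_def using sa_T V a sa_sa T_U by blast+
  define e where "e = sa (sb (D i j))"
  have e: "e \<in> T j i i" unfolding e_def using sa_T sb_T D_T V by blast
  have eU: "e \<in> U" "sa e \<in> U" using T_U e sa_T V by blast+
  have se: "sa e = sb (D i j)" unfolding e_def using sa_sa T_U sb_T D_T V by blast
  have bU: "b \<in> U" "a \<in> U" using b a T_U by blast+
  \<comment> \<open>After one exchange this degenerate tetrahedron has \<open>a\<close> and
    \<open>sb (D i j)\<close> as faces with a common first corner. Exchanging its first two vertices
    applies \<open>sa\<close> to both, and for the latter the effect on a sphere is already
    known.\<close>
  have "Tet a a (D i k) (D i j)" using D_tet[OF a V] .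
  then have "Tet b (D i k) a (sa e)" using swap12 b_def se by metis
  then have t: "Tet (D i k) b b e" using swap01 b_def sa_sa eU by metis
  have t': "Tet b (D i k) a (sa e)" by fact
  define u where "u = inv act j i v"
  have u: "u \<in> carrier A" unfolding u_def using act_closed V v by blast
  have "Tet b (D i k) (add a v) (add (sa e) v)" using add23' t' v by blast
  then have "Tet (D i k) b (sa (add a v)) (sa (add (sa e) v))" by (rule swap01)
  moreover have "sa (add (sa e) v) = add e u" using sa_add_aux[OF V(2,1) v] unfolding e_def u_def .
  ultimately have "Tet (D i k) b (sa (add a v)) (add e u)" by simp
  moreover have "Tet (D i k) b (add b u) (add e u)" using add23' t u by blast
  ultimately show ?thesis using Tet_un2 unfolding b_def u_def by blast
qed

section \<open>Transport between corners as a functor\<close>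

lemma act_mult: assumes V: "i \<in> V" "j \<in> V" and v: "v \<in> carrier A" and w: "w \<in> carrier A"
  shows "act i j (v \<otimes> w) = act i j v \<otimes> act i j w"
proof -
  define a where "a = D j i"
  define b where "b = sb a"
  have b: "b \<in> T j i j" unfolding a_def b_def using D_T sb_T V by blast
  then have sb: "sa b \<in> T i j j" using sa_T V by blast
  have "add (sa b) (inv act i j (v \<otimes> w)) = sa (add (add b w) v)"
    using sa_add[OF b] V v w add_mult[OF b] by simp
  also have "\<dots> = add (sa (add b w)) (inv act i j v)" using sa_add[OF add_T[OF b]] V v w by simp
  also have "\<dots> = add (add (sa b) (inv act i j w)) (inv act i j v)" using sa_add[OF b] V w by simp
  also have "\<dots> = add (sa b) (inv act i j v \<otimes> inv act i j w)" using add_mult[OF sb] V v w act_closed by simp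
  finally have "inv act i j (v \<otimes> w) = inv act i j v \<otimes> inv act i j w"
    using add_inj[OF _ sb] V v w act_closed by simp
  also have "\<dots> = inv (act i j v \<otimes> act i j w)" using A.inv_mult act_closed V v w by simp
  finally have "inv (inv act i j (v \<otimes> w)) = inv (inv (act i j v \<otimes> act i j w))" by (rule arg_cong)
  then show ?thesis using act_closed V v w by simp
qed

lemma act_one: assumes V: "i \<in> V" "j \<in> V" shows "act i j \<one> = \<one>"
  using act_mult[OF V one_cl one_cl] A.r_cancel_one'[OF act_closed[OF V one_cl] act_closed[OF V one_cl]] by simp

lemma act_inv: assumes V: "i \<in> V" "j \<in> V" and v: "v \<in> carrier A"
  shows "act i j (inv v) = inv act i j v"
  using act_mult[OF V A.inv_closed[OF v] v] act_one[OF V] A.inv_equality[of "act i j (inv v)" "act i j v"] v act_closed[OF V]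
  by simp

text \<open>A sphere at corner k of a triangle is carried through the braid relation. One side moves
  it from k to j and then to i, the other moves it from k to i at once. The triangle in the
  hypothesis is what makes the two routes comparable.\<close>

lemma act_act: assumes a: "a \<in> T i j k" and V: "i \<in> V" "j \<in> V" "k \<in> V" and v: "v \<in> carrier A"
  shows "act i j (act j k v) = act i k v"
proof -
  define c where "c = sb (sa (sb a))"
  have c1: "c \<in> T k j i" unfolding c_def using a V sa_T sb_T by blast
  have c2: "sa c \<in> T j k i" "sb c \<in> T k i j" using c1 V sa_T sb_T by blast+
  have c3: "sb (sa c) \<in> T j i k" "sa (sb c) \<in> T i k j" using c2 V sa_T sb_T by blast+
  have c4: "sa (sb (sa c)) \<in> T i j k" using c3 V sa_T by blast
  note cU = T_U[OF c1] T_U[OF c2(1)] T_U[OF c3(2)]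
  note act = act_closed act_inv
  have "sa (sb (sa (add c v))) = add (sa (sb (sa c))) (inv act i j (act j k v))"
    using sa_add[OF c1 V(3,2,1) v] sb_add'[OF cU(2)] sa_add[OF c3(1)] V v by (simp add: act)
  moreover have "sb (sa (sb (add c v))) = add (sb (sa (sb c))) (inv act i k v)"
    using sb_add'[OF cU(1)] sa_add[OF c2(2)] sb_add'[OF cU(3)] V v by (simp add: act)
  moreover have "sa (sb (sa (add c v))) = sb (sa (sb (add c v)))"
    using braid add_T[OF c1 V(3,2,1) v] T_U by blast
  ultimately have "inv act i j (act j k v) = inv act i k v"
    using add_inj[OF _ c4] braid[OF cU(1)] V v by (simp add: act)
  then have "inv (inv act i j (act j k v)) = inv (inv act i k v)" by (rule arg_cong)
  then show ?thesis using act(1) V v by simp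
qed

text \<open>Since \<open>sa\<close> is an involution fixing \<open>D i i\<close>, the map
  \<open>act i i\<close> is an involution; by \<open>act_act\<close> it is also idempotent.\<close>

lemma act_id: assumes i: "i \<in> V" and v: "v \<in> carrier A" shows "act i i v = v"
proof -
  have d: "D i i \<in> T i i i" using D_T i by blast
  have *: "sa (add (D i i) v) = add (D i i) (inv act i i v)" if "v \<in> carrier A" for v
    using sa_add[OF d i i i that] sa_D i by simp
  have "add (D i i) v = sa (sa (add (D i i) v))" using add_T[OF d i i i v] T_U sa_sa by metis
  also have "\<dots> = add (D i i) (act i i (act i i v))" using * v act_closed i act_inv by simp
  finally have "v = act i i (act i i v)" using add_inj[OF _ d] i v act_closed by blast
  then show ?thesis using act_act[OF d] i v by simp
qed

text \<open>The triangle i, j, i needed for \<open>act_act\<close> is the degenerate one over the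
  edge i, j with its last vertices exchanged.\<close>

lemma act_inverse: assumes V: "i \<in> V" "j \<in> V" and v: "v \<in> carrier A" shows "act i j (act j i v) = v"
proof -
  have "sb (D i j) \<in> T i j i" using D_T V sb_T by blast
  then show ?thesis using act_act act_id V v by metis
qed

text \<open>Faces 0 and 1 do not share their first corners, but both contain vertex k. With k moved
  to the front, \<open>add12\<close> adds the same sphere \<open>w\<close> to both; seen from their
  own first corners this sphere is \<open>v\<close> at i and its transport at j.\<close>

lemma add10:
  assumes "Tet a0 a1 a2 a3" "a0 \<in> T j k l" "a1 \<in> T i k l" "a2 \<in> T i j l" "a3 \<in> T i j k"
    "i \<in> V" "j \<in> V" "k \<in> V" "l \<in> V" "v \<in> carrier A"
  shows "Tet (add a0 (act j i v)) (add a1 v) a2 a3"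
proof -
  note V = assms(6-9)
  note U = Tet_U[OF assms(1)]
  define w where "w = inv act k i v"
  have w: "w \<in> carrier A" using w_def act_closed V assms(10) by simp
  have "Tet (sa a0) a2 a1 (sb a3)" by (rule swap12[OF assms(1)])
  then have t: "Tet a2 (sa a0) (sa a1) (sa (sb a3))" by (rule swap01)
  have b: "sa a0 \<in> T k j l" "sa a1 \<in> T k i l" using assms sa_T by blast+
  have t: "Tet a2 (add (sa a0) w) (add (sa a1) w) (sa (sb a3))" using add12 t w by blast
  have e1: "sa (add (sa a1) w) = add a1 v"
    using sa_add[OF b(2)] V w U sa_sa assms(10) unfolding w_def by (simp add: act_inv act_inverse act_closed)
  have e0: "sa (add (sa a0) w) = add a0 (act j i v)"
    using sa_add[OF b(1)] V w U sa_sa assms(10) act_act[of "sb (sa a3)" j k i v] sb_T[of "sa a3" j i k] sa_T[OF assms(5)]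
    unfolding w_def by (simp add: act_inv act_closed)
  have "sb a3 \<in> U" using sb_T assms T_U by blast
  then have "Tet (add (sa a0) w) a2 (add a1 v) (sb a3)" using swap01[OF t] e1 sa_sa by simp
  then show ?thesis using swap12 e0 sb_sb U by metis
qed

end

subsection \<open>Maps on compact quotients\<close>

text \<open>A continuous map from a compact space to a Hausdorff space is closed onto its image, so
  continuity may be tested after composing with \<open>q\<close>. This treats formulas whose
  denominators vanish somewhere: in suitable parameters the denominator disappears.\<close>

lemma continuous_on_compact_quotient:
  fixes q :: "'c::topological_space \<Rightarrow> 'z::t2_space" and h :: "'z \<Rightarrow> 'a::topological_space"
  assumes C: "compact C" and q: "continuous_on C q" and F: "continuous_on C F"
    and eq: "\<And>c. c \<in> C \<Longrightarrow> h (q c) = F c"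
  shows "continuous_on (q ` C) h"
  unfolding continuous_on_closed_invariant
proof (intro allI impI)
  fix B :: "'a set" assume "closed B"
  then obtain A where A: "closed A" "A \<inter> C = F -` B \<inter> C"
    using F unfolding continuous_on_closed_invariant by blast
  have "compact (C \<inter> A)" using C A by (simp add: compact_Int_closed)
  then have "closed (q ` (C \<inter> A))"
    by (intro compact_imp_closed compact_continuous_image continuous_on_subset[OF q]) auto
  moreover have "q ` (C \<inter> A) \<inter> q ` C = h -` B \<inter> q ` C"
  proof -
    have "c \<in> A \<longleftrightarrow> h (q c) \<in> B" if "c \<in> C" for c
      using arg_cong[OF A(2), of "\<lambda>S. c \<in> S"] eq[OF that] that by simp
    then show ?thesis by (intro Set.set_eqI) (simp add: image_iff Bex_def, metis)
  qed
  ultimately show "\<exists>A. closed A \<and> A \<inter> q ` C = h -` B \<inter> q ` C"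
    by (intro exI[of _ "q ` (C \<inter> A)"] conjI)
qed

lemma quotient_map_into:
  fixes q :: "'c::topological_space \<Rightarrow> 'z::t2_space" and h :: "'z \<Rightarrow> 'a::topological_space"
  assumes "compact C" "continuous_on C q" "continuous_on C F" "F ` C \<subseteq> M"
    and "\<And>c. c \<in> C \<Longrightarrow> h (q c) = F c" and "S \<subseteq> q ` C"
  shows "continuous_on S h \<and> h ` S \<subseteq> M"
proof
  show "continuous_on S h"
    by (rule continuous_on_subset[OF continuous_on_compact_quotient[OF assms(1-3,5)] assms(6)])
  have "h ` q ` C \<subseteq> M" using assms(4,5) by (simp add: image_subset_iff)
  with assms(6) show "h ` S \<subseteq> M" by (meson image_mono subset_trans)
qed

text \<open>Two parametrizations from one compact domain, meant for the lens at a corner and for its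
  complement.\<close>

lemma quotient_map_into2:
  fixes q1 q2 :: "'c::topological_space \<Rightarrow> 'z::t2_space" and h :: "'z \<Rightarrow> 'a::topological_space"
  assumes C: "compact C" and q: "continuous_on C q1" "continuous_on C q2"
    and F: "continuous_on C F1" "continuous_on C F2" and FM: "F1 ` C \<subseteq> M" "F2 ` C \<subseteq> M"
    and eq1: "\<And>c. c \<in> C \<Longrightarrow> h (q1 c) = F1 c"
    and eq2: "\<And>c. c \<in> C \<Longrightarrow> h (q2 c) = F2 c"
    and S: "S \<subseteq> q1 ` C \<union> q2 ` C"
  shows "continuous_on S h \<and> h ` S \<subseteq> M"
proof -
  have "continuous_on (q1 ` C \<union> q2 ` C) h"
    by (intro continuous_on_closed_Un continuous_on_compact_quotient[OF C q(1) F(1) eq1]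
        continuous_on_compact_quotient[OF C q(2) F(2) eq2] compact_imp_closed
        compact_continuous_image q C) auto
  then have "continuous_on S h" using S by (rule continuous_on_subset)
  moreover have "h ` (q1 ` C \<union> q2 ` C) \<subseteq> M" using FM eq1 eq2 by (simp add: image_subset_iff ball_Un)
  then have "h ` S \<subseteq> M" using S by (meson image_mono subset_trans)
  ultimately show ?thesis ..
qed

subsection \<open>Triangles and tetrahedra in barycentric tuples\<close>

text \<open>Triples replace the coordinate functions of the standard simplex, so that continuity and
  case distinctions become real arithmetic. The translation back is \<open>tri_of\<close>.\<close>

definition D2 :: "(real \<times> real \<times> real) set" where
  "D2 = {(x, y, z). 0 \<le> x \<and> 0 \<le> y \<and> 0 \<le> z \<and> x + y + z = 1}"

definition bd2 :: "(real \<times> real \<times> real) set" where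
  "bd2 = {(x, y, z) \<in> D2. x = 0 \<or> y = 0 \<or> z = 0}"

definition D3 :: "(real \<times> real \<times> real \<times> real) set" where
  "D3 = {(x, y, z, w). 0 \<le> x \<and> 0 \<le> y \<and> 0 \<le> z \<and> 0 \<le> w \<and> x + y + z + w = 1}"

lemma D2_iff: "(x, y, z) \<in> D2 \<longleftrightarrow> 0 \<le> x \<and> 0 \<le> y \<and> 0 \<le> z \<and> x + y + z = 1"
  by (simp add: D2_def)

lemma bd2_iff: "(x, y, z) \<in> bd2 \<longleftrightarrow> (x, y, z) \<in> D2 \<and> (x = 0 \<or> y = 0 \<or> z = 0)"
  by (auto simp: bd2_def)

lemma D3_iff: "(x, y, z, w) \<in> D3 \<longleftrightarrow> 0 \<le> x \<and> 0 \<le> y \<and> 0 \<le> z \<and> 0 \<le> w \<and> x + y + z + w = 1"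
  by (simp add: D3_def)

lemma bd2_D2: "p \<in> bd2 \<Longrightarrow> p \<in> D2"
  by (auto simp: bd2_def)

lemma compact_D2: "compact D2"
proof -
  have "D2 = (\<lambda>(s, t). (s, (1 - s) * t, (1 - s) * (1 - t))) ` ({0..1} \<times> {0..1})"
  proof (intro Set.set_eqI iffI)
    fix p assume "p \<in> D2"
    obtain x y z where p: "p = (x, y, z)" by (metis prod_cases3)
    with \<open>p \<in> D2\<close> have D: "0 \<le> x" "0 \<le> y" "0 \<le> z" "x + y + z = 1" by (auto simp: D2_iff)
    show "p \<in> (\<lambda>(s, t). (s, (1 - s) * t, (1 - s) * (1 - t))) ` ({0..1} \<times> {0..1})"
    proof (cases "x = 1")
      case True
      then show ?thesis using D p by (intro image_eqI[where x="(1,0)"]) auto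
    next
      case False
      then have "1 - x > 0" using D by linarith
      moreover have "z = (1 - x) - y" using D by linarith
      ultimately show ?thesis using D p
        by (intro image_eqI[where x="(x, y / (1 - x))"]) (auto simp: right_diff_distrib)
    qed
  next
    fix p assume "p \<in> (\<lambda>(s, t). (s, (1 - s) * t, (1 - s) * (1 - t))) ` ({0..1::real} \<times> {0..1::real})"
    moreover have "(s, (1 - s) * t, (1 - s) * (1 - t)) \<in> D2" if "0 \<le> s" "s \<le> 1" "0 \<le> t" "t \<le> 1" for s t :: real
      using that by (simp add: D2_iff) (simp add: algebra_simps)
    ultimately show "p \<in> D2" by auto
  qed
  also have "compact \<dots>"
    by (intro compact_continuous_image compact_Times compact_Icc)
      (auto simp: case_prod_unfold intro!: continuous_intros)
  finally show ?thesis .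
qed

abbreviation "J \<equiv> {0..1::real}"

definition tri :: "'a::topological_space set \<Rightarrow> (real \<times> real \<times> real \<Rightarrow> 'a) \<Rightarrow> bool" where
  "tri M a \<longleftrightarrow> continuous_on D2 a \<and> a ` D2 \<subseteq> M"

definition hom2 :: "'a::topological_space set \<Rightarrow> (real \<times> real \<times> real \<Rightarrow> 'a) \<Rightarrow> (real \<times> real \<times> real \<Rightarrow> 'a) \<Rightarrow> bool" where
  "hom2 M a b \<longleftrightarrow> homotopic_with_canon (\<lambda>k. \<forall>p\<in>bd2. k p = a p) D2 M a b"

lemma hom2_iff: "hom2 M a b \<longleftrightarrow> (\<exists>h. continuous_on (J \<times> D2) h \<and> h ` (J \<times> D2) \<subseteq> M \<and>
    (\<forall>p\<in>D2. h (0, p) = a p) \<and> (\<forall>p\<in>D2. h (1, p) = b p) \<and> (\<forall>t\<in>J. \<forall>p\<in>bd2. h (t, p) = a p))"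
  unfolding hom2_def
  by (subst homotopic_with) (simp_all add: bd2_D2 prod_topology_subtopology_eu image_subset_iff_funcset conj_assoc)

lemma hom2I:
  assumes "continuous_on (J \<times> D2) h \<and> h ` (J \<times> D2) \<subseteq> M"
    and "\<And>p. p \<in> D2 \<Longrightarrow> h (0, p) = a p" "\<And>p. p \<in> D2 \<Longrightarrow> h (1, p) = b p"
    and "\<And>t p. 0 \<le> t \<Longrightarrow> t \<le> 1 \<Longrightarrow> p \<in> bd2 \<Longrightarrow> h (t, p) = a p"
  shows "hom2 M a b"
  unfolding hom2_iff using assms by (intro exI[of _ h]) auto

lemma hom2_bd: "hom2 M a b \<Longrightarrow> p \<in> bd2 \<Longrightarrow> b p = a p"
  unfolding hom2_iff using bd2_D2 by (metis atLeastAtMost_iff order_refl zero_le_one)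

lemma hom2_pred: assumes "hom2 M a b"
  shows "(\<lambda>k. \<forall>p\<in>bd2. k p = b p) = (\<lambda>k. \<forall>p\<in>bd2. k p = a p)"
  using hom2_bd[OF assms] by auto

lemma hom2_sym: assumes "hom2 M a b" shows "hom2 M b a"
  using assms unfolding hom2_def hom2_pred[OF assms] by (rule homotopic_with_symD)

lemma hom2_trans: assumes "hom2 M a b" "hom2 M b c" shows "hom2 M a c"
  using assms(1) assms(2)[unfolded hom2_def hom2_pred[OF assms(1)]]
  unfolding hom2_def by (rule homotopic_with_trans)

lemma hom2_eq:
  assumes "tri M a" "\<And>x y z. (x, y, z) \<in> D2 \<Longrightarrow> b (x, y, z) = a (x, y, z)"
  shows "hom2 M a b"
proof (rule hom2I[where h="\<lambda>(t, p). a p"])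
  show "continuous_on (J \<times> D2) (\<lambda>(t, p). a p) \<and> (\<lambda>(t, p). a p) ` (J \<times> D2) \<subseteq> M"
    using assms(1) unfolding tri_def case_prod_unfold
    by (auto intro!: continuous_on_compose2[of D2 a _ snd] continuous_intros)
qed (use assms(2) in auto)

lemma hom2_tri: assumes "hom2 M a b" shows "tri M a" "tri M b"
proof -
  have "continuous_map (top_of_set D2) (top_of_set M) a \<and> continuous_map (top_of_set D2) (top_of_set M) b"
    by (rule homotopic_with_imp_continuous_maps[OF assms[unfolded hom2_def]])
  then show "tri M a" "tri M b" by (simp_all add: tri_def image_subset_iff_funcset)
qed

definition faces :: "(real \<times> real \<times> real \<times> real \<Rightarrow> 'a) \<Rightarrow> (real \<times> real \<times> real \<Rightarrow> 'a) \<Rightarrow> (real \<times> real \<times> real \<Rightarrow> 'a) \<Rightarrow>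
    (real \<times> real \<times> real \<Rightarrow> 'a) \<Rightarrow> (real \<times> real \<times> real \<Rightarrow> 'a) \<Rightarrow> bool" where
  "faces \<omega> a0 a1 a2 a3 \<longleftrightarrow>
     (\<forall>x y z. (x, y, z) \<in> D2 \<longrightarrow> \<omega> (0, x, y, z) = a0 (x, y, z) \<and> \<omega> (x, 0, y, z) = a1 (x, y, z) \<and>
        \<omega> (x, y, 0, z) = a2 (x, y, z) \<and> \<omega> (x, y, z, 0) = a3 (x, y, z))"

definition tet :: "'a::topological_space set \<Rightarrow> (real \<times> real \<times> real \<Rightarrow> 'a) \<Rightarrow> (real \<times> real \<times> real \<Rightarrow> 'a) \<Rightarrow>
    (real \<times> real \<times> real \<Rightarrow> 'a) \<Rightarrow> (real \<times> real \<times> real \<Rightarrow> 'a) \<Rightarrow> bool" where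
  "tet M a0 a1 a2 a3 \<longleftrightarrow>
     (\<exists>\<omega>. (continuous_on D3 \<omega> \<and> \<omega> ` D3 \<subseteq> M) \<and> faces \<omega> a0 a1 a2 a3)"

lemma facesD:
  assumes "faces \<omega> a0 a1 a2 a3" "0 \<le> x" "0 \<le> y" "0 \<le> z" "x + y + z = 1"
  shows "\<omega> (0, x, y, z) = a0 (x, y, z)" "\<omega> (x, 0, y, z) = a1 (x, y, z)"
    "\<omega> (x, y, 0, z) = a2 (x, y, z)" "\<omega> (x, y, z, 0) = a3 (x, y, z)"
  using assms unfolding faces_def D2_iff by simp_all

lemma tetI:
  assumes "continuous_on D3 \<omega> \<and> \<omega> ` D3 \<subseteq> M" "faces \<omega> a0 a1 a2 a3"
  shows "tet M a0 a1 a2 a3"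
  unfolding tet_def using assms by (intro exI[of _ \<omega>] conjI) simp_all

lemma tetE:
  assumes "tet M a0 a1 a2 a3"
  obtains \<omega> where "continuous_on D3 \<omega> \<and> \<omega> ` D3 \<subseteq> M" "faces \<omega> a0 a1 a2 a3"
  using assms unfolding tet_def by (elim exE conjE) simp

lemma continuous_on_compose_into:
  assumes "continuous_on S f \<and> f ` S \<subseteq> M" "continuous_on X g" "\<And>x. x \<in> X \<Longrightarrow> g x \<in> S"
  shows "continuous_on X (\<lambda>x. f (g x)) \<and> (\<lambda>x. f (g x)) ` X \<subseteq> M"
proof -
  have "g ` X \<subseteq> S" using assms(3) by blast
  then have "continuous_on X (\<lambda>x. f (g x))"
    by (rule continuous_on_compose2[OF conjunct1[OF assms(1)] assms(2)])
  with assms(1,3) show ?thesis by (simp add: image_subset_iff)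
qed

lemma tet_tri:
  assumes "tet M a0 a1 a2 a3" shows "tri M a0" "tri M a1" "tri M a2" "tri M a3"
proof -
  obtain \<omega> where w: "continuous_on D3 \<omega> \<and> \<omega> ` D3 \<subseteq> M" and f: "faces \<omega> a0 a1 a2 a3"
    by (rule tetE[OF assms])
  have *: "tri M a" if "continuous_on D2 g" "\<And>p. p \<in> D2 \<Longrightarrow> g p \<in> D3" "\<And>p. p \<in> D2 \<Longrightarrow> \<omega> (g p) = a p" for a g
  proof -
    have c: "continuous_on D2 (\<lambda>p. \<omega> (g p)) \<and> (\<lambda>p. \<omega> (g p)) ` D2 \<subseteq> M"
      by (rule continuous_on_compose_into[OF w that(1,2)])
    then have "continuous_on D2 a" using that(3) continuous_on_eq by blast
    moreover have "a ` D2 \<subseteq> M" using c that(3) by (metis (no_types, lifting) image_cong)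
    ultimately show ?thesis unfolding tri_def by blast
  qed
  show "tri M a0"
    by (intro *[of "\<lambda>p. (0, p)"]) (auto simp: D2_def D3_def facesD[OF f] intro!: continuous_intros)
  show "tri M a1"
    by (intro *[of "\<lambda>(x, y, z). (x, 0, y, z)"])
      (auto simp: D2_def D3_def facesD[OF f] case_prod_unfold intro!: continuous_intros)
  show "tri M a2"
    by (intro *[of "\<lambda>(x, y, z). (x, y, 0, z)"])
      (auto simp: D2_def D3_def facesD[OF f] case_prod_unfold intro!: continuous_intros)
  show "tri M a3"
    by (intro *[of "\<lambda>(x, y, z). (x, y, z, 0)"])
      (auto simp: D2_def D3_def facesD[OF f] case_prod_unfold intro!: continuous_intros)
qed

section \<open>Vertex transpositions of triangles and tetrahedra\<close>

definition swa :: "(real \<times> real \<times> real \<Rightarrow> 'a) \<Rightarrow> real \<times> real \<times> real \<Rightarrow> 'a" where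
  "swa a = (\<lambda>(x, y, z). a (y, x, z))"

definition swb :: "(real \<times> real \<times> real \<Rightarrow> 'a) \<Rightarrow> real \<times> real \<times> real \<Rightarrow> 'a" where
  "swb a = (\<lambda>(x, y, z). a (x, z, y))"

lemma swa_apply [simp]: "swa a (x, y, z) = a (y, x, z)" by (simp add: swa_def)
lemma swb_apply [simp]: "swb a (x, y, z) = a (x, z, y)" by (simp add: swb_def)
lemma swa_swa: "swa (swa a) = a" by (auto simp: swa_def)
lemma swb_swb: "swb (swb a) = a" by (auto simp: swb_def)
lemma swap_braid: "swa (swb (swa a)) = swb (swa (swb a))" by (auto simp: swa_def swb_def)

lemma tri_swap: assumes "tri M a" shows "tri M (swa a)" "tri M (swb a)"
  unfolding tri_def swa_def swb_def case_prod_unfold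
  by (rule continuous_on_compose_into[OF assms[unfolded tri_def]];
      auto simp: D2_def intro!: continuous_intros)+

lemma hom2_swap: assumes "hom2 M a b" shows "hom2 M (swa a) (swa b)" "hom2 M (swb a) (swb b)"
proof -
  from assms obtain h where h: "continuous_on (J \<times> D2) h \<and> h ` (J \<times> D2) \<subseteq> M"
    and e: "\<forall>p\<in>D2. h (0, p) = a p" "\<forall>p\<in>D2. h (1, p) = b p" "\<forall>t\<in>J. \<forall>p\<in>bd2. h (t, p) = a p"
    unfolding hom2_iff by blast
  show "hom2 M (swa a) (swa b)"
    by (rule hom2I[where h="\<lambda>p. h (fst p, fst (snd (snd p)), fst (snd p), snd (snd (snd p)))"],
        rule continuous_on_compose_into[OF h])
      (use e in \<open>auto simp: D2_def bd2_def intro!: continuous_intros\<close>)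
  show "hom2 M (swb a) (swb b)"
    by (rule hom2I[where h="\<lambda>p. h (fst p, fst (snd p), snd (snd (snd p)), fst (snd (snd p)))"],
        rule continuous_on_compose_into[OF h])
      (use e in \<open>auto simp: D2_def bd2_def intro!: continuous_intros\<close>)
qed

lemma tet_swap:
  assumes "tet M a0 a1 a2 a3"
  shows "tet M a1 a0 (swa a2) (swa a3)" "tet M (swa a0) a2 a1 (swb a3)" "tet M (swb a0) (swb a1) a3 a2"
proof -
  obtain \<omega> where w: "continuous_on D3 \<omega> \<and> \<omega> ` D3 \<subseteq> M" and f: "faces \<omega> a0 a1 a2 a3"
    by (rule tetE[OF assms])
  have *: "tet M b0 b1 b2 b3"
    if "continuous_on D3 g" "\<And>p. p \<in> D3 \<Longrightarrow> g p \<in> D3" "faces (\<lambda>p. \<omega> (g p)) b0 b1 b2 b3" for g b0 b1 b2 b3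
    by (rule tetI[OF continuous_on_compose_into[OF w that(1,2)] that(3)])
  show "tet M a1 a0 (swa a2) (swa a3)"
  proof (rule *[of "\<lambda>(x, y, z, w). (y, x, z, w)"])
    show "continuous_on D3 (\<lambda>(x, y, z, w). (y, x, z, w))"
      unfolding case_prod_unfold by (intro continuous_intros)
    show "(case p of (x, y, z, w) \<Rightarrow> (y, x, z, w)) \<in> D3" if "p \<in> D3" for p
      using that by (cases p) (simp add: D3_iff)
    show "faces (\<lambda>p. \<omega> (case p of (x, y, z, w) \<Rightarrow> (y, x, z, w))) a1 a0 (swa a2) (swa a3)"
      unfolding faces_def D2_iff by (simp add: facesD[OF f])
  qed
  show "tet M (swa a0) a2 a1 (swb a3)"
  proof (rule *[of "\<lambda>(x, y, z, w). (x, z, y, w)"])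
    show "continuous_on D3 (\<lambda>(x, y, z, w). (x, z, y, w))"
      unfolding case_prod_unfold by (intro continuous_intros)
    show "(case p of (x, y, z, w) \<Rightarrow> (x, z, y, w)) \<in> D3" if "p \<in> D3" for p
      using that by (cases p) (simp add: D3_iff)
    show "faces (\<lambda>p. \<omega> (case p of (x, y, z, w) \<Rightarrow> (x, z, y, w))) (swa a0) a2 a1 (swb a3)"
      unfolding faces_def D2_iff by (simp add: facesD[OF f])
  qed
  show "tet M (swb a0) (swb a1) a3 a2"
  proof (rule *[of "\<lambda>(x, y, z, w). (x, y, w, z)"])
    show "continuous_on D3 (\<lambda>(x, y, z, w). (x, y, w, z))"
      unfolding case_prod_unfold by (intro continuous_intros)
    show "(case p of (x, y, z, w) \<Rightarrow> (x, y, w, z)) \<in> D3" if "p \<in> D3" for p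
      using that by (cases p) (simp add: D3_iff)
    show "faces (\<lambda>p. \<omega> (case p of (x, y, z, w) \<Rightarrow> (x, y, w, z))) (swb a0) (swb a1) a3 a2"
      unfolding faces_def D2_iff by (simp add: facesD[OF f])
  qed
qed

subsection \<open>Existence and uniqueness of fillers\<close>

text \<open>The faces 1, 2, 3 spread out over face 0: where a coordinate is the smallest, it is
  subtracted from all three, and the total amount removed, three times the minimum, goes to vertex
  0. This is projection from face 0 onto the other faces in direction (3, -1, -1, -1).\<close>

definition horn :: "(real \<times> real \<times> real \<Rightarrow> 'a) \<Rightarrow> (real \<times> real \<times> real \<Rightarrow> 'a) \<Rightarrow> (real \<times> real \<times> real \<Rightarrow> 'a) \<Rightarrow>
    real \<times> real \<times> real \<Rightarrow> 'a" where
  "horn a1 a2 a3 = (\<lambda>(x, y, z).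
     if x \<le> y \<and> x \<le> z then a1 (3 * x, y - x, z - x)
     else if y \<le> z then a2 (3 * y, x - y, z - y) else a3 (3 * z, x - z, y - z))"

definition mn3 :: "real \<times> real \<times> real \<Rightarrow> real" where
  "mn3 = (\<lambda>(x, y, z). min x (min y z))"

lemma mn3_apply: "mn3 (x, y, z) = min x (min y z)" by (simp add: mn3_def)

lemma mn3_cont [continuous_intros]: "continuous_on S mn3"
  unfolding mn3_def case_prod_unfold by (intro continuous_intros)

text \<open>The tetrahedron itself supplies the homotopy: each point of face 0 moves in direction
  (3, -1, -1, -1) until a coordinate vanishes. Boundary points have minimum 0 and do not move.
  Uniqueness of fillers up to homotopy follows.\<close>

lemma tet_hom2_horn:
  assumes "tet M a0 a1 a2 a3" shows "hom2 M a0 (horn a1 a2 a3)"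
proof -
  obtain \<omega> where w: "continuous_on D3 \<omega> \<and> \<omega> ` D3 \<subseteq> M" and f: "faces \<omega> a0 a1 a2 a3"
    by (rule tetE[OF assms])
  define g where "g = (\<lambda>(t, p). (t * (3 * mn3 p), fst p - t * mn3 p, fst (snd p) - t * mn3 p, snd (snd p) - t * mn3 p))"
  have gap: "g (t, x, y, z) = (t * (3 * mn3 (x, y, z)), x - t * mn3 (x, y, z), y - t * mn3 (x, y, z), z - t * mn3 (x, y, z))" for t x y z
    by (simp add: g_def)
  show ?thesis
  proof (rule hom2I[where h="\<lambda>p. \<omega> (g p)"])
    show "continuous_on (J \<times> D2) (\<lambda>p. \<omega> (g p)) \<and> (\<lambda>p. \<omega> (g p)) ` (J \<times> D2) \<subseteq> M"
    proof (rule continuous_on_compose_into[OF w])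
      show "continuous_on (J \<times> D2) g" unfolding g_def case_prod_unfold
        by (intro continuous_intros continuous_on_compose2[OF mn3_cont[of UNIV], of _ snd]) auto
      fix q assume "q \<in> J \<times> D2"
      moreover obtain t x y z where "q = (t, x, y, z)" by (metis prod_cases4)
      ultimately have q: "q = (t, x, y, z)" "0 \<le> t" "t \<le> 1" "(x, y, z) \<in> D2" by simp_all
      define m where "m = mn3 (x, y, z)"
      have m: "0 \<le> m" "m \<le> x" "m \<le> y" "m \<le> z" using q(4) by (auto simp: m_def mn3_apply D2_iff)
      have "0 \<le> t * m" "0 \<le> m * t" "t * m \<le> m" using m(1) q(2,3) by (auto intro: mult_left_le_one_le)
      then show "g q \<in> D3" using m q(4) by (simp add: q(1) gap D3_iff D2_iff flip: m_def)
    qed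
  next
    fix p assume p: "p \<in> D2"
    obtain x y z where q: "p = (x, y, z)" by (metis prod_cases3)
    have D: "0 \<le> x" "0 \<le> y" "0 \<le> z" "x + y + z = 1" using p q by (simp_all add: D2_iff)
    show "\<omega> (g (0, p)) = a0 p" using D by (simp add: q gap facesD[OF f])
    consider "x \<le> y \<and> x \<le> z" | "\<not> (x \<le> y \<and> x \<le> z)" "y \<le> z" | "\<not> (x \<le> y \<and> x \<le> z)" "\<not> y \<le> z" by blast
    then show "\<omega> (g (1, p)) = horn a1 a2 a3 p"
    proof cases
      case 1
      then have "mn3 (x, y, z) = x" by (simp add: mn3_apply)
      then show ?thesis using D 1 by (simp add: q gap horn_def facesD[OF f])
    next
      case 2
      then have "mn3 (x, y, z) = y" by (auto simp: mn3_apply)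
      then show ?thesis using D 2 by (auto simp add: q gap horn_def facesD[OF f])
    next
      case 3
      then have "mn3 (x, y, z) = z" by (auto simp: mn3_apply)
      then show ?thesis using D 3 by (auto simp add: q gap horn_def facesD[OF f])
    qed
  next
    fix t :: real and p assume t: "0 \<le> t" "t \<le> 1" and p: "p \<in> bd2"
    obtain x y z where q: "p = (x, y, z)" by (metis prod_cases3)
    have "mn3 (x, y, z) = 0" using p by (auto simp: q bd2_iff D2_iff mn3_apply)
    then show "\<omega> (g (t, p)) = a0 p" using p by (simp add: q gap facesD[OF f] bd2_iff D2_iff)
  qed
qed

text \<open>The hypotheses on the edges make the three formulas agree where two coordinates are both
  smallest.\<close>

lemma horn_tri:
  assumes t: "tri M a1" "tri M a2" "tri M a3"
    and e1: "\<And>x y. 0 \<le> x \<Longrightarrow> 0 \<le> y \<Longrightarrow> x + y = 1 \<Longrightarrow> a1 (x, 0, y) = a2 (x, 0, y)"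
    and e2: "\<And>x y. 0 \<le> x \<Longrightarrow> 0 \<le> y \<Longrightarrow> x + y = 1 \<Longrightarrow> a1 (x, y, 0) = a3 (x, 0, y)"
    and e3: "\<And>x y. 0 \<le> x \<Longrightarrow> 0 \<le> y \<Longrightarrow> x + y = 1 \<Longrightarrow> a2 (x, y, 0) = a3 (x, y, 0)"
  shows "tri M (horn a1 a2 a3)"
proof -
  define C1 where "C1 = {p \<in> D2. fst p \<le> fst (snd p)} \<inter> {p \<in> D2. fst p \<le> snd (snd p)}"
  define C2 where "C2 = {p \<in> D2. fst (snd p) \<le> fst p} \<inter> {p \<in> D2. fst (snd p) \<le> snd (snd p)}"
  define C3 where "C3 = {p \<in> D2. snd (snd p) \<le> fst p} \<inter> {p \<in> D2. snd (snd p) \<le> fst (snd p)}"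
  have cl: "closed C1" "closed C2" "closed C3" unfolding C1_def C2_def C3_def
    by (intro closed_Int closed_Collect_le[where g=fst, unfolded Collect_conj_eq] continuous_closedin_preimage
       continuous_on_closed_Collect_le compact_imp_closed compact_D2 continuous_intros)+
  have h1: "horn a1 a2 a3 p = a1 (3 * fst p, fst (snd p) - fst p, snd (snd p) - fst p)" if "p \<in> C1" for p
    using that by (cases p) (auto simp: C1_def horn_def)
  have h2: "horn a1 a2 a3 p = a2 (3 * fst (snd p), fst p - fst (snd p), snd (snd p) - fst (snd p))" if "p \<in> C2" for p
  proof (cases p)
    case (fields x y z)
    have D: "0 \<le> x" "0 \<le> y" "0 \<le> z" "x + y + z = 1" "y \<le> x" "y \<le> z" using that fields by (auto simp: C2_def D2_iff)
    show ?thesis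
    proof (cases "x \<le> y \<and> x \<le> z")
      case True
      then have "x = y" using D by simp
      then show ?thesis using D fields e1[of "3 * y" "z - y"] by (simp add: horn_def)
    next
      case False
      then show ?thesis using D fields by (auto simp: horn_def)
    qed
  qed
  have h3: "horn a1 a2 a3 p = a3 (3 * snd (snd p), fst p - snd (snd p), fst (snd p) - snd (snd p))" if "p \<in> C3" for p
  proof (cases p)
    case (fields x y z)
    have D: "0 \<le> x" "0 \<le> y" "0 \<le> z" "x + y + z = 1" "z \<le> x" "z \<le> y" using that fields by (auto simp: C3_def D2_iff)
    show ?thesis
    proof (cases "x \<le> y \<and> x \<le> z")
      case True
      then have "x = z" using D by simp
      then show ?thesis using D fields e2[of "3 * z" "y - z"] True by (simp add: horn_def)
    next
      case F: False
      show ?thesis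
      proof (cases "y \<le> z")
        case True
        then have "y = z" using D by simp
        then show ?thesis using D fields e3[of "3 * z" "x - z"] F by (auto simp: horn_def)
      next
        case False
        then show ?thesis using D fields F by (auto simp: horn_def)
      qed
    qed
  qed
  note T = t[unfolded tri_def]
  have D: "p \<in> D2 \<Longrightarrow> (fst p, fst (snd p), snd (snd p)) \<in> D2" for p by simp
  have 1: "continuous_on C1 (horn a1 a2 a3) \<and> horn a1 a2 a3 ` C1 \<subseteq> M"
  proof -
    have "continuous_on C1 (\<lambda>p. a1 (3 * fst p, fst (snd p) - fst p, snd (snd p) - fst p)) \<and>
      (\<lambda>p. a1 (3 * fst p, fst (snd p) - fst p, snd (snd p) - fst p)) ` C1 \<subseteq> M"
      by (rule continuous_on_compose_into[OF T(1)]) (auto simp: C1_def D2_def intro!: continuous_intros)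
    then show ?thesis using h1 by (simp cong: continuous_on_cong image_cong)
  qed
  have 2: "continuous_on C2 (horn a1 a2 a3) \<and> horn a1 a2 a3 ` C2 \<subseteq> M"
  proof -
    have "continuous_on C2 (\<lambda>p. a2 (3 * fst (snd p), fst p - fst (snd p), snd (snd p) - fst (snd p))) \<and>
      (\<lambda>p. a2 (3 * fst (snd p), fst p - fst (snd p), snd (snd p) - fst (snd p))) ` C2 \<subseteq> M"
      by (rule continuous_on_compose_into[OF T(2)]) (auto simp: C2_def D2_def intro!: continuous_intros)
    then show ?thesis using h2 by (simp cong: continuous_on_cong image_cong)
  qed
  have 3: "continuous_on C3 (horn a1 a2 a3) \<and> horn a1 a2 a3 ` C3 \<subseteq> M"
  proof -
    have "continuous_on C3 (\<lambda>p. a3 (3 * snd (snd p), fst p - snd (snd p), fst (snd p) - snd (snd p))) \<and>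
      (\<lambda>p. a3 (3 * snd (snd p), fst p - snd (snd p), fst (snd p) - snd (snd p))) ` C3 \<subseteq> M"
      by (rule continuous_on_compose_into[OF T(3)]) (auto simp: C3_def D2_def intro!: continuous_intros)
    then show ?thesis using h3 by (simp cong: continuous_on_cong image_cong)
  qed
  have sub: "D2 \<subseteq> C1 \<union> C2 \<union> C3" by (auto simp: C1_def C2_def C3_def)
  have "continuous_on (C1 \<union> C2 \<union> C3) (horn a1 a2 a3)"
    by (intro continuous_on_closed_Un closed_Un cl conjunct1[OF 1] conjunct1[OF 2] conjunct1[OF 3])
  then have "continuous_on D2 (horn a1 a2 a3)" using sub by (rule continuous_on_subset)
  moreover have "horn a1 a2 a3 ` (C1 \<union> C2 \<union> C3) \<subseteq> M" using 1 2 3 by (simp add: image_Un)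
  then have "horn a1 a2 a3 ` D2 \<subseteq> M" using image_mono[OF sub] by (rule subset_trans[rotated])
  ultimately show ?thesis unfolding tri_def ..
qed

text \<open>The converse of \<open>tet_hom2_horn\<close>: the homotopy from the horn to
  \<open>a0\<close> is spread along the segments of direction (3, -1, -1, -1), which sweep out the
  tetrahedron. Over the boundary of face 0 the segments shrink to points; this is compatible because
  the homotopy is constant there.\<close>

lemma horn_tet:
  assumes h: "hom2 M (horn a1 a2 a3) a0"
    and e1: "\<And>x y. 0 \<le> x \<Longrightarrow> 0 \<le> y \<Longrightarrow> x + y = 1 \<Longrightarrow> a1 (x, 0, y) = a2 (x, 0, y)"
    and e2: "\<And>x y. 0 \<le> x \<Longrightarrow> 0 \<le> y \<Longrightarrow> x + y = 1 \<Longrightarrow> a1 (x, y, 0) = a3 (x, 0, y)"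
    and e3: "\<And>x y. 0 \<le> x \<Longrightarrow> 0 \<le> y \<Longrightarrow> x + y = 1 \<Longrightarrow> a2 (x, y, 0) = a3 (x, y, 0)"
  shows "tet M a0 a1 a2 a3"
proof -
  obtain h where h: "continuous_on (J \<times> D2) h" "h ` (J \<times> D2) \<subseteq> M"
    and h0: "\<And>p. p \<in> D2 \<Longrightarrow> h (0, p) = horn a1 a2 a3 p" and h1: "\<And>p. p \<in> D2 \<Longrightarrow> h (1, p) = a0 p"
    and hb: "\<And>t p. t \<in> J \<Longrightarrow> p \<in> bd2 \<Longrightarrow> h (t, p) = horn a1 a2 a3 p"
    using assms(1) unfolding hom2_iff by metis
  \<comment> \<open>The point of face 0 on the same segment is obtained by adding x / 3 to the last
    three coordinates. Away from shared edges the time is 1 on face 0 and 0 on the other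
    faces.\<close>
  define \<omega> where "\<omega> = (\<lambda>(x, p). h (3 * mn3 p / (x + 3 * mn3 p), fst p + x / 3, fst (snd p) + x / 3, snd (snd p) + x / 3))"
  define q where "q = (\<lambda>(t, p). (3 * mn3 p * (1 - t), fst p - (1 - t) * mn3 p, fst (snd p) - (1 - t) * mn3 p, snd (snd p) - (1 - t) * mn3 p))"
  have mn: "mn3 (x - c, y - c, z - c) = mn3 (x, y, z) - c" for x y z c by (simp add: mn3_apply min_def)
  have mn': "mn3 (x + c, y + c, z + c) = mn3 (x, y, z) + c" for x y z c by (simp add: mn3_apply min_def)
  have "continuous_on D3 \<omega> \<and> \<omega> ` D3 \<subseteq> M"
  proof (rule quotient_map_into[where q=q and C="J \<times> D2" and F=h])
    show "compact (J \<times> D2)" by (intro compact_Times compact_Icc compact_D2)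
    show "continuous_on (J \<times> D2) q" unfolding q_def case_prod_unfold
      by (intro continuous_intros continuous_on_compose2[OF mn3_cont[of UNIV], of _ snd]) auto
    show "\<omega> (q c) = h c" if "c \<in> J \<times> D2" for c
    proof -
      obtain t x y z where c: "c = (t, x, y, z)" by (metis prod_cases4)
      define m where "m = mn3 (x, y, z)"
      have t: "t \<in> J" "(x, y, z) \<in> D2" using that c by auto
      have m: "0 \<le> m" using t by (auto simp: m_def mn3_apply D2_iff)
      have "\<omega> (q c) = h (3 * (m * t) / (3 * m), x, y, z)"
        by (simp add: \<omega>_def q_def c mn flip: m_def) (simp add: algebra_simps)
      also have "\<dots> = h c"
      proof (cases "m = 0")
        case True
        then have "(x, y, z) \<in> bd2" using t by (auto simp: bd2_iff m_def mn3_apply D2_iff min_def split: if_splits)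
        then show ?thesis using hb[of 0 "(x,y,z)"] hb[of t "(x,y,z)"] t True c by simp
      next
        case False
        then show ?thesis using c by simp
      qed
      finally show ?thesis .
    qed
    show "D3 \<subseteq> q ` (J \<times> D2)"
    proof
      fix p assume "p \<in> D3"
      moreover obtain x0 x y z where p: "p = (x0, x, y, z)" by (metis prod_cases4)
      ultimately have D: "0 \<le> x0" "0 \<le> x" "0 \<le> y" "0 \<le> z" "x0 + x + y + z = 1" by (auto simp: D3_iff)
      define m where "m = mn3 (x, y, z)"
      have m: "0 \<le> m" using D by (auto simp: m_def mn3_apply)
      define t where "t = 3 * m / (x0 + 3 * m)"
      have "0 < x0 + 3 * m \<or> x0 + 3 * m = 0" using m D by linarith
      then have t: "t \<in> J" using m D by (auto simp add: t_def divide_le_eq_1)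
      have tm: "(m + x0 / 3) * (1 - t) = x0 / 3"
        using m D by (cases "x0 + 3 * m = 0") (auto simp: t_def field_simps)
      have "q (t, x + x0 / 3, y + x0 / 3, z + x0 / 3) = p"
      proof -
        have e1: "3 * (m + x0 / 3) * (1 - t) = x0" using tm by (metis mult.assoc nonzero_mult_div_cancel_left times_divide_eq_right zero_neq_numeral)
        have e2: "(1 - t) * (m + x0 / 3) = x0 / 3" using tm by (simp only: mult.commute)
        show ?thesis unfolding q_def p prod.case fst_conv snd_conv mn' m_def[symmetric] e1 e2 by simp
      qed
      moreover have "(x + x0 / 3, y + x0 / 3, z + x0 / 3) \<in> D2" using D by (simp add: D2_iff)
      ultimately show "p \<in> q ` (J \<times> D2)" using t
        by (intro image_eqI[where x="(t, x + x0 / 3, y + x0 / 3, z + x0 / 3)"]) simp_all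
    qed
  qed (use h in auto)
  moreover have "faces \<omega> a0 a1 a2 a3"
    unfolding faces_def
  proof (intro allI impI conjI)
    fix x y z :: real assume D: "(x, y, z) \<in> D2"
    then have D': "0 \<le> x" "0 \<le> y" "0 \<le> z" "x + y + z = 1" by (auto simp: D2_iff)
    define m where "m = mn3 (x, y, z)"
    \<comment> \<open>On an edge of face 0 the time is 0 / 0 = 0 instead of 1; the homotopy is
      constant there, so the value is still that of \<open>a0\<close>.\<close>
    have hw: "h (0, x, y, z) = a0 (x, y, z)" if "m = 0"
    proof -
      have "(x, y, z) \<in> bd2" using that D by (auto simp: bd2_iff m_def mn3_apply D2_iff min_def split: if_splits)
      then show ?thesis using hb[of 0 "(x,y,z)"] hb[of 1 "(x,y,z)"] h1[OF D] by simp
    qed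
    show "\<omega> (0, x, y, z) = a0 (x, y, z)"
      using h1[OF D] hw by (cases "m = 0") (simp_all add: \<omega>_def flip: m_def)
    have m0: "mn3 (0, y, z) = 0" "mn3 (y, 0, z) = 0" "mn3 (y, z, 0) = 0" using D' by (auto simp: mn3_apply)
    have DD: "(x / 3, y + x / 3, z + x / 3) \<in> D2" "(y + x / 3, x / 3, z + x / 3) \<in> D2" "(y + x / 3, z + x / 3, x / 3) \<in> D2"
      using D' by (auto simp: D2_iff)
    show "\<omega> (x, 0, y, z) = a1 (x, y, z)"
      using h0[OF DD(1)] D' by (simp add: \<omega>_def m0 horn_def)
    show "\<omega> (x, y, 0, z) = a2 (x, y, z)"
      using h0[OF DD(2)] D' e1[of x z] by (auto simp add: \<omega>_def m0 horn_def)
    show "\<omega> (x, y, z, 0) = a3 (x, y, z)"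
      using h0[OF DD(3)] D' e2[of x z] e3[of x y] by (auto simp add: \<omega>_def m0 horn_def)
  qed
  ultimately show ?thesis by (rule tetI)
qed

abbreviation into :: "'b::topological_space set \<Rightarrow> 'a::topological_space set \<Rightarrow> ('b \<Rightarrow> 'a) \<Rightarrow> bool" where
  "into S M h \<equiv> continuous_on S h \<and> h ` S \<subseteq> M"

lemma into_Un: "closed A \<Longrightarrow> closed B \<Longrightarrow> into A M h \<Longrightarrow> into B M h \<Longrightarrow> into (A \<union> B) M h"
  by (simp add: continuous_on_closed_Un image_Un)

lemma into_subset: assumes "into T M h" "S \<subseteq> T" shows "into S M h"
  using continuous_on_subset[OF conjunct1[OF assms(1)] assms(2)]
    subset_trans[OF image_mono[OF assms(2)] conjunct2[OF assms(1)]] by simp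

lemma into_cong: assumes "into S M f" "\<And>x. x \<in> S \<Longrightarrow> h x = f x" shows "into S M h"
  using assms by (simp cong: continuous_on_cong image_cong)

lemma compact_D3: "compact D3"
proof -
  have "D3 = (\<lambda>(s, p). (s, (1 - s) * fst p, (1 - s) * fst (snd p), (1 - s) * snd (snd p))) ` (J \<times> D2)"
  proof (intro Set.set_eqI iffI)
    fix p assume "p \<in> D3"
    obtain x y z w where p: "p = (x, y, z, w)" by (metis prod_cases4)
    with \<open>p \<in> D3\<close> have D: "0 \<le> x" "0 \<le> y" "0 \<le> z" "0 \<le> w" "x + y + z + w = 1" by (auto simp: D3_iff)
    show "p \<in> (\<lambda>(s, p). (s, (1 - s) * fst p, (1 - s) * fst (snd p), (1 - s) * snd (snd p))) ` (J \<times> D2)"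
    proof (cases "x = 1")
      case True
      then show ?thesis using D p by (intro image_eqI[where x="(1, 1, 0, 0)"]) (auto simp: D2_iff)
    next
      case False
      then have "1 - x > 0" using D by linarith
      moreover have "y / (1 - x) + z / (1 - x) + w / (1 - x) = 1"
        using calculation D by (simp flip: add_divide_distrib)
      ultimately show ?thesis using D p
        by (intro image_eqI[where x="(x, y / (1 - x), z / (1 - x), w / (1 - x))"]) (auto simp: D2_iff)
    qed
  next
    fix p assume "p \<in> (\<lambda>(s, p). (s, (1 - s) * fst p, (1 - s) * fst (snd p), (1 - s) * snd (snd p))) ` (J \<times> D2)"
    moreover have "(s, (1 - s) * x, (1 - s) * y, (1 - s) * z) \<in> D3"
      if "0 \<le> s" "s \<le> 1" "0 \<le> x" "0 \<le> y" "0 \<le> z" "x + y + z = 1" for s x y z :: real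
      using that by (simp add: D3_iff add.assoc flip: distrib_left)
    ultimately show "p \<in> D3" by (auto simp: D2_def)
  qed
  also have "compact \<dots>"
    by (intro compact_continuous_image compact_Times compact_Icc compact_D2)
      (auto simp: case_prod_unfold intro!: continuous_intros)
  finally show ?thesis .
qed

lemma closed_le_on:
  fixes f g :: "'b::topological_space \<Rightarrow> real"
  assumes "closed S" "continuous_on S f" "continuous_on S g"
  shows "closed {p \<in> S. f p \<le> g p}"
  using continuous_on_closed_Collect_le[OF assms(2,3,1)] .

text \<open>The horn construction one dimension higher: where a coordinate is the smallest, it is
  subtracted from all four and four times its value goes to the cone vertex. On the boundary the
  minimum is 0, so every face keeps its values.\<close>

lemma tet_cone:
  assumes "tet M a123 a023 a013 a012" "tet M a124 a024 a014 a012" "tet M a134 a034 a014 a013"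
    "tet M a234 a034 a024 a023"
  shows "tet M a234 a134 a124 a123"
proof -
  obtain w4 where w4: "into D3 M w4" and f4: "faces w4 a123 a023 a013 a012" by (rule tetE[OF assms(1)])
  obtain w3 where w3: "into D3 M w3" and f3: "faces w3 a124 a024 a014 a012" by (rule tetE[OF assms(2)])
  obtain w2 where w2: "into D3 M w2" and f2: "faces w2 a134 a034 a014 a013" by (rule tetE[OF assms(3)])
  obtain w1 where w1: "into D3 M w1" and f1: "faces w1 a234 a034 a024 a023" by (rule tetE[OF assms(4)])
  define \<omega> where "\<omega> = (\<lambda>(x, y, z, w).
     if x \<le> y \<and> x \<le> z \<and> x \<le> w then w1 (4 * x, y - x, z - x, w - x)
     else if y \<le> z \<and> y \<le> w then w2 (4 * y, x - y, z - y, w - y)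
     else if z \<le> w then w3 (4 * z, x - z, y - z, w - z) else w4 (4 * w, x - w, y - w, z - w))"
  define C1 where "C1 = {p \<in> D3. fst p \<le> fst (snd p)} \<inter> {p \<in> D3. fst p \<le> fst (snd (snd p))} \<inter> {p \<in> D3. fst p \<le> snd (snd (snd p))}"
  define C2 where "C2 = {p \<in> D3. fst (snd p) \<le> fst p} \<inter> {p \<in> D3. fst (snd p) \<le> fst (snd (snd p))} \<inter> {p \<in> D3. fst (snd p) \<le> snd (snd (snd p))}"
  define C3 where "C3 = {p \<in> D3. fst (snd (snd p)) \<le> fst p} \<inter> {p \<in> D3. fst (snd (snd p)) \<le> fst (snd p)} \<inter> {p \<in> D3. fst (snd (snd p)) \<le> snd (snd (snd p))}"
  define C4 where "C4 = {p \<in> D3. snd (snd (snd p)) \<le> fst p} \<inter> {p \<in> D3. snd (snd (snd p)) \<le> fst (snd p)} \<inter> {p \<in> D3. snd (snd (snd p)) \<le> fst (snd (snd p))}"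
  have cl: "closed C1" "closed C2" "closed C3" "closed C4" unfolding C1_def C2_def C3_def C4_def
    by (intro closed_Int closed_le_on compact_imp_closed compact_D3 continuous_intros)+
  have e1: "\<omega> p = w1 (4 * fst p, fst (snd p) - fst p, fst (snd (snd p)) - fst p, snd (snd (snd p)) - fst p)" if "p \<in> C1" for p
    using that by (cases p) (auto simp: C1_def \<omega>_def)
  have e2: "\<omega> p = w2 (4 * fst (snd p), fst p - fst (snd p), fst (snd (snd p)) - fst (snd p), snd (snd (snd p)) - fst (snd p))" if "p \<in> C2" for p
  proof -
    obtain x y z w where q: "p = (x, y, z, w)" by (metis prod_cases4)
    have D: "0 \<le> x" "0 \<le> y" "0 \<le> z" "0 \<le> w" "x + y + z + w = 1" "y \<le> x" "y \<le> z" "y \<le> w"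
      using that q by (auto simp: C2_def D3_iff)
    consider "x = y" | "y < x" using D by linarith
    then show ?thesis
      by cases (use D in \<open>simp_all add: q \<omega>_def facesD[OF f1] facesD[OF f2]\<close>)
  qed
  have e3: "\<omega> p = w3 (4 * fst (snd (snd p)), fst p - fst (snd (snd p)), fst (snd p) - fst (snd (snd p)), snd (snd (snd p)) - fst (snd (snd p)))" if "p \<in> C3" for p
  proof -
    obtain x y z w where q: "p = (x, y, z, w)" by (metis prod_cases4)
    have D: "0 \<le> x" "0 \<le> y" "0 \<le> z" "0 \<le> w" "x + y + z + w = 1" "z \<le> x" "z \<le> y" "z \<le> w"
      using that q by (auto simp: C3_def D3_iff)
    consider "x = z" | "z < x" "y = z" | "z < x" "z < y" using D by linarith
    then show ?thesis
      by cases (use D in \<open>simp_all add: q \<omega>_def facesD[OF f1] facesD[OF f2] facesD[OF f3]\<close>)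
  qed
  have e4: "\<omega> p = w4 (4 * snd (snd (snd p)), fst p - snd (snd (snd p)), fst (snd p) - snd (snd (snd p)), fst (snd (snd p)) - snd (snd (snd p)))" if "p \<in> C4" for p
  proof -
    obtain x y z w where q: "p = (x, y, z, w)" by (metis prod_cases4)
    have D: "0 \<le> x" "0 \<le> y" "0 \<le> z" "0 \<le> w" "x + y + z + w = 1" "w \<le> x" "w \<le> y" "w \<le> z"
      using that q by (auto simp: C4_def D3_iff)
    consider "x = w" | "w < x" "y = w" | "w < x" "w < y" "z = w" | "w < x" "w < y" "w < z" using D by linarith
    then show ?thesis
      by cases (use D in \<open>simp_all add: q \<omega>_def facesD[OF f1] facesD[OF f2] facesD[OF f3] facesD[OF f4]\<close>)
  qed
  have 1: "into C1 M \<omega>"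
  proof (rule into_cong[OF _ e1])
    show "into C1 M (\<lambda>p. w1 (4 * fst p, fst (snd p) - fst p, fst (snd (snd p)) - fst p, snd (snd (snd p)) - fst p))"
      by (rule continuous_on_compose_into[OF w1]) (auto simp: C1_def D3_def intro!: continuous_intros)
  qed
  have 2: "into C2 M \<omega>"
  proof (rule into_cong[OF _ e2])
    show "into C2 M (\<lambda>p. w2 (4 * fst (snd p), fst p - fst (snd p), fst (snd (snd p)) - fst (snd p), snd (snd (snd p)) - fst (snd p)))"
      by (rule continuous_on_compose_into[OF w2]) (auto simp: C2_def D3_def intro!: continuous_intros)
  qed
  have 3: "into C3 M \<omega>"
  proof (rule into_cong[OF _ e3])
    show "into C3 M (\<lambda>p. w3 (4 * fst (snd (snd p)), fst p - fst (snd (snd p)), fst (snd p) - fst (snd (snd p)), snd (snd (snd p)) - fst (snd (snd p))))"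
      by (rule continuous_on_compose_into[OF w3]) (auto simp: C3_def D3_def intro!: continuous_intros)
  qed
  have 4: "into C4 M \<omega>"
  proof (rule into_cong[OF _ e4])
    show "into C4 M (\<lambda>p. w4 (4 * snd (snd (snd p)), fst p - snd (snd (snd p)), fst (snd p) - snd (snd (snd p)), fst (snd (snd p)) - snd (snd (snd p))))"
      by (rule continuous_on_compose_into[OF w4]) (auto simp: C4_def D3_def intro!: continuous_intros)
  qed
  have "into (C1 \<union> C2 \<union> C3 \<union> C4) M \<omega>" by (intro into_Un closed_Un cl 1 2 3 4)
  moreover have "D3 \<subseteq> C1 \<union> C2 \<union> C3 \<union> C4" unfolding C1_def C2_def C3_def C4_def
    by (rule subsetI) (simp, linarith)
  ultimately have "into D3 M \<omega>" by (rule into_subset)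
  moreover have "faces \<omega> a234 a134 a124 a123"
    unfolding faces_def
  proof (intro allI impI conjI)
    fix x y z :: real assume "(x, y, z) \<in> D2"
    then have D: "0 \<le> x" "0 \<le> y" "0 \<le> z" "x + y + z = 1" by (auto simp: D2_iff)
    then have "(0, x, y, z) \<in> C1" "(x, 0, y, z) \<in> C2" "(x, y, 0, z) \<in> C3" "(x, y, z, 0) \<in> C4"
      by (simp_all add: C1_def C2_def C3_def C4_def D3_iff)
    note e = e1[OF this(1)] e2[OF this(2)] e3[OF this(3)] e4[OF this(4)]
    show "\<omega> (0, x, y, z) = a234 (x, y, z)" "\<omega> (x, 0, y, z) = a134 (x, y, z)"
      "\<omega> (x, y, 0, z) = a124 (x, y, z)" "\<omega> (x, y, z, 0) = a123 (x, y, z)"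
      using e D by (simp_all add: facesD[OF f1] facesD[OF f2] facesD[OF f3] facesD[OF f4])
  qed
  ultimately show ?thesis by (rule tetI)
qed

subsection \<open>Gluing a sphere at a corner\<close>

text \<open>In the coordinates (r, u) around the corner [0], the map g fills the lens r \<le> \<rho>(u) and F the rest.\<close>

definition cone_glue :: "(real \<Rightarrow> real) \<Rightarrow> (real \<times> real \<Rightarrow> 'a) \<Rightarrow> (real \<times> real \<Rightarrow> 'a) \<Rightarrow> real \<times> real \<times> real \<Rightarrow> 'a" where
  "cone_glue \<rho> g F = (\<lambda>(x, y, z). let r = 1 - x; u = z / r in
     if r \<le> \<rho> u then g (r / \<rho> u, u) else F ((r - \<rho> u) / (1 - \<rho> u), u))"

text \<open>With r = s * \<rho> u the lens is parametrized without division, and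
  \<open>cone_glue_upper\<close> does the same for the complement with r = \<rho> u + s * (1 -
  \<rho> u). At r = 0 the formula is evaluated at u = 0 / 0 = 0. This is harmless because
  \<open>g\<close> equals \<open>b\<close> at radius 0 and on lenses of width 0.\<close>

lemma cone_glue_lower:
  assumes \<rho>: "0 \<le> \<rho> u" "0 \<le> \<rho> 0" and s: "0 \<le> s" "s \<le> 1"
    and g0: "\<And>u. u \<in> J \<Longrightarrow> g (0, u) = b" and gc: "\<rho> u = 0 \<Longrightarrow> g (s, u) = b" and u: "u \<in> J"
  shows "cone_glue \<rho> g F (1 - s * \<rho> u, s * \<rho> u * (1 - u), s * \<rho> u * u) = g (s, u)"
proof (cases "s * \<rho> u = 0")
  case True
  then have "g (s, u) = b" using g0[OF u] gc by auto
  moreover have "cone_glue \<rho> g F (1, 0, 0) = b" using \<rho> g0[of 0] by (simp add: cone_glue_def)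
  ultimately show ?thesis using True by (simp only: mult_zero_left diff_zero)
next
  case False
  then have "s * \<rho> u \<le> \<rho> u" using s \<rho> by (simp add: mult_left_le_one_le)
  then show ?thesis using False by (simp add: cone_glue_def)
qed

lemma cone_glue_upper:
  assumes \<rho>: "0 \<le> \<rho> u" "\<rho> u \<le> 1" "0 \<le> \<rho> 0" and s: "0 \<le> s" "s \<le> 1"
    and g0: "\<And>u. u \<in> J \<Longrightarrow> g (0, u) = b" and g1: "g (1, u) = b" and F0: "F (0, u) = b"
    and Fc: "\<rho> u = 1 \<Longrightarrow> F (s, u) = b"
    and r: "r = \<rho> u + s * (1 - \<rho> u)"
  shows "cone_glue \<rho> g F (1 - r, r * (1 - u), r * u) = F (s, u)"
proof (cases "r = 0")
  case True
  have "0 \<le> s * (1 - \<rho> u)" using s \<rho> by simp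
  then have "\<rho> u = 0" using True r \<rho> by linarith
  then have "s = 0" using True r by simp
  then show ?thesis using True \<rho> g0[of 0] F0 by (simp add: cone_glue_def)
next
  case False
  consider "\<rho> u = 1" | "\<rho> u < 1" "s = 0" | "\<rho> u < 1" "0 < s" using \<rho> s by linarith
  then show ?thesis
  proof cases
    case 1
    then show ?thesis using r g1 Fc by (simp add: cone_glue_def)
  next
    case 2
    then show ?thesis using r g1 F0 False by (simp add: cone_glue_def)
  next
    case 3
    then have "0 < s * (1 - \<rho> u)" by simp
    then have "\<not> r \<le> \<rho> u" using r by linarith
    moreover have "(r - \<rho> u) / (1 - \<rho> u) = s" using r 3 by simp
    ultimately show ?thesis using False by (simp add: cone_glue_def)
  qed
qed

lemma cone_cover:
  assumes D: "(x, y, z) \<in> D2" and r: "r = 1 - x" and u: "u = z / r" and \<rho>: "0 \<le> \<rho>" "\<rho> \<le> 1"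
  shows "u \<in> J" "y = r * (1 - u)" "z = r * u"
    "(\<exists>s\<in>J. r = s * \<rho>) \<or> (\<exists>s\<in>J. r = \<rho> + s * (1 - \<rho>))"
proof -
  have D: "0 \<le> x" "0 \<le> y" "0 \<le> z" "x + y + z = 1" using D by (auto simp: D2_iff)
  show "u \<in> J" using D r u by (auto simp: divide_le_eq_1)
  show z: "z = r * u" using D r u by auto
  show "y = r * (1 - u)" using z D r by (simp add: right_diff_distrib)
  show "(\<exists>s\<in>J. r = s * \<rho>) \<or> (\<exists>s\<in>J. r = \<rho> + s * (1 - \<rho>))"
  proof (cases "r \<le> \<rho>")
    case True
    then show ?thesis using D r \<rho> by (intro disjI1 bexI[of _ "r / \<rho>"]) (auto simp: divide_le_eq_1)
  next
    case False
    then show ?thesis using D r \<rho> by (intro disjI2 bexI[of _ "(r - \<rho>) / (1 - \<rho>)"]) (auto simp: divide_le_eq_1)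
  qed
qed

lemma cone_point:
  assumes "r \<in> J" "u \<in> J" shows "(1 - r, r * (1 - u), r * u) \<in> D2"
  using assms by (simp add: D2_iff algebra_simps mult_left_le)

lemma lens_range: assumes "u \<in> J" shows "0 \<le> u * (1 - u)" "u * (1 - u) < (1::real)"
proof -
  show "0 \<le> u * (1 - u)" using assms by simp
  have "0 \<le> (u - 1/2) * (u - 1/2)" by simp
  then show "u * (1 - u) < 1" by (simp add: algebra_simps)
qed

text \<open>The width of the lens may depend on the homotopy parameter t, so the lens can itself be
  deformed. The last two conditions ask a piece to be constant wherever its part of the triangle has
  collapsed.\<close>

lemma cone_glue_into:
  fixes M :: "'a::topological_space set"
  assumes \<rho>: "continuous_on (J \<times> J) \<rho>" "\<And>t u. t \<in> J \<Longrightarrow> u \<in> J \<Longrightarrow> 0 \<le> \<rho> (t, u) \<and> \<rho> (t, u) \<le> 1"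
    and g: "into (J \<times> J \<times> J) M g" and F: "into (J \<times> J \<times> J) M F"
    and g0: "\<And>t u. t \<in> J \<Longrightarrow> u \<in> J \<Longrightarrow> g (t, 0, u) = b t" and g1: "\<And>t u. t \<in> J \<Longrightarrow> u \<in> J \<Longrightarrow> g (t, 1, u) = b t"
    and F0: "\<And>t u. t \<in> J \<Longrightarrow> u \<in> J \<Longrightarrow> F (t, 0, u) = b t"
    and gc: "\<And>t s u. t \<in> J \<Longrightarrow> s \<in> J \<Longrightarrow> u \<in> J \<Longrightarrow> \<rho> (t, u) = 0 \<Longrightarrow> g (t, s, u) = b t"
    and Fc: "\<And>t s u. t \<in> J \<Longrightarrow> s \<in> J \<Longrightarrow> u \<in> J \<Longrightarrow> \<rho> (t, u) = 1 \<Longrightarrow> F (t, s, u) = b t"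
  shows "into (J \<times> D2) M (\<lambda>(t, p). cone_glue (\<lambda>u. \<rho> (t, u)) (\<lambda>q. g (t, q)) (\<lambda>q. F (t, q)) p)"
proof -
  define q1 where "q1 = (\<lambda>(t, s, u). (t, 1 - s * \<rho> (t, u), s * \<rho> (t, u) * (1 - u), s * \<rho> (t, u) * u))"
  define q2 where "q2 = (\<lambda>(t, s, u). (t, 1 - (\<rho> (t, u) + s * (1 - \<rho> (t, u))), (\<rho> (t, u) + s * (1 - \<rho> (t, u))) * (1 - u), (\<rho> (t, u) + s * (1 - \<rho> (t, u))) * u))"
  have \<rho>c: "continuous_on (J \<times> J \<times> J) (\<lambda>p. \<rho> (fst p, snd (snd p)))"
    by (rule continuous_on_compose2[OF \<rho>(1)]) (auto intro!: continuous_intros)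
  show ?thesis
  proof (rule quotient_map_into2[where ?q1.0=q1 and ?q2.0=q2 and C="J \<times> J \<times> J" and ?F1.0=g and ?F2.0=F])
    show "compact (J \<times> J \<times> J)" by (intro compact_Times compact_Icc)
    show "continuous_on (J \<times> J \<times> J) q1" "continuous_on (J \<times> J \<times> J) q2"
      unfolding q1_def q2_def case_prod_unfold by (intro continuous_intros \<rho>c)+
    show "continuous_on (J \<times> J \<times> J) g" "continuous_on (J \<times> J \<times> J) F" "g ` (J \<times> J \<times> J) \<subseteq> M" "F ` (J \<times> J \<times> J) \<subseteq> M"
      using g F by simp_all
    fix c :: "real \<times> real \<times> real" assume "c \<in> J \<times> J \<times> J"
    moreover obtain t s u where c: "c = (t, s, u)" by (metis prod_cases3)
    ultimately have t: "t \<in> J" "s \<in> J" "u \<in> J" by auto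
    have "cone_glue (\<lambda>u. \<rho> (t, u)) (\<lambda>q. g (t, q)) (\<lambda>q. F (t, q)) (1 - s * \<rho> (t, u), s * \<rho> (t, u) * (1 - u), s * \<rho> (t, u) * u) = g (t, s, u)"
      by (rule cone_glue_lower[where b="b t"]) (use t \<rho>(2) g0 gc in auto)
    then show "(case q1 c of (t, p) \<Rightarrow> cone_glue (\<lambda>u. \<rho> (t, u)) (\<lambda>q. g (t, q)) (\<lambda>q. F (t, q)) p) = g c"
      by (simp add: q1_def c)
    have "cone_glue (\<lambda>u. \<rho> (t, u)) (\<lambda>q. g (t, q)) (\<lambda>q. F (t, q))
       (1 - (\<rho> (t, u) + s * (1 - \<rho> (t, u))), (\<rho> (t, u) + s * (1 - \<rho> (t, u))) * (1 - u), (\<rho> (t, u) + s * (1 - \<rho> (t, u))) * u) = F (t, s, u)"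
      by (rule cone_glue_upper[where b="b t"]) (use t \<rho>(2) g0 g1 F0 Fc in auto)
    then show "(case q2 c of (t, p) \<Rightarrow> cone_glue (\<lambda>u. \<rho> (t, u)) (\<lambda>q. g (t, q)) (\<lambda>q. F (t, q)) p) = F c"
      by (simp add: q2_def c)
  next
    show "J \<times> D2 \<subseteq> q1 ` (J \<times> J \<times> J) \<union> q2 ` (J \<times> J \<times> J)"
    proof
      fix p assume "p \<in> J \<times> D2"
      moreover obtain t x y z where p: "p = (t, x, y, z)" by (metis prod_cases4)
      ultimately have t: "t \<in> J" and D: "(x, y, z) \<in> D2" by auto
      define r u where "r = 1 - x" and "u = z / r"
      have uJ: "u \<in> J" by (rule cone_cover(1)[OF D r_def u_def, of 0]) auto
      note cov = cone_cover[OF D r_def u_def, of "\<rho> (t, u)"]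
      have yz: "y = r * (1 - u)" "z = r * u" using cov(2,3) \<rho>(2)[OF t uJ] by simp_all
      have "(\<exists>s\<in>J. r = s * \<rho> (t, u)) \<or> (\<exists>s\<in>J. r = \<rho> (t, u) + s * (1 - \<rho> (t, u)))"
        using cov(4) \<rho>(2)[OF t uJ] by simp
      then show "p \<in> q1 ` (J \<times> J \<times> J) \<union> q2 ` (J \<times> J \<times> J)"
      proof (elim disjE bexE)
        fix s assume s: "s \<in> J" "r = s * \<rho> (t, u)"
        have "p = q1 (t, s, u)" unfolding q1_def p prod.case s(2)[symmetric] yz[symmetric] by (simp add: r_def)
        then show ?thesis using t uJ s(1) by (intro UnI1 image_eqI[where x="(t, s, u)"]) simp_all
      next
        fix s assume s: "s \<in> J" "r = \<rho> (t, u) + s * (1 - \<rho> (t, u))"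
        have "p = q2 (t, s, u)" unfolding q2_def p prod.case s(2)[symmetric] yz[symmetric] by (simp add: r_def)
        then show ?thesis using t uJ s(1) by (intro UnI2 image_eqI[where x="(t, s, u)"]) simp_all
      qed
    qed
  qed
qed

section \<open>Gluing on triangles and its compatibility with homotopies\<close>

definition gl :: "(real \<times> real \<times> real \<Rightarrow> 'a) \<Rightarrow> (real \<times> real \<Rightarrow> 'a) \<Rightarrow> real \<times> real \<times> real \<Rightarrow> 'a" where
  "gl a f = cone_glue (\<lambda>u. u * (1 - u)) f (\<lambda>(s, u). a (1 - s, s * (1 - u), s * u))"

lemma unit_square_eq: "unit_square = J \<times> J" by (simp add: unit_square_def)

lemma square_boundary_iff: "(s, t) \<in> square_boundary \<longleftrightarrow> s \<in> J \<and> t \<in> J \<and> (s = 0 \<or> s = 1 \<or> t = 0 \<or> t = 1)"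
  by (simp add: square_boundary_def unit_square_def)

lemma spheroidsD:
  assumes "f \<in> spheroids M m0"
  shows "into (J \<times> J) M f" "\<And>u. u \<in> J \<Longrightarrow> f (0, u) = m0" "\<And>u. u \<in> J \<Longrightarrow> f (1, u) = m0"
    "\<And>s. s \<in> J \<Longrightarrow> f (s, 0) = m0" "\<And>s. s \<in> J \<Longrightarrow> f (s, 1) = m0"
  using assms by (auto simp: spheroids_def unit_square_eq square_boundary_iff)

lemma gl_into:
  fixes M :: "'a::topological_space set"
  assumes a: "into (J \<times> D2) M a" and f: "into (J \<times> J \<times> J) M f"
    and b: "\<And>t z. t \<in> J \<Longrightarrow> z \<in> square_boundary \<Longrightarrow> f (t, z) = a (t, 1, 0, 0)"
  shows "into (J \<times> D2) M (\<lambda>(t, p). gl (\<lambda>p. a (t, p)) (\<lambda>z. f (t, z)) p)"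
proof -
  define F where "F = (\<lambda>(t, s, u). a (t, 1 - s, s * (1 - u), s * u))"
  define \<rho> where "\<rho> = (\<lambda>(t::real, u::real). u * (1 - u))"
  have F: "into (J \<times> J \<times> J) M F"
    unfolding F_def case_prod_unfold
    by (rule continuous_on_compose_into[OF a]) (auto intro!: continuous_intros cone_point)
  have "into (J \<times> D2) M (\<lambda>(t, p). cone_glue (\<lambda>u. \<rho> (t, u)) (\<lambda>q. f (t, q)) (\<lambda>q. F (t, q)) p)"
  proof (rule cone_glue_into[where b="\<lambda>t. a (t, 1, 0, 0)", OF _ _ f F])
    show "continuous_on (J \<times> J) \<rho>" unfolding \<rho>_def case_prod_unfold by (intro continuous_intros)
    fix t u s :: real assume t: "t \<in> J" and u: "u \<in> J"
    show "0 \<le> \<rho> (t, u) \<and> \<rho> (t, u) \<le> 1" using lens_range[OF u] by (simp add: \<rho>_def)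
    show "f (t, 0, u) = a (t, 1, 0, 0)" "f (t, 1, u) = a (t, 1, 0, 0)"
      using t u by (simp_all add: b square_boundary_iff)
    show "F (t, 0, u) = a (t, 1, 0, 0)" by (simp add: F_def)
    assume s: "s \<in> J"
    show "f (t, s, u) = a (t, 1, 0, 0)" if "\<rho> (t, u) = 0"
      using t u s that by (intro b) (auto simp: square_boundary_iff \<rho>_def)
    show "F (t, s, u) = a (t, 1, 0, 0)" if "\<rho> (t, u) = 1"
      using lens_range(2)[OF u] that by (simp add: \<rho>_def)
  qed
  then show ?thesis by (simp only: gl_def F_def \<rho>_def prod.case case_prod_unfold fst_conv snd_conv)
qed

definition sph_hom :: "'a::topological_space set \<Rightarrow> 'a \<Rightarrow> (real \<times> real \<Rightarrow> 'a) \<Rightarrow> (real \<times> real \<Rightarrow> 'a) \<Rightarrow> bool" where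
  "sph_hom M m0 f g \<longleftrightarrow> homotopic_with_canon (\<lambda>k. \<forall>z\<in>square_boundary. k z = m0) unit_square M f g"

lemma square_boundary_sub: "z \<in> square_boundary \<Longrightarrow> z \<in> unit_square"
  by (auto simp: square_boundary_def)

lemma sph_hom_iff: "sph_hom M m0 f g \<longleftrightarrow> (\<exists>h. into (J \<times> J \<times> J) M h \<and>
    (\<forall>p\<in>unit_square. h (0, p) = f p) \<and> (\<forall>p\<in>unit_square. h (1, p) = g p) \<and>
    (\<forall>t\<in>J. \<forall>p\<in>square_boundary. h (t, p) = m0))"
  unfolding sph_hom_def
  by (subst homotopic_with) (simp_all add: square_boundary_sub[unfolded unit_square_eq] prod_topology_subtopology_eu image_subset_iff_funcset unit_square_eq)

lemma sph_hom_sym: "sph_hom M m0 f g \<Longrightarrow> sph_hom M m0 g f"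
  unfolding sph_hom_def by (rule homotopic_with_symD)

lemma sph_hom_trans: "sph_hom M m0 f g \<Longrightarrow> sph_hom M m0 g h \<Longrightarrow> sph_hom M m0 f h"
  unfolding sph_hom_def by (rule homotopic_with_trans)

lemma sph_homI:
  assumes "into (J \<times> J \<times> J) M h" "\<And>p. p \<in> J \<times> J \<Longrightarrow> h (0, p) = f p" "\<And>p. p \<in> J \<times> J \<Longrightarrow> h (1, p) = g p"
    "\<And>t p. t \<in> J \<Longrightarrow> p \<in> square_boundary \<Longrightarrow> h (t, p) = m0"
  shows "sph_hom M m0 f g"
  unfolding sph_hom_iff unit_square_eq using assms by (intro exI[of _ h]) simp

lemma sph_homE:
  assumes "sph_hom M m0 f g"
  obtains h where "into (J \<times> J \<times> J) M h" "\<And>p. p \<in> J \<times> J \<Longrightarrow> h (0, p) = f p" "\<And>p. p \<in> J \<times> J \<Longrightarrow> h (1, p) = g p"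
    "\<And>t p. t \<in> J \<Longrightarrow> p \<in> square_boundary \<Longrightarrow> h (t, p) = m0"
proof -
  obtain h where h: "into (J \<times> J \<times> J) M h" "\<forall>p\<in>J \<times> J. h (0, p) = f p" "\<forall>p\<in>J \<times> J. h (1, p) = g p"
    "\<forall>t\<in>J. \<forall>p\<in>square_boundary. h (t, p) = m0"
    using assms unfolding sph_hom_iff unit_square_eq by blast
  show thesis by (rule that[of h]) (use h in auto)
qed

lemma sph_hom_spheroids:
  assumes "sph_hom M m0 f g" shows "f \<in> spheroids M m0" "g \<in> spheroids M m0"
proof -
  have "continuous_map (top_of_set unit_square) (top_of_set M) f \<and> continuous_map (top_of_set unit_square) (top_of_set M) g"
    by (rule homotopic_with_imp_continuous_maps[OF assms[unfolded sph_hom_def]])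
  moreover have "(\<forall>z\<in>square_boundary. f z = m0) \<and> (\<forall>z\<in>square_boundary. g z = m0)"
    by (rule homotopic_with_imp_property[OF assms[unfolded sph_hom_def]])
  ultimately show "f \<in> spheroids M m0" "g \<in> spheroids M m0" by (simp_all add: spheroids_def image_subset_iff_funcset)
qed

lemma hom2E:
  assumes "hom2 M a b"
  obtains h where "into (J \<times> D2) M h" "\<And>p. p \<in> D2 \<Longrightarrow> h (0, p) = a p" "\<And>p. p \<in> D2 \<Longrightarrow> h (1, p) = b p"
    "\<And>t p. t \<in> J \<Longrightarrow> p \<in> bd2 \<Longrightarrow> h (t, p) = a p"
proof -
  obtain h where h: "into (J \<times> D2) M h" "\<forall>p\<in>D2. h (0, p) = a p" "\<forall>p\<in>D2. h (1, p) = b p"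
    "\<forall>t\<in>J. \<forall>p\<in>bd2. h (t, p) = a p"
    using assms unfolding hom2_iff by blast
  show thesis by (rule that[of h]) (use h in auto)
qed

lemma gl_apply:
  assumes "r = 1 - x" "u = z / r"
  shows "gl a f (x, y, z) = (if r \<le> u * (1 - u) then f (r / (u * (1 - u)), u)
      else (\<lambda>s. a (1 - s, s * (1 - u), s * u)) ((r - u * (1 - u)) / (1 - u * (1 - u))))"
  by (simp only: gl_def cone_glue_def prod.case Let_def assms)

lemma gl_bd:
  assumes "p \<in> bd2" "\<And>z. z \<in> square_boundary \<Longrightarrow> f z = a (1, 0, 0)"
  shows "gl a f p = a p"
proof -
  obtain x y z where p: "p = (x, y, z)" by (metis prod_cases3)
  have D: "(x, y, z) \<in> D2" "x = 0 \<or> y = 0 \<or> z = 0" using assms(1) p by (auto simp: bd2_iff)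
  have D': "0 \<le> x" "0 \<le> y" "0 \<le> z" "x + y + z = 1" using D by (auto simp: D2_iff)
  define r u where "r = 1 - x" and "u = z / r"
  have ru: "u \<in> J" "y = r * (1 - u)" "z = r * u" using cone_cover(1-3)[OF D(1) r_def u_def, of 0] by auto
  note g = gl_apply[OF r_def u_def, of a f y]
  have f00: "f (0, 0) = a (1, 0, 0)" using assms(2)[of "(0,0)"] by (simp add: square_boundary_iff)
  show ?thesis
  proof (cases "r = 0")
    case True
    then have "x = 1" "y = 0" "z = 0" using D' r_def by linarith+
    moreover have "u = 0" using u_def True by simp
    ultimately show ?thesis using g f00 True by (simp add: p)
  next
    case False
    then have "0 < r" using D' r_def by linarith
    have x: "x = 1 - r" using r_def by simp
    have "r = 1 \<or> u = 1 \<or> u = 0" using D(2) False unfolding ru(2,3) x by auto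
    then consider "r = 1" | "u = 1" | "u = 0" by blast
    then show ?thesis
    proof cases
      case 1
      then have "\<not> r \<le> u * (1 - u)" using lens_range[OF ru(1)] by simp
      moreover have "(r - u * (1 - u)) / (1 - u * (1 - u)) = 1" using 1 lens_range[OF ru(1)] by simp
      ultimately have "gl a f (x, y, z) = a (1 - 1, 1 * (1 - u), 1 * u)" unfolding g by simp
      then show ?thesis unfolding p ru(2,3) x 1 by simp
    next
      case 2
      then have "gl a f (x, y, z) = a (1 - r, r * (1 - u), r * u)" unfolding g using \<open>0 < r\<close> by simp
      then show ?thesis unfolding p ru(2,3) x .
    next
      case 3
      then have "gl a f (x, y, z) = a (1 - r, r * (1 - u), r * u)" unfolding g using \<open>0 < r\<close> by simp
      then show ?thesis unfolding p ru(2,3) x .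
    qed
  qed
qed

lemma frac_J: "0 \<le> r \<Longrightarrow> r \<le> d \<Longrightarrow> r / d \<in> J" for r d :: real
  by (cases "d = 0") (auto simp: divide_le_eq_1)

lemma gl_hom2:
  assumes a: "hom2 M a a'" and f: "sph_hom M (a (1, 0, 0)) f f'"
  shows "hom2 M (gl a f) (gl a' f')"
proof -
  obtain h where h: "into (J \<times> D2) M h" and h0: "\<And>p. p \<in> D2 \<Longrightarrow> h (0, p) = a p" and h1: "\<And>p. p \<in> D2 \<Longrightarrow> h (1, p) = a' p"
    and hb: "\<And>t p. t \<in> J \<Longrightarrow> p \<in> bd2 \<Longrightarrow> h (t, p) = a p" using hom2E[OF a] by blast
  obtain k where k: "into (J \<times> J \<times> J) M k" and k0: "\<And>p. p \<in> J \<times> J \<Longrightarrow> k (0, p) = f p" and k1: "\<And>p. p \<in> J \<times> J \<Longrightarrow> k (1, p) = f' p"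
    and kb: "\<And>t p. t \<in> J \<Longrightarrow> p \<in> square_boundary \<Longrightarrow> k (t, p) = a (1, 0, 0)" using sph_homE[OF f] by blast
  have c: "(1, 0, 0) \<in> bd2" by (simp add: bd2_iff D2_iff)
  have kh: "k (t, z) = h (t, 1, 0, 0)" if "t \<in> J" "z \<in> square_boundary" for t z
    using kb[OF that] hb[OF that(1) c] by simp
  have glc: "gl b g p = gl b' g' p" if "\<And>p. p \<in> D2 \<Longrightarrow> b p = b' p" "\<And>p. p \<in> J \<times> J \<Longrightarrow> g p = g' p" "p \<in> D2"
    for b b' :: "_ \<Rightarrow> 'a" and g g' p
  proof -
    obtain x y z where p: "p = (x, y, z)" by (metis prod_cases3)
    have D: "(x, y, z) \<in> D2" using that(3) p by simp
    define r u where "r = 1 - x" and "u = z / r"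
    have u: "u \<in> J" using cone_cover(1)[OF D r_def u_def, of 0] by auto
    have r: "0 \<le> r" "r \<le> 1" using D by (auto simp: r_def D2_iff)
    note l = lens_range[OF u]
    have "g (r / (u * (1 - u)), u) = g' (r / (u * (1 - u)), u)" if "r \<le> u * (1 - u)"
      using \<open>\<And>p. p \<in> J \<times> J \<Longrightarrow> g p = g' p\<close>[of "(r / (u * (1 - u)), u)"] u frac_J[OF r(1) that] by simp
    moreover have "b (1 - s, s * (1 - u), s * u) = b' (1 - s, s * (1 - u), s * u)" if "s \<in> J" for s
      using \<open>\<And>p. p \<in> D2 \<Longrightarrow> b p = b' p\<close> cone_point[OF that u] by simp
    moreover have "(r - u * (1 - u)) / (1 - u * (1 - u)) \<in> J" if "\<not> r \<le> u * (1 - u)"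
      using that l r by (simp add: divide_le_eq_1)
    ultimately show ?thesis unfolding p gl_apply[OF r_def u_def]
      by (cases "r \<le> u * (1 - u)") (simp_all only: if_True if_False not_True_eq_False not_False_eq_True True_implies_equals)
  qed
  show ?thesis
  proof (rule hom2I)
    show "into (J \<times> D2) M (\<lambda>(t, p). gl (\<lambda>p. h (t, p)) (\<lambda>z. k (t, z)) p)" by (rule gl_into[OF h k kh])
    show "(case (0, p) of (t, p) \<Rightarrow> gl (\<lambda>p. h (t, p)) (\<lambda>z. k (t, z)) p) = gl a f p" if "p \<in> D2" for p
      using glc[OF h0 k0 that] by simp
    show "(case (1, p) of (t, p) \<Rightarrow> gl (\<lambda>p. h (t, p)) (\<lambda>z. k (t, z)) p) = gl a' f' p" if "p \<in> D2" for p
      using glc[OF h1 k1 that] by simp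
    fix t :: real and p assume t: "0 \<le> t" "t \<le> 1" and p: "p \<in> bd2"
    have "gl (\<lambda>p. h (t, p)) (\<lambda>z. k (t, z)) p = h (t, p)" by (rule gl_bd[OF p]) (use kh t in simp)
    also have "\<dots> = gl a f p" using hb[of t p] gl_bd[OF p, of f a] kb[of 0] k0 square_boundary_sub t p
      by (simp add: unit_square_eq)
    finally show "(case (t, p) of (t, p) \<Rightarrow> gl (\<lambda>p. h (t, p)) (\<lambda>z. k (t, z)) p) = gl a f p" by simp
  qed
qed

lemma cone_glue_bd:
  assumes f: "f \<in> spheroids M m0" and g: "g \<in> spheroids M m0" and \<rho>: "\<And>u. u \<in> J \<Longrightarrow> 0 \<le> \<rho> u \<and> \<rho> u \<le> 1"
    and p: "p \<in> bd2"
  shows "cone_glue \<rho> g f p = m0"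
proof -
  obtain x y z where q: "p = (x, y, z)" by (metis prod_cases3)
  have D: "(x, y, z) \<in> D2" "x = 0 \<or> y = 0 \<or> z = 0" using p q by (auto simp: bd2_iff)
  have D': "0 \<le> x" "0 \<le> y" "0 \<le> z" "x + y + z = 1" using D by (auto simp: D2_iff)
  define r u where "r = 1 - x" and "u = z / r"
  have ru: "u \<in> J" "y = r * (1 - u)" "z = r * u" using cone_cover(1-3)[OF D(1) r_def u_def, of 0] by auto
  have eq: "cone_glue \<rho> g f (x, y, z) = (if r \<le> \<rho> u then g (r / \<rho> u, u) else f ((r - \<rho> u) / (1 - \<rho> u), u))"
    by (simp only: cone_glue_def prod.case Let_def r_def u_def)
  have r: "0 \<le> r" "r \<le> 1" using D' r_def by linarith+
  have x: "x = 1 - r" using r_def by simp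
  note \<rho> = \<rho>[OF ru(1)]
  have gJ: "r / \<rho> u \<in> J" if "r \<le> \<rho> u" using frac_J[OF r(1) that] .
  have fJ: "(r - \<rho> u) / (1 - \<rho> u) \<in> J" if "\<not> r \<le> \<rho> u" using frac_J[of "r - \<rho> u" "1 - \<rho> u"] that r by simp
  have "r = 1 \<or> u = 1 \<or> u = 0 \<or> r = 0" using D(2) unfolding ru(2,3) x by auto
  then consider "r = 0" | "r = 1" | "u = 1" | "u = 0" by blast
  then show ?thesis
  proof cases
    case 1
    then show ?thesis unfolding q eq using \<rho> spheroidsD(2)[OF g ru(1)] by simp
  next
    case 2
    then show ?thesis unfolding q eq using \<rho> spheroidsD(3)[OF g ru(1)] spheroidsD(3)[OF f ru(1)] by auto
  next
    case 3
    then show ?thesis unfolding q eq using gJ fJ spheroidsD(5)[OF g] spheroidsD(5)[OF f] by simp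
  next
    case 4
    then show ?thesis unfolding q eq using gJ fJ spheroidsD(4)[OF g] spheroidsD(4)[OF f] by simp
  qed
qed

lemma into_snd: "into S M f \<Longrightarrow> into (J \<times> S) M (\<lambda>c. f (snd c))"
  by (rule continuous_on_compose_into) (auto intro!: continuous_intros)

text \<open>The lens is widened linearly to the strip r \<le> c. Both pieces are spheres here, so
  the boundary stays at the base point although the strip meets the sides of the triangle. The case
  c = 1 leaves nothing outside the strip, and c = 1/2 gives \<open>spheroid_join\<close>.\<close>

lemma cone_glue_shrink:
  assumes f: "f \<in> spheroids M m0" and g: "g \<in> spheroids M m0" and c: "0 < c" "c \<le> 1"
    and fc: "c = 1 \<Longrightarrow> f = (\<lambda>_. m0)"
  shows "hom2 M (cone_glue (\<lambda>u. u * (1 - u)) g f) (cone_glue (\<lambda>_. c) g f)"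
proof -
  define \<rho> where "\<rho> = (\<lambda>(t, u). (1 - t) * (u * (1 - u)) + t * c)"
  define G F where "G = (\<lambda>c::real\<times>real\<times>real. g (snd c))" and "F = (\<lambda>c::real\<times>real\<times>real. f (snd c))"
  have \<rho>J: "0 \<le> \<rho> (t, u) \<and> \<rho> (t, u) \<le> 1" if "t \<in> J" "u \<in> J" for t u
  proof -
    have "(1 - t) * (u * (1 - u)) \<le> (1 - t) * 1" using that lens_range[OF that(2)] by (intro mult_left_mono) auto
    moreover have "0 \<le> (1 - t) * (u * (1 - u))" using that lens_range[OF that(2)] by simp
    moreover have "t * c \<le> t" "0 \<le> t * c" using that c by (auto simp: mult_left_le)
    ultimately show ?thesis by (simp add: \<rho>_def)
  qed
  have h: "into (J \<times> D2) M (\<lambda>(t, p). cone_glue (\<lambda>u. \<rho> (t, u)) (\<lambda>q. G (t, q)) (\<lambda>q. F (t, q)) p)"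
  proof (rule cone_glue_into[where b="\<lambda>_. m0"])
    show "continuous_on (J \<times> J) \<rho>" unfolding \<rho>_def case_prod_unfold by (intro continuous_intros)
    show "into (J \<times> J \<times> J) M G" unfolding G_def by (rule into_snd[OF spheroidsD(1)[OF g]])
    show "into (J \<times> J \<times> J) M F" unfolding F_def by (rule into_snd[OF spheroidsD(1)[OF f]])
    fix t s u :: real assume t: "t \<in> J" and u: "u \<in> J"
    show "0 \<le> \<rho> (t, u) \<and> \<rho> (t, u) \<le> 1" by (rule \<rho>J[OF t u])
    show "G (t, 0, u) = m0" "G (t, 1, u) = m0" "F (t, 0, u) = m0"
      using spheroidsD(2,3)[OF g u] spheroidsD(2)[OF f u] by (simp_all add: G_def F_def)
    assume s: "s \<in> J"
    have l: "0 \<le> (1 - t) * (u * (1 - u))" "0 \<le> t * c" using t c lens_range[OF u] by simp_all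
    show "G (t, s, u) = m0" if "\<rho> (t, u) = 0"
    proof -
      have "(1 - t) * (u * (1 - u)) + t * c = 0" using that by (simp add: \<rho>_def)
      then have "t * c = 0" "(1 - t) * (u * (1 - u)) = 0" using l by linarith+
      then have "u = 0 \<or> u = 1" using c by auto
      then show ?thesis using spheroidsD(4,5)[OF g s] by (auto simp: G_def)
    qed
    show "F (t, s, u) = m0" if "\<rho> (t, u) = 1"
    proof -
      have "t = 1"
      proof (rule ccontr)
        assume "t \<noteq> 1"
        then have "(1 - t) * (u * (1 - u)) < (1 - t) * 1" using t lens_range[OF u] by (intro mult_strict_left_mono) auto
        moreover have "t * c \<le> t" using t c by (auto simp: mult_left_le)
        ultimately show False using that by (simp add: \<rho>_def)
      qed
      then have "c = 1" using that by (simp add: \<rho>_def)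
      then show ?thesis using fc by (simp add: F_def)
    qed
  qed
  show ?thesis
  proof (rule hom2I[OF h])
    show "(case (0, p) of (t, p) \<Rightarrow> cone_glue (\<lambda>u. \<rho> (t, u)) (\<lambda>q. G (t, q)) (\<lambda>q. F (t, q)) p) =
      cone_glue (\<lambda>u. u * (1 - u)) g f p" for p by (simp add: \<rho>_def G_def F_def)
    show "(case (1, p) of (t, p) \<Rightarrow> cone_glue (\<lambda>u. \<rho> (t, u)) (\<lambda>q. G (t, q)) (\<lambda>q. F (t, q)) p) =
      cone_glue (\<lambda>_. c) g f p" for p by (simp add: \<rho>_def G_def F_def)
    fix t :: real and p assume t: "0 \<le> t" "t \<le> 1" and p: "p \<in> bd2"
    have "cone_glue (\<lambda>u. \<rho> (t, u)) g f p = m0" by (rule cone_glue_bd[OF f g \<rho>J p]) (use t in auto)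
    moreover have "cone_glue (\<lambda>u. u * (1 - u)) g f p = m0"
      by (rule cone_glue_bd[OF f g _ p]) (use lens_range in \<open>auto intro: less_imp_le\<close>)
    ultimately show "(case (t, p) of (t, p) \<Rightarrow> cone_glue (\<lambda>u. \<rho> (t, u)) (\<lambda>q. G (t, q)) (\<lambda>q. F (t, q)) p) =
      cone_glue (\<lambda>u. u * (1 - u)) g f p" by (simp add: G_def F_def)
  qed
qed

section \<open>Spheres as triangles with constant boundary\<close>

text \<open>Polar coordinates around the corner [0]: the square becomes the triangle when its side
  of radius 0 is collapsed.\<close>

definition bar :: "(real \<times> real \<Rightarrow> 'a) \<Rightarrow> real \<times> real \<times> real \<Rightarrow> 'a" where
  "bar f = (\<lambda>(x, y, z). f (1 - x, z / (1 - x)))"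

lemma hom2_cong:
  assumes "hom2 M a b" "\<And>x y z. (x, y, z) \<in> D2 \<Longrightarrow> a' (x, y, z) = a (x, y, z)"
    "\<And>x y z. (x, y, z) \<in> D2 \<Longrightarrow> b' (x, y, z) = b (x, y, z)"
  shows "hom2 M a' b'"
proof -
  have 1: "hom2 M a a'" by (rule hom2_eq[OF hom2_tri(1)[OF assms(1)] assms(2)])
  have 2: "hom2 M b b'" by (rule hom2_eq[OF hom2_tri(2)[OF assms(1)] assms(3)])
  show ?thesis by (rule hom2_trans[OF hom2_sym[OF 1] hom2_trans[OF assms(1) 2]])
qed

lemma const_spheroid: "m0 \<in> M \<Longrightarrow> (\<lambda>_. m0) \<in> spheroids M m0"
  by (auto simp: spheroids_def)

lemma spheroid_base: "f \<in> spheroids M m0 \<Longrightarrow> m0 \<in> M"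
  using spheroidsD(1,2)[of f M m0] by (metis SigmaI atLeastAtMost_iff image_subset_iff order_refl zero_le_one)

lemma gl_const_bar:
  assumes f: "f \<in> spheroids M m0"
  shows "hom2 M (gl (\<lambda>_. m0) f) (bar f)"
proof (rule hom2_cong[OF cone_glue_shrink[OF const_spheroid[OF spheroid_base[OF f]] f zero_less_one order_refl]])
  fix x y z :: real assume D: "(x, y, z) \<in> D2"
  show "gl (\<lambda>_. m0) f (x, y, z) = cone_glue (\<lambda>u. u * (1 - u)) f (\<lambda>_. m0) (x, y, z)"
    by (simp add: gl_def case_prod_unfold)
  show "bar f (x, y, z) = cone_glue (\<lambda>_. 1) f (\<lambda>_. m0) (x, y, z)"
    using D by (simp add: bar_def cone_glue_def D2_iff Let_def)
qed simp

text \<open>The sphere glued last lies next to the corner, at small radius, and so becomes the first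
  factor of the join.\<close>

lemma gl_bar_join:
  assumes f: "f \<in> spheroids M m0" and g: "g \<in> spheroids M m0"
  shows "hom2 M (gl (bar f) g) (bar (spheroid_join g f))"
proof (rule hom2_cong[OF cone_glue_shrink[OF f g, of "1/2"]])
  fix x y z :: real assume D: "(x, y, z) \<in> D2"
  define r u where "r = 1 - x" and "u = z / r"
  have u: "u \<in> J" using cone_cover(1)[OF D r_def u_def, of 0] by auto
  note l = lens_range[OF u]
  have eq: "cone_glue \<rho> g f (x, y, z) = (if r \<le> \<rho> u then g (r / \<rho> u, u) else f ((r - \<rho> u) / (1 - \<rho> u), u))" for \<rho>
    by (simp only: cone_glue_def prod.case Let_def r_def u_def)
  have "bar f (1 - s, s * (1 - u), s * u) = f (s, u)" if "s \<noteq> 0" for s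
    using that by (simp add: bar_def)
  moreover have "(r - u * (1 - u)) / (1 - u * (1 - u)) \<noteq> 0" if "\<not> r \<le> u * (1 - u)"
    using that l by simp
  ultimately show "gl (bar f) g (x, y, z) = cone_glue (\<lambda>u. u * (1 - u)) g f (x, y, z)"
    unfolding gl_apply[OF r_def u_def] eq by metis
  have "bar (spheroid_join g f) (x, y, z) = spheroid_join g f (r, u)" by (simp add: bar_def r_def u_def)
  also have "\<dots> = cone_glue (\<lambda>_. 1 / 2) g f (x, y, z)"
  proof -
    have "(r - 1 / 2) / (1 - 1 / 2) = 2 * r - 1" "r / (1 / 2) = 2 * r" by simp_all
    then show ?thesis unfolding eq spheroid_join_def prod.case by (simp add: mult.commute)
  qed
  finally show "bar (spheroid_join g f) (x, y, z) = cone_glue (\<lambda>_. 1 / 2) g f (x, y, z)" .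
qed simp_all

lemma bar_cone:
  assumes "s \<in> J" "u \<in> J" "\<And>z. z \<in> square_boundary \<Longrightarrow> f z = m0"
  shows "bar f (1 - s, s * (1 - u), s * u) = f (s, u)"
  using assms by (cases "s = 0") (simp_all add: bar_def square_boundary_iff)

lemma cone_bd: "(s, u) \<in> square_boundary \<Longrightarrow> (1 - s, s * (1 - u), s * u) \<in> bd2"
  using cone_point[of s u] by (auto simp: bd2_iff square_boundary_iff)

lemma bar_spheroid:
  assumes "tri M (bar f)" "\<And>z. z \<in> square_boundary \<Longrightarrow> f z = m0"
  shows "f \<in> spheroids M m0"
proof -
  have "into (J \<times> J) M (\<lambda>p. bar f (1 - fst p, fst p * (1 - snd p), fst p * snd p))"
    by (rule continuous_on_compose_into[OF assms(1)[unfolded tri_def]]) (auto intro!: continuous_intros cone_point)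
  then have "into (J \<times> J) M f"
    by (rule into_cong) (use bar_cone[OF _ _ assms(2)] in auto)
  then show ?thesis using assms(2) by (simp add: spheroids_def unit_square_eq)
qed

text \<open>As a triangle the join is an end of the homotopy in \<open>gl_bar_join\<close>; its
  continuity is read off from there.\<close>

lemma spheroid_join_closed:
  assumes f: "f \<in> spheroids M m0" and g: "g \<in> spheroids M m0"
  shows "spheroid_join f g \<in> spheroids M m0"
proof (rule bar_spheroid)
  show "tri M (bar (spheroid_join f g))" by (rule hom2_tri(2)[OF gl_bar_join[OF g f]])
  fix z assume z: "z \<in> square_boundary"
  obtain s u where su: "z = (s, u)" by (metis surj_pair)
  have D: "s \<in> J" "u \<in> J" "s = 0 \<or> s = 1 \<or> u = 0 \<or> u = 1" using z su by (auto simp: square_boundary_iff)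
  show "spheroid_join f g z = m0"
    using D spheroidsD(2-5)[OF f] spheroidsD(2-5)[OF g] by (auto simp: spheroid_join_def su)
qed

lemma bar_hom2:
  assumes "sph_hom M m0 f f'" shows "hom2 M (bar f) (bar f')"
proof -
  note s = sph_hom_spheroids[OF assms]
  have "hom2 M (gl (\<lambda>_. m0) f) (gl (\<lambda>_. m0) f')"
    using assms spheroid_base[OF s(1)] by (intro gl_hom2 hom2_eq) (auto simp: tri_def)
  then show ?thesis using gl_const_bar[OF s(1)] gl_const_bar[OF s(2)] hom2_trans hom2_sym by blast
qed

text \<open>Homotopies of triangles pull back along polar coordinates, so no information on the
  sphere is lost in \<open>bar\<close>.\<close>

lemma hom2_bar:
  assumes h: "hom2 M (bar f) (bar f')" and f: "f \<in> spheroids M m0" "f' \<in> spheroids M m0"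
  shows "sph_hom M m0 f f'"
proof -
  obtain h where h: "into (J \<times> D2) M h" and h0: "\<And>p. p \<in> D2 \<Longrightarrow> h (0, p) = bar f p" and h1: "\<And>p. p \<in> D2 \<Longrightarrow> h (1, p) = bar f' p"
    and hb: "\<And>t p. t \<in> J \<Longrightarrow> p \<in> bd2 \<Longrightarrow> h (t, p) = bar f p" using hom2E[OF h] by blast
  have fb: "\<And>z. z \<in> square_boundary \<Longrightarrow> f z = m0" "\<And>z. z \<in> square_boundary \<Longrightarrow> f' z = m0"
    using f by (auto simp: spheroids_def)
  show ?thesis
  proof (rule sph_homI[where h="\<lambda>c. h (fst c, 1 - fst (snd c), fst (snd c) * (1 - snd (snd c)), fst (snd c) * snd (snd c))"])
    show "into (J \<times> J \<times> J) M (\<lambda>c. h (fst c, 1 - fst (snd c), fst (snd c) * (1 - snd (snd c)), fst (snd c) * snd (snd c)))"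
      by (rule continuous_on_compose_into[OF h]) (auto intro!: continuous_intros cone_point)
    fix p :: "real \<times> real"
    obtain s u where p: "p = (s, u)" by (metis surj_pair)
    {
      assume "p \<in> J \<times> J"
      then have "s \<in> J" "u \<in> J" using p by auto
      then show "h (fst (0, p), 1 - fst (snd (0, p)), fst (snd (0, p)) * (1 - snd (snd (0, p))), fst (snd (0, p)) * snd (snd (0, p))) = f p"
        "h (fst (1, p), 1 - fst (snd (1, p)), fst (snd (1, p)) * (1 - snd (snd (1, p))), fst (snd (1, p)) * snd (snd (1, p))) = f' p"
        using h0[OF cone_point[of s u]] h1[OF cone_point[of s u]] bar_cone[OF _ _ fb(1), of s u] bar_cone[OF _ _ fb(2), of s u]
        by (simp_all add: p)
    }
    fix t :: real assume t: "t \<in> J" and b: "p \<in> square_boundary"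
    then have "s \<in> J" "u \<in> J" using p by (auto simp: square_boundary_iff)
    then show "h (fst (t, p), 1 - fst (snd (t, p)), fst (snd (t, p)) * (1 - snd (snd (t, p))), fst (snd (t, p)) * snd (snd (t, p))) = m0"
      using hb[OF t cone_bd[OF b[unfolded p]]] bar_cone[OF _ _ fb(1), of s u] fb(1)[OF b] by (simp add: p)
  qed
qed

lemma spheroid_join_hom:
  assumes f: "sph_hom M m0 f f'" and g: "sph_hom M m0 g g'"
  shows "sph_hom M m0 (spheroid_join f g) (spheroid_join f' g')"
proof -
  note s = sph_hom_spheroids[OF f] sph_hom_spheroids[OF g]
  have "bar g (1, 0, 0) = m0" using spheroidsD(2)[OF s(3), of 0] by (simp add: bar_def)
  then have "hom2 M (gl (bar g) f) (gl (bar g') f')" using gl_hom2[OF bar_hom2[OF g]] f by simp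
  then have "hom2 M (bar (spheroid_join f g)) (bar (spheroid_join f' g'))"
    using gl_bar_join[OF s(3,1)] gl_bar_join[OF s(4,2)] hom2_sym hom2_trans by blast
  then show ?thesis by (rule hom2_bar[OF _ spheroid_join_closed[OF s(1,3)] spheroid_join_closed[OF s(2,4)]])
qed

lemma spheroid_of_triangle:
  assumes a: "tri M a" and b: "\<And>p. p \<in> bd2 \<Longrightarrow> a p = m0"
  obtains f where "f \<in> spheroids M m0" "\<And>x y z. (x, y, z) \<in> D2 \<Longrightarrow> bar f (x, y, z) = a (x, y, z)"
proof
  define f where "f = (\<lambda>p. a (1 - fst p, fst p * (1 - snd p), fst p * snd p))"
  show eq: "bar f (x, y, z) = a (x, y, z)" if D: "(x, y, z) \<in> D2" for x y z
  proof (cases "x = 1")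
    case True
    then have "y = 0" "z = 0" using D by (auto simp: D2_iff)
    then show ?thesis using True by (simp add: bar_def f_def)
  next
    case False
    then have "(1 - x) * (1 - z / (1 - x)) = y" "(1 - x) * (z / (1 - x)) = z"
      using D by (auto simp: D2_iff right_diff_distrib)
    then show ?thesis by (simp only: bar_def f_def prod.case fst_conv snd_conv) simp
  qed
  show "f \<in> spheroids M m0"
  proof (rule bar_spheroid)
    show "tri M (bar f)" by (rule hom2_tri(2)[OF hom2_eq[OF a eq]])
    show "f z = m0" if "z \<in> square_boundary" for z
      using b[OF cone_bd[of "fst z" "snd z"]] that by (simp add: f_def)
  qed
qed

text \<open>Exchanging the last two vertices replaces u by 1 - u, which preserves the lens. At the
  corner itself the convention u = 0 / 0 = 0 breaks this symmetry, hence the condition on two values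
  of \<open>f\<close>.\<close>

lemma swb_gl:
  assumes "f (0, 0) = f (0, 1)" and D: "(x, y, z) \<in> D2"
  shows "swb (gl a f) (x, y, z) = gl (swb a) (\<lambda>(s, t). f (s, 1 - t)) (x, y, z)"
proof -
  have D': "0 \<le> x" "0 \<le> y" "0 \<le> z" "x + y + z = 1" using D by (auto simp: D2_iff)
  define r where "r = 1 - x"
  define u where "u = z / r"
  define v where "v = y / r"
  show ?thesis
  proof (cases "r = 0")
    case True
    then have "x = 1" "y = 0" "z = 0" using D' r_def by linarith+
    then show ?thesis using assms(1) by (simp add: gl_def cone_glue_def)
  next
    case False
    have "y = r - z" using D' r_def by linarith
    then have v: "v = 1 - u" using False unfolding v_def u_def by (simp add: diff_divide_distrib)
    have l: "v * (1 - v) = u * (1 - u)" unfolding v by simp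
    show ?thesis unfolding swb_apply gl_apply[OF r_def u_def] gl_apply[OF r_def v_def] l unfolding v
      by (simp add: mult.commute)
  qed
qed

lemma tet_cong:
  assumes "tet M a0 a1 a2 a3" "\<And>x y z. (x, y, z) \<in> D2 \<Longrightarrow> b0 (x, y, z) = a0 (x, y, z)"
    "\<And>x y z. (x, y, z) \<in> D2 \<Longrightarrow> b1 (x, y, z) = a1 (x, y, z)"
    "\<And>x y z. (x, y, z) \<in> D2 \<Longrightarrow> b2 (x, y, z) = a2 (x, y, z)"
    "\<And>x y z. (x, y, z) \<in> D2 \<Longrightarrow> b3 (x, y, z) = a3 (x, y, z)"
  shows "tet M b0 b1 b2 b3"
  using assms unfolding tet_def faces_def by simp

lemma tet_degenerate:
  assumes "tri M a"
  shows "tet M a a (\<lambda>(x, y, z). a (x + y, 0, z)) (\<lambda>(x, y, z). a (x + y, z, 0))"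
proof (rule tetI[where \<omega>="\<lambda>p. a (fst p + fst (snd p), snd (snd p))"])
  show "into D3 M (\<lambda>p. a (fst p + fst (snd p), snd (snd p)))"
    by (rule continuous_on_compose_into[OF assms[unfolded tri_def]])
      (auto simp: D3_def D2_def intro!: continuous_intros)
qed (simp add: faces_def)

section \<open>Gluing a sphere inside a tetrahedron\<close>

text \<open>The lens depends only on the distance r from vertex 0 and on the share u = w / r of the
  last vertex. On faces 1 and 2 it is therefore the lens of \<open>gl\<close>, on face 3 it shrinks
  to the vertex, and face 0, at r = 1, lies outside it. This is why spheres are added to faces 1 and
  2 at once.\<close>

definition gl3 :: "(real \<times> real \<times> real \<times> real \<Rightarrow> 'a) \<Rightarrow> (real \<times> real \<Rightarrow> 'a) \<Rightarrow> real \<times> real \<times> real \<times> real \<Rightarrow> 'a" where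
  "gl3 \<omega> f = (\<lambda>(x, y, z, w). let r = 1 - x; u = w / r in
     if r \<le> u * (1 - u) then f (r / (u * (1 - u)), u)
     else (\<lambda>s. \<omega> (1 - s, s * (y / r), s * (z / r), s * u)) ((r - u * (1 - u)) / (1 - u * (1 - u))))"

lemma gl3_apply:
  assumes "r = 1 - x" "u = w / r"
  shows "gl3 \<omega> f (x, y, z, w) = (if r \<le> u * (1 - u) then f (r / (u * (1 - u)), u)
     else (\<lambda>s. \<omega> (1 - s, s * (y / r), s * (z / r), s * u)) ((r - u * (1 - u)) / (1 - u * (1 - u))))"
  by (simp only: gl3_def prod.case Let_def assms)

lemma gl3_cone:
  assumes "r \<noteq> 0"
  shows "gl3 \<omega> f (1 - r, r * x, r * y, r * u) = (if r \<le> u * (1 - u) then f (r / (u * (1 - u)), u)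
     else (\<lambda>s. \<omega> (1 - s, s * x, s * y, s * u)) ((r - u * (1 - u)) / (1 - u * (1 - u))))"
proof -
  have e: "r = 1 - (1 - r)" "u = r * u / r" "r * x / r = x" "r * y / r = y" using assms by simp_all
  show ?thesis unfolding gl3_apply[OF e(1,2)] e(3,4) ..
qed

lemma cone_point3:
  assumes "r \<in> J" "(x, y, z) \<in> D2" shows "(1 - r, r * x, r * y, r * z) \<in> D3"
proof -
  have "r * x + r * y + r * z = r" using assms(2) by (simp add: D2_iff flip: distrib_left)
  then show ?thesis using assms by (simp add: D2_iff D3_iff)
qed

text \<open>The directions at vertex 0 form a copy of \<open>D2\<close>. The radius in a fixed
  direction is parametrized inside the lens by \<open>q1\<close> and outside it by
  \<open>q2\<close>.\<close>

lemma gl3_into: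
  assumes w: "into D3 M \<omega>" and f: "f \<in> spheroids M (\<omega> (1, 0, 0, 0))"
  shows "into D3 M (gl3 \<omega> f)"
proof -
  define l where "l = (\<lambda>p::real \<times> real \<times> real. snd (snd p) * (1 - snd (snd p)))"
  define q1 where "q1 = (\<lambda>(s, p). (1 - s * l p, s * l p * fst p, s * l p * fst (snd p), s * l p * snd (snd p)))"
  define q2 where "q2 = (\<lambda>(s, p). (1 - (l p + s * (1 - l p)), (l p + s * (1 - l p)) * fst p,
     (l p + s * (1 - l p)) * fst (snd p), (l p + s * (1 - l p)) * snd (snd p)))"
  have lJ: "0 \<le> l p" "l p < 1" "snd (snd p) \<in> J" if "p \<in> D2" for p
  proof -
    show "snd (snd p) \<in> J" using that by (cases p) (auto simp: D2_iff)
    then show "0 \<le> l p" "l p < 1" unfolding l_def by (rule lens_range)+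
  qed
  have base: "gl3 \<omega> f (1, 0, 0, 0) = \<omega> (1, 0, 0, 0)"
    using spheroidsD(2)[OF f, of 0] by (simp add: gl3_def)
  show ?thesis
  proof (rule quotient_map_into2[where ?q1.0=q1 and ?q2.0=q2 and C="J \<times> D2" and ?F1.0="\<lambda>c. f (fst c, snd (snd (snd c)))"
        and ?F2.0="\<lambda>c. \<omega> (1 - fst c, fst c * fst (snd c), fst c * fst (snd (snd c)), fst c * snd (snd (snd c)))"])
    show "compact (J \<times> D2)" by (intro compact_Times compact_Icc compact_D2)
    show "continuous_on (J \<times> D2) q1" "continuous_on (J \<times> D2) q2"
      unfolding q1_def q2_def l_def case_prod_unfold by (intro continuous_intros)+
    have 1: "into (J \<times> D2) M (\<lambda>c. f (fst c, snd (snd (snd c))))"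
      by (rule continuous_on_compose_into[OF spheroidsD(1)[OF f]]) (auto simp: D2_def intro!: continuous_intros)
    have 2: "into (J \<times> D2) M (\<lambda>c. \<omega> (1 - fst c, fst c * fst (snd c), fst c * fst (snd (snd c)), fst c * snd (snd (snd c))))"
      by (rule continuous_on_compose_into[OF w]) (auto intro!: continuous_intros cone_point3)
    show "continuous_on (J \<times> D2) (\<lambda>c. f (fst c, snd (snd (snd c))))"
      "(\<lambda>c. f (fst c, snd (snd (snd c)))) ` (J \<times> D2) \<subseteq> M" using 1 by simp_all
    show "continuous_on (J \<times> D2) (\<lambda>c. \<omega> (1 - fst c, fst c * fst (snd c), fst c * fst (snd (snd c)), fst c * snd (snd (snd c))))"
      "(\<lambda>c. \<omega> (1 - fst c, fst c * fst (snd c), fst c * fst (snd (snd c)), fst c * snd (snd (snd c)))) ` (J \<times> D2) \<subseteq> M"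
      using 2 by simp_all
    fix c assume "c \<in> J \<times> D2"
    moreover obtain s x y u where c: "c = (s, x, y, u)" by (metis prod_cases4)
    ultimately have s: "s \<in> J" and D: "(x, y, u) \<in> D2" by auto
    note l = lJ[OF D]
    have u: "u \<in> J" using l by simp
    define d where "d = l (x, y, u)"
    have d: "d = u * (1 - u)" by (simp add: d_def l_def)
    have dl: "0 \<le> d" "d < 1" using l by (simp_all add: d_def)
    show "gl3 \<omega> f (q1 c) = f (fst c, snd (snd (snd c)))"
    proof (cases "s * d = 0")
      case True
      have "f (s, u) = \<omega> (1, 0, 0, 0)"
        using True d spheroidsD(2)[OF f u] spheroidsD(4,5)[OF f s] by auto
      moreover have "q1 c = (1, 0, 0, 0)" unfolding q1_def c prod.case d_def[symmetric] True by simp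
      ultimately show ?thesis using base c by simp
    next
      case False
      have q: "q1 c = (1 - s * d, s * d * x, s * d * y, s * d * u)" by (simp add: q1_def c d_def)
      have "s * d \<le> d" using s dl by (simp add: mult_left_le_one_le)
      then show ?thesis unfolding q gl3_cone[OF False] d[symmetric] using False c by simp
    qed
    define r where "r = d + s * (1 - d)"
    have q: "q2 c = (1 - r, r * x, r * y, r * u)" by (simp add: q2_def c d_def r_def)
    show "gl3 \<omega> f (q2 c) = \<omega> (1 - fst c, fst c * fst (snd c), fst c * fst (snd (snd c)), fst c * snd (snd (snd c)))"
    proof (cases "r = 0")
      case True
      have "0 \<le> s * (1 - d)" using s dl by simp
      then have "d = 0" using True r_def dl by linarith
      then have "s = 0" using True r_def by simp
      then show ?thesis unfolding q True using base c by simp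
    next
      case False
      show ?thesis
      proof (cases "s = 0")
        case True
        then have "r = d" by (simp add: r_def)
        then have "gl3 \<omega> f (q2 c) = f (1, u)" unfolding q gl3_cone[OF False] d[symmetric] using False by simp
        then show ?thesis using True spheroidsD(3)[OF f u] c by simp
      next
        case F: False
        then have "0 < s * (1 - d)" using s dl by simp
        then have "\<not> r \<le> d" using r_def by linarith
        moreover have "(r - d) / (1 - d) = s" using r_def dl by simp
        ultimately show ?thesis unfolding q gl3_cone[OF False] d[symmetric] using c by simp
      qed
    qed
  next
    show "D3 \<subseteq> q1 ` (J \<times> D2) \<union> q2 ` (J \<times> D2)"
    proof
      fix p assume "p \<in> D3"
      moreover obtain x0 x y z where p: "p = (x0, x, y, z)" by (metis prod_cases4)
      ultimately have D: "0 \<le> x0" "0 \<le> x" "0 \<le> y" "0 \<le> z" "x0 + x + y + z = 1" by (auto simp: D3_iff)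
      define r where "r = 1 - x0"
      obtain v where v: "v \<in> D2" "r * fst v = x" "r * fst (snd v) = y" "r * snd (snd v) = z"
      proof (cases "r = 0")
        case True
        then have "x = 0" "y = 0" "z = 0" using D r_def by linarith+
        then show thesis using True by (intro that[of "(1, 0, 0)"]) (auto simp: D2_iff)
      next
        case False
        then have "0 < r" using D r_def by linarith
        moreover have "x / r + y / r + z / r = 1" using False D r_def by (simp flip: add_divide_distrib)
        ultimately show thesis using D by (intro that[of "(x / r, y / r, z / r)"]) (auto simp: D2_iff)
      qed
      have r: "0 \<le> r" "r \<le> 1" using D r_def by linarith+
      note l = lJ[OF v(1)]
      have x0: "x0 = 1 - r" using r_def by simp
      show "p \<in> q1 ` (J \<times> D2) \<union> q2 ` (J \<times> D2)"
      proof (cases "r \<le> l v")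
        case True
        then have "r / l v * l v = r" using r by (cases "l v = 0") auto
        then have "p = q1 (r / l v, v)" unfolding q1_def prod.case p x0 by (simp only: v)
        then show ?thesis using frac_J[OF r(1) True] v(1) by (intro UnI1 image_eqI[where x="(r / l v, v)"]) simp_all
      next
        case False
        define s where "s = (r - l v) / (1 - l v)"
        have "l v + s * (1 - l v) = r" using l by (simp add: s_def)
        then have "p = q2 (s, v)" unfolding q2_def prod.case p x0 by (simp only: v)
        moreover have "s \<in> J" unfolding s_def using False r by (intro frac_J) simp_all
        ultimately show ?thesis using v(1) by (intro UnI2 image_eqI[where x="(s, v)"]) simp_all
      qed
    qed
  qed
qed

lemma tet_gl:
  assumes "tet M a0 a1 a2 a3" and f: "f \<in> spheroids M (a1 (1, 0, 0))"
  shows "tet M a0 (gl a1 f) (gl a2 f) a3"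
proof -
  obtain \<omega> where w: "into D3 M \<omega>" and F: "faces \<omega> a0 a1 a2 a3" by (rule tetE[OF assms(1)])
  have b: "\<omega> (1, 0, 0, 0) = a1 (1, 0, 0)" using facesD(2)[OF F, of 1 0 0] by simp
  have b3: "\<omega> (1, 0, 0, 0) = a3 (1, 0, 0)" using facesD(4)[OF F, of 1 0 0] by simp
  have "into D3 M (gl3 \<omega> f)" using f by (intro gl3_into w) (simp add: b)
  moreover have "faces (gl3 \<omega> f) a0 (gl a1 f) (gl a2 f) a3"
    unfolding faces_def
  proof (intro allI impI conjI)
    fix x y z :: real assume D: "(x, y, z) \<in> D2"
    then have D': "0 \<le> x" "0 \<le> y" "0 \<le> z" "x + y + z = 1" by (auto simp: D2_iff)
    have z: "z * (1 - z) < 1" using lens_range(2)[of z] D' by simp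
    show "gl3 \<omega> f (0, x, y, z) = a0 (x, y, z)"
      using z by (simp add: gl3_def facesD[OF F D'])
    define r u where "r = 1 - x" and "u = z / r"
    have u: "u \<in> J" using cone_cover(1)[OF D r_def u_def, of 0] by auto
    note l = lens_range[OF u]
    have r: "0 \<le> r" "r \<le> 1" using D' r_def by linarith+
    have yr: "y / r = 1 - u" if "r \<noteq> 0"
    proof -
      have "y = r - z" using D' r_def by linarith
      then show ?thesis using that by (simp add: u_def diff_divide_distrib)
    qed
    define s where "s = (r - u * (1 - u)) / (1 - u * (1 - u))"
    have s: "s \<in> J" if "\<not> r \<le> u * (1 - u)" unfolding s_def using that r by (intro frac_J) simp_all
    have rn: "r \<noteq> 0" if "\<not> r \<le> u * (1 - u)" using that l by auto
    have cs: "1 - s + s * (1 - u) + s * u = 1" by (simp add: algebra_simps)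
    show "gl3 \<omega> f (x, 0, y, z) = gl a1 f (x, y, z)"
    proof (cases "r \<le> u * (1 - u)")
      case True
      then show ?thesis unfolding gl3_apply[OF r_def u_def] gl_apply[OF r_def u_def] by simp
    next
      case False
      have "gl3 \<omega> f (x, 0, y, z) = \<omega> (1 - s, 0, s * (1 - u), s * u)"
        unfolding gl3_apply[OF r_def u_def] s_def[symmetric] using False yr[OF rn] by simp
      also have "\<dots> = a1 (1 - s, s * (1 - u), s * u)" using s[OF False] u by (intro facesD(2)[OF F] cs) simp_all
      finally show ?thesis unfolding gl_apply[OF r_def u_def] s_def[symmetric] using False by simp
    qed
    show "gl3 \<omega> f (x, y, 0, z) = gl a2 f (x, y, z)"
    proof (cases "r \<le> u * (1 - u)")
      case True
      then show ?thesis unfolding gl3_apply[OF r_def u_def] gl_apply[OF r_def u_def] by simp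
    next
      case False
      have "gl3 \<omega> f (x, y, 0, z) = \<omega> (1 - s, s * (1 - u), 0, s * u)"
        unfolding gl3_apply[OF r_def u_def] s_def[symmetric] using False yr[OF rn] by simp
      also have "\<dots> = a2 (1 - s, s * (1 - u), s * u)" using s[OF False] u by (intro facesD(3)[OF F] cs) simp_all
      finally show ?thesis unfolding gl_apply[OF r_def u_def] s_def[symmetric] using False by simp
    qed
    show "gl3 \<omega> f (x, y, z, 0) = a3 (x, y, z)"
    proof (cases "r = 0")
      case True
      then have "x = 1" "y = 0" "z = 0" using D' r_def by linarith+
      then show ?thesis using spheroidsD(2)[OF f, of 0] b b3 by (simp add: gl3_def)
    next
      case False
      then have "0 < r" using r by simp
      then have "gl3 \<omega> f (x, y, z, 0) = \<omega> (x, y, z, 0)" by (simp add: gl3_def r_def)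
      then show ?thesis using facesD(4)[OF F D'] by simp
    qed
  qed
  ultimately show ?thesis by (rule tetI)
qed

subsection \<open>Moving a sphere along a loop\<close>

text \<open>A concentric square of side (1 + \<theta>) / 2 carries \<open>k\<close>, and the collar
  runs along \<open>h\<close> from parameter \<theta> on the outer boundary to parameter 1. Thus
  \<theta> = 0 gives \<open>transport\<close> and \<theta> = 1 leaves \<open>k\<close> alone;
  letting \<theta> grow with t peels off the collar.\<close>

definition tube :: "(real \<Rightarrow> real) \<Rightarrow> (real \<times> real \<Rightarrow> 'a) \<Rightarrow> (real \<times> real \<times> real \<Rightarrow> 'a) \<Rightarrow> real \<times> real \<times> real \<Rightarrow> 'a" where
  "tube \<theta> h k = (\<lambda>(t, s, u).
     let d = max \<bar>s - 1/2\<bar> \<bar>u - 1/2\<bar>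
     in if d \<le> (1 + \<theta> t) / 4 then k (t, 1/2 + 2 * (s - 1/2) / (1 + \<theta> t), 1/2 + 2 * (u - 1/2) / (1 + \<theta> t))
        else h (t, 2 - 4 * d + \<theta> t))"

lemma tube_into:
  assumes \<theta>: "continuous_on J \<theta>" "\<And>t. t \<in> J \<Longrightarrow> \<theta> t \<in> J"
    and h: "into (J \<times> J) M h" and k: "into (J \<times> J \<times> J) M k"
    and hk: "\<And>t z. t \<in> J \<Longrightarrow> z \<in> square_boundary \<Longrightarrow> k (t, z) = h (t, 1)"
  shows "into (J \<times> J \<times> J) M (tube \<theta> h k)"
proof -
  define d where "d = (\<lambda>c::real \<times> real \<times> real. max \<bar>fst (snd c) - 1/2\<bar> \<bar>snd (snd c) - 1/2\<bar>)"
  define e where "e = (\<lambda>c::real \<times> real \<times> real. (1 + \<theta> (fst c)) / 4)"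
  have dc: "continuous_on S d" for S unfolding d_def by (intro continuous_intros)
  have th: "continuous_on (J \<times> J \<times> J) (\<lambda>c. \<theta> (fst c))"
    by (rule continuous_on_compose2[OF \<theta>(1)]) (auto intro!: continuous_intros)
  have ec: "continuous_on (J \<times> J \<times> J) e" unfolding e_def by (intro continuous_intros th) simp
  define A where "A = {c \<in> J \<times> J \<times> J. d c \<le> e c}"
  define B where "B = {c \<in> J \<times> J \<times> J. e c \<le> d c}"
  have cl: "closed A" "closed B" unfolding A_def B_def
    by (intro closed_le_on closed_Times closed_atLeastAtMost dc ec)+
  define kk where "kk = (\<lambda>c. (fst c, 1/2 + 2 * (fst (snd c) - 1/2) / (1 + \<theta> (fst c)), 1/2 + 2 * (snd (snd c) - 1/2) / (1 + \<theta> (fst c))))"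
  define hh where "hh = (\<lambda>c. (fst c, 2 - 4 * d c + \<theta> (fst c)))"
  have pos: "1 + \<theta> (fst c) \<noteq> 0" "0 < 1 + \<theta> (fst c)" if "c \<in> J \<times> J \<times> J" for c using \<theta>(2)[of "fst c"] that by auto
  have half: "1/2 + 2 * x / y \<in> J" if "\<bar>x\<bar> \<le> y / 4" "0 < y" for x y :: real
  proof -
    have "\<bar>2 * x / y\<bar> \<le> 1/2" using that by (simp add: abs_mult abs_divide field_simps)
    then show ?thesis unfolding abs_le_iff atLeastAtMost_iff by linarith
  qed
  have kA: "into A M (\<lambda>c. k (kk c))"
  proof (rule continuous_on_compose_into[OF k])
    show "continuous_on A kk" unfolding kk_def
      by (intro continuous_intros continuous_on_subset[OF th]) (use pos in \<open>auto simp: A_def\<close>)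
    fix c assume c: "c \<in> A"
    then have cJ: "c \<in> J \<times> J \<times> J" and dc: "d c \<le> e c" by (auto simp: A_def)
    have "1/2 + 2 * (fst (snd c) - 1/2) / (1 + \<theta> (fst c)) \<in> J" "1/2 + 2 * (snd (snd c) - 1/2) / (1 + \<theta> (fst c)) \<in> J"
      using dc[unfolded d_def e_def max.bounded_iff] pos[OF cJ] by (simp_all only: half)
    then show "kk c \<in> J \<times> J \<times> J" using cJ unfolding kk_def mem_Times_iff fst_conv snd_conv by simp
  qed
  have hB: "into B M (\<lambda>c. h (hh c))"
  proof (rule continuous_on_compose_into[OF h])
    show "continuous_on B hh" unfolding hh_def
      by (intro continuous_intros continuous_on_subset[OF th] dc) (auto simp: B_def)
    fix c assume c: "c \<in> B"
    then have cJ: "c \<in> J \<times> J \<times> J" and dc: "e c \<le> d c" by (auto simp: B_def)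
    have "0 \<le> fst (snd c)" "fst (snd c) \<le> 1" "0 \<le> snd (snd c)" "snd (snd c) \<le> 1" using cJ by (simp_all add: mem_Times_iff)
    then have "\<bar>fst (snd c) - 1/2\<bar> \<le> 1/2" "\<bar>snd (snd c) - 1/2\<bar> \<le> 1/2" by linarith+
    then have "d c \<le> 1/2" by (simp add: d_def)
    then show "hh c \<in> J \<times> J" using cJ dc \<theta>(2)[of "fst c"] by (auto simp: hh_def e_def mem_Times_iff)
  qed
  have eqA: "tube \<theta> h k c = k (kk c)" if "c \<in> A" for c
    using that by (cases c) (simp add: tube_def A_def kk_def d_def e_def)
  have eqB: "tube \<theta> h k c = h (hh c)" if "c \<in> B" for c
  proof (cases "d c = e c")
    case False
    then have "\<not> d c \<le> e c" using that by (simp add: B_def)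
    then show ?thesis by (cases c) (simp add: tube_def hh_def d_def e_def Let_def)
  next
    case True
    have cJ: "c \<in> J \<times> J \<times> J" using that by (simp add: B_def)
    obtain t s u where c: "c = (t, s, u)" by (metis prod_cases3)
    have t: "t \<in> J" "0 < 1 + \<theta> t" using cJ pos[OF cJ] by (auto simp: c)
    have cA: "c \<in> A" using True cJ by (simp add: A_def)
    have kkJ: "snd (kk c) \<in> J \<times> J"
    proof -
      have "1/2 + 2 * (fst (snd c) - 1/2) / (1 + \<theta> (fst c)) \<in> J" "1/2 + 2 * (snd (snd c) - 1/2) / (1 + \<theta> (fst c)) \<in> J"
        using eq_refl[OF True, unfolded d_def e_def max.bounded_iff] pos[OF cJ] by (simp_all only: half)
      then show ?thesis unfolding kk_def mem_Times_iff fst_conv snd_conv by simp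
    qed
    have "\<bar>s - 1/2\<bar> = (1 + \<theta> t) / 4 \<or> \<bar>u - 1/2\<bar> = (1 + \<theta> t) / 4" using True by (auto simp: d_def e_def c max_def split: if_splits)
    then have "s - 1/2 = (1 + \<theta> t) / 4 \<or> s - 1/2 = - ((1 + \<theta> t) / 4) \<or> u - 1/2 = (1 + \<theta> t) / 4 \<or> u - 1/2 = - ((1 + \<theta> t) / 4)"
      unfolding abs_eq_iff' by blast
    moreover have "1/2 + 2 * ((1 + \<theta> t) / 4) / (1 + \<theta> t) = 1" "1/2 + 2 * (- ((1 + \<theta> t) / 4)) / (1 + \<theta> t) = 0"
      using t by (simp_all add: field_simps)
    ultimately have "fst (snd (kk c)) = 1 \<or> fst (snd (kk c)) = 0 \<or> snd (snd (kk c)) = 1 \<or> snd (snd (kk c)) = 0"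
      unfolding kk_def c fst_conv snd_conv by metis
    then have "snd (kk c) \<in> square_boundary" using kkJ by (cases "snd (kk c)") (auto simp: square_boundary_iff)
    then have "k (t, snd (kk c)) = h (t, 1)" by (rule hk[OF t(1)])
    moreover have "kk c = (t, snd (kk c))" by (simp add: kk_def c)
    moreover have "hh c = (t, 1)" using True by (simp add: hh_def c e_def)
    ultimately show ?thesis using eqA[OF cA] by simp
  qed
  have "into (A \<union> B) M (tube \<theta> h k)"
    by (intro into_Un cl into_cong[OF kA] into_cong[OF hB] eqA eqB)
  moreover have "J \<times> J \<times> J \<subseteq> A \<union> B" by (auto simp: A_def B_def)
  ultimately show ?thesis by (rule into_subset)
qed

lemma tube_boundary:
  assumes t: "t \<in> J" and z: "z \<in> square_boundary" and \<theta>: "\<theta> t \<in> J" and k: "k (t, z) = h (t, 1)"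
  shows "tube \<theta> h k (t, z) = h (t, \<theta> t)"
proof -
  obtain s u where su: "z = (s, u)" by (metis surj_pair)
  have D: "s \<in> J" "u \<in> J" "s = 0 \<or> s = 1 \<or> u = 0 \<or> u = 1" using z su by (auto simp: square_boundary_iff)
  have d: "max \<bar>s - 1/2\<bar> \<bar>u - 1/2\<bar> = 1/2" using D by (auto simp: abs_if max_def)
  show ?thesis
  proof (cases "\<theta> t = 1")
    case True
    moreover have "1/2 + 2 * (v - 1/2) / (1 + 1) = v" for v :: real by (simp add: field_simps)
    ultimately show ?thesis using k unfolding tube_def su prod.case d Let_def by simp
  next
    case False
    then have "\<not> 1/2 \<le> (1 + \<theta> t) / 4" using \<theta> by simp
    then show ?thesis unfolding tube_def su prod.case d Let_def by simp
  qed
qed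

lemma tube_zero:
  assumes "\<theta> t = 0" shows "tube \<theta> h k (t, z) = transport (\<lambda>v. h (t, v)) (\<lambda>z. k (t, z)) z"
  by (cases z) (simp add: tube_def transport_def assms algebra_simps Let_def)

lemma tube_one:
  assumes "\<theta> t = 1" "z \<in> J \<times> J" shows "tube \<theta> h k (t, z) = k (t, z)"
proof -
  obtain s u where su: "z = (s, u)" by (metis surj_pair)
  have "0 \<le> s" "s \<le> 1" "0 \<le> u" "u \<le> 1" using assms(2) su by simp_all
  then have "\<bar>s - 1/2\<bar> \<le> 1/2" "\<bar>u - 1/2\<bar> \<le> 1/2" by linarith+
  then have "max \<bar>s - 1/2\<bar> \<bar>u - 1/2\<bar> \<le> (1 + 1) / 4" by simp
  moreover have "1/2 + 2 * (v - 1/2) / (1 + 1) = v" for v :: real by (simp add: field_simps)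
  ultimately show ?thesis using assms(1) unfolding tube_def su prod.case Let_def by simp
qed

lemma transport_hom:
  assumes p: "homotopic_paths M p p'" "pathstart p = m0" "pathfinish p = m0" and f: "sph_hom M m0 f f'"
  shows "sph_hom M m0 (transport p f) (transport p' f')"
proof -
  obtain h where h: "into (J \<times> J) M h" and h0: "\<And>v. v \<in> J \<Longrightarrow> h (0, v) = p v" and h1: "\<And>v. v \<in> J \<Longrightarrow> h (1, v) = p' v"
    and he: "\<And>t. t \<in> J \<Longrightarrow> h (t, 0) = m0 \<and> h (t, 1) = m0"
    using p unfolding homotopic_paths by (auto simp: pathstart_def pathfinish_def image_subset_iff_funcset)
  obtain k where k: "into (J \<times> J \<times> J) M k" and k0: "\<And>p. p \<in> J \<times> J \<Longrightarrow> k (0, p) = f p" and k1: "\<And>p. p \<in> J \<times> J \<Longrightarrow> k (1, p) = f' p"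
    and kb: "\<And>t p. t \<in> J \<Longrightarrow> p \<in> square_boundary \<Longrightarrow> k (t, p) = m0" using sph_homE[OF f] by blast
  have hk: "k (t, z) = h (t, 1)" if "t \<in> J" "z \<in> square_boundary" for t z using he kb that by simp
  have tr: "transport (\<lambda>v. q v) (\<lambda>z. g z) z = transport q' g' z"
    if "z \<in> J \<times> J" "\<And>v. v \<in> J \<Longrightarrow> q v = q' v" "\<And>z. z \<in> J \<times> J \<Longrightarrow> g z = g' z" for q q' :: "real \<Rightarrow> 'a" and g g' z
  proof -
    obtain s u where su: "z = (s, u)" by (metis surj_pair)
    define d where "d = max \<bar>s - 1/2\<bar> \<bar>u - 1/2\<bar>"
    have "0 \<le> s" "s \<le> 1" "0 \<le> u" "u \<le> 1" using that(1) su by simp_all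
    then have "\<bar>s - 1/2\<bar> \<le> 1/2" "\<bar>u - 1/2\<bar> \<le> 1/2" by linarith+
    then have d: "d \<le> 1/2" "\<bar>s - 1/2\<bar> \<le> d" "\<bar>u - 1/2\<bar> \<le> d" by (simp_all add: d_def)
    have eq: "transport q g (s, u) = (if d \<le> 1/4 then g (2 * s - 1/2, 2 * u - 1/2) else q (2 - 4 * d))" for q :: "real \<Rightarrow> 'a" and g
      by (simp add: transport_def d_def Let_def)
    show ?thesis
    proof (cases "d \<le> 1/4")
      case True
      then have "(2 * s - 1/2, 2 * u - 1/2) \<in> J \<times> J" using d by (auto simp: abs_le_iff)
      then show ?thesis using True that(3) unfolding su eq by simp
    next
      case False
      then have "2 - 4 * d \<in> J" using d by simp
      then show ?thesis using False that(2) unfolding su eq by simp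
    qed
  qed
  show ?thesis
  proof (rule sph_homI)
    show "into (J \<times> J \<times> J) M (tube (\<lambda>_. 0) h k)" by (rule tube_into[OF _ _ h k hk]) auto
    show "tube (\<lambda>_. 0) h k (0, z) = transport p f z" if "z \<in> J \<times> J" for z
      unfolding tube_zero[where \<theta>="\<lambda>_. 0", OF refl] by (rule tr[OF that h0 k0])
    show "tube (\<lambda>_. 0) h k (1, z) = transport p' f' z" if "z \<in> J \<times> J" for z
      unfolding tube_zero[where \<theta>="\<lambda>_. 0", OF refl] by (rule tr[OF that h1 k1])
    show "tube (\<lambda>_. 0) h k (t, z) = m0" if "t \<in> J" "z \<in> square_boundary" for t z
      using tube_boundary[OF that, of "\<lambda>_. 0" k h] hk that he by simp
  qed
qed

lemma sph_hom_refl: assumes "f \<in> spheroids M m0" shows "sph_hom M m0 f f"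
  by (rule sph_homI[where h="\<lambda>c. f (snd c)", OF into_snd[OF spheroidsD(1)[OF assms]]])
    (use assms in \<open>auto simp: spheroids_def\<close>)

text \<open>At time t the constant triangle at \<open>p t\<close> carries \<open>f\<close>
  transported along the part of \<open>p\<close> after t. This deforms \<open>transport p f\<close>
  into \<open>f\<close> while the base point runs along \<open>p\<close>. The deformation is a map
  on a prism; \<open>w1\<close> and \<open>w2\<close> are the inner triangles of its cut into three
  tetrahedra.\<close>

lemma tet_prism:
  assumes p: "p \<in> loops M m0" and f: "f \<in> spheroids M m0"
  obtains w1 w2 where
    "tet M (\<lambda>(x, y, z). p z) (\<lambda>(x, y, z). p z) w1 (gl (\<lambda>_. m0) (transport p f))"
    "tet M (\<lambda>(x, y, z). p (1 - x)) w2 w1 (\<lambda>(x, y, z). p z)"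
    "tet M (gl (\<lambda>_. m0) f) w2 (\<lambda>(x, y, z). p (1 - x)) (\<lambda>(x, y, z). p (1 - x))"
proof -
  have pJ: "into J M p" "p 0 = m0" "p 1 = m0"
    using p by (simp_all add: loops_def path_def path_image_def pathstart_def pathfinish_def)
  define h where "h = (\<lambda>c::real\<times>real. p (snd c))"
  define k where "k = (\<lambda>c::real\<times>real\<times>real. f (snd c))"
  have h: "into (J \<times> J) M h" unfolding h_def by (rule into_snd[OF pJ(1)])
  have k: "into (J \<times> J \<times> J) M k" unfolding k_def by (rule into_snd[OF spheroidsD(1)[OF f]])
  have hk: "k (t, z) = h (t, 1)" if "t \<in> J" "z \<in> square_boundary" for t z
    using f that(2) pJ(3) by (simp add: h_def k_def spheroids_def)
  define V where "V = tube (\<lambda>t. t) h k"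
  have V: "into (J \<times> J \<times> J) M V" unfolding V_def by (rule tube_into[OF _ _ h k hk]) (auto intro!: continuous_intros)
  have Vb: "V (t, z) = p t" if "t \<in> J" "z \<in> square_boundary" for t z
    unfolding V_def using tube_boundary[OF that, of "\<lambda>t. t" k h] hk[OF that] that(1) by (simp add: h_def)
  define K where "K = (\<lambda>(t, q). gl (\<lambda>_. p t) (\<lambda>z. V (t, z)) q)"
  have K: "into (J \<times> D2) M K"
  proof -
    have "into (J \<times> D2) M (\<lambda>c. p (fst c))"
      by (rule continuous_on_compose_into[OF pJ(1)]) (auto intro!: continuous_intros)
    then have "into (J \<times> D2) M (\<lambda>(t, q). gl (\<lambda>q. (\<lambda>c. p (fst c)) (t, q)) (\<lambda>z. V (t, z)) q)"
      by (rule gl_into[OF _ V]) (simp add: Vb)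
    then show ?thesis by (simp add: K_def)
  qed
  have Kb: "K (t, q) = p t" if "t \<in> J" "q \<in> bd2" for t q
    unfolding K_def prod.case by (rule gl_bd[OF that(2)]) (use Vb that in simp)
  have glc: "gl (\<lambda>_. c) g q = gl (\<lambda>_. c) g' q" if "q \<in> D2" "\<And>z. z \<in> J \<times> J \<Longrightarrow> g z = g' z" for c :: 'a and g g' q
  proof -
    obtain x y z where q: "q = (x, y, z)" by (metis prod_cases3)
    have D: "(x, y, z) \<in> D2" using that(1) q by simp
    define r u where "r = 1 - x" and "u = z / r"
    have u: "u \<in> J" using cone_cover(1)[OF D r_def u_def, of 0] by auto
    have r: "0 \<le> r" using D by (auto simp: r_def D2_iff)
    show ?thesis unfolding q gl_apply[OF r_def u_def] using that(2)[of "(r / (u * (1 - u)), u)"] frac_J[OF r] u by auto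
  qed
  have K0: "K (0, q) = gl (\<lambda>_. m0) (transport p f) q" if "q \<in> D2" for q
    unfolding K_def prod.case pJ(2)
    by (rule glc[OF that]) (simp add: V_def tube_zero h_def k_def)
  have K1: "K (1, q) = gl (\<lambda>_. m0) f q" if "q \<in> D2" for q
    unfolding K_def prod.case pJ(3)
    by (rule glc[OF that]) (simp add: V_def tube_one k_def)
  note bd = bd2_iff D2_iff
  show thesis
  proof
    \<comment> \<open>In each piece the time is the total weight of the vertices lying on the upper
      triangle: of the last vertex here, then of the last two, then of the last three.\<close>
    show "tet M (\<lambda>(x, y, z). p z) (\<lambda>(x, y, z). p z) (\<lambda>(x, y, z). K (z, x, y, z)) (gl (\<lambda>_. m0) (transport p f))"
    proof (rule tetI)
      show "into D3 M (\<lambda>c. K (snd (snd (snd c)), fst c, fst (snd c), fst (snd (snd c)) + snd (snd (snd c))))"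
        by (rule continuous_on_compose_into[OF K]) (auto simp: D3_def D2_iff intro!: continuous_intros)
    qed (simp add: faces_def K0 Kb bd)
    show "tet M (\<lambda>(x, y, z). p (1 - x)) (\<lambda>(x, y, z). K (y + z, x, y, z)) (\<lambda>(x, y, z). K (z, x, y, z)) (\<lambda>(x, y, z). p z)"
    proof (rule tetI)
      show "into D3 M (\<lambda>c. K (fst (snd (snd c)) + snd (snd (snd c)), fst c, fst (snd c) + fst (snd (snd c)), snd (snd (snd c))))"
        by (rule continuous_on_compose_into[OF K]) (auto simp: D3_def D2_iff intro!: continuous_intros)
      have "p (y + z) = p (1 - x)" if "x + y + z = 1" for x y z
      proof -
        have "1 - x = y + z" using that by linarith
        then show ?thesis by simp
      qed
      then have "\<forall>x y z. 0 \<le> x \<and> 0 \<le> y \<and> 0 \<le> z \<and> x + y + z = 1 \<longrightarrow> p (y + z) = p (1 - x)" by blast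
      then show "faces (\<lambda>c. K (fst (snd (snd c)) + snd (snd (snd c)), fst c, fst (snd c) + fst (snd (snd c)), snd (snd (snd c))))
        (\<lambda>(x, y, z). p (1 - x)) (\<lambda>(x, y, z). K (y + z, x, y, z)) (\<lambda>(x, y, z). K (z, x, y, z)) (\<lambda>(x, y, z). p z)"
        by (simp add: faces_def Kb bd)
    qed
    show "tet M (gl (\<lambda>_. m0) f) (\<lambda>(x, y, z). K (y + z, x, y, z)) (\<lambda>(x, y, z). p (1 - x)) (\<lambda>(x, y, z). p (1 - x))"
    proof (rule tetI)
      show "into D3 M (\<lambda>c. K (fst (snd c) + fst (snd (snd c)) + snd (snd (snd c)), fst c + fst (snd c), fst (snd (snd c)), snd (snd (snd c))))"
        by (rule continuous_on_compose_into[OF K]) (auto simp: D3_def D2_iff intro!: continuous_intros)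
      have "p (y + z) = p (1 - x)" if "x + y + z = 1" for x y z
      proof -
        have "1 - x = y + z" using that by linarith
        then show ?thesis by simp
      qed
      then have "\<forall>x y z. 0 \<le> x \<and> 0 \<le> y \<and> 0 \<le> z \<and> x + y + z = 1 \<longrightarrow> p (y + z) = p (1 - x)" by blast
      then show "faces (\<lambda>c. K (fst (snd c) + fst (snd (snd c)) + snd (snd (snd c)), fst c + fst (snd c), fst (snd (snd c)), snd (snd (snd c))))
        (gl (\<lambda>_. m0) f) (\<lambda>(x, y, z). K (y + z, x, y, z)) (\<lambda>(x, y, z). p (1 - x)) (\<lambda>(x, y, z). p (1 - x))"
        by (simp add: faces_def Kb K1 bd)
    qed
  qed
qed

subsection \<open>Classes of singular triangles\<close>

definition tri_of :: "(real \<times> real \<times> real \<Rightarrow> 'a) \<Rightarrow> (nat \<Rightarrow> real) \<Rightarrow> 'a" where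
  "tri_of a = (\<lambda>x\<in>standard_simplex 2. a (x 0, x 1, x 2))"

definition cls :: "'a::topological_space set \<Rightarrow> (real \<times> real \<times> real \<Rightarrow> 'a) \<Rightarrow> 'a triangleclass" where
  "cls M a = triangle_class M (tri_of a)"

lemma bary_apply: "bary x y z 0 = x" "bary x y z (Suc 0) = y" "bary x y z 2 = z" "2 < i \<Longrightarrow> bary x y z i = 0"
  by (auto simp: bary_def)

lemma sum_le_2: "(\<Sum>i\<le>2::nat. f i) = f 0 + f 1 + (f 2 :: real)"
  by (simp add: numeral_2_eq_2)

lemma sum_le_3: "(\<Sum>i\<le>3::nat. f i) = f 0 + f 1 + f 2 + (f 3 :: real)"
  by (simp add: numeral_2_eq_2 numeral_3_eq_3)

lemma simplex2_D2: "x \<in> standard_simplex 2 \<Longrightarrow> (x 0, x 1, x 2) \<in> D2"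
  by (simp add: standard_simplex_def D2_iff sum_le_2)

lemma simplex2_bary: assumes "x \<in> standard_simplex 2" shows "bary (x 0) (x 1) (x 2) = x"
proof
  fix i
  have "x i = 0" if "2 < i" using assms that by (simp add: standard_simplex_def)
  moreover have "i = 0 \<or> i = 1 \<or> i = 2 \<or> 2 < i" by linarith
  ultimately show "bary (x 0) (x 1) (x 2) i = x i" by (auto simp: bary_def)
qed

lemma bary_simplex2: assumes "(x, y, z) \<in> D2" shows "bary x y z \<in> standard_simplex 2"
proof -
  have "0 \<le> bary x y z i \<and> bary x y z i \<le> 1" for i using assms by (auto simp: bary_def D2_iff)
  then show ?thesis using assms by (simp add: standard_simplex_def bary_apply D2_iff sum_le_2)
qed

lemma tri_of_bary: "(x, y, z) \<in> D2 \<Longrightarrow> tri_of a (bary x y z) = a (x, y, z)"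
  by (simp add: tri_of_def bary_simplex2 bary_apply)

lemma tri_of_eqI:
  assumes "\<And>x y z. (x, y, z) \<in> D2 \<Longrightarrow> a (x, y, z) = b (x, y, z)" shows "tri_of a = tri_of b"
  unfolding tri_of_def by (rule restrict_ext) (use assms simplex2_D2 in blast)

lemma continuous_on_coords: "continuous_on S (\<lambda>x::nat \<Rightarrow> real. (x 0, x 1, x 2))"
  by (intro continuous_on_Pair continuous_on_subset[OF continuous_on_product_coordinates subset_UNIV])

lemma continuous_on_bary: "continuous_on S (\<lambda>(x, y, z). bary x y z)"
proof (rule continuous_on_coordinatewise_then_product)
  fix i :: nat
  have "i = 0 \<or> i = 1 \<or> i = 2 \<or> 2 < i" by linarith
  then show "continuous_on S (\<lambda>p. (case p of (x, y, z) \<Rightarrow> bary x y z) i)"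
    by (elim disjE) (simp_all add: case_prod_unfold bary_apply, (intro continuous_intros)+)
qed

lemma singular_simplex_euclidean:
  "singular_simplex p (top_of_set M) f \<longleftrightarrow> into (standard_simplex p) M f \<and> f \<in> extensional (standard_simplex p)"
  unfolding singular_simplex_def euclidean_product_topology
  by (simp add: image_subset_iff_funcset)

lemma tri_of_extensional: "tri_of a \<in> extensional (standard_simplex 2)"
  by (simp add: tri_of_def)

lemma tri_of_into: "into (standard_simplex 2) M (tri_of a) \<longleftrightarrow> tri M a"
proof
  assume a: "tri M a"
  have "into (standard_simplex 2) M (\<lambda>x. a (x 0, x 1, x 2))"
    by (rule continuous_on_compose_into[OF a[unfolded tri_def] continuous_on_coords]) (rule simplex2_D2)
  then show "into (standard_simplex 2) M (tri_of a)" by (rule into_cong) (simp add: tri_of_def)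
next
  assume a: "into (standard_simplex 2) M (tri_of a)"
  have "into D2 M (\<lambda>p. tri_of a ((\<lambda>(x, y, z). bary x y z) p))"
    by (rule continuous_on_compose_into[OF a continuous_on_bary]) (auto intro: bary_simplex2)
  then have "into D2 M a" by (rule into_cong) (auto simp: tri_of_bary)
  then show "tri M a" by (simp add: tri_def)
qed

lemma singular_tri_of: "singular_simplex 2 (top_of_set M) (tri_of a) \<longleftrightarrow> tri M a"
  unfolding singular_simplex_euclidean tri_of_into using tri_of_extensional by blast

lemma singular_simplex2E:
  assumes "singular_simplex 2 (top_of_set M) \<sigma>"
  obtains a where "\<sigma> = tri_of a" "tri M a"
proof
  show eq: "\<sigma> = tri_of (\<lambda>(x, y, z). \<sigma> (bary x y z))"
  proof
    fix x show "\<sigma> x = tri_of (\<lambda>(x, y, z). \<sigma> (bary x y z)) x"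
      using assms by (cases "x \<in> standard_simplex 2")
        (simp_all add: tri_of_def simplex2_bary[simplified] singular_simplex_euclidean extensional_def)
  qed
  show "tri M (\<lambda>(x, y, z). \<sigma> (bary x y z))" using assms eq singular_tri_of by metis
qed

lemma simplex2_boundary_bd2:
  "x \<in> simplex2_boundary \<longleftrightarrow> x \<in> standard_simplex 2 \<and> (x 0, x 1, x 2) \<in> bd2"
  unfolding simplex2_boundary_def bd2_iff using simplex2_D2 by auto

lemma tri_of_homotopic:
  "homotopic_with (\<lambda>k. \<forall>z\<in>simplex2_boundary. k z = tri_of a z)
     (subtopology (powertop_real UNIV) (standard_simplex 2)) (top_of_set M) (tri_of a) (tri_of b) \<longleftrightarrow> hom2 M a b"
  (is "?L = _")
proof -
  have sb: "z \<in> standard_simplex 2" if "z \<in> simplex2_boundary" for z using that by (simp add: simplex2_boundary_def)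
  have L: "?L \<longleftrightarrow> (\<exists>h. into (J \<times> standard_simplex 2) M h \<and>
    (\<forall>p\<in>standard_simplex 2. h (0, p) = tri_of a p) \<and> (\<forall>p\<in>standard_simplex 2. h (1, p) = tri_of b p) \<and>
    (\<forall>t\<in>J. \<forall>p\<in>simplex2_boundary. h (t, p) = tri_of a p))"
    unfolding euclidean_product_topology
    by (subst homotopic_with) (simp_all add: sb prod_topology_subtopology_eu image_subset_iff_funcset)
  show ?thesis
  proof
    assume ?L
    then obtain h where h: "into (J \<times> standard_simplex 2) M h"
      and h0: "\<And>p. p \<in> standard_simplex 2 \<Longrightarrow> h (0, p) = tri_of a p"
      and h1: "\<And>p. p \<in> standard_simplex 2 \<Longrightarrow> h (1, p) = tri_of b p"
      and hb: "\<And>t p. t \<in> J \<Longrightarrow> p \<in> simplex2_boundary \<Longrightarrow> h (t, p) = tri_of a p" unfolding L by metis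
    define g where "g = (\<lambda>c::real \<times> real \<times> real \<times> real. (fst c, (\<lambda>(x, y, z). bary x y z) (snd c)))"
    show "hom2 M a b"
    proof (rule hom2I[where h="\<lambda>c. h (g c)"])
      show "into (J \<times> D2) M (\<lambda>c. h (g c))"
      proof (rule continuous_on_compose_into[OF h])
        show "continuous_on (J \<times> D2) g" unfolding g_def
          by (intro continuous_intros continuous_on_compose2[OF continuous_on_bary[of UNIV]]) auto
      qed (auto simp: g_def bary_simplex2)
      fix p :: "real \<times> real \<times> real"
      obtain x y z where p: "p = (x, y, z)" by (metis prod_cases3)
      show "h (g (0, p)) = a p" "h (g (1, p)) = b p" if "p \<in> D2"
        using that h0 h1 by (simp_all add: g_def p bary_simplex2 tri_of_bary)
      show "h (g (t, p)) = a p" if "0 \<le> t" "t \<le> 1" "p \<in> bd2" for t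
      proof -
        have "bary x y z \<in> simplex2_boundary"
          using that bd2_D2 by (simp add: simplex2_boundary_bd2 p bary_apply bary_simplex2)
        then show ?thesis using hb[of t "bary x y z"] that bd2_D2[OF that(3)] by (simp add: g_def p tri_of_bary)
      qed
    qed
  next
    assume "hom2 M a b"
    then obtain h where h: "into (J \<times> D2) M h" and h0: "\<And>p. p \<in> D2 \<Longrightarrow> h (0, p) = a p" and h1: "\<And>p. p \<in> D2 \<Longrightarrow> h (1, p) = b p"
      and hb: "\<And>t p. t \<in> J \<Longrightarrow> p \<in> bd2 \<Longrightarrow> h (t, p) = a p" using hom2E by blast
    have "into (J \<times> standard_simplex 2) M (\<lambda>c. h (fst c, (snd c 0, snd c 1, snd c 2)))"
    proof (rule continuous_on_compose_into[OF h])
      show "continuous_on (J \<times> standard_simplex 2) (\<lambda>c. (fst c, (snd c 0, snd c 1, snd c 2)))"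
        by (rule continuous_on_Pair[OF continuous_on_fst[OF continuous_on_id]
              continuous_on_compose2[OF continuous_on_coords[of UNIV] continuous_on_snd[OF continuous_on_id]]]) simp
    qed (use simplex2_D2 in auto)
    moreover have "tri_of a p = a (p 0, p 1, p 2)" "tri_of b p = b (p 0, p 1, p 2)"
      if "p \<in> standard_simplex 2" for p using that by (simp_all add: tri_of_def)
    ultimately show ?L unfolding L using h0 h1 hb simplex2_D2 sb
      by (intro exI[of _ "\<lambda>c. h (fst c, (snd c 0, snd c 1, snd c 2))"]) (simp add: simplex2_boundary_bd2)
  qed
qed

lemma tri_of_mem_cls: "tri_of b \<in> cls M a \<longleftrightarrow> hom2 M a b"
  unfolding cls_def triangle_class_def mem_Collect_eq tri_of_homotopic singular_tri_of using hom2_tri(2) by blast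

lemma mem_clsE:
  assumes "\<sigma> \<in> cls M a" obtains b where "\<sigma> = tri_of b" "hom2 M a b"
proof -
  have "singular_simplex 2 (top_of_set M) \<sigma>" using assms by (simp add: cls_def triangle_class_def)
  then obtain b where b: "\<sigma> = tri_of b" by (rule singular_simplex2E)
  then show thesis using that assms tri_of_mem_cls by blast
qed

lemma cls_eqI: assumes "hom2 M a b" shows "cls M a = cls M b"
proof -
  have "\<sigma> \<in> cls M a \<longleftrightarrow> \<sigma> \<in> cls M b" for \<sigma>
    using assms mem_clsE[of \<sigma> M] tri_of_mem_cls hom2_trans hom2_sym by metis
  then show ?thesis by blast
qed

lemma cls_eqD: assumes "cls M a = cls M b" "tri M b" shows "hom2 M a b"
proof -
  have "tri_of b \<in> cls M b" using hom2_eq[OF assms(2) refl] tri_of_mem_cls by blast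
  then show ?thesis using assms(1) tri_of_mem_cls by blast
qed

lemma cls_eq_pt: assumes "tri M a" "\<And>x y z. (x, y, z) \<in> D2 \<Longrightarrow> b (x, y, z) = a (x, y, z)"
  shows "cls M b = cls M a"
  using cls_eqI[OF hom2_eq[OF assms]] by simp

text \<open>The operations on classes are unions over all representatives. A class is nonempty and
  each representative contributes the same set, so the union is that set.\<close>

lemma UN_cls:
  assumes "tri M a" "\<And>b. hom2 M a b \<Longrightarrow> F (tri_of b) = X"
  shows "(\<Union>\<sigma>\<in>cls M a. F \<sigma>) = X"
proof -
  have "tri_of a \<in> cls M a" using hom2_eq[OF assms(1) refl] tri_of_mem_cls by blast
  moreover have "F \<sigma> = X" if "\<sigma> \<in> cls M a" for \<sigma> using mem_clsE[OF that] assms(2) by metis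
  ultimately show ?thesis by blast
qed

lemma Q_op_cls: assumes "tri M a" shows "Q_op M (cls M a) = cls M (swa a)"
  unfolding Q_op_def
proof (rule UN_cls[OF assms])
  fix b assume b: "hom2 M a b"
  have "(\<lambda>x\<in>standard_simplex 2. tri_of b (bary (x 1) (x 0) (x 2))) = tri_of (swa b)"
    unfolding tri_of_def[of "swa b"]
  proof (rule restrict_ext)
    fix x :: "nat \<Rightarrow> real" assume "x \<in> standard_simplex 2"
    then have "(x 1, x 0, x 2) \<in> D2" using simplex2_D2[of x] by (simp add: D2_iff)
    then show "tri_of b (bary (x 1) (x 0) (x 2)) = swa b (x 0, x 1, x 2)" by (simp only: tri_of_bary swa_apply)
  qed
  then show "triangle_class M (\<lambda>x\<in>standard_simplex 2. tri_of b (bary (x 1) (x 0) (x 2))) = cls M (swa a)"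
    using cls_eqI[OF hom2_swap(1)[OF b]] by (simp only: cls_def)
qed

lemma P_op_cls: assumes "tri M a" shows "P_op M (cls M a) = cls M (swb (swa a))"
  unfolding P_op_def
proof (rule UN_cls[OF assms])
  fix b assume b: "hom2 M a b"
  have "(\<lambda>x\<in>standard_simplex 2. tri_of b (bary (x 2) (x 0) (x 1))) = tri_of (swb (swa b))"
    unfolding tri_of_def[of "swb (swa b)"]
  proof (rule restrict_ext)
    fix x :: "nat \<Rightarrow> real" assume "x \<in> standard_simplex 2"
    then have "(x 2, x 0, x 1) \<in> D2" using simplex2_D2[of x] by (simp add: D2_iff)
    then show "tri_of b (bary (x 2) (x 0) (x 1)) = swb (swa b) (x 0, x 1, x 2)" by (simp only: tri_of_bary swa_apply swb_apply)
  qed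
  then show "triangle_class M (\<lambda>x\<in>standard_simplex 2. tri_of b (bary (x 2) (x 0) (x 1))) = cls M (swb (swa a))"
    using cls_eqI[OF hom2_swap(2)[OF hom2_swap(1)[OF b]]] by (simp only: cls_def)
qed

section \<open>Sphere classes and their action on triangle classes\<close>

abbreviation "sphc \<equiv> spheroid_class"

lemma sphc_mem: "g \<in> sphc M m0 f \<longleftrightarrow> sph_hom M m0 f g"
  by (simp add: spheroid_class_def sph_hom_def)

lemma sphc_eqI: assumes "sph_hom M m0 f g" shows "sphc M m0 f = sphc M m0 g"
proof -
  have "k \<in> sphc M m0 f \<longleftrightarrow> k \<in> sphc M m0 g" for k
    unfolding sphc_mem using assms sph_hom_trans sph_hom_sym by metis
  then show ?thesis by blast
qed

lemma sphc_self: "f \<in> spheroids M m0 \<Longrightarrow> f \<in> sphc M m0 f"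
  by (simp add: sphc_mem sph_hom_refl)

lemma UN_sphc:
  assumes "f \<in> spheroids M m0" "\<And>g. sph_hom M m0 f g \<Longrightarrow> F g = X"
  shows "(\<Union>g\<in>sphc M m0 f. F g) = X"
  using sphc_self[OF assms(1)] assms(2) sphc_mem by blast

lemma glue_tri_of: "glue (tri_of a) f = tri_of (gl a f)"
  unfolding glue_def tri_of_def[of "gl a f"]
proof (rule restrict_ext)
  fix p :: "nat \<Rightarrow> real" assume p: "p \<in> standard_simplex 2"
  define r u where "r = 1 - p 0" and "u = p 2 / r"
  note D = simplex2_D2[OF p]
  have u: "u \<in> J" using cone_cover(1)[OF D r_def u_def, of 0] by auto
  have r: "0 \<le> r" "r \<le> 1" using D by (auto simp: r_def D2_iff)
  note l = lens_range[OF u]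
  define s where "s = (r - u * (1 - u)) / (1 - u * (1 - u))"
  have "tri_of a (bary (1 - s) (s * (1 - u)) (s * u)) = a (1 - s, s * (1 - u), s * u)" if "\<not> r \<le> u * (1 - u)"
  proof -
    have "s \<in> J" unfolding s_def using that r by (intro frac_J) simp_all
    then show ?thesis by (intro tri_of_bary cone_point u)
  qed
  then show "(let r = 1 - p 0; u = p 2 / r; \<rho> = u * (1 - u)
     in if r \<le> \<rho> then f (r / \<rho>, u)
        else let r' = (r - \<rho>) / (1 - \<rho>) in tri_of a (bary (1 - r') (r' * (1 - u)) (r' * u))) = gl a f (p 0, p 1, p 2)"
    unfolding gl_apply[OF r_def u_def] Let_def r_def[symmetric] u_def[symmetric] s_def[symmetric] by simp
qed

lemma add_sphere_cls:
  assumes a: "tri M a" "a (1, 0, 0) = m0" and f: "f \<in> spheroids M m0"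
  shows "add_sphere M (cls M a) (sphc M m0 f) = cls M (gl a f)"
  unfolding add_sphere_def
proof (rule UN_cls[OF a(1)], rule UN_sphc[OF f])
  fix b g assume "hom2 M a b" "sph_hom M m0 f g"
  then have "hom2 M (gl a f) (gl b g)" using a(2) by (intro gl_hom2) simp_all
  then show "triangle_class M (glue (tri_of b) g) = cls M (gl a f)"
    unfolding glue_tri_of cls_def[symmetric] using cls_eqI by metis
qed

lemma pi2_carrier: "v \<in> carrier (pi2 M m0) \<longleftrightarrow> (\<exists>f\<in>spheroids M m0. v = sphc M m0 f)"
  by (auto simp: pi2_def)

lemma pi2_mult:
  assumes f: "f \<in> spheroids M m0" and g: "g \<in> spheroids M m0"
  shows "sphc M m0 f \<otimes>\<^bsub>pi2 M m0\<^esub> sphc M m0 g = sphc M m0 (spheroid_join f g)"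
proof -
  have "(\<Union>f'\<in>sphc M m0 f. \<Union>g'\<in>sphc M m0 g. sphc M m0 (spheroid_join f' g')) = sphc M m0 (spheroid_join f g)"
  proof (rule UN_sphc[OF f], rule UN_sphc[OF g])
    fix f' g' assume "sph_hom M m0 f f'" "sph_hom M m0 g g'"
    then show "sphc M m0 (spheroid_join f' g') = sphc M m0 (spheroid_join f g)"
      using sphc_eqI[OF spheroid_join_hom] by metis
  qed
  then show ?thesis by (simp add: pi2_def)
qed

section \<open>The filler relation on triangle classes\<close>

text \<open>All corners are required at the base point because vertex permutations bring each of
  them to the place where spheres are glued.\<close>

definition vert :: "(real \<times> real \<times> real \<Rightarrow> 'a) \<Rightarrow> 'a \<Rightarrow> bool" where
  "vert a m0 \<longleftrightarrow> a (1, 0, 0) = m0 \<and> a (0, 1, 0) = m0 \<and> a (0, 0, 1) = m0"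

lemma tet_corners:
  assumes "tet M a0 a1 a2 a3"
  shows "a1 (1, 0, 0) = a2 (1, 0, 0)" "a2 (1, 0, 0) = a3 (1, 0, 0)"
    "a0 (1, 0, 0) = a2 (0, 1, 0)" "a2 (0, 1, 0) = a3 (0, 1, 0)"
    "a0 (0, 1, 0) = a1 (0, 1, 0)" "a1 (0, 1, 0) = a3 (0, 0, 1)"
    "a0 (0, 0, 1) = a1 (0, 0, 1)" "a1 (0, 0, 1) = a2 (0, 0, 1)"
proof -
  obtain \<omega> where f: "faces \<omega> a0 a1 a2 a3" by (rule tetE[OF assms])
  show "a1 (1, 0, 0) = a2 (1, 0, 0)" "a2 (1, 0, 0) = a3 (1, 0, 0)"
    using facesD[OF f, of 1 0 0] by simp_all
  show "a0 (1, 0, 0) = a2 (0, 1, 0)" "a2 (0, 1, 0) = a3 (0, 1, 0)"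
    using facesD(1)[OF f, of 1 0 0] facesD(3,4)[OF f, of 0 1 0] by simp_all
  show "a0 (0, 1, 0) = a1 (0, 1, 0)" "a1 (0, 1, 0) = a3 (0, 0, 1)"
    using facesD(1,2)[OF f, of 0 1 0] facesD(4)[OF f, of 0 0 1] by simp_all
  show "a0 (0, 0, 1) = a1 (0, 0, 1)" "a1 (0, 0, 1) = a2 (0, 0, 1)"
    using facesD(1,2,3)[OF f, of 0 0 1] by simp_all
qed

lemma tet_vert:
  assumes "tet M a0 a1 a2 a3" "vert a0 m0" "a1 (1, 0, 0) = m0"
  shows "vert a1 m0" "vert a2 m0" "vert a3 m0"
  using tet_corners[OF assms(1)] assms(2,3) by (simp_all add: vert_def)

lemma tet_edges:
  assumes "tet M a0 a1 a2 a3" "0 \<le> x" "0 \<le> y" "x + y = 1"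
  shows "a1 (x, 0, y) = a2 (x, 0, y)" "a1 (x, y, 0) = a3 (x, 0, y)" "a2 (x, y, 0) = a3 (x, y, 0)"
    "a0 (x, y, 0) = a3 (0, x, y)" "a0 (x, 0, y) = a2 (0, x, y)" "a0 (0, x, y) = a1 (0, x, y)"
proof -
  obtain \<omega> where f: "faces \<omega> a0 a1 a2 a3" by (rule tetE[OF assms(1)])
  show "a1 (x, 0, y) = a2 (x, 0, y)" "a1 (x, y, 0) = a3 (x, 0, y)" "a2 (x, y, 0) = a3 (x, y, 0)"
    "a0 (x, y, 0) = a3 (0, x, y)" "a0 (x, 0, y) = a2 (0, x, y)" "a0 (0, x, y) = a1 (0, x, y)"
    using assms(2-4) facesD[OF f, of x 0 y] facesD[OF f, of x y 0] facesD[OF f, of 0 x y] by simp_all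
qed

lemma tet_hom0: assumes "tet M a0 a1 a2 a3" "hom2 M a0 b" shows "tet M b a1 a2 a3"
  by (rule horn_tet[OF hom2_trans[OF hom2_sym[OF tet_hom2_horn[OF assms(1)]] assms(2)] tet_edges(1,2,3)[OF assms(1)]])

text \<open>A face is replaced by a homotopic one when it is opposite to the first vertex, since
  only the homotopy class of the horn matters there. The other faces are brought to that position by
  permutations and put back afterwards.\<close>

lemma tet_hom:
  assumes "tet M a0 a1 a2 a3" "hom2 M a0 b0" "hom2 M a1 b1" "hom2 M a2 b2" "hom2 M a3 b3"
  shows "tet M b0 b1 b2 b3"
proof -
  have "tet M b0 a1 a2 a3" by (rule tet_hom0[OF assms(1,2)])
  then have "tet M b1 b0 (swa a2) (swa a3)" using tet_swap(1) tet_hom0 assms(3) by blast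
  then have "tet M b0 b1 a2 a3" using tet_swap(1)[of M b1 b0 "swa a2" "swa a3"] by (simp only: swa_swa)
  then have "tet M a2 (swa b0) (swa b1) (swa (swb a3))" using tet_swap(1,2) by blast
  then have "tet M b2 (swa b0) (swa b1) (swa (swb a3))" using tet_hom0 assms(4) by blast
  then have "tet M (swa b0) b2 b1 (swb a3)" using tet_swap(1)[of M b2 "swa b0" "swa b1" "swa (swb a3)"] by (simp only: swa_swa)
  then have "tet M b0 b1 b2 a3" using tet_swap(2)[of M "swa b0" b2 b1 "swb a3"] by (simp only: swa_swa swb_swb)
  then have "tet M (swb b0) (swb b1) a3 b2" by (rule tet_swap(3))
  then have "tet M (swa (swb b0)) a3 (swb b1) (swb b2)" by (rule tet_swap(2))
  then have "tet M a3 (swa (swb b0)) (swa (swb b1)) (swa (swb b2))" by (rule tet_swap(1))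
  then have "tet M b3 (swa (swb b0)) (swa (swb b1)) (swa (swb b2))" using tet_hom0 assms(5) by blast
  then have "tet M (swa (swb b0)) b3 (swb b1) (swb b2)"
    using tet_swap(1)[of M b3 "swa (swb b0)" "swa (swb b1)" "swa (swb b2)"] by (simp only: swa_swa)
  then have "tet M (swb b0) (swb b1) b3 b2"
    using tet_swap(2)[of M "swa (swb b0)" b3 "swb b1" "swb b2"] by (simp only: swa_swa swb_swb)
  then show ?thesis using tet_swap(3)[of M "swb b0" "swb b1" b3 b2] by (simp only: swb_swb)
qed

text \<open>It is enough that some representatives fit, because by \<open>tet_hom\<close> all others
  then fit too. The conditions on faces 0 and 1 cover all four vertices.\<close>

definition TetG :: "'a::topological_space set \<Rightarrow> 'a \<Rightarrow> 'a triangleclass \<Rightarrow> 'a triangleclass \<Rightarrow> 'a triangleclass \<Rightarrow>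
    'a triangleclass \<Rightarrow> bool" where
  "TetG M m0 z0 z1 z2 z3 \<longleftrightarrow> (\<exists>a0 a1 a2 a3. z0 = cls M a0 \<and> z1 = cls M a1 \<and> z2 = cls M a2 \<and> z3 = cls M a3 \<and>
     tet M a0 a1 a2 a3 \<and> vert a0 m0 \<and> vert a1 m0)"

definition based :: "'a::topological_space set \<Rightarrow> 'a \<Rightarrow> 'a triangleclass set" where
  "based M m0 = cls M ` {a. tri M a \<and> vert a m0}"

definition sbG :: "'a::topological_space set \<Rightarrow> 'a triangleclass \<Rightarrow> 'a triangleclass" where
  "sbG M z = P_op M (Q_op M z)"

lemma sbG_cls: assumes "tri M a" shows "sbG M (cls M a) = cls M (swb a)"
  unfolding sbG_def Q_op_cls[OF assms] P_op_cls[OF tri_swap(1)[OF assms]] swa_swa ..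

lemma TetGI:
  assumes "tet M a0 a1 a2 a3" "vert a0 m0" "a1 (1, 0, 0) = m0"
  shows "TetG M m0 (cls M a0) (cls M a1) (cls M a2) (cls M a3)"
  unfolding TetG_def using assms tet_vert[OF assms] by blast

lemma TetGE:
  assumes "TetG M m0 z0 z1 z2 z3"
  obtains a0 a1 a2 a3 where "z0 = cls M a0" "z1 = cls M a1" "z2 = cls M a2" "z3 = cls M a3"
     "tet M a0 a1 a2 a3" "vert a0 m0" "vert a1 m0" "vert a2 m0" "vert a3 m0"
     "tri M a0" "tri M a1" "tri M a2" "tri M a3"
proof -
  obtain a0 a1 a2 a3 where *: "z0 = cls M a0" "z1 = cls M a1" "z2 = cls M a2" "z3 = cls M a3"
     "tet M a0 a1 a2 a3" "vert a0 m0" "vert a1 m0" using assms unfolding TetG_def by blast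
  moreover have "a1 (1, 0, 0) = m0" using *(7) by (simp add: vert_def)
  ultimately show thesis using that tet_vert[OF *(5,6)] tet_tri[OF *(5)] by blast
qed

lemma TetG_cls:
  assumes "TetG M m0 (cls M a0) (cls M a1) (cls M a2) (cls M a3)" "tri M a0" "tri M a1" "tri M a2" "tri M a3"
  shows "tet M a0 a1 a2 a3"
proof -
  obtain b0 b1 b2 b3 where "cls M a0 = cls M b0" "cls M a1 = cls M b1" "cls M a2 = cls M b2" "cls M a3 = cls M b3"
     "tet M b0 b1 b2 b3" using assms(1) unfolding TetG_def by blast
  note b = this
  show ?thesis
    by (rule tet_hom[OF b(5) cls_eqD[OF b(1)[symmetric] assms(2)] cls_eqD[OF b(2)[symmetric] assms(3)]
          cls_eqD[OF b(3)[symmetric] assms(4)] cls_eqD[OF b(4)[symmetric] assms(5)]])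
qed

lemma vert_swap: "vert a m0 \<Longrightarrow> vert (swa a) m0" "vert a m0 \<Longrightarrow> vert (swb a) m0"
  by (simp_all add: vert_def)

lemma TetG_swap:
  assumes "TetG M m0 z0 z1 z2 z3"
  shows "TetG M m0 z1 z0 (Q_op M z2) (Q_op M z3)" "TetG M m0 (Q_op M z0) z2 z1 (sbG M z3)"
    "TetG M m0 (sbG M z0) (sbG M z1) z3 z2"
proof -
  obtain a0 a1 a2 a3 where z: "z0 = cls M a0" "z1 = cls M a1" "z2 = cls M a2" "z3 = cls M a3"
     and t: "tet M a0 a1 a2 a3" and v: "vert a0 m0" "vert a1 m0" "vert a2 m0" "vert a3 m0"
     and tr: "tri M a0" "tri M a1" "tri M a2" "tri M a3" by (rule TetGE[OF assms])
  have c: "a0 (1, 0, 0) = m0" "a2 (1, 0, 0) = m0" "(swb a1) (1, 0, 0) = m0" using v by (simp_all add: vert_def)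
  show "TetG M m0 z1 z0 (Q_op M z2) (Q_op M z3)"
    using TetGI[OF tet_swap(1)[OF t] v(2) c(1)] by (simp only: z Q_op_cls[OF tr(3)] Q_op_cls[OF tr(4)])
  show "TetG M m0 (Q_op M z0) z2 z1 (sbG M z3)"
    using TetGI[OF tet_swap(2)[OF t] vert_swap(1)[OF v(1)] c(2)] by (simp only: z Q_op_cls[OF tr(1)] sbG_cls[OF tr(4)])
  show "TetG M m0 (sbG M z0) (sbG M z1) z3 z2"
    using TetGI[OF tet_swap(3)[OF t] vert_swap(2)[OF v(1)] c(3)] by (simp only: z sbG_cls[OF tr(1)] sbG_cls[OF tr(2)])
qed

lemma TetG_based: assumes "TetG M m0 z0 z1 z2 z3"
  shows "z0 \<in> based M m0 \<and> z1 \<in> based M m0 \<and> z2 \<in> based M m0 \<and> z3 \<in> based M m0"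
  by (rule TetGE[OF assms]) (auto simp: based_def)

text \<open>Any face closing the other three is homotopic to their horn.\<close>

lemma TetG_unique: assumes "TetG M m0 z z1 z2 z3" "TetG M m0 z' z1 z2 z3" shows "z = z'"
proof -
  obtain a0 a1 a2 a3 where z: "z = cls M a0" "z1 = cls M a1" "z2 = cls M a2" "z3 = cls M a3"
     and t: "tet M a0 a1 a2 a3" and tr: "tri M a0" "tri M a1" "tri M a2" "tri M a3" by (rule TetGE[OF assms(1)])
  obtain b where b: "z' = cls M b" "tri M b" using TetG_based[OF assms(2)] unfolding based_def by blast
  have "tet M b a1 a2 a3" by (rule TetG_cls[OF assms(2)[unfolded z b(1)] b(2) tr(2,3,4)])
  then have "cls M b = cls M (horn a1 a2 a3)" by (intro cls_eqI tet_hom2_horn)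
  moreover have "cls M a0 = cls M (horn a1 a2 a3)" using t by (intro cls_eqI tet_hom2_horn)
  ultimately show ?thesis unfolding z(1) b(1) by simp
qed

lemma TetG_cone:
  assumes "TetG M m0 a123 a023 a013 a012" "TetG M m0 a124 a024 a014 a012" "TetG M m0 a134 a034 a014 a013"
    "TetG M m0 a234 a034 a024 a023"
  shows "TetG M m0 a234 a134 a124 a123"
proof -
  \<comment> \<open>One representative is fixed for each class, so that a triangle shared by several
    of the tetrahedra is literally the same map in all of them, as \<open>tet_cone\<close>
    requires.\<close>
  define R where "R z = (SOME a. z = cls M a \<and> tri M a \<and> vert a m0)" for z
  have R: "z = cls M (R z)" "tri M (R z)" "vert (R z) m0" if "z \<in> based M m0" for z
  proof -
    have "\<exists>a. z = cls M a \<and> tri M a \<and> vert a m0" using that by (auto simp: based_def)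
    from someI_ex[OF this] show "z = cls M (R z)" "tri M (R z)" "vert (R z) m0" unfolding R_def by blast+
  qed
  have RT: "tet M (R z0) (R z1) (R z2) (R z3)" if "TetG M m0 z0 z1 z2 z3" for z0 z1 z2 z3
  proof -
    note b = TetG_based[OF that]
    have c: "cls M (R z0) = z0" "cls M (R z1) = z1" "cls M (R z2) = z2" "cls M (R z3) = z3"
      and t: "tri M (R z0)" "tri M (R z1)" "tri M (R z2)" "tri M (R z3)"
      using R(1,2) b by simp_all
    show ?thesis by (rule TetG_cls[of M m0, OF _ t]) (simp only: c that)
  qed
  have t: "tet M (R a234) (R a134) (R a124) (R a123)"
    by (rule tet_cone[OF RT[OF assms(1)] RT[OF assms(2)] RT[OF assms(3)] RT[OF assms(4)]])
  have b: "a234 \<in> based M m0" "a134 \<in> based M m0" "a124 \<in> based M m0" "a123 \<in> based M m0"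
    using TetG_based[OF assms(1)] TetG_based[OF assms(2)] TetG_based[OF assms(3)] TetG_based[OF assms(4)] by blast+
  have "R a134 (1, 0, 0) = m0" using R(3)[OF b(2)] by (simp add: vert_def)
  from TetGI[OF t R(3)[OF b(1)] this] show ?thesis
    by (simp only: R(1)[OF b(1), symmetric] R(1)[OF b(2), symmetric] R(1)[OF b(3), symmetric] R(1)[OF b(4), symmetric])
qed

lemma add_sphere_based:
  assumes "z \<in> based M m0" "v \<in> carrier (pi2 M m0)"
  obtains a f where "z = cls M a" "tri M a" "vert a m0" "v = sphc M m0 f" "f \<in> spheroids M m0"
    "add_sphere M z v = cls M (gl a f)"
  using assms add_sphere_cls unfolding based_def pi2_carrier vert_def by blast

lemma TetG_add:
  assumes "TetG M m0 z0 z1 z2 z3" and v: "v \<in> carrier (pi2 M m0)"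
  shows "TetG M m0 z0 (add_sphere M z1 v) (add_sphere M z2 v) z3"
proof -
  obtain a0 a1 a2 a3 where z: "z0 = cls M a0" "z1 = cls M a1" "z2 = cls M a2" "z3 = cls M a3"
     and t: "tet M a0 a1 a2 a3" and v4: "vert a0 m0" "vert a1 m0" "vert a2 m0" "vert a3 m0"
     and tr: "tri M a0" "tri M a1" "tri M a2" "tri M a3" by (rule TetGE[OF assms(1)])
  obtain f where f: "f \<in> spheroids M m0" "v = sphc M m0 f" using v pi2_carrier by blast
  have c: "a1 (1, 0, 0) = m0" "a2 (1, 0, 0) = m0" using v4 by (simp_all add: vert_def)
  have t': "tet M a0 (gl a1 f) (gl a2 f) a3" using f(1) c by (intro tet_gl[OF t]) simp
  have "gl a1 f (1, 0, 0) = m0"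
    using gl_bd[of "(1, 0, 0)" f a1] f(1) c by (simp add: bd2_iff D2_iff spheroids_def)
  from TetGI[OF t' v4(1) this] show ?thesis
    unfolding z f add_sphere_cls[OF tr(2) c(1) f(1)] add_sphere_cls[OF tr(3) c(2) f(1)] .
qed

definition flipf :: "(real \<times> real \<Rightarrow> 'a) \<Rightarrow> real \<times> real \<Rightarrow> 'a" where
  "flipf f = (\<lambda>(s, t). f (s, 1 - t))"

definition flipG :: "'a::topological_space set \<Rightarrow> 'a \<Rightarrow> 'a sphereclass \<Rightarrow> 'a sphereclass" where
  "flipG M m0 v = (\<Union>f\<in>v. sphc M m0 (flipf f))"

lemma flipf_hom: assumes "sph_hom M m0 f g" shows "sph_hom M m0 (flipf f) (flipf g)"
proof -
  obtain k where k: "into (J \<times> J \<times> J) M k" and k0: "\<And>p. p \<in> J \<times> J \<Longrightarrow> k (0, p) = f p" and k1: "\<And>p. p \<in> J \<times> J \<Longrightarrow> k (1, p) = g p"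
    and kb: "\<And>t p. t \<in> J \<Longrightarrow> p \<in> square_boundary \<Longrightarrow> k (t, p) = m0" using sph_homE[OF assms] by blast
  show ?thesis
  proof (rule sph_homI[where h="\<lambda>c. k (fst c, fst (snd c), 1 - snd (snd c))"])
    show "into (J \<times> J \<times> J) M (\<lambda>c. k (fst c, fst (snd c), 1 - snd (snd c)))"
      by (rule continuous_on_compose_into[OF k]) (auto intro!: continuous_intros)
    fix p :: "real \<times> real"
    obtain s u where p: "p = (s, u)" by (metis surj_pair)
    show "k (fst (0, p), fst (snd (0, p)), 1 - snd (snd (0, p))) = flipf f p"
      "k (fst (1, p), fst (snd (1, p)), 1 - snd (snd (1, p))) = flipf g p" if "p \<in> J \<times> J"
      using that k0[of "(s, 1 - u)"] k1[of "(s, 1 - u)"] by (auto simp: p flipf_def)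
    show "k (fst (t, p), fst (snd (t, p)), 1 - snd (snd (t, p))) = m0" if "t \<in> J" "p \<in> square_boundary" for t
      using that kb[of t "(s, 1 - u)"] by (auto simp: p square_boundary_iff)
  qed
qed

lemma flipf_spheroid: "f \<in> spheroids M m0 \<Longrightarrow> flipf f \<in> spheroids M m0"
  using sph_hom_spheroids(1) flipf_hom sph_hom_refl by blast

lemma flipG_sphc: assumes "f \<in> spheroids M m0" shows "flipG M m0 (sphc M m0 f) = sphc M m0 (flipf f)"
  unfolding flipG_def by (rule UN_sphc[OF assms]) (metis flipf_hom sphc_eqI)

lemma sbG_add:
  assumes "z \<in> based M m0" "v \<in> carrier (pi2 M m0)"
  shows "sbG M (add_sphere M z v) = add_sphere M (sbG M z) (flipG M m0 v)"
proof -
  obtain a f where z: "z = cls M a" "tri M a" "vert a m0" and v: "v = sphc M m0 f" "f \<in> spheroids M m0"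
    and e: "add_sphere M z v = cls M (gl a f)" using add_sphere_based[OF assms] by blast
  have c: "a (1, 0, 0) = m0" "swb a (1, 0, 0) = m0" using z(3) by (simp_all add: vert_def)
  have t: "tri M (gl a f)"
    using hom2_tri(1)[OF gl_hom2[OF hom2_eq[OF z(2) refl] sph_hom_refl], of f] v(2) c(1) by simp
  have "f (0, 0) = f (0, 1)" using spheroidsD(2)[OF v(2), of 0] spheroidsD(2)[OF v(2), of 1] by simp
  then have "cls M (gl (swb a) (flipf f)) = cls M (swb (gl a f))"
    using swb_gl[of f _ _ _ a] by (intro cls_eq_pt[OF tri_swap(2)[OF t]]) (simp only: flipf_def)
  moreover have "add_sphere M (cls M (swb a)) (sphc M m0 (flipf f)) = cls M (gl (swb a) (flipf f))"
    by (rule add_sphere_cls[OF tri_swap(2)[OF z(2)] c(2) flipf_spheroid[OF v(2)]])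
  ultimately show ?thesis
    unfolding e sbG_cls[OF t] unfolding z(1) v(1) sbG_cls[OF z(2)] flipG_sphc[OF v(2)] by simp
qed

subsection \<open>Triangles with prescribed edges\<close>

text \<open>The edges are an arbitrary family of loops indexed by pairs of labels, not a section:
  labels with a flag will later accommodate two sections in a single instance.\<close>

locale edge_system =
  fixes M :: "'a::topological_space set" and m0 :: 'a and V :: "'v set" and lp :: "'v \<Rightarrow> 'v \<Rightarrow> real \<Rightarrow> 'a"
  assumes lp_loop: "i \<in> V \<Longrightarrow> j \<in> V \<Longrightarrow> lp i j \<in> loops M m0"
    and lp_rev: "i \<in> V \<Longrightarrow> j \<in> V \<Longrightarrow> t \<in> J \<Longrightarrow> lp j i t = lp i j (1 - t)"
    and lp_const: "i \<in> V \<Longrightarrow> t \<in> J \<Longrightarrow> lp i i t = m0"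
    and V_nonempty: "V \<noteq> {}"
begin

definition lab :: "'v \<Rightarrow> 'v \<Rightarrow> 'v \<Rightarrow> (real \<times> real \<times> real \<Rightarrow> 'a) \<Rightarrow> bool" where
  "lab i j k a \<longleftrightarrow> tri M a \<and> (\<forall>x y. 0 \<le> x \<and> 0 \<le> y \<and> x + y = 1 \<longrightarrow>
     a (x, y, 0) = lp i j y \<and> a (x, 0, y) = lp i k y \<and> a (0, x, y) = lp j k y)"

definition T :: "'v \<Rightarrow> 'v \<Rightarrow> 'v \<Rightarrow> 'a triangleclass set" where
  "T i j k = cls M ` {a. lab i j k a \<and> i \<in> V \<and> j \<in> V \<and> k \<in> V}"

definition D :: "'v \<Rightarrow> 'v \<Rightarrow> 'a triangleclass" where
  "D i j = cls M (\<lambda>(x, y, z). lp i j z)"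

definition act :: "'v \<Rightarrow> 'v \<Rightarrow> 'a sphereclass \<Rightarrow> 'a sphereclass" where
  "act i j v = (\<Union>f\<in>v. sphc M m0 (transport (lp i j) f))"

lemma labD:
  assumes "lab i j k a" "0 \<le> x" "0 \<le> y" "x + y = 1"
  shows "a (x, y, 0) = lp i j y" "a (x, 0, y) = lp i k y" "a (0, x, y) = lp j k y"
  using assms unfolding lab_def by simp_all

lemma labI:
  assumes "tri M a" "\<And>x y. 0 \<le> x \<Longrightarrow> 0 \<le> y \<Longrightarrow> x + y = 1 \<Longrightarrow>
     a (x, y, 0) = lp i j y \<and> a (x, 0, y) = lp i k y \<and> a (0, x, y) = lp j k y"
  shows "lab i j k a"
  using assms unfolding lab_def by simp

lemma lp_ends: assumes "i \<in> V" "j \<in> V" shows "lp i j 0 = m0" "lp i j 1 = m0" "into J M (lp i j)"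
  using lp_loop[OF assms] by (simp_all add: loops_def path_def path_image_def pathstart_def pathfinish_def)

lemma lp_swap: assumes "i \<in> V" "j \<in> V" "0 \<le> x" "0 \<le> y" "x + y = 1" shows "lp i j x = lp j i y"
proof -
  have "x = 1 - y" using assms by linarith
  show ?thesis unfolding \<open>x = 1 - y\<close> using lp_rev[OF assms(1,2), of y] assms(3-5) by simp
qed

lemma lab_vert: assumes "lab i j k a" "i \<in> V" "j \<in> V" "k \<in> V" shows "vert a m0"
  using labD[OF assms(1), of 1 0] labD[OF assms(1), of 0 1] lp_ends assms by (simp add: vert_def)

lemma lab_tri: "lab i j k a \<Longrightarrow> tri M a" by (simp add: lab_def)

lemma lab_swa: assumes "lab i j k a" "i \<in> V" "j \<in> V" "k \<in> V" shows "lab j i k (swa a)"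
proof (rule labI[OF tri_swap(1)[OF lab_tri[OF assms(1)]]])
  fix x y :: real assume x: "0 \<le> x" "0 \<le> y" "x + y = 1"
  have "y + x = 1" using x by linarith
  then show "swa a (x, y, 0) = lp j i y \<and> swa a (x, 0, y) = lp j k y \<and> swa a (0, x, y) = lp i k y"
    using labD[OF assms(1) x] labD(1)[OF assms(1) x(2,1)] lp_swap[OF assms(2,3) x] by simp
qed

lemma lab_swb: assumes "lab i j k a" "i \<in> V" "j \<in> V" "k \<in> V" shows "lab i k j (swb a)"
proof (rule labI[OF tri_swap(2)[OF lab_tri[OF assms(1)]]])
  fix x y :: real assume x: "0 \<le> x" "0 \<le> y" "x + y = 1"
  have "y + x = 1" using x by linarith
  then show "swb a (x, y, 0) = lp i k y \<and> swb a (x, 0, y) = lp i j y \<and> swb a (0, x, y) = lp k j y"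
    using labD[OF assms(1) x] labD(3)[OF assms(1) x(2,1)] lp_swap[OF assms(3,4) x] by simp
qed

lemma TE:
  assumes "z \<in> T i j k"
  obtains a where "z = cls M a" "lab i j k a" "tri M a" "vert a m0" "i \<in> V" "j \<in> V" "k \<in> V"
proof -
  obtain a where a: "z = cls M a" "lab i j k a" "i \<in> V" "j \<in> V" "k \<in> V" using assms unfolding T_def by blast
  show thesis by (rule that[OF a(1,2) lab_tri[OF a(2)] lab_vert[OF a(2-5)] a(3-5)])
qed

lemma T_I: "lab i j k a \<Longrightarrow> i \<in> V \<Longrightarrow> j \<in> V \<Longrightarrow> k \<in> V \<Longrightarrow> cls M a \<in> T i j k"
  unfolding T_def by blast

lemma T_based: assumes "z \<in> T i j k" shows "z \<in> based M m0"
  by (rule TE[OF assms]) (auto simp: based_def)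

lemma T_Q: assumes "z \<in> T i j k" shows "Q_op M z \<in> T j i k"
  by (rule TE[OF assms]) (simp add: Q_op_cls T_I lab_swa)

lemma T_sb: assumes "z \<in> T i j k" shows "sbG M z \<in> T i k j"
  by (rule TE[OF assms]) (simp add: sbG_cls T_I lab_swb)

lemma lab_D: assumes "i \<in> V" "j \<in> V" shows "lab i i j (\<lambda>(x, y, z). lp i j z)"
proof (rule labI)
  show "tri M (\<lambda>(x, y, z). lp i j z)" unfolding tri_def case_prod_unfold
    by (rule continuous_on_compose_into[OF lp_ends(3)[OF assms]]) (auto simp: D2_def intro!: continuous_intros)
qed (simp add: lp_ends assms lp_const)

lemma lab_const: "i \<in> V \<Longrightarrow> lab i i i (\<lambda>_. m0)"
proof (rule labI)
  assume i: "i \<in> V"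
  have "m0 \<in> M" using lp_ends(1,3)[OF i i] by auto
  then show "tri M (\<lambda>_. m0)" by (auto simp: tri_def)
qed (simp add: lp_const)

lemma D_const: assumes "i \<in> V" shows "D i i = cls M (\<lambda>_. m0)"
  unfolding D_def by (rule cls_eq_pt[OF lab_tri[OF lab_const[OF assms]]]) (use assms lp_const in \<open>auto simp: D2_iff\<close>)

lemma m0_M: "m0 \<in> M"
  using V_nonempty lp_ends(1,3) by fastforce

lemma add_const: assumes "i \<in> V" "f \<in> spheroids M m0"
  shows "add_sphere M (D i i) (sphc M m0 f) = cls M (bar f)"
  unfolding D_const[OF assms(1)] using add_sphere_cls[OF lab_tri[OF lab_const[OF assms(1)]] refl assms(2)]
    cls_eqI[OF gl_const_bar[OF assms(2)]] by simp

lemma lab_gl: assumes "lab i j k a" "i \<in> V" "j \<in> V" "k \<in> V" and f: "f \<in> spheroids M m0"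
  shows "lab i j k (gl a f)"
proof (rule labI)
  have c: "a (1, 0, 0) = m0" using lab_vert[OF assms(1-4)] by (simp add: vert_def)
  have h: "hom2 M (gl a f) (gl a f)"
    using gl_hom2[OF hom2_eq[OF lab_tri[OF assms(1)] refl], of f f] sph_hom_refl[OF f] c by simp
  show "tri M (gl a f)" by (rule hom2_tri(1)[OF h])
  fix x y :: real assume x: "0 \<le> x" "0 \<le> y" "x + y = 1"
  have "gl a f p = a p" if "p \<in> bd2" for p using f c by (intro gl_bd[OF that]) (simp add: spheroids_def)
  then show "gl a f (x, y, 0) = lp i j y \<and> gl a f (x, 0, y) = lp i k y \<and> gl a f (0, x, y) = lp j k y"
    using x labD[OF assms(1) x] by (simp add: bd2_iff D2_iff)
qed

lemma add_sphere_T: assumes z: "z \<in> T i j k" and v: "v \<in> carrier (pi2 M m0)" shows "add_sphere M z v \<in> T i j k"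
proof -
  obtain a where a: "z = cls M a" "lab i j k a" "tri M a" "vert a m0" "i \<in> V" "j \<in> V" "k \<in> V" by (rule TE[OF z])
  obtain f where f: "f \<in> spheroids M m0" "v = sphc M m0 f" using v pi2_carrier by blast
  have "a (1, 0, 0) = m0" using a(4) by (simp add: vert_def)
  then show ?thesis unfolding a(1) f(2) add_sphere_cls[OF a(3) _ f(1)]
    using T_I[OF lab_gl[OF a(2,5-7) f(1)]] a(5-7) by (simp add: add_sphere_cls[OF a(3) _ f(1)])
qed

text \<open>The missing face is the horn itself, with the constant homotopy.\<close>

lemma TetG_ex:
  assumes z: "z1 \<in> T i k l" "z2 \<in> T i j l" "z3 \<in> T i j k"
  shows "\<exists>z0\<in>T j k l. TetG M m0 z0 z1 z2 z3"
proof -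
  obtain a1 where a1: "z1 = cls M a1" "lab i k l a1" "tri M a1" "vert a1 m0" "i \<in> V" "k \<in> V" "l \<in> V" by (rule TE[OF z(1)])
  obtain a2 where a2: "z2 = cls M a2" "lab i j l a2" "tri M a2" "vert a2 m0" "i \<in> V" "j \<in> V" "l \<in> V" by (rule TE[OF z(2)])
  obtain a3 where a3: "z3 = cls M a3" "lab i j k a3" "tri M a3" "vert a3 m0" "i \<in> V" "j \<in> V" "k \<in> V" by (rule TE[OF z(3)])
  have e: "a1 (x, 0, y) = a2 (x, 0, y)" "a1 (x, y, 0) = a3 (x, 0, y)" "a2 (x, y, 0) = a3 (x, y, 0)"
    if "0 \<le> x" "0 \<le> y" "x + y = 1" for x y
    using labD[OF a1(2) that] labD[OF a2(2) that] labD[OF a3(2) that] by simp_all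
  define a0 where "a0 = horn a1 a2 a3"
  have t0: "tri M a0" unfolding a0_def by (rule horn_tri[OF a1(3) a2(3) a3(3) e])
  have t: "tet M a0 a1 a2 a3" by (rule horn_tet[OF hom2_eq[OF t0[unfolded a0_def]] e]) (simp_all add: a0_def)
  have l: "lab j k l a0"
  proof (rule labI[OF t0])
    fix x y :: real assume x: "0 \<le> x" "0 \<le> y" "x + y = 1"
    show "a0 (x, y, 0) = lp j k y \<and> a0 (x, 0, y) = lp j l y \<and> a0 (0, x, y) = lp k l y"
      using tet_edges(4-6)[OF t x] labD[OF a1(2) x] labD[OF a2(2) x] labD[OF a3(2) x] by simp
  qed
  have v: "vert a0 m0" by (rule lab_vert[OF l a3(6,7) a1(7)])
  have "a1 (1, 0, 0) = m0" using a1(4) by (simp add: vert_def)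
  from TetGI[OF t v this] show ?thesis unfolding a1(1) a2(1) a3(1)
    using T_I[OF l a3(6,7) a1(7)] by blast
qed

lemma TetG_D: assumes z: "z \<in> T i j k" shows "TetG M m0 z z (D i k) (D i j)"
proof -
  obtain a where a: "z = cls M a" "lab i j k a" "tri M a" "vert a m0" "i \<in> V" "j \<in> V" "k \<in> V" by (rule TE[OF z])
  have "tet M a a (\<lambda>(x, y, z). lp i k z) (\<lambda>(x, y, z). lp i j z)"
    by (rule tet_cong[OF tet_degenerate[OF a(3)]])
      (simp_all add: labD[OF a(2)] D2_iff)
  moreover have "a (1, 0, 0) = m0" using a(4) by (simp add: vert_def)
  ultimately show ?thesis unfolding a(1) D_def by (intro TetGI a(4))
qed

lemma act_sphc: assumes "i \<in> V" "j \<in> V" "f \<in> spheroids M m0"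
  shows "act i j (sphc M m0 f) = sphc M m0 (transport (lp i j) f)" "transport (lp i j) f \<in> spheroids M m0"
proof -
  have "homotopic_paths M (lp i j) (lp i j)" "pathstart (lp i j) = m0" "pathfinish (lp i j) = m0"
    using lp_loop[OF assms(1,2)] by (simp_all add: loops_def)
  note tr = transport_hom[OF this]
  show "act i j (sphc M m0 f) = sphc M m0 (transport (lp i j) f)"
    unfolding act_def by (rule UN_sphc[OF assms(3)]) (metis tr sphc_eqI)
  show "transport (lp i j) f \<in> spheroids M m0" by (rule sph_hom_spheroids(1)[OF tr[OF sph_hom_refl[OF assms(3)]]])
qed

lemma E_eq: assumes "i \<in> V" "j \<in> V" shows "Q_op M (sbG M (D j i)) = cls M (\<lambda>(x, y, z). lp i j (1 - x))"
proof -
  have t: "tri M (\<lambda>(x, y, z). lp j i z)" by (rule lab_tri[OF lab_D[OF assms(2,1)]])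
  have "Q_op M (sbG M (D j i)) = cls M (swa (swb (\<lambda>(x, y, z). lp j i z)))"
    by (simp only: D_def sbG_cls[OF t] Q_op_cls[OF tri_swap(2)[OF t]])
  moreover have "cls M (\<lambda>(x, y, z). lp i j (1 - x)) = cls M (swa (swb (\<lambda>(x, y, z). lp j i z)))"
    by (rule cls_eq_pt[OF tri_swap(1)[OF tri_swap(2)[OF t]]]) (use lp_rev[OF assms] in \<open>auto simp: D2_iff\<close>)
  ultimately show ?thesis by simp
qed

lemma TetG_prism: assumes ij: "i \<in> V" "j \<in> V" and w: "w \<in> carrier (pi2 M m0)"
  shows "\<exists>w1 w2. TetG M m0 (D i j) (D i j) w1 (add_sphere M (D i i) (act i j w)) \<and>
        TetG M m0 (Q_op M (sbG M (D j i))) w2 w1 (D i j) \<and>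
        TetG M m0 (add_sphere M (D j j) w) w2 (Q_op M (sbG M (D j i))) (Q_op M (sbG M (D j i)))"
proof -
  obtain f where f: "f \<in> spheroids M m0" "w = sphc M m0 f" using w pi2_carrier by blast
  obtain w1 w2 where t1: "tet M (\<lambda>(x, y, z). lp i j z) (\<lambda>(x, y, z). lp i j z) w1 (gl (\<lambda>_. m0) (transport (lp i j) f))"
    and t2: "tet M (\<lambda>(x, y, z). lp i j (1 - x)) w2 w1 (\<lambda>(x, y, z). lp i j z)"
    and t3: "tet M (gl (\<lambda>_. m0) f) w2 (\<lambda>(x, y, z). lp i j (1 - x)) (\<lambda>(x, y, z). lp i j (1 - x))"
    by (rule tet_prism[OF lp_loop[OF ij] f(1)])
  note c = lp_ends[OF ij]
  have a: "add_sphere M (D i i) (sphc M m0 g) = cls M (gl (\<lambda>_. m0) g)" if "i \<in> V" "g \<in> spheroids M m0" for i g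
    unfolding D_const[OF that(1)] by (rule add_sphere_cls[OF lab_tri[OF lab_const[OF that(1)]] refl that(2)])
  have g: "gl (\<lambda>_. m0) f p = m0" if "p \<in> bd2" for p
    using f(1) gl_bd[OF that, of f "\<lambda>_. m0"] by (simp add: spheroids_def)
  have v1: "vert (\<lambda>(x, y, z). lp i j z) m0" "vert (\<lambda>(x, y, z). lp i j (1 - x)) m0" "vert (gl (\<lambda>_. m0) f) m0"
    using c g by (simp_all add: vert_def bd2_iff D2_iff)
  have b: "w2 (1, 0, 0) = m0" using tet_corners(1,2)[OF t2] c by simp
  have b1: "(\<lambda>(x, y, z). lp i j z) (1, 0, 0) = m0" using c by simp
  show ?thesis unfolding E_eq[OF ij] f(2) act_sphc(1)[OF ij f(1)] a[OF ij(1) act_sphc(2)[OF ij f(1)]] a[OF ij(2) f(1)]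
    unfolding D_def
    using TetGI[OF t1 v1(1) b1] TetGI[OF t2 v1(2) b] TetGI[OF t3 v1(3) b]
    by (intro exI[of _ "cls M w1"] exI[of _ "cls M w2"] conjI)
qed

end

section \<open>The triangles of an edge system satisfy the axioms of the calculus\<close>

sublocale edge_system \<subseteq> tet_calculus V T "based M m0" "Q_op M" "sbG M" "TetG M m0" D "pi2 M m0" "add_sphere M" "flipG M m0" act
proof (unfold_locales, goal_cases)
  case 1 then show ?case by (rule T_based)
next
  case 2 then show ?case using T_Q by blast
next
  case 3 then show ?case using T_sb by blast
next
  case 4 then show ?case by (auto simp: based_def Q_op_cls tri_swap swa_swa)
next
  case 5 then show ?case by (auto simp: based_def sbG_cls tri_swap swb_swb)
next
  case 6 then show ?case by (auto simp: based_def Q_op_cls sbG_cls tri_swap swap_braid)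
next
  case 7 then show ?case by (rule TetG_based)
next
  case 8 then show ?case by (rule TetG_swap)
next
  case 9 then show ?case by (rule TetG_swap)
next
  case 10 then show ?case by (rule TetG_swap)
next
  case 11 then show ?case by (intro TetG_ex)
next
  case 12 then show ?case by (rule TetG_unique)
next
  case 13 then show ?case by (rule TetG_cone)
next
  case (14 i j) then show ?case unfolding D_def by (intro T_I lab_D)
next
  case (15 i) show ?case unfolding D_const[OF 15] Q_op_cls[OF lab_tri[OF lab_const[OF 15]]] by (simp add: swa_def case_prod_unfold)
next
  case (16 i) show ?case unfolding D_const[OF 16] sbG_cls[OF lab_tri[OF lab_const[OF 16]]] by (simp add: swb_def case_prod_unfold)
next
  case 17 then show ?case by (intro TetG_D)
next
  case 18 then show ?case by (intro add_sphere_T)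
next
  case 19 then show ?case by (rule TetG_add)
next
  case 20 then show ?case by (rule sbG_add)
next
  case (21 v) then show ?case using flipG_sphc flipf_spheroid unfolding pi2_carrier by blast
next
  case 22 show ?case using const_spheroid[OF m0_M] by (auto simp: pi2_def)
next
  case (23 v w)
  obtain f where f: "f \<in> spheroids M m0" "v = sphc M m0 f" using 23(1) unfolding pi2_carrier by (elim bexE)
  obtain g where g: "g \<in> spheroids M m0" "w = sphc M m0 g" using 23(2) unfolding pi2_carrier by (elim bexE)
  show ?case unfolding f(2) g(2) pi2_mult[OF f(1) g(1)] pi2_carrier
    by (rule bexI[OF refl spheroid_join_closed[OF f(1) g(1)]])
next
  case (24 i v w)
  obtain f where f1: "f \<in> spheroids M m0" "v = sphc M m0 f" using 24(2) unfolding pi2_carrier by (elim bexE)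
  obtain g where f2: "g \<in> spheroids M m0" "w = sphc M m0 g" using 24(3) unfolding pi2_carrier by (elim bexE)
  note f = f1 f2
  have "cls M (bar f) = cls M (bar g)" using 24(4) unfolding f(2,4) add_const[OF 24(1) f(1)] add_const[OF 24(1) f(3)] .
  then have "hom2 M (bar f) (bar g)" by (rule cls_eqD) (rule hom2_tri(1)[OF bar_hom2[OF sph_hom_refl[OF f(3)]]])
  then show ?case unfolding f(2,4) by (intro sphc_eqI hom2_bar f(1,3))
next
  \<comment> \<open>With three equal labels all edges are constant, so the triangle is a sphere in
    polar coordinates.\<close>
  case (25 i z)
  obtain a where a: "z = cls M a" "lab i i i a" "tri M a" by (rule TE[OF 25(2)])
  have "a p = m0" if p: "p \<in> bd2" for p
  proof -
    obtain x y u where q: "p = (x, y, u)" by (metis prod_cases3)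
    then show ?thesis using p labD[OF a(2), of x y] labD[OF a(2), of x u] labD[OF a(2), of y u] lp_const[OF 25(1)]
      by (auto simp: bd2_iff D2_iff)
  qed
  from spheroid_of_triangle[OF a(3) this]
  obtain f where f: "f \<in> spheroids M m0" "\<And>x y z. (x, y, z) \<in> D2 \<Longrightarrow> bar f (x, y, z) = a (x, y, z)" by blast
  have "add_sphere M (D i i) (sphc M m0 f) = z"
    unfolding add_const[OF 25(1) f(1)] a(1) by (rule cls_eq_pt[OF a(3) f(2)])
  then show ?case using f(1) pi2_carrier by blast
next
  case (26 i)
  have "add_sphere M (D i i) (sphc M m0 (\<lambda>_. m0)) = cls M (\<lambda>_. m0)"
    unfolding add_const[OF 26 const_spheroid[OF m0_M]] by (simp add: bar_def case_prod_unfold)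
  then show ?case using D_const[OF 26] by (simp add: pi2_def)
next
  case (27 i v w)
  \<comment> \<open>The sphere \<open>w\<close> is added after \<open>v\<close>, hence lies nearer
    to the corner and comes first in the product.\<close>
  obtain f where f1: "f \<in> spheroids M m0" "v = sphc M m0 f" using 27(2) unfolding pi2_carrier by (elim bexE)
  obtain g where f2: "g \<in> spheroids M m0" "w = sphc M m0 g" using 27(3) unfolding pi2_carrier by (elim bexE)
  note f = f1 f2
  have t: "tri M (bar f)" by (rule hom2_tri(1)[OF bar_hom2[OF sph_hom_refl[OF f(1)]]])
  have b: "bar f (1, 0, 0) = m0" using spheroidsD(2)[OF f(1), of 0] by (simp add: bar_def)
  show ?case unfolding f(2,4) add_const[OF 27(1) f(1)] add_sphere_cls[OF t b f(3)] pi2_mult[OF f(3,1)]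
      add_const[OF 27(1) spheroid_join_closed[OF f(3,1)]]
    by (rule cls_eqI[OF gl_bar_join[OF f(1,3)]])
next
  case (28 i j w)
  obtain f where f: "f \<in> spheroids M m0" "w = sphc M m0 f" using 28(3) unfolding pi2_carrier by (elim bexE)
  show ?case unfolding f(2) act_sphc(1)[OF 28(1,2) f(1)] pi2_carrier
    by (rule bexI[OF refl act_sphc(2)[OF 28(1,2) f(1)]])
next
  case 29 then show ?case by (rule TetG_prism)
next
  case 30 show ?case by (rule V_nonempty)
qed

subsection \<open>Defects\<close>

context tet_calculus
begin

lemma add_inv_cancel: assumes "a \<in> T i j k" "i \<in> V" "j \<in> V" "k \<in> V" "v \<in> carrier A"
  shows "add (add a v) (inv v) = a" "add (add a (inv v)) v = a"
  using add_mult[OF assms(1-4)] add_one[OF assms(1-4)] assms(5) by simp_all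

text \<open>The sphere is subtracted from face 1, at vertex 0. All other choices of face and corner
  reduce to this one by moving spheres, which is the content of \<open>defect_swap\<close>.\<close>

definition defect :: "'t \<Rightarrow> 't \<Rightarrow> 't \<Rightarrow> 't \<Rightarrow> 'm" where
  "defect a0 a1 a2 a3 = (THE c. c \<in> carrier A \<and> Tet a0 (add a1 (inv c)) a2 a3)"

lemma defect_eqI:
  assumes "Tet a0 (add a1 (inv c)) a2 a3" "c \<in> carrier A" "a1 \<in> T i k l" "i \<in> V" "k \<in> V" "l \<in> V"
  shows "defect a0 a1 a2 a3 = c"
  unfolding defect_def
proof (rule the_equality)
  fix d assume d: "d \<in> carrier A \<and> Tet a0 (add a1 (inv d)) a2 a3"
  then have "add a1 (inv d) = add a1 (inv c)" using Tet_un1 assms(1) by blast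
  then have "inv d = inv c" using add_inj assms d by (metis A.inv_closed)
  then show "d = c" using d assms(2) A.inv_inv by metis
qed (use assms in simp)

lemma defect:
  assumes "a0 \<in> T j k l" "a1 \<in> T i k l" "a2 \<in> T i j l" "a3 \<in> T i j k" "i \<in> V" "j \<in> V" "k \<in> V" "l \<in> V"
  shows "defect a0 a1 a2 a3 \<in> carrier A" "Tet a0 (add a1 (inv defect a0 a1 a2 a3)) a2 a3"
proof -
  obtain b where b: "b \<in> T i k l" "Tet a0 b a2 a3" using Tet_ex1[OF assms(1,3,4)] assms by blast
  obtain v where v: "v \<in> carrier A" "b = add a1 v" using add_surj[OF assms(2) b(1)] assms by blast
  have t: "Tet a0 (add a1 (inv (inv v))) a2 a3" using b v by simp
  have "defect a0 a1 a2 a3 = inv v" by (rule defect_eqI[OF t A.inv_closed[OF v(1)] assms(2,5,7,8)])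
  then show "defect a0 a1 a2 a3 \<in> carrier A" "Tet a0 (add a1 (inv defect a0 a1 a2 a3)) a2 a3" using t v by simp_all
qed

text \<open>Each transposition leaves the correcting sphere where it does not belong. After the
  first it sits on face 0 and returns by \<open>add10\<close> with a transport; after the second it
  sits on face 2 and returns by \<open>add12\<close>. In the third \<open>sb\<close> inverts it in
  place.\<close>

lemma defect_swap:
  assumes a: "a0 \<in> T j k l" "a1 \<in> T i k l" "a2 \<in> T i j l" "a3 \<in> T i j k" "i \<in> V" "j \<in> V" "k \<in> V" "l \<in> V"
  shows "defect a1 a0 (sa a2) (sa a3) = inv act j i (defect a0 a1 a2 a3)"
    "defect (sa a0) a2 a1 (sb a3) = inv defect a0 a1 a2 a3"
    "defect (sb a0) (sb a1) a3 a2 = inv defect a0 a1 a2 a3"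
proof -
  define c where "c = defect a0 a1 a2 a3"
  have c: "c \<in> carrier A" and t: "Tet a0 (add a1 (inv c)) a2 a3" using defect[OF a] by (simp_all add: c_def)
  note V = a(5-8)
  have ac: "act j i c \<in> carrier A" using act_closed V c by blast
  have "Tet (add a1 (inv c)) a0 (sa a2) (sa a3)" by (rule swap01[OF t])
  then have "Tet (add (add a1 (inv c)) (act i j (act j i c))) (add a0 (act j i c)) (sa a2) (sa a3)"
    using add10 add_T[OF a(2)] a sa_T ac c by (metis A.inv_closed)
  then have "Tet a1 (add a0 (inv (inv act j i c))) (sa a2) (sa a3)"
    using act_inverse[OF V(1,2) c] add_inv_cancel(2)[OF a(2)] V c ac by simp
  from defect_eqI[OF this A.inv_closed[OF ac] a(1)] show "defect a1 a0 (sa a2) (sa a3) = inv act j i (defect a0 a1 a2 a3)"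
    using V c_def by simp
  have "Tet (sa a0) a2 (add a1 (inv c)) (sb a3)" by (rule swap12[OF t])
  then have "Tet (sa a0) (add a2 c) (add (add a1 (inv c)) c) (sb a3)" using add12 c by blast
  then have "Tet (sa a0) (add a2 (inv (inv c))) a1 (sb a3)" using add_inv_cancel(2)[OF a(2)] V c by simp
  from defect_eqI[OF this A.inv_closed[OF c] a(3)] show "defect (sa a0) a2 a1 (sb a3) = inv defect a0 a1 a2 a3"
    using V c_def by simp
  have "sb (add a1 (inv c)) = add (sb a1) (inv (inv c))" using sb_add' T_U a(2) c by (metis A.inv_closed)
  then have "Tet (sb a0) (add (sb a1) (inv (inv c))) a3 a2" using swap23[OF t] by simp
  from defect_eqI[OF this A.inv_closed[OF c] sb_T[OF a(2)]] show "defect (sb a0) (sb a1) a3 a2 = inv defect a0 a1 a2 a3"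
    using V c_def by simp
qed

text \<open>Coning from p over the faces of the tetrahedron q, r, s, t produces a second correction
  of that tetrahedron. Comparing it with the defect of q, r, s, t expresses this defect by those of
  the four tetrahedra through p.\<close>

lemma defect_cocycle:
  assumes WV: "\<And>i. i \<in> W \<Longrightarrow> i \<in> V"
    and X: "\<And>i j k. i \<in> W \<Longrightarrow> j \<in> W \<Longrightarrow> k \<in> W \<Longrightarrow> X i j k \<in> T i j k"
    and W: "p \<in> W" "q \<in> W" "r \<in> W" "s \<in> W" "t \<in> W"
    and c: "\<And>i j k l. c i j k l = defect (X j k l) (X i k l) (X i j l) (X i j k)"
  shows "act p q (c q r s t) \<otimes> inv c p r s t \<otimes> c p q s t \<otimes> inv c p q r t \<otimes> c p q r s = \<one>"
proof -
  note V = W[THEN WV]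
  have cc: "c i j k l \<in> carrier A" if "i \<in> W" "j \<in> W" "k \<in> W" "l \<in> W" for i j k l
    unfolding c using defect(1) X that[THEN WV] that by blast
  have ct: "Tet (X j k l) (add (X i k l) (inv c i j k l)) (X i j l) (X i j k)" if "i \<in> W" "j \<in> W" "k \<in> W" "l \<in> W" for i j k l
    unfolding c using defect(2) X that[THEN WV] that by blast
  \<comment> \<open>The correction is placed on the face opposite to p, because the other three
    faces are shared by the tetrahedra around p and must be unchanged for the cone.\<close>
  have h: "Tet (add (X j k l) (act j p (c p j k l))) (X p k l) (X p j l) (X p j k)" if Z: "j \<in> W" "k \<in> W" "l \<in> W" for j k l
  proof -
    note C = cc[OF W(1) Z]
    have "Tet (add (X j k l) (act j p (c p j k l))) (add (add (X p k l) (inv c p j k l)) (c p j k l)) (X p j l) (X p j k)"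
      by (rule add10[OF ct[OF W(1) Z] X[OF Z] add_T X X V(1) Z[THEN WV] C]) (use X W(1) V(1) Z Z[THEN WV] C in auto)
    then show ?thesis using add_inv_cancel(2)[OF X[OF W(1) Z(2,3)]] V(1) Z[THEN WV] C by simp
  qed
  note C = cc[OF W(1,3,4,5)] cc[OF W(1,2,4,5)] cc[OF W(1,2,3,5)] cc[OF W(1,2,3,4)] cc[OF W(2,3,4,5)]
  define A1 where "A1 = act q p (c p r s t)"
  define A2 where "A2 = act q p (c p q s t)"
  define A3 where "A3 = act q p (c p q r t)"
  define A4 where "A4 = act q p (c p q r s)"
  have AC: "A1 \<in> carrier A" "A2 \<in> carrier A" "A3 \<in> carrier A" "A4 \<in> carrier A"
    unfolding A1_def A2_def A3_def A4_def using act_closed V C by blast+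
  note x = X[OF W(3,4,5)] X[OF W(2,4,5)] X[OF W(2,3,5)] X[OF W(2,3,4)]
  have 0: "Tet (add (X r s t) (act r p (c p r s t))) (add (X q s t) A2) (add (X q r t) A3) (add (X q r s) A4)"
    unfolding A2_def A3_def A4_def
    by (rule cone0[OF h[OF W(2,3,4)] h[OF W(2,3,5)] h[OF W(2,4,5)] h[OF W(3,4,5)]])
  have a1: "act r q (inv A1) = inv act r p (c p r s t)"
    unfolding A1_def using act_act[OF X[OF W(3,2,1)] V(3,2,1) C(1)] act_inv act_closed V C by simp
  have aC: "act r p (c p r s t) \<in> carrier A" using act_closed V C by blast
  \<comment> \<open>The corrections are now gathered on \<open>X q s t\<close>: the one on face 0 by
    \<open>add10\<close>, and those on faces 2 and 3 by \<open>add12\<close> and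
    \<open>add13'\<close>.\<close>
  have "Tet (add (add (X r s t) (act r p (c p r s t))) (act r q (inv A1))) (add (add (X q s t) A2) (inv A1)) (add (X q r t) A3) (add (X q r s) A4)"
    by (rule add10[OF 0 add_T add_T add_T add_T V(2,3,4,5)]) (use x V C AC aC in auto)
  then have 1: "Tet (X r s t) (add (add (X q s t) A2) (inv A1)) (add (X q r t) A3) (add (X q r s) A4)"
    unfolding a1 using add_inv_cancel(1)[OF x(1)] V aC by simp
  from add12[OF 1 A.inv_closed[OF AC(3)]]
  have 2: "Tet (X r s t) (add (add (add (X q s t) A2) (inv A1)) (inv A3)) (X q r t) (add (X q r s) A4)"
    using add_inv_cancel(1)[OF x(3)] V AC by simp
  from add13'[OF 2 AC(4)]
  have "Tet (X r s t) (add (add (add (add (X q s t) A2) (inv A1)) (inv A3)) A4) (X q r t) (X q r s)"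
    using add_inv_cancel(1)[OF x(4)] V AC by simp
  then have 3: "Tet (X r s t) (add (X q s t) (A4 \<otimes> (inv A3 \<otimes> (inv A1 \<otimes> A2)))) (X q r t) (X q r s)"
    using add_mult[OF x(2)] V AC by simp
  then have "add (X q s t) (A4 \<otimes> (inv A3 \<otimes> (inv A1 \<otimes> A2))) = add (X q s t) (inv c q r s t)"
    using Tet_un1 ct[OF W(2,3,4,5)] by blast
  then have e: "A4 \<otimes> (inv A3 \<otimes> (inv A1 \<otimes> A2)) = inv c q r s t"
    using add_inj[OF _ x(2)] V AC C by simp
  define d where "d = c p q r s \<otimes> (inv c p q r t \<otimes> (inv c p r s t \<otimes> c p q s t))"
  have bk: "act p q (act q p v) = v" if "v \<in> carrier A" for v using act_inverse V that by blast
  have "inv act p q (c q r s t) = act p q (inv c q r s t)" using act_inv V C by simp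
  also have "\<dots> = d" unfolding e[symmetric] d_def using V C AC
    by (simp add: act_mult act_inv A1_def A2_def A3_def A4_def bk act_closed)
  finally have i: "inv act p q (c q r s t) = d" .
  have "act p q (c q r s t) \<otimes> inv c p r s t \<otimes> c p q s t \<otimes> inv c p q r t \<otimes> c p q r s
     = act p q (c q r s t) \<otimes> d"
    unfolding d_def using C act_closed V by (simp add: A.m_ac)
  also have "\<dots> = \<one>" unfolding i[symmetric] using act_closed V C by simp
  finally show ?thesis .
qed

end

text \<open>Comparison of two families of edges along a prism: i is the lower and pr i the upper copy of a
  vertex. The square over the edge i j is cut along the diagonal from i to pr j into N and H; the
  condition square says that the cut along the other diagonal gives the same square.\<close>

locale prism_comparison = tet_calculus V T U sa sb Tet D A add flip act
  for V :: "'v set" and T :: "'v \<Rightarrow> 'v \<Rightarrow> 'v \<Rightarrow> 't set" and U :: "'t set"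
    and sa sb :: "'t \<Rightarrow> 't" and Tet :: "'t \<Rightarrow> 't \<Rightarrow> 't \<Rightarrow> 't \<Rightarrow> bool" and D :: "'v \<Rightarrow> 'v \<Rightarrow> 't"
    and A :: "'m monoid" (structure) and add :: "'t \<Rightarrow> 'm \<Rightarrow> 't" and flip :: "'m \<Rightarrow> 'm"
    and act :: "'v \<Rightarrow> 'v \<Rightarrow> 'm \<Rightarrow> 'm" +
  fixes W :: "'v set" and pr :: "'v \<Rightarrow> 'v" and N H :: "'v \<Rightarrow> 'v \<Rightarrow> 't"
  assumes W_V: "i \<in> W \<Longrightarrow> i \<in> V" and pr_V: "i \<in> W \<Longrightarrow> pr i \<in> V"
    and N_T: "i \<in> W \<Longrightarrow> j \<in> W \<Longrightarrow> N i j \<in> T i j (pr j)"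
    and H_T: "i \<in> W \<Longrightarrow> j \<in> W \<Longrightarrow> H i j \<in> T i (pr i) (pr j)"
    and square: "i \<in> W \<Longrightarrow> j \<in> W \<Longrightarrow> Tet (sb (H j i)) (H i j) (N i j) (sa (N j i))"
    and act_pr: "i \<in> W \<Longrightarrow> v \<in> carrier A \<Longrightarrow> act (pr i) i v = v"
begin

text \<open>The staircase cut of the prism over i, j, k into the tetrahedra i j k k', i j j' k' and
  i i' j' k', where a prime denotes the upper copy. The inner triangles are i j k' and i j' k'; the
  walls are \<open>N\<close> and \<open>H\<close>.\<close>

definition push :: "'v \<Rightarrow> 'v \<Rightarrow> 'v \<Rightarrow> 't \<Rightarrow> 't \<Rightarrow> bool" where
  "push i j k a a' \<longleftrightarrow> (\<exists>b1\<in>T i j (pr k). \<exists>b2\<in>T i (pr j) (pr k).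
     Tet (N j k) (N i k) b1 a \<and> Tet (H j k) b2 b1 (N i j) \<and> Tet a' b2 (H i k) (H i j))"

lemma push_ex:
  assumes a: "a \<in> T i j k" and W: "i \<in> W" "j \<in> W" "k \<in> W"
  shows "\<exists>a'\<in>T (pr i) (pr j) (pr k). push i j k a a'"
proof -
  note V = W[THEN W_V] W[THEN pr_V]
  obtain b1 where b1: "b1 \<in> T i j (pr k)" "Tet (N j k) (N i k) b1 a"
    using Tet_ex2[OF N_T[OF W(2,3)] N_T[OF W(1,3)] a] V by blast
  obtain b2 where b2: "b2 \<in> T i (pr j) (pr k)" "Tet (H j k) b2 b1 (N i j)"
    using Tet_ex1[OF H_T[OF W(2,3)] b1(1) N_T[OF W(1,2)]] V by blast
  obtain a' where "a' \<in> T (pr i) (pr j) (pr k)" "Tet a' b2 (H i k) (H i j)"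
    using Tet_ex[OF b2(1) H_T[OF W(1,3)] H_T[OF W(1,2)]] V by blast
  then show ?thesis using b1 b2 unfolding push_def by blast
qed

lemma push_unique: "push i j k a a' \<Longrightarrow> push i j k a a'' \<Longrightarrow> a' = a''"
  unfolding push_def using Tet_un2 Tet_un1 Tet_un0 by metis

text \<open>Reversing the order of j and k changes the diagonal in the wall over that edge. The
  change takes place in the 4-simplex i j k j' k', whose face opposite to i is the condition
  \<open>square\<close>.\<close>

lemma push_sb:
  assumes p: "push i j k a a'" and W: "i \<in> W" "j \<in> W" "k \<in> W" and a: "a \<in> T i j k"
  shows "push i k j (sb a) (sb a')"
proof -
  note V = W[THEN W_V] W[THEN pr_V]
  obtain b1 b2 where b1: "b1 \<in> T i j (pr k)" and b2: "b2 \<in> T i (pr j) (pr k)" and t1: "Tet (N j k) (N i k) b1 a"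
    and t2: "Tet (H j k) b2 b1 (N i j)" and t3: "Tet a' b2 (H i k) (H i j)"
    using p unfolding push_def by blast
  have n: "sa (N k j) \<in> T j k (pr j)" using sa_T N_T W V by blast
  obtain b1' where b1': "b1' \<in> T i k (pr j)" and t4: "Tet (sa (N k j)) b1' (N i j) a"
    using Tet_ex1[OF n N_T[OF W(1,2)] a] V by blast
  have t5: "Tet (sb (H k j)) b2 (N i k) b1'" by (rule cone1[OF t4 t1 t2 square[OF W(2,3)]])
  have U: "N k j \<in> U" "H k j \<in> U" using T_U N_T H_T W by blast+
  have 1: "Tet (N k j) (N i j) b1' (sb a)" using swap12[OF t4] sa_sa U by simp
  have 2: "Tet (H k j) (sb b2) b1' (N i k)" using swap23[OF t5] sb_sb U by simp
  have 3: "Tet (sb a') (sb b2) (H i j) (H i k)" by (rule swap23[OF t3])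
  show ?thesis unfolding push_def using b1' sb_T[OF b2] V 1 2 3 by blast
qed

text \<open>The corresponding change of diagonal over the edge i, j takes place in the 4-simplex i j
  i' j' k'.\<close>

lemma push_sa:
  assumes p: "push i j k a a'" and W: "i \<in> W" "j \<in> W" "k \<in> W" and a: "a \<in> T i j k"
  shows "push j i k (sa a) (sa a')"
proof -
  note V = W[THEN W_V] W[THEN pr_V]
  obtain b1 b2 where b1: "b1 \<in> T i j (pr k)" and b2: "b2 \<in> T i (pr j) (pr k)" and t1: "Tet (N j k) (N i k) b1 a"
    and t2: "Tet (H j k) b2 b1 (N i j)" and t3: "Tet a' b2 (H i k) (H i j)"
    using p unfolding push_def by blast
  have n: "sa (N j i) \<in> T i j (pr i)" using sa_T N_T W V by blast
  obtain c2 where c2: "c2 \<in> T j (pr i) (pr k)" and t4: "Tet c2 (H i k) b1 (sa (N j i))"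
    using Tet_ex[OF H_T[OF W(1,3)] b1 n] V by blast
  have t5: "Tet a' (H j k) c2 (sb (H j i))" by (rule cone0[OF square[OF W(1,2)] t4 t2 t3])
  have U: "N j i \<in> U" "H j i \<in> U" using T_U N_T H_T W by blast+
  have 1: "Tet (N i k) (N j k) (sa b1) (sa a)" by (rule swap01[OF t1])
  have 2: "Tet (H i k) c2 (sa b1) (N j i)" using swap01[OF t4] sa_sa U by simp
  have 3: "Tet (sa a') c2 (H j k) (H j i)" using swap12[OF t5] sb_sb U by simp
  show ?thesis unfolding push_def using c2 sa_T[OF b1] V 1 2 3 by blast
qed

text \<open>The sphere stays at vertex i through the first two tetrahedra. In the third it passes to
  the upper copy of i, which has no effect by \<open>act_pr\<close>.\<close>

lemma push_add:
  assumes p: "push i j k a a'" and W: "i \<in> W" "j \<in> W" "k \<in> W" and a': "a' \<in> T (pr i) (pr j) (pr k)" and v: "v \<in> carrier A"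
  shows "push i j k (add a v) (add a' v)"
proof -
  note V = W[THEN W_V] W[THEN pr_V]
  obtain b1 b2 where b1: "b1 \<in> T i j (pr k)" and b2: "b2 \<in> T i (pr j) (pr k)" and t1: "Tet (N j k) (N i k) b1 a"
    and t2: "Tet (H j k) b2 b1 (N i j)" and t3: "Tet a' b2 (H i k) (H i j)"
    using p unfolding push_def by blast
  have 1: "Tet (N j k) (N i k) (add b1 v) (add a v)" by (rule add23'[OF t1 v])
  have 2: "Tet (H j k) (add b2 v) (add b1 v) (N i j)" by (rule add12[OF t2 v])
  have "Tet (add a' (act (pr i) i v)) (add b2 v) (H i k) (H i j)"
    by (rule add10[OF t3 a' b2 H_T[OF W(1,3)] H_T[OF W(1,2)] V(1,4,5,6) v])
  then have 3: "Tet (add a' v) (add b2 v) (H i k) (H i j)" using act_pr[OF W(1) v] by simp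
  show ?thesis unfolding push_def using add_T[OF b1] add_T[OF b2] V v 1 2 3 by blast
qed

text \<open>The staircase one dimension higher: the prism over a tetrahedron is cut into four
  4-simplices, and in each of them a cone lemma replaces the current tetrahedron by one with one
  more vertex in the upper copy, starting from the last.\<close>

lemma push_Tet:
  assumes t: "Tet a123 a023 a013 a012" and p: "push j k l a123 b123" "push i k l a023 b023" "push i j l a013 b013" "push i j k a012 b012"
  shows "Tet b123 b023 b013 b012"
proof -
  obtain c123 d123 where 1: "Tet (N k l) (N j l) c123 a123" "Tet (H k l) d123 c123 (N j k)" "Tet b123 d123 (H j l) (H j k)"
    using p(1) unfolding push_def by blast
  obtain c023 d023 where 2: "Tet (N k l) (N i l) c023 a023" "Tet (H k l) d023 c023 (N i k)" "Tet b023 d023 (H i l) (H i k)"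
    using p(2) unfolding push_def by blast
  obtain c013 d013 where 3: "Tet (N j l) (N i l) c013 a013" "Tet (H j l) d013 c013 (N i j)" "Tet b013 d013 (H i l) (H i j)"
    using p(3) unfolding push_def by blast
  obtain c012 d012 where 4: "Tet (N j k) (N i k) c012 a012" "Tet (H j k) d012 c012 (N i j)" "Tet b012 d012 (H i k) (H i j)"
    using p(4) unfolding push_def by blast
  have s1: "Tet c123 c023 c013 a012" by (rule cone3[OF t 3(1) 2(1) 1(1)])
  have s2: "Tet d123 d023 c013 c012" by (rule cone2[OF 4(1) s1 2(2) 1(2)])
  have s3: "Tet b123 d023 d013 d012" by (rule cone1[OF 4(2) 3(2) s2 1(3)])
  show ?thesis by (rule cone0[OF 4(3) 3(3) 2(3) s3])
qed

definition shift :: "('v \<Rightarrow> 'v \<Rightarrow> 'v \<Rightarrow> 't) \<Rightarrow> ('v \<Rightarrow> 'v \<Rightarrow> 'v \<Rightarrow> 't) \<Rightarrow> 'v \<Rightarrow> 'v \<Rightarrow> 'v \<Rightarrow> 'm" where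
  "shift X X' i j k = (THE v. v \<in> carrier A \<and> push i j k (X i j k) (add (X' (pr i) (pr j) (pr k)) (inv v)))"

context
  fixes X X' :: "'v \<Rightarrow> 'v \<Rightarrow> 'v \<Rightarrow> 't"
  assumes X: "\<And>i j k. i \<in> W \<Longrightarrow> j \<in> W \<Longrightarrow> k \<in> W \<Longrightarrow> X i j k \<in> T i j k"
    and X': "\<And>i j k. i \<in> W \<Longrightarrow> j \<in> W \<Longrightarrow> k \<in> W \<Longrightarrow> X' (pr i) (pr j) (pr k) \<in> T (pr i) (pr j) (pr k)"
begin

lemma shift_eqI:
  assumes "push i j k (X i j k) (add (X' (pr i) (pr j) (pr k)) (inv v))" "v \<in> carrier A" "i \<in> W" "j \<in> W" "k \<in> W"
  shows "shift X X' i j k = v"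
  unfolding shift_def
proof (rule the_equality)
  fix w assume w: "w \<in> carrier A \<and> push i j k (X i j k) (add (X' (pr i) (pr j) (pr k)) (inv w))"
  then have "add (X' (pr i) (pr j) (pr k)) (inv w) = add (X' (pr i) (pr j) (pr k)) (inv v)"
    using push_unique assms(1) by blast
  then have "inv w = inv v" using add_inj[OF _ X'[OF assms(3-5)]] pr_V assms w by simp
  then have "inv (inv w) = inv (inv v)" by simp
  then show "w = v" using w assms(2) by simp
qed (use assms in simp)

lemma shift:
  assumes W: "i \<in> W" "j \<in> W" "k \<in> W"
  shows "shift X X' i j k \<in> carrier A"
    "push i j k (X i j k) (add (X' (pr i) (pr j) (pr k)) (inv shift X X' i j k))"
proof -
  obtain a' where a': "a' \<in> T (pr i) (pr j) (pr k)" "push i j k (X i j k) a'" using push_ex[OF X[OF W] W] by blast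
  obtain v where v: "v \<in> carrier A" "a' = add (X' (pr i) (pr j) (pr k)) v"
    using add_surj[OF X'[OF W] a'(1)] W pr_V by blast
  have p: "push i j k (X i j k) (add (X' (pr i) (pr j) (pr k)) (inv (inv v)))" using a' v by simp
  have "shift X X' i j k = inv v" by (rule shift_eqI[OF p A.inv_closed[OF v(1)] W])
  then show "shift X X' i j k \<in> carrier A"
    "push i j k (X i j k) (add (X' (pr i) (pr j) (pr k)) (inv shift X X' i j k))" using p v by simp_all
qed

lemma shift_sb:
  assumes W: "i \<in> W" "j \<in> W" "k \<in> W" and e: "X i k j = sb (X i j k)" "X' (pr i) (pr k) (pr j) = sb (X' (pr i) (pr j) (pr k))"
  shows "shift X X' i k j = inv shift X X' i j k"
proof (rule shift_eqI)
  note s = shift[OF W]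
  have "push i k j (sb (X i j k)) (sb (add (X' (pr i) (pr j) (pr k)) (inv shift X X' i j k)))"
    by (rule push_sb[OF s(2) W X[OF W]])
  then show "push i k j (X i k j) (add (X' (pr i) (pr k) (pr j)) (inv (inv shift X X' i j k)))"
    unfolding e using sb_add'[OF T_U[OF X'[OF W]]] s(1) by simp
qed (use W shift in auto)

lemma shift_sa:
  assumes W: "i \<in> W" "j \<in> W" "k \<in> W" and e: "X j i k = sa (X i j k)" "X' (pr j) (pr i) (pr k) = sa (X' (pr i) (pr j) (pr k))"
  shows "shift X X' j i k = inv act (pr j) (pr i) (shift X X' i j k)"
proof (rule shift_eqI)
  note s = shift[OF W]
  note V = W[THEN pr_V]
  have "push j i k (sa (X i j k)) (sa (add (X' (pr i) (pr j) (pr k)) (inv shift X X' i j k)))"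
    by (rule push_sa[OF s(2) W X[OF W]])
  then show "push j i k (X j i k) (add (X' (pr j) (pr i) (pr k)) (inv (inv act (pr j) (pr i) (shift X X' i j k))))"
    unfolding e using sa_add[OF X'[OF W] V] s(1) act_inv[OF V(2,1)] act_closed[OF V(2,1)] by simp
  show "inv act (pr j) (pr i) (shift X X' i j k) \<in> carrier A" using s(1) act_closed[OF V(2,1)] by simp
qed (use W in auto)

text \<open>The corrected tetrahedron of \<open>X\<close> is pushed to the upper copy, where its
  faces are those of \<open>X'\<close> up to shifts. The corrected tetrahedron of \<open>X'\<close>
  is given the same shifts on faces 0, 2 and 3; the two then agree on face 1.\<close>

lemma defect_shift:
  assumes W: "i \<in> W" "j \<in> W" "k \<in> W" "l \<in> W"
  shows "defect (X j k l) (X i k l) (X i j l) (X i j k) =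
    defect (X' (pr j) (pr k) (pr l)) (X' (pr i) (pr k) (pr l)) (X' (pr i) (pr j) (pr l)) (X' (pr i) (pr j) (pr k)) \<otimes>
    (act (pr i) (pr j) (shift X X' j k l) \<otimes> inv shift X X' i k l \<otimes> shift X X' i j l \<otimes> inv shift X X' i j k)"
proof -
  note V = W[THEN W_V]
  note V' = W[THEN pr_V]
  define c c' where "c = defect (X j k l) (X i k l) (X i j l) (X i j k)"
    and "c' = defect (X' (pr j) (pr k) (pr l)) (X' (pr i) (pr k) (pr l)) (X' (pr i) (pr j) (pr l)) (X' (pr i) (pr j) (pr k))"
  note x = X[OF W(2,3,4)] X[OF W(1,3,4)] X[OF W(1,2,4)] X[OF W(1,2,3)]
  note x' = X'[OF W(2,3,4)] X'[OF W(1,3,4)] X'[OF W(1,2,4)] X'[OF W(1,2,3)]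
  have c: "c \<in> carrier A" "Tet (X j k l) (add (X i k l) (inv c)) (X i j l) (X i j k)"
    unfolding c_def by (rule defect[OF x V])+
  have c': "c' \<in> carrier A" "Tet (X' (pr j) (pr k) (pr l)) (add (X' (pr i) (pr k) (pr l)) (inv c')) (X' (pr i) (pr j) (pr l)) (X' (pr i) (pr j) (pr k))"
    unfolding c'_def by (rule defect[OF x' V'])+
  define S0 S1 S2 S3 where "S0 = shift X X' j k l" and "S1 = shift X X' i k l" and "S2 = shift X X' i j l" and "S3 = shift X X' i j k"
  have S: "S0 \<in> carrier A" "S1 \<in> carrier A" "S2 \<in> carrier A" "S3 \<in> carrier A"
    unfolding S0_def S1_def S2_def S3_def by (rule shift(1)[OF W(2,3,4)] shift(1)[OF W(1,3,4)] shift(1)[OF W(1,2,4)] shift(1)[OF W(1,2,3)])+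
  note p = shift(2)[OF W(2,3,4), folded S0_def] shift(2)[OF W(1,3,4), folded S1_def] shift(2)[OF W(1,2,4), folded S2_def]
    shift(2)[OF W(1,2,3), folded S3_def]
  have "push i k l (add (X i k l) (inv c)) (add (add (X' (pr i) (pr k) (pr l)) (inv S1)) (inv c))"
    by (rule push_add[OF p(2) W(1,3,4)]) (use add_T[OF x'(2)] V' S c in auto)
  from push_Tet[OF c(2) p(1) this p(3,4)]
  have 1: "Tet (add (X' (pr j) (pr k) (pr l)) (inv S0)) (add (X' (pr i) (pr k) (pr l)) (inv c \<otimes> inv S1))
      (add (X' (pr i) (pr j) (pr l)) (inv S2)) (add (X' (pr i) (pr j) (pr k)) (inv S3))"
    using add_mult[OF x'(2)] V' S c by simp
  \<comment> \<open>\<open>B\<close> is the shift of face 0 seen from the first vertex, so that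
    \<open>add10\<close> can produce \<open>inv S0\<close> on face 0.\<close>
  define B where "B = act (pr i) (pr j) S0"
  have B: "B \<in> carrier A" "act (pr j) (pr i) (inv B) = inv S0"
    unfolding B_def using act_closed act_inv act_inverse V' S by simp_all
  have "Tet (add (X' (pr j) (pr k) (pr l)) (act (pr j) (pr i) (inv B))) (add (add (X' (pr i) (pr k) (pr l)) (inv c')) (inv B))
     (X' (pr i) (pr j) (pr l)) (X' (pr i) (pr j) (pr k))"
    by (rule add10[OF c'(2) x'(1) add_T x'(3,4) V']) (use x' V' B c' in auto)
  from add13'[OF add12[OF this A.inv_closed[OF S(3)]] S(4)]
  have "Tet (add (X' (pr j) (pr k) (pr l)) (inv S0)) (add (add (add (add (X' (pr i) (pr k) (pr l)) (inv c')) (inv B)) (inv S2)) S4)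
     (add (X' (pr i) (pr j) (pr l)) (inv S2)) (add (X' (pr i) (pr j) (pr k)) (inv S3))" if "S4 = S3" for S4
    using B that by simp
  then have "Tet (add (X' (pr j) (pr k) (pr l)) (inv S0)) (add (X' (pr i) (pr k) (pr l)) (S3 \<otimes> (inv S2 \<otimes> (inv B \<otimes> inv c'))))
     (add (X' (pr i) (pr j) (pr l)) (inv S2)) (add (X' (pr i) (pr j) (pr k)) (inv S3))"
    using add_mult[OF x'(2)] V' S c' B by simp
  then have "add (X' (pr i) (pr k) (pr l)) (S3 \<otimes> (inv S2 \<otimes> (inv B \<otimes> inv c'))) = add (X' (pr i) (pr k) (pr l)) (inv c \<otimes> inv S1)"
    using Tet_un1 1 by blast
  then have "S3 \<otimes> (inv S2 \<otimes> (inv B \<otimes> inv c')) = inv c \<otimes> inv S1" using add_inj[OF _ x'(2)] V' S c c' B by simp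
  then have "inv (S3 \<otimes> (inv S2 \<otimes> (inv B \<otimes> inv c'))) = inv (inv c \<otimes> inv S1)" by simp
  then have "inv S3 \<otimes> (S2 \<otimes> (B \<otimes> c')) = c \<otimes> S1" using S c c' B by (simp add: A.inv_mult)
  then have "c \<otimes> S1 \<otimes> inv S1 = inv S3 \<otimes> (S2 \<otimes> (B \<otimes> c')) \<otimes> inv S1" by simp
  then have "c = inv S3 \<otimes> (S2 \<otimes> (B \<otimes> c')) \<otimes> inv S1" using S c by (simp add: A.m_assoc)
  also have "\<dots> = c' \<otimes> (B \<otimes> inv S1 \<otimes> S2 \<otimes> inv S3)" using S c' B by (simp add: A.m_ac)
  finally show ?thesis unfolding c_def c'_def B_def S0_def S1_def S2_def S3_def .
qed

end
end

subsection \<open>The fundamental group\<close>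

abbreviation "pc \<equiv> path_class"

lemma loopsD: assumes "p \<in> loops M m0"
  shows "path p" "path_image p \<subseteq> M" "pathstart p = m0" "pathfinish p = m0" "into J M p" "p 0 = m0" "p 1 = m0"
  using assms by (simp_all add: loops_def path_def path_image_def pathstart_def pathfinish_def)

lemma homotopic_loops_mem: assumes "homotopic_paths M p q" "p \<in> loops M m0" shows "q \<in> loops M m0"
  using assms homotopic_paths_imp_path[OF assms(1)] homotopic_paths_imp_subset[OF assms(1)]
    homotopic_paths_imp_pathstart[OF assms(1)] homotopic_paths_imp_pathfinish[OF assms(1)] by (simp add: loops_def)

text \<open>Linear interpolation between two reparametrizations of one loop. It yields both the unit
  law and the inverse law: a loop followed back and forth is a reparametrization with the same end
  values as a constant one.\<close>

lemma homotopic_reparam: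
  assumes p: "p \<in> loops M m0" and \<phi>: "continuous_on J \<phi>" "\<And>t. t \<in> J \<Longrightarrow> \<phi> t \<in> J" and \<psi>: "continuous_on J \<psi>" "\<And>t. t \<in> J \<Longrightarrow> \<psi> t \<in> J"
    and e: "\<phi> 0 = \<psi> 0" "\<phi> 1 = \<psi> 1"
    and q: "\<And>t. t \<in> J \<Longrightarrow> q t = p (\<phi> t)" and r: "\<And>t. t \<in> J \<Longrightarrow> r t = p (\<psi> t)"
  shows "homotopic_paths M q r"
proof -
  define g where "g = (\<lambda>c::real \<times> real. (1 - fst c) * \<phi> (snd c) + fst c * \<psi> (snd c))"
  have gJ: "g c \<in> J" if "c \<in> J \<times> J" for c
  proof -
    have "\<phi> (snd c) \<in> J" "\<psi> (snd c) \<in> J" "fst c \<in> J" using that \<phi>(2) \<psi>(2) by auto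
    then show ?thesis using convex_bound_le[of "\<phi> (snd c)" 1 "\<psi> (snd c)" "1 - fst c" "fst c"]
      by (simp add: g_def)
  qed
  have "continuous_on (J \<times> J) (\<lambda>c. \<phi> (snd c))" "continuous_on (J \<times> J) (\<lambda>c. \<psi> (snd c))"
    by (rule continuous_on_compose2[OF \<phi>(1)] continuous_on_compose2[OF \<psi>(1)]; auto intro!: continuous_intros)+
  then have "continuous_on (J \<times> J) g" unfolding g_def by (intro continuous_intros)
  then have h: "into (J \<times> J) M (\<lambda>c. p (g c))" using gJ by (rule continuous_on_compose_into[OF loopsD(5)[OF p]])
  show ?thesis unfolding homotopic_paths
  proof (intro exI[of _ "\<lambda>c. p (g c)"] conjI ballI)
    show "continuous_on (J \<times> J) (\<lambda>c. p (g c))" "(\<lambda>c. p (g c)) \<in> J \<times> J \<rightarrow> M" using h by auto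
    fix x :: real assume x: "x \<in> J"
    show "p (g (0, x)) = q x" "p (g (1, x)) = r x" using q[OF x] r[OF x] by (simp_all add: g_def)
    show "pathstart ((\<lambda>c. p (g c)) \<circ> Pair x) = pathstart q" "pathfinish ((\<lambda>c. p (g c)) \<circ> Pair x) = pathfinish q"
      using q[of 0] q[of 1] e by (simp_all add: pathstart_def pathfinish_def g_def algebra_simps)
  qed
qed

lemma const_loop: "m0 \<in> M \<Longrightarrow> (\<lambda>_. m0) \<in> loops M m0"
  by (auto simp: loops_def path_def path_image_def pathstart_def pathfinish_def)

lemma join_loop: "p \<in> loops M m0 \<Longrightarrow> q \<in> loops M m0 \<Longrightarrow> p +++ q \<in> loops M m0"
  using path_image_join_subset[of p q] by (auto simp: loops_def)

lemma reverse_loop: "p \<in> loops M m0 \<Longrightarrow> reversepath p \<in> loops M m0"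
  by (simp add: loops_def)

lemma pc_mem: "q \<in> pc M p \<longleftrightarrow> homotopic_paths M p q"
  by (simp add: path_class_def)

lemma pc_eqI: assumes "homotopic_paths M p q" shows "pc M p = pc M q"
proof -
  have "homotopic_paths M p r \<longleftrightarrow> homotopic_paths M q r" for r
    using assms homotopic_paths_trans homotopic_paths_sym by metis
  then show ?thesis unfolding path_class_def by (rule Collect_cong)
qed

lemma pc_self: "p \<in> loops M m0 \<Longrightarrow> p \<in> pc M p"
  by (simp add: pc_mem loops_def)

lemma pi1_carrier: "g \<in> carrier (pi1 M m0) \<longleftrightarrow> (\<exists>p\<in>loops M m0. g = pc M p)"
  by (auto simp: pi1_def)

lemma pi1_mem: assumes "p \<in> g" "g \<in> carrier (pi1 M m0)" shows "g = pc M p" "p \<in> loops M m0"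
proof -
  obtain q where q: "q \<in> loops M m0" "g = pc M q" using assms(2) unfolding pi1_carrier by (elim bexE)
  then have h: "homotopic_paths M q p" using assms(1) by (simp add: pc_mem)
  show "g = pc M p" using pc_eqI[OF h] q(2) by simp
  show "p \<in> loops M m0" by (rule homotopic_loops_mem[OF h q(1)])
qed

lemma pi1_mult: assumes "p \<in> loops M m0" "q \<in> loops M m0"
  shows "pc M p \<otimes>\<^bsub>pi1 M m0\<^esub> pc M q = pc M (p +++ q)"
proof -
  have "pc M (p' +++ q') = pc M (p +++ q)" if "p' \<in> pc M p" "q' \<in> pc M q" for p' q'
  proof -
    have "homotopic_paths M (p +++ q) (p' +++ q')"
      using that assms loopsD by (intro homotopic_paths_join) (auto simp: pc_mem loops_def)
    from pc_eqI[OF this] show ?thesis by simp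
  qed
  then have "(\<Union>p'\<in>pc M p. \<Union>q'\<in>pc M q. pc M (p' +++ q')) = pc M (p +++ q)"
    using pc_self[OF assms(1)] pc_self[OF assms(2)] by blast
  then show ?thesis by (simp add: pi1_def)
qed

lemma pi1_one: "\<one>\<^bsub>pi1 M m0\<^esub> = pc M (\<lambda>_. m0)"
  by (simp add: pi1_def)

lemma pi1_lid: assumes "p \<in> loops M m0" shows "pc M ((\<lambda>_. m0) +++ p) = pc M p"
proof (rule pc_eqI, rule homotopic_reparam[OF assms, where \<phi>="\<lambda>t. max (2 * t - 1) 0" and \<psi>="\<lambda>t. t"])
  fix t :: real assume "t \<in> J"
  show "((\<lambda>_. m0) +++ p) t = p (max (2 * t - 1) 0)"
    using loopsD(6)[OF assms] by (auto simp: joinpaths_def max_def)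
qed (auto intro!: continuous_intros)

lemma pi1_linv: assumes "p \<in> loops M m0" shows "pc M (reversepath p +++ p) = pc M (\<lambda>_. m0)"
proof (rule pc_eqI, rule homotopic_reparam[OF assms, where \<phi>="\<lambda>t. \<bar>2 * t - 1\<bar>" and \<psi>="\<lambda>_. 1"])
  fix t :: real assume "t \<in> J"
  show "(reversepath p +++ p) t = p \<bar>2 * t - 1\<bar>"
  proof (cases "t \<le> 1/2")
    case True
    then have "\<bar>2 * t - 1\<bar> = 1 - 2 * t" by simp
    with True show ?thesis by (simp add: joinpaths_def reversepath_def)
  next
    case False
    then have "\<bar>2 * t - 1\<bar> = 2 * t - 1" by simp
    with False show ?thesis by (simp add: joinpaths_def)
  qed
  show "m0 = p 1" using loopsD(7)[OF assms] by simp
qed (auto intro!: continuous_intros)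

lemma pi1_group: assumes "m0 \<in> M" shows "group (pi1 M m0)"
proof (rule groupI)
  fix x y assume "x \<in> carrier (pi1 M m0)" "y \<in> carrier (pi1 M m0)"
  then obtain p q where "p \<in> loops M m0" "x = pc M p" "q \<in> loops M m0" "y = pc M q" unfolding pi1_carrier by (elim bexE)
  then show "x \<otimes>\<^bsub>pi1 M m0\<^esub> y \<in> carrier (pi1 M m0)" using pi1_mult join_loop unfolding pi1_carrier by metis
next
  show "\<one>\<^bsub>pi1 M m0\<^esub> \<in> carrier (pi1 M m0)" unfolding pi1_one pi1_carrier using const_loop[OF assms] by blast
next
  fix x y z assume "x \<in> carrier (pi1 M m0)" "y \<in> carrier (pi1 M m0)" "z \<in> carrier (pi1 M m0)"
  then obtain p q r where p: "p \<in> loops M m0" "x = pc M p" and q: "q \<in> loops M m0" "y = pc M q"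
    and r: "r \<in> loops M m0" "z = pc M r" unfolding pi1_carrier by (elim bexE)
  have "homotopic_paths M (p +++ (q +++ r)) ((p +++ q) +++ r)"
    by (rule homotopic_paths_assoc) (simp_all add: loopsD[OF p(1)] loopsD[OF q(1)] loopsD[OF r(1)])
  from pc_eqI[OF this] show "x \<otimes>\<^bsub>pi1 M m0\<^esub> y \<otimes>\<^bsub>pi1 M m0\<^esub> z = x \<otimes>\<^bsub>pi1 M m0\<^esub> (y \<otimes>\<^bsub>pi1 M m0\<^esub> z)"
    by (simp only: p(2) q(2) r(2) pi1_mult[OF p(1) q(1)] pi1_mult[OF q(1) r(1)]
        pi1_mult[OF join_loop[OF p(1) q(1)] r(1)] pi1_mult[OF p(1) join_loop[OF q(1) r(1)]])
next
  fix x assume "x \<in> carrier (pi1 M m0)"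
  then obtain p where p: "p \<in> loops M m0" "x = pc M p" unfolding pi1_carrier by (elim bexE)
  show "\<one>\<^bsub>pi1 M m0\<^esub> \<otimes>\<^bsub>pi1 M m0\<^esub> x = x"
    unfolding pi1_one p(2) pi1_mult[OF const_loop[OF assms] p(1)] by (rule pi1_lid[OF p(1)])
  show "\<exists>y\<in>carrier (pi1 M m0). y \<otimes>\<^bsub>pi1 M m0\<^esub> x = \<one>\<^bsub>pi1 M m0\<^esub>"
  proof (rule bexI)
    show "pc M (reversepath p) \<otimes>\<^bsub>pi1 M m0\<^esub> x = \<one>\<^bsub>pi1 M m0\<^esub>"
      unfolding pi1_one p(2) pi1_mult[OF reverse_loop[OF p(1)] p(1)] by (rule pi1_linv[OF p(1)])
    show "pc M (reversepath p) \<in> carrier (pi1 M m0)" unfolding pi1_carrier using reverse_loop[OF p(1)] by blast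
  qed
qed

lemma pi1_action_sphc:
  assumes g: "g \<in> carrier (pi1 M m0)" "p \<in> g" and f: "f \<in> spheroids M m0"
  shows "pi1_action M m0 g (sphc M m0 f) = sphc M m0 (transport p f)"
proof -
  note p = pi1_mem[OF g(2,1)]
  have "(\<Union>f'\<in>sphc M m0 f. sphc M m0 (transport q f')) = sphc M m0 (transport p f)" if "q \<in> g" for q
  proof (rule UN_sphc[OF f])
    fix f' assume f': "sph_hom M m0 f f'"
    have "homotopic_paths M p q" using that p(1) pc_mem by blast
    from sphc_eqI[OF transport_hom[OF this loopsD(3,4)[OF p(2)] f']]
    show "sphc M m0 (transport q f') = sphc M m0 (transport p f)" by simp
  qed
  then show ?thesis unfolding pi1_action_def using g(2) by blast
qed

text \<open>The square of the homotopy becomes a triangle when its side at the terminal point of the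
  paths is collapsed to [2]; the side at the initial point becomes the constant edge from [0] to
  [1]. Such triangles are the nondegenerate halves of the prism walls.\<close>

lemma homotopy_triangle:
  assumes h: "homotopic_paths M p q" and p: "p \<in> loops M m0"
  obtains a where "tri M a" "\<And>x y. 0 \<le> x \<Longrightarrow> 0 \<le> y \<Longrightarrow> x + y = 1 \<Longrightarrow>
    a (x, y, 0) = m0 \<and> a (x, 0, y) = p y \<and> a (0, x, y) = q y"
proof -
  obtain h where h: "into (J \<times> J) M h" and h0: "\<And>v. v \<in> J \<Longrightarrow> h (0, v) = p v" and h1: "\<And>v. v \<in> J \<Longrightarrow> h (1, v) = q v"
    and he: "\<And>t. t \<in> J \<Longrightarrow> h (t, 0) = m0 \<and> h (t, 1) = m0"
    using h loopsD(6,7)[OF p] unfolding homotopic_paths by (auto simp: pathstart_def pathfinish_def image_subset_iff_funcset)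
  define a where "a = (\<lambda>(x::real, y, z). h (y / (1 - z), z))"
  define qq where "qq = (\<lambda>(t::real, v::real). ((1 - t) * (1 - v), t * (1 - v), v))"
  have "into D2 M a"
  proof (rule quotient_map_into[where q=qq and C="J \<times> J" and F=h])
    show "compact (J \<times> J)" by (intro compact_Times compact_Icc)
    show "continuous_on (J \<times> J) qq" unfolding qq_def case_prod_unfold by (intro continuous_intros)
    show "continuous_on (J \<times> J) h" "h ` (J \<times> J) \<subseteq> M" using h by simp_all
    fix c assume "c \<in> J \<times> J"
    then obtain t v where c: "c = (t, v)" "t \<in> J" "v \<in> J" by blast
    show "a (qq c) = h c"
    proof (cases "v = 1")
      case True
      then show ?thesis using he[of 0] he[OF c(2)] by (simp add: c(1) a_def qq_def)
    next
      case False
      then show ?thesis by (simp add: c(1) a_def qq_def)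
    qed
  next
    show "D2 \<subseteq> qq ` (J \<times> J)"
    proof
      fix w assume w: "w \<in> D2"
      obtain x y z where q: "w = (x, y, z)" by (metis prod_cases3)
      have D: "0 \<le> x" "0 \<le> y" "0 \<le> z" "x + y + z = 1" using w q by (auto simp: D2_iff)
      show "w \<in> qq ` (J \<times> J)"
      proof (cases "z = 1")
        case True
        then have "x = 0" "y = 0" using D by linarith+
        then show ?thesis using True by (intro image_eqI[where x="(0, 1)"]) (simp_all add: q qq_def)
      next
        case False
        have x: "x = (1 - z) - y" using D by linarith
        have "qq (y / (1 - z), z) = w" using False unfolding qq_def q x by (simp add: left_diff_distrib)
        moreover have "y / (1 - z) \<in> J" using D by (intro frac_J) linarith+
        ultimately show ?thesis using D by (intro image_eqI[where x="(y / (1 - z), z)"]) simp_all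
      qed
    qed
  qed
  moreover have "a (x, y, 0) = m0 \<and> a (x, 0, y) = p y \<and> a (0, x, y) = q y" if "0 \<le> x" "0 \<le> y" "x + y = 1" for x y
  proof -
    have "a (0, x, y) = q y"
    proof (cases "y = 1")
      case True
      then show ?thesis using that he[of 0] he[of 1] h1[of 1] by (simp add: a_def)
    next
      case False
      have "x = 1 - y" using that by linarith
      then have "x / (1 - y) = 1" using False by simp
      then show ?thesis using that h1[of y] unfolding a_def prod.case by (simp only:) simp
    qed
    then show ?thesis using that he[of y] h0[of y] by (simp add: a_def)
  qed
  ultimately show thesis using that unfolding tri_def by blast
qed

subsection \<open>The operation m\<close>

definition bary3 :: "real \<times> real \<times> real \<times> real \<Rightarrow> nat \<Rightarrow> real" where
  "bary3 = (\<lambda>(x, y, z, w). (\<lambda>_. 0)(0 := x, 1 := y, 2 := z, 3 := w))"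

lemma bary3_simplex: "p \<in> D3 \<Longrightarrow> bary3 p \<in> standard_simplex 3"
  by (cases p) (auto simp: bary3_def standard_simplex_def D3_iff sum_le_3)

lemma simplex3_D3: "x \<in> standard_simplex 3 \<Longrightarrow> (x 0, x 1, x 2, x 3) \<in> D3"
  by (simp add: standard_simplex_def D3_iff sum_le_3)

lemma continuous_on_bary3: "continuous_on S bary3"
proof (rule continuous_on_coordinatewise_then_product)
  fix i :: nat
  have "i = 0 \<or> i = 1 \<or> i = 2 \<or> i = 3 \<or> 3 < i" by linarith
  then show "continuous_on S (\<lambda>p. bary3 p i)"
    by (elim disjE) (simp_all add: case_prod_unfold bary3_def, (intro continuous_intros)+)
qed

lemma face_tri_of:
  "face \<omega> i j l = tri_of (\<lambda>(x, y, z). \<omega> (\<lambda>k. vertex i k * x + vertex j k * y + vertex l k * z))"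
  unfolding face_def tri_of_def simplex_map_def oriented_simplex_def
  by (rule restrict_ext) (simp add: sum_le_2)

text \<open>The faces [1,2,0] and [1,0,3] of \<omega> are faces 3 and 2 with permuted vertices,
  whence \<open>P_op\<close> and \<open>Q_op\<close>. The choice of \<omega> is immaterial because
  the remaining face is determined by the other three up to homotopy.\<close>

lemma m_op_TetG:
  assumes t: "TetG M m0 z0 z1 z2 z3"
  shows "m_op M (P_op M z3) z1 (Q_op M z2) = z0"
proof -
  define R where "R \<omega> \<longleftrightarrow> singular_simplex 3 (top_of_set M) \<omega> \<and>
        face \<omega> 1 2 0 \<in> P_op M z3 \<and> face \<omega> 0 2 3 \<in> z1 \<and> face \<omega> 1 0 3 \<in> Q_op M z2" for \<omega>
  obtain a0 a1 a2 a3 where z: "z0 = cls M a0" "z1 = cls M a1" "z2 = cls M a2" "z3 = cls M a3"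
     and tt: "tet M a0 a1 a2 a3" and v: "vert a0 m0" "vert a1 m0" "vert a2 m0" "vert a3 m0"
     and tr: "tri M a0" "tri M a1" "tri M a2" "tri M a3" by (rule TetGE[OF t])
  have fc: "face \<omega> 1 2 0 = tri_of (swb (swa (\<lambda>(x, y, z). \<omega> (bary3 (x, y, z, 0)))))"
    "face \<omega> 0 2 3 = tri_of (\<lambda>(x, y, z). \<omega> (bary3 (x, 0, y, z)))"
    "face \<omega> 1 0 3 = tri_of (swa (\<lambda>(x, y, z). \<omega> (bary3 (x, y, 0, z))))"
    "face \<omega> 1 2 3 = tri_of (\<lambda>(x, y, z). \<omega> (bary3 (0, x, y, z)))" for \<omega> :: "(nat \<Rightarrow> real) \<Rightarrow> 'a"
    unfolding face_tri_of
    by (rule tri_of_eqI; simp; rule arg_cong[where f=\<omega>]; rule ext; simp add: vertex_def bary3_def)+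
  have ex: "\<exists>\<omega>. R \<omega>"
  proof -
    obtain w where w: "into D3 M w" and f: "faces w a0 a1 a2 a3" by (rule tetE[OF tt])
    define \<omega> where "\<omega> = (\<lambda>x\<in>standard_simplex 3. w (x 0, x 1, x 2, x 3))"
    have "into (standard_simplex 3) M (\<lambda>x. w (x 0, x 1, x 2, x 3))"
    proof (rule continuous_on_compose_into[OF w])
      show "continuous_on (standard_simplex 3) (\<lambda>x::nat \<Rightarrow> real. (x 0, x 1, x 2, x 3))"
        by (intro continuous_on_Pair continuous_on_subset[OF continuous_on_product_coordinates subset_UNIV])
    qed (rule simplex3_D3)
    then have "into (standard_simplex 3) M \<omega>" by (rule into_cong) (simp add: \<omega>_def)
    then have s: "singular_simplex 3 (top_of_set M) \<omega>" unfolding singular_simplex_euclidean by (simp add: \<omega>_def)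
    have wb: "\<omega> (bary3 (x, y, u, v)) = w (x, y, u, v)" if "(x, y, u, v) \<in> D3" for x y u v
      using bary3_simplex[OF that] by (simp add: \<omega>_def bary3_def)
    have "face \<omega> 1 2 0 = tri_of (swb (swa a3))" "face \<omega> 0 2 3 = tri_of a1" "face \<omega> 1 0 3 = tri_of (swa a2)"
      unfolding fc by (rule tri_of_eqI; simp add: wb D3_iff D2_iff facesD[OF f])+
    then have "R \<omega>" using s unfolding R_def z P_op_cls[OF tr(4)] Q_op_cls[OF tr(3)]
      by (simp add: tri_of_mem_cls hom2_eq tri_swap tr)
    then show ?thesis by blast
  qed
  have un: "triangle_class M (face \<omega> 1 2 3) = z0" if "R \<omega>" for \<omega>
  proof -
    define b0 b1 b2 b3 where "b0 = (\<lambda>(x, y, z). \<omega> (bary3 (0, x, y, z)))" and "b1 = (\<lambda>(x, y, z). \<omega> (bary3 (x, 0, y, z)))"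
      and "b2 = (\<lambda>(x, y, z). \<omega> (bary3 (x, y, 0, z)))" and "b3 = (\<lambda>(x, y, z). \<omega> (bary3 (x, y, z, 0)))"
    note bd = b0_def b1_def b2_def b3_def
    have s: "into (standard_simplex 3) M \<omega>" using that unfolding R_def singular_simplex_euclidean by blast
    have w: "into D3 M (\<lambda>p. \<omega> (bary3 p))" by (rule continuous_on_compose_into[OF s continuous_on_bary3 bary3_simplex])
    have tb: "tet M b0 b1 b2 b3" by (rule tetI[OF w]) (simp add: faces_def bd)
    have "hom2 M (swb (swa a3)) (swb (swa b3))" "hom2 M a1 b1" "hom2 M (swa a2) (swa b2)"
      using that unfolding R_def fc z P_op_cls[OF tr(4)] Q_op_cls[OF tr(3)] bd[symmetric] tri_of_mem_cls by blast+
    then have h: "hom2 M a3 b3" "hom2 M a1 b1" "hom2 M a2 b2"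
      using hom2_swap(1)[OF hom2_swap(2), of M "swb (swa a3)" "swb (swa b3)"] hom2_swap(1)[of M "swa a2" "swa b2"]
      by (simp_all only: swa_swa swb_swb)
    have "tet M b0 a1 a2 a3"
      by (rule tet_hom[OF tb hom2_eq[OF tet_tri(1)[OF tb] refl] hom2_sym[OF h(2)] hom2_sym[OF h(3)] hom2_sym[OF h(1)]])
    then have "cls M b0 = cls M a0"
      using cls_eqI[OF tet_hom2_horn] tt by metis
    then show ?thesis unfolding fc bd(1)[symmetric] z(1) by (simp only: cls_def)
  qed
  have "R (SOME \<omega>. R \<omega>)" using ex by (rule someI_ex)
  from un[OF this] show ?thesis unfolding m_op_def R_def .
qed

subsection \<open>The cochain as a defect\<close>

lemma spheroid_class_pi1_action:
  assumes "g \<in> carrier (pi1 M m0)" "v \<in> carrier (pi2 M m0)" "p \<in> g"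
  shows "pi1_action M m0 g v = (\<Union>f\<in>v. sphc M m0 (transport p f))"
proof -
  obtain f where f: "f \<in> spheroids M m0" "v = sphc M m0 f" using assms(2) unfolding pi2_carrier by (elim bexE)
  note p = pi1_mem[OF assms(3,1)]
  have h: "homotopic_paths M p p" using p(2) by (simp add: loops_def)
  have "(\<Union>f'\<in>sphc M m0 f. sphc M m0 (transport p f')) = sphc M m0 (transport p f)"
  proof (rule UN_sphc[OF f(1)])
    fix f' assume "sph_hom M m0 f f'"
    from sphc_eqI[OF transport_hom[OF h loopsD(3,4)[OF p(2)] this]]
    show "sphc M m0 (transport p f') = sphc M m0 (transport p f)" by simp
  qed
  then show ?thesis unfolding f(2) pi1_action_sphc[OF assms(1,3) f(1)] by simp
qed

lemma loop_sectionD: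
  assumes "loop_section M m0 s" "g \<in> carrier (pi1 M m0)"
  shows "s g \<in> g" "s g \<in> loops M m0"
    "t \<in> J \<Longrightarrow> s (inv\<^bsub>pi1 M m0\<^esub> g) t = s g (1 - t)" "t \<in> J \<Longrightarrow> s \<one>\<^bsub>pi1 M m0\<^esub> t = m0"
  using assms pi1_mem(2)[OF _ assms(2), of "s g"] unfolding loop_section_def by simp_all

locale two_sections =
  fixes M :: "'a::topological_space set" and m0 :: 'a and s s' :: "'a pathclass \<Rightarrow> real \<Rightarrow> 'a"
  assumes m0: "m0 \<in> M" and s: "loop_section M m0 s" and s': "loop_section M m0 s'"
    and ord2: "g \<in> carrier (pi1 M m0) \<Longrightarrow> group.ord (pi1 M m0) g \<noteq> 2"
begin

abbreviation (input) G where "G \<equiv> pi1 M m0"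

sublocale G: group G by (rule pi1_group[OF m0])

lemmas gsimps = G.m_assoc G.inv_mult_group

lemma cancel [simp]:
  "x \<in> carrier G \<Longrightarrow> y \<in> carrier G \<Longrightarrow> inv\<^bsub>G\<^esub> x \<otimes>\<^bsub>G\<^esub> (x \<otimes>\<^bsub>G\<^esub> y) = y"
  "x \<in> carrier G \<Longrightarrow> y \<in> carrier G \<Longrightarrow> x \<otimes>\<^bsub>G\<^esub> (inv\<^bsub>G\<^esub> x \<otimes>\<^bsub>G\<^esub> y) = y"
  by (simp_all flip: G.m_assoc)

definition sec :: "bool \<Rightarrow> 'a pathclass \<Rightarrow> real \<Rightarrow> 'a" where
  "sec b = (if b then s' else s)"

lemma sec: "loop_section M m0 (sec b)"
  using s s' by (simp add: sec_def)

text \<open>The flag of a vertex selects the section; an edge between different copies uses s.\<close>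

definition lp :: "'a pathclass \<times> bool \<Rightarrow> 'a pathclass \<times> bool \<Rightarrow> real \<Rightarrow> 'a" where
  "lp u v = sec (snd u \<and> snd v) (inv\<^bsub>G\<^esub> fst u \<otimes>\<^bsub>G\<^esub> fst v)"

sublocale edge_system M m0 "carrier G \<times> UNIV" lp
proof
  fix i j :: "'a pathclass \<times> bool" and t :: real
  assume i: "i \<in> carrier G \<times> UNIV"
  show "lp i i t = m0" if "t \<in> J"
    using loop_sectionD(4)[OF sec G.one_closed that] i by (auto simp: lp_def)
  assume j: "j \<in> carrier G \<times> UNIV"
  have g: "inv\<^bsub>G\<^esub> fst i \<otimes>\<^bsub>G\<^esub> fst j \<in> carrier G" using i j by auto
  show "lp i j \<in> loops M m0" unfolding lp_def by (rule loop_sectionD(2)[OF sec g])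
  have "inv\<^bsub>G\<^esub> fst j \<otimes>\<^bsub>G\<^esub> fst i = inv\<^bsub>G\<^esub> (inv\<^bsub>G\<^esub> fst i \<otimes>\<^bsub>G\<^esub> fst j)" using i j by (auto simp: gsimps)
  then show "lp j i t = lp i j (1 - t)" if "t \<in> J"
    using loop_sectionD(3)[OF sec g that] unfolding lp_def by (simp add: conj_commute)
qed (use G.one_closed in blast)

lemma act_pi1_action:
  assumes "i \<in> carrier G" "j \<in> carrier G" "v \<in> carrier (pi2 M m0)"
  shows "act (i, b) (j, b') v = pi1_action M m0 (inv\<^bsub>G\<^esub> i \<otimes>\<^bsub>G\<^esub> j) v"
proof -
  have g: "inv\<^bsub>G\<^esub> i \<otimes>\<^bsub>G\<^esub> j \<in> carrier G" using assms by simp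
  have "lp (i, b) (j, b') \<in> inv\<^bsub>G\<^esub> i \<otimes>\<^bsub>G\<^esub> j" unfolding lp_def using loop_sectionD(1)[OF sec g] by simp
  from spheroid_class_pi1_action[OF g assms(3) this] show ?thesis unfolding act_def by simp
qed

text \<open>Different vertex triples with the same edge loops carry the same triangles. This serves
  for translations and for replacing a vertex by its other copy where the loops agree.\<close>

lemma T_cong:
  assumes "\<And>t. t \<in> J \<Longrightarrow> lp i j t = lp i' j' t \<and> lp i k t = lp i' k' t \<and> lp j k t = lp j' k' t"
    and "i \<in> carrier G \<times> UNIV" "j \<in> carrier G \<times> UNIV" "k \<in> carrier G \<times> UNIV"
      "i' \<in> carrier G \<times> UNIV" "j' \<in> carrier G \<times> UNIV" "k' \<in> carrier G \<times> UNIV"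
  shows "T i j k = T i' j' k'"
proof -
  have J: "y \<in> J" if "0 \<le> x \<and> 0 \<le> y \<and> x + y = 1" for x y :: real using that by auto
  have "lab i j k a \<longleftrightarrow> lab i' j' k' a" for a
  proof -
    have "(a (x, y, 0) = lp i j y \<and> a (x, 0, y) = lp i k y \<and> a (0, x, y) = lp j k y) \<longleftrightarrow>
      (a (x, y, 0) = lp i' j' y \<and> a (x, 0, y) = lp i' k' y \<and> a (0, x, y) = lp j' k' y)"
      if "0 \<le> x \<and> 0 \<le> y \<and> x + y = 1" for x y using assms(1)[OF J[OF that]] by simp
    then show ?thesis unfolding lab_def by blast
  qed
  then show ?thesis unfolding T_def using assms(2-7) by simp
qed

text \<open>The edges in \<open>Gamma\<close> run towards the lower vertex; \<open>lp_swap\<close>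
  reverses them, and the product of the two labels telescopes.\<close>

lemma Gamma_T:
  assumes "i \<in> carrier G" "j \<in> carrier G" "k \<in> carrier G"
  shows "Gamma M m0 (sec b) (inv\<^bsub>G\<^esub> j \<otimes>\<^bsub>G\<^esub> i) (inv\<^bsub>G\<^esub> k \<otimes>\<^bsub>G\<^esub> j) = T (i, b) (j, b) (k, b)"
proof -
  define g h where "g = inv\<^bsub>G\<^esub> j \<otimes>\<^bsub>G\<^esub> i" and "h = inv\<^bsub>G\<^esub> k \<otimes>\<^bsub>G\<^esub> j"
  have gh: "h \<otimes>\<^bsub>G\<^esub> g = inv\<^bsub>G\<^esub> k \<otimes>\<^bsub>G\<^esub> i" unfolding g_def h_def using assms by (simp add: gsimps)
  have lpe: "sec b g = lp (j, b) (i, b)" "sec b h = lp (k, b) (j, b)" "sec b (h \<otimes>\<^bsub>G\<^esub> g) = lp (k, b) (i, b)"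
    unfolding gh by (simp_all add: lp_def g_def h_def)
  have V: "(i, b) \<in> carrier G \<times> UNIV" "(j, b) \<in> carrier G \<times> UNIV" "(k, b) \<in> carrier G \<times> UNIV" using assms by auto
  have ed: "edge (tri_of a) 1 0 t = a (t, 1 - t, 0)" "edge (tri_of a) 2 1 t = a (0, t, 1 - t)" "edge (tri_of a) 2 0 t = a (t, 0, 1 - t)"
    if "t \<in> J" for a :: "real \<times> real \<times> real \<Rightarrow> 'a" and t
  proof -
    have "(\<lambda>k. (1 - t) * vertex 1 k + t * vertex 0 k) = bary t (1 - t) 0" "(\<lambda>k. (1 - t) * vertex 2 k + t * vertex 1 k) = bary 0 t (1 - t)"
      "(\<lambda>k. (1 - t) * vertex 2 k + t * vertex 0 k) = bary t 0 (1 - t)"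
      by (auto simp: vertex_def bary_def fun_eq_iff)
    then show "edge (tri_of a) 1 0 t = a (t, 1 - t, 0)" "edge (tri_of a) 2 1 t = a (0, t, 1 - t)" "edge (tri_of a) 2 0 t = a (t, 0, 1 - t)"
      unfolding edge_def using that tri_of_bary[of t "1 - t" 0 a] tri_of_bary[of 0 t "1 - t" a] tri_of_bary[of t 0 "1 - t" a]
      by (simp_all add: D2_iff)
  qed
  have "(\<forall>t\<in>J. edge (tri_of a) 1 0 t = sec b g t \<and> edge (tri_of a) 2 1 t = sec b h t \<and> edge (tri_of a) 2 0 t = sec b (h \<otimes>\<^bsub>G\<^esub> g) t) \<and> tri M a
     \<longleftrightarrow> lab (i, b) (j, b) (k, b) a" for a
  proof -
    have "(\<forall>t\<in>J. edge (tri_of a) 1 0 t = sec b g t \<and> edge (tri_of a) 2 1 t = sec b h t \<and> edge (tri_of a) 2 0 t = sec b (h \<otimes>\<^bsub>G\<^esub> g) t)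
      \<longleftrightarrow> (\<forall>x y. 0 \<le> x \<and> 0 \<le> y \<and> x + y = 1 \<longrightarrow> a (x, y, 0) = lp (j, b) (i, b) x \<and> a (0, x, y) = lp (k, b) (j, b) x \<and> a (x, 0, y) = lp (k, b) (i, b) x)"
      (is "?L \<longleftrightarrow> ?R")
    proof
      assume L: ?L
      show ?R
      proof (intro allI impI)
        fix x y :: real assume x: "0 \<le> x \<and> 0 \<le> y \<and> x + y = 1"
        then have xJ: "x \<in> J" and y: "y = 1 - x" by auto
        show "a (x, y, 0) = lp (j, b) (i, b) x \<and> a (0, x, y) = lp (k, b) (j, b) x \<and> a (x, 0, y) = lp (k, b) (i, b) x"
          using bspec[OF L xJ] unfolding y ed[OF xJ] lpe by simp
      qed
    next
      assume R: ?R
      show ?L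
      proof
        fix t assume t: "t \<in> J"
        show "edge (tri_of a) 1 0 t = sec b g t \<and> edge (tri_of a) 2 1 t = sec b h t \<and> edge (tri_of a) 2 0 t = sec b (h \<otimes>\<^bsub>G\<^esub> g) t"
          using R[rule_format, of t "1 - t"] t unfolding ed[OF t] lpe by simp
      qed
    qed
    also have "\<dots> \<longleftrightarrow> (\<forall>x y. 0 \<le> x \<and> 0 \<le> y \<and> x + y = 1 \<longrightarrow> a (x, y, 0) = lp (i, b) (j, b) y \<and> a (x, 0, y) = lp (i, b) (k, b) y \<and> a (0, x, y) = lp (j, b) (k, b) y)"
    proof (intro iff_allI)
      fix x y :: real
      have "lp (j, b) (i, b) x = lp (i, b) (j, b) y" "lp (k, b) (j, b) x = lp (j, b) (k, b) y" "lp (k, b) (i, b) x = lp (i, b) (k, b) y"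
        if "0 \<le> x \<and> 0 \<le> y \<and> x + y = 1" using lp_swap V that by simp_all
      then show "(0 \<le> x \<and> 0 \<le> y \<and> x + y = 1 \<longrightarrow> a (x, y, 0) = lp (j, b) (i, b) x \<and> a (0, x, y) = lp (k, b) (j, b) x \<and> a (x, 0, y) = lp (k, b) (i, b) x)
        \<longleftrightarrow> (0 \<le> x \<and> 0 \<le> y \<and> x + y = 1 \<longrightarrow> a (x, y, 0) = lp (i, b) (j, b) y \<and> a (x, 0, y) = lp (i, b) (k, b) y \<and> a (0, x, y) = lp (j, b) (k, b) y)"
        by auto
    qed
    finally show ?thesis unfolding lab_def by (simp only: conj_commute)
  qed
  note iff = this
  have "{a. singular_simplex 2 (top_of_set M) a \<and> (\<forall>t\<in>J. edge a 1 0 t = sec b g t \<and> edge a 2 1 t = sec b h t \<and>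
                      edge a 2 0 t = sec b (h \<otimes>\<^bsub>G\<^esub> g) t)} = tri_of ` {a. lab (i, b) (j, b) (k, b) a}" (is "?A = ?B")
  proof (intro equalityI subsetI)
    fix \<tau> assume t: "\<tau> \<in> ?A"
    then have "singular_simplex 2 (top_of_set M) \<tau>" by simp
    then obtain a where a: "\<tau> = tri_of a" "tri M a" by (rule singular_simplex2E)
    then show "\<tau> \<in> ?B" using t iff[of a] by simp
  next
    fix \<tau> assume "\<tau> \<in> ?B"
    then obtain a where a: "\<tau> = tri_of a" "lab (i, b) (j, b) (k, b) a" by blast
    then show "\<tau> \<in> ?A" using iff[of a] lab_tri[OF a(2)] singular_tri_of[of M a] by simp
  qed
  then have "Gamma M m0 (sec b) g h = triangle_class M ` tri_of ` {a. lab (i, b) (j, b) (k, b) a}"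
    unfolding Gamma_def by simp
  also have "\<dots> = T (i, b) (j, b) (k, b)" unfolding T_def using V by (simp add: image_image cls_def)
  finally show ?thesis unfolding g_def h_def .
qed

text \<open>The triangles in Gamma carry their labels on edges run backwards, hence the order of the factors.\<close>

definition Xf :: "('a pathclass \<Rightarrow> 'a pathclass \<Rightarrow> 'a triangleclass) \<Rightarrow> 'a pathclass \<times> bool \<Rightarrow> 'a pathclass \<times> bool \<Rightarrow> 'a pathclass \<times> bool \<Rightarrow> 'a triangleclass" where
  "Xf x u v w = x (inv\<^bsub>G\<^esub> fst v \<otimes>\<^bsub>G\<^esub> fst u) (inv\<^bsub>G\<^esub> fst w \<otimes>\<^bsub>G\<^esub> fst v)"

lemma Xf_props:
  assumes x: "triangle_choice M m0 (sec b) x" and V: "i \<in> carrier G" "j \<in> carrier G" "k \<in> carrier G"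
  shows "Xf x (i, b) (j, b) (k, b) \<in> T (i, b) (j, b) (k, b)"
    "Q_op M (Xf x (i, b) (j, b) (k, b)) = Xf x (j, b) (i, b) (k, b)"
    "P_op M (Xf x (i, b) (j, b) (k, b)) = Xf x (j, b) (k, b) (i, b)"
proof -
  define g h where "g = inv\<^bsub>G\<^esub> j \<otimes>\<^bsub>G\<^esub> i" and "h = inv\<^bsub>G\<^esub> j \<otimes>\<^bsub>G\<^esub> k"
  have gh: "g \<in> carrier G" "h \<in> carrier G" using V by (simp_all add: g_def h_def)
  have e: "inv\<^bsub>G\<^esub> h = inv\<^bsub>G\<^esub> k \<otimes>\<^bsub>G\<^esub> j" "inv\<^bsub>G\<^esub> g = inv\<^bsub>G\<^esub> i \<otimes>\<^bsub>G\<^esub> j" "inv\<^bsub>G\<^esub> g \<otimes>\<^bsub>G\<^esub> h = inv\<^bsub>G\<^esub> i \<otimes>\<^bsub>G\<^esub> k" "inv\<^bsub>G\<^esub> h \<otimes>\<^bsub>G\<^esub> g = inv\<^bsub>G\<^esub> k \<otimes>\<^bsub>G\<^esub> i"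
    using V by (simp_all add: g_def h_def gsimps)
  have X: "Xf x (i, b) (j, b) (k, b) = x g (inv\<^bsub>G\<^esub> h)" by (simp add: Xf_def e g_def)
  have "x g (inv\<^bsub>G\<^esub> h) \<in> Gamma M m0 (sec b) g (inv\<^bsub>G\<^esub> h)" using x gh unfolding triangle_choice_def by blast
  then show "Xf x (i, b) (j, b) (k, b) \<in> T (i, b) (j, b) (k, b)"
    unfolding X using Gamma_T[OF V] by (simp add: e g_def)
  have "Q_op M (x g (inv\<^bsub>G\<^esub> h)) = x (inv\<^bsub>G\<^esub> g) (inv\<^bsub>G\<^esub> h \<otimes>\<^bsub>G\<^esub> g)"
    and "P_op M (x g (inv\<^bsub>G\<^esub> h)) = x (inv\<^bsub>G\<^esub> h) (inv\<^bsub>G\<^esub> g \<otimes>\<^bsub>G\<^esub> h)"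
    using x gh unfolding triangle_choice_def by blast+
  then show "Q_op M (Xf x (i, b) (j, b) (k, b)) = Xf x (j, b) (i, b) (k, b)"
    "P_op M (Xf x (i, b) (j, b) (k, b)) = Xf x (j, b) (k, b) (i, b)"
    unfolding X unfolding e(3,4) unfolding e(1,2) by (simp_all add: Xf_def g_def)
qed

lemma Xf_sb:
  assumes "triangle_choice M m0 (sec b) x" "i \<in> carrier G" "j \<in> carrier G" "k \<in> carrier G"
  shows "sbG M (Xf x (i, b) (j, b) (k, b)) = Xf x (i, b) (k, b) (j, b)"
  unfolding sbG_def Xf_props(2)[OF assms] Xf_props(3)[OF assms(1,3,2,4)] ..

definition cf :: "('a pathclass \<Rightarrow> 'a pathclass \<Rightarrow> 'a triangleclass) \<Rightarrow> bool \<Rightarrow> 'a pathclass \<Rightarrow> 'a pathclass \<Rightarrow> 'a pathclass \<Rightarrow> 'a pathclass \<Rightarrow> 'a sphereclass" where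
  "cf x b i j k l = defect (Xf x (j, b) (k, b) (l, b)) (Xf x (i, b) (k, b) (l, b)) (Xf x (i, b) (j, b) (l, b)) (Xf x (i, b) (j, b) (k, b))"

lemma Xf_translate:
  assumes "u \<in> carrier G" "i \<in> carrier G" "j \<in> carrier G" "k \<in> carrier G"
  shows "Xf x (u \<otimes>\<^bsub>G\<^esub> i, b) (u \<otimes>\<^bsub>G\<^esub> j, b) (u \<otimes>\<^bsub>G\<^esub> k, b) = Xf x (i, b) (j, b) (k, b)"
  using assms by (simp add: Xf_def gsimps)

lemma cf_translate:
  assumes "u \<in> carrier G" "i \<in> carrier G" "j \<in> carrier G" "k \<in> carrier G" "l \<in> carrier G"
  shows "cf x b (u \<otimes>\<^bsub>G\<^esub> i) (u \<otimes>\<^bsub>G\<^esub> j) (u \<otimes>\<^bsub>G\<^esub> k) (u \<otimes>\<^bsub>G\<^esub> l) = cf x b i j k l"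
  using assms by (simp add: cf_def Xf_translate)

context
  fixes x b assumes x: "triangle_choice M m0 (sec b) x"
begin

lemmas XT = Xf_props(1)[OF x]

lemma cf_closed: assumes "i \<in> carrier G" "j \<in> carrier G" "k \<in> carrier G" "l \<in> carrier G"
  shows "cf x b i j k l \<in> carrier (pi2 M m0)"
  unfolding cf_def by (rule defect(1)[OF XT XT XT XT]) (use assms in auto)

lemma cf_Tet: assumes "i \<in> carrier G" "j \<in> carrier G" "k \<in> carrier G" "l \<in> carrier G"
  shows "TetG M m0 (Xf x (j, b) (k, b) (l, b)) (add_sphere M (Xf x (i, b) (k, b) (l, b)) (inv\<^bsub>pi2 M m0\<^esub> (cf x b i j k l)))
     (Xf x (i, b) (j, b) (l, b)) (Xf x (i, b) (j, b) (k, b))"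
  unfolding cf_def by (rule defect(2)[OF XT XT XT XT]) (use assms in auto)

lemma cf_swap:
  assumes V: "i \<in> carrier G" "j \<in> carrier G" "k \<in> carrier G" "l \<in> carrier G"
  shows "cf x b j i k l = inv\<^bsub>pi2 M m0\<^esub> pi1_action M m0 (inv\<^bsub>G\<^esub> j \<otimes>\<^bsub>G\<^esub> i) (cf x b i j k l)"
    "cf x b i k j l = inv\<^bsub>pi2 M m0\<^esub> cf x b i j k l"
    "cf x b i j l k = inv\<^bsub>pi2 M m0\<^esub> cf x b i j k l"
proof -
  note W = V[THEN SigmaI, OF UNIV_I, of b]
  note d = defect_swap[OF XT[OF V(2,3,4)] XT[OF V(1,3,4)] XT[OF V(1,2,4)] XT[OF V(1,2,3)] W]
  show "cf x b j i k l = inv\<^bsub>pi2 M m0\<^esub> pi1_action M m0 (inv\<^bsub>G\<^esub> j \<otimes>\<^bsub>G\<^esub> i) (cf x b i j k l)"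
    using d(1) unfolding Xf_props(2)[OF x V(1,2,4)] Xf_props(2)[OF x V(1,2,3)] cf_def[symmetric]
      act_pi1_action[OF V(2,1) cf_closed[OF V]] .
  show "cf x b i k j l = inv\<^bsub>pi2 M m0\<^esub> cf x b i j k l"
    using d(2) unfolding Xf_props(2)[OF x V(2,3,4)] Xf_sb[OF x V(1,2,3)] cf_def[symmetric] .
  show "cf x b i j l k = inv\<^bsub>pi2 M m0\<^esub> cf x b i j k l"
    using d(3) unfolding Xf_sb[OF x V(2,3,4)] Xf_sb[OF x V(1,3,4)] cf_def[symmetric] .
qed

text \<open>The tetrahedron in the definition of m has its vertices in the order j, i, l, k. It
  arises from i, j, k, l by exchanging the last two and then the first two vertices. The first
  exchange turns the subtracted sphere into an added one, so that y is the defect itself and not its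
  inverse.\<close>

lemma y_cochain_cf:
  assumes V: "i \<in> carrier G" "j \<in> carrier G" "k \<in> carrier G" "l \<in> carrier G"
    and e: "g = inv\<^bsub>G\<^esub> l \<otimes>\<^bsub>G\<^esub> i" "h = inv\<^bsub>G\<^esub> l \<otimes>\<^bsub>G\<^esub> j" "r = inv\<^bsub>G\<^esub> l \<otimes>\<^bsub>G\<^esub> k"
  shows "y_cochain M m0 x g h r = cf x b i j k l"
proof -
  define c where "c = cf x b i j k l"
  note W = V[THEN SigmaI, OF UNIV_I, of b]
  have c: "c \<in> carrier (pi2 M m0)" unfolding c_def by (rule cf_closed[OF V])
  have "TetG M m0 (sbG M (Xf x (j, b) (k, b) (l, b))) (sbG M (add_sphere M (Xf x (i, b) (k, b) (l, b)) (inv\<^bsub>pi2 M m0\<^esub> c)))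
     (Xf x (i, b) (j, b) (k, b)) (Xf x (i, b) (j, b) (l, b))"
    unfolding c_def by (rule TetG_swap(3)[OF cf_Tet[OF V]])
  then have "TetG M m0 (Xf x (j, b) (l, b) (k, b)) (add_sphere M (Xf x (i, b) (l, b) (k, b)) c)
     (Xf x (i, b) (j, b) (k, b)) (Xf x (i, b) (j, b) (l, b))"
    unfolding Xf_sb[OF x V(2,3,4)] sb_add'[OF T_U[OF XT[OF V(1,3,4)]] A.inv_closed[OF c]] Xf_sb[OF x V(1,3,4)] A.inv_inv[OF c] .
  from TetG_swap(1)[OF this]
  have t: "TetG M m0 (add_sphere M (Xf x (i, b) (l, b) (k, b)) c) (Xf x (j, b) (l, b) (k, b))
     (Xf x (j, b) (i, b) (k, b)) (Xf x (j, b) (i, b) (l, b))"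
    unfolding Xf_props(2)[OF x V(1,2,3)] Xf_props(2)[OF x V(1,2,4)] .
  have m: "m_op M (Xf x (i, b) (l, b) (j, b)) (Xf x (j, b) (l, b) (k, b)) (Xf x (i, b) (j, b) (k, b))
     = add_sphere M (Xf x (i, b) (l, b) (k, b)) c"
    using m_op_TetG[OF t] unfolding Xf_props(3)[OF x V(2,1,4)] Xf_props(2)[OF x V(2,1,3)] .
  have ee: "x g (inv\<^bsub>G\<^esub> h) = Xf x (i, b) (l, b) (j, b)" "x h (inv\<^bsub>G\<^esub> r) = Xf x (j, b) (l, b) (k, b)"
    "x (inv\<^bsub>G\<^esub> h \<otimes>\<^bsub>G\<^esub> g) (inv\<^bsub>G\<^esub> r \<otimes>\<^bsub>G\<^esub> h) = Xf x (i, b) (j, b) (k, b)" "x g (inv\<^bsub>G\<^esub> r) = Xf x (i, b) (l, b) (k, b)"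
    unfolding Xf_def e using V by (simp_all add: gsimps)
  show ?thesis unfolding y_cochain_def ee m c_def[symmetric]
  proof (rule the_equality)
    fix v assume "v \<in> carrier (pi2 M m0) \<and> add_sphere M (Xf x (i, b) (l, b) (k, b)) c = add_sphere M (Xf x (i, b) (l, b) (k, b)) v"
    then show "v = c" using add_inj[OF _ XT[OF V(1,4,3)] W(1,4,3)] c by metis
  qed (use c in simp)
qed

text \<open>With l = pqr, the elements inv l, inv l * p and inv l * pq are exactly the arguments of
  y in alpha. Thus alpha is the translation-invariant defect written in inhomogeneous
  coordinates.\<close>

lemma alpha_cf:
  assumes V: "p \<in> carrier G" "q \<in> carrier G" "r \<in> carrier G"
  shows "alpha_cochain M m0 x (p, q, r) = cf x b \<one>\<^bsub>G\<^esub> p (p \<otimes>\<^bsub>G\<^esub> q) (p \<otimes>\<^bsub>G\<^esub> q \<otimes>\<^bsub>G\<^esub> r)"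
proof -
  have "alpha_cochain M m0 x (p, q, r) = y_cochain M m0 x (inv\<^bsub>G\<^esub> (p \<otimes>\<^bsub>G\<^esub> q \<otimes>\<^bsub>G\<^esub> r)) (inv\<^bsub>G\<^esub> (q \<otimes>\<^bsub>G\<^esub> r)) (inv\<^bsub>G\<^esub> r)"
    using V by (simp add: alpha_cochain_def)
  also have "\<dots> = cf x b \<one>\<^bsub>G\<^esub> p (p \<otimes>\<^bsub>G\<^esub> q) (p \<otimes>\<^bsub>G\<^esub> q \<otimes>\<^bsub>G\<^esub> r)"
    by (rule y_cochain_cf) (use V in \<open>simp_all add: gsimps\<close>)
  finally show ?thesis .
qed

lemma alpha_cf':
  assumes V: "u \<in> carrier G" "p \<in> carrier G" "q \<in> carrier G" "r \<in> carrier G"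
  shows "alpha_cochain M m0 x (p, q, r) = cf x b u (u \<otimes>\<^bsub>G\<^esub> p) (u \<otimes>\<^bsub>G\<^esub> p \<otimes>\<^bsub>G\<^esub> q) (u \<otimes>\<^bsub>G\<^esub> p \<otimes>\<^bsub>G\<^esub> q \<otimes>\<^bsub>G\<^esub> r)"
  using cf_translate[OF V(1) G.one_closed, of p "p \<otimes>\<^bsub>G\<^esub> q" "p \<otimes>\<^bsub>G\<^esub> q \<otimes>\<^bsub>G\<^esub> r" x b] V alpha_cf[OF V(2-4)]
  by (simp add: gsimps)

lemma alpha_closed:
  assumes V: "p \<in> carrier G" "q \<in> carrier G" "r \<in> carrier G"
  shows "alpha_cochain M m0 x (p, q, r) \<in> carrier (pi2 M m0)"
  unfolding alpha_cf[OF V] by (rule cf_closed) (use V in auto)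

lemma alpha_symmetric:
  assumes V: "p \<in> carrier G" "q \<in> carrier G" "r \<in> carrier G"
  shows "alpha_cochain M m0 x (p, q, r) = inv\<^bsub>pi2 M m0\<^esub> pi1_action M m0 p (alpha_cochain M m0 x (inv\<^bsub>G\<^esub> p, p \<otimes>\<^bsub>G\<^esub> q, r))"
    "alpha_cochain M m0 x (p, q, r) = inv\<^bsub>pi2 M m0\<^esub> alpha_cochain M m0 x (p \<otimes>\<^bsub>G\<^esub> q, inv\<^bsub>G\<^esub> q, q \<otimes>\<^bsub>G\<^esub> r)"
    "alpha_cochain M m0 x (p, q, r) = inv\<^bsub>pi2 M m0\<^esub> alpha_cochain M m0 x (p, q \<otimes>\<^bsub>G\<^esub> r, inv\<^bsub>G\<^esub> r)"
proof -
  have c: "p \<otimes>\<^bsub>G\<^esub> q \<in> carrier G" "p \<otimes>\<^bsub>G\<^esub> q \<otimes>\<^bsub>G\<^esub> r \<in> carrier G" using V by auto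
  have "alpha_cochain M m0 x (inv\<^bsub>G\<^esub> p, p \<otimes>\<^bsub>G\<^esub> q, r) = cf x b p \<one>\<^bsub>G\<^esub> (p \<otimes>\<^bsub>G\<^esub> q) (p \<otimes>\<^bsub>G\<^esub> q \<otimes>\<^bsub>G\<^esub> r)"
    using alpha_cf'[OF V(1), of "inv\<^bsub>G\<^esub> p" "p \<otimes>\<^bsub>G\<^esub> q" r] V by (simp add: gsimps)
  then show "alpha_cochain M m0 x (p, q, r) = inv\<^bsub>pi2 M m0\<^esub> pi1_action M m0 p (alpha_cochain M m0 x (inv\<^bsub>G\<^esub> p, p \<otimes>\<^bsub>G\<^esub> q, r))"
    using cf_swap(1)[OF V(1) G.one_closed c] V unfolding alpha_cf[OF V] by simp
  have "alpha_cochain M m0 x (p \<otimes>\<^bsub>G\<^esub> q, inv\<^bsub>G\<^esub> q, q \<otimes>\<^bsub>G\<^esub> r) = cf x b \<one>\<^bsub>G\<^esub> (p \<otimes>\<^bsub>G\<^esub> q) p (p \<otimes>\<^bsub>G\<^esub> q \<otimes>\<^bsub>G\<^esub> r)"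
    using alpha_cf[of "p \<otimes>\<^bsub>G\<^esub> q" "inv\<^bsub>G\<^esub> q" "q \<otimes>\<^bsub>G\<^esub> r"] V by (simp add: gsimps)
  then show "alpha_cochain M m0 x (p, q, r) = inv\<^bsub>pi2 M m0\<^esub> alpha_cochain M m0 x (p \<otimes>\<^bsub>G\<^esub> q, inv\<^bsub>G\<^esub> q, q \<otimes>\<^bsub>G\<^esub> r)"
    using cf_swap(2)[OF G.one_closed c(1) V(1) c(2)] unfolding alpha_cf[OF V] by simp
  have "alpha_cochain M m0 x (p, q \<otimes>\<^bsub>G\<^esub> r, inv\<^bsub>G\<^esub> r) = cf x b \<one>\<^bsub>G\<^esub> p (p \<otimes>\<^bsub>G\<^esub> q \<otimes>\<^bsub>G\<^esub> r) (p \<otimes>\<^bsub>G\<^esub> q)"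
    using alpha_cf[of p "q \<otimes>\<^bsub>G\<^esub> r" "inv\<^bsub>G\<^esub> r"] V by (simp add: gsimps)
  then show "alpha_cochain M m0 x (p, q, r) = inv\<^bsub>pi2 M m0\<^esub> alpha_cochain M m0 x (p, q \<otimes>\<^bsub>G\<^esub> r, inv\<^bsub>G\<^esub> r)"
    using cf_swap(3)[OF G.one_closed V(1) c(2,1)] unfolding alpha_cf[OF V] by simp
qed

text \<open>The five vertices are 1, p, pq, pqr and pqrt. Only the face opposite to 1 has to be
  translated to start at 1, and its first corner is p, which accounts for the action of p.\<close>

lemma alpha_cocycle:
  assumes V: "p \<in> carrier G" "q \<in> carrier G" "r \<in> carrier G" "t \<in> carrier G"
  shows "pi1_action M m0 p (alpha_cochain M m0 x (q, r, t)) \<otimes>\<^bsub>pi2 M m0\<^esub> inv\<^bsub>pi2 M m0\<^esub> alpha_cochain M m0 x (p \<otimes>\<^bsub>G\<^esub> q, r, t)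
     \<otimes>\<^bsub>pi2 M m0\<^esub> alpha_cochain M m0 x (p, q \<otimes>\<^bsub>G\<^esub> r, t) \<otimes>\<^bsub>pi2 M m0\<^esub> inv\<^bsub>pi2 M m0\<^esub> alpha_cochain M m0 x (p, q, r \<otimes>\<^bsub>G\<^esub> t)
     \<otimes>\<^bsub>pi2 M m0\<^esub> alpha_cochain M m0 x (p, q, r) = \<one>\<^bsub>pi2 M m0\<^esub>"
proof -
  define q' r' t' where "q' = p \<otimes>\<^bsub>G\<^esub> q" and "r' = q' \<otimes>\<^bsub>G\<^esub> r" and "t' = r' \<otimes>\<^bsub>G\<^esub> t"
  have C: "q' \<in> carrier G" "r' \<in> carrier G" "t' \<in> carrier G" using V by (simp_all add: q'_def r'_def t'_def)
  have e: "alpha_cochain M m0 x (q, r, t) = cf x b p q' r' t'"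
    "alpha_cochain M m0 x (p \<otimes>\<^bsub>G\<^esub> q, r, t) = cf x b \<one>\<^bsub>G\<^esub> q' r' t'"
    "alpha_cochain M m0 x (p, q \<otimes>\<^bsub>G\<^esub> r, t) = cf x b \<one>\<^bsub>G\<^esub> p r' t'"
    "alpha_cochain M m0 x (p, q, r \<otimes>\<^bsub>G\<^esub> t) = cf x b \<one>\<^bsub>G\<^esub> p q' t'"
    "alpha_cochain M m0 x (p, q, r) = cf x b \<one>\<^bsub>G\<^esub> p q' r'"
    using alpha_cf'[OF V] alpha_cf V by (simp_all add: q'_def r'_def t'_def gsimps)
  have "act (\<one>\<^bsub>G\<^esub>, b) (p, b) (cf x b p q' r' t') = pi1_action M m0 p (cf x b p q' r' t')"
    using act_pi1_action[OF G.one_closed V(1) cf_closed[OF V(1) C]] V by simp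
  moreover have "act (\<one>\<^bsub>G\<^esub>, b) (p, b) (cf x b p q' r' t') \<otimes>\<^bsub>pi2 M m0\<^esub> inv\<^bsub>pi2 M m0\<^esub> cf x b \<one>\<^bsub>G\<^esub> q' r' t'
    \<otimes>\<^bsub>pi2 M m0\<^esub> cf x b \<one>\<^bsub>G\<^esub> p r' t' \<otimes>\<^bsub>pi2 M m0\<^esub> inv\<^bsub>pi2 M m0\<^esub> cf x b \<one>\<^bsub>G\<^esub> p q' t' \<otimes>\<^bsub>pi2 M m0\<^esub> cf x b \<one>\<^bsub>G\<^esub> p q' r' = \<one>\<^bsub>pi2 M m0\<^esub>"
    unfolding cf_def
  proof (rule defect_cocycle[where W="carrier G \<times> {b}" and X="Xf x"
        and c="\<lambda>i j k l. defect (Xf x j k l) (Xf x i k l) (Xf x i j l) (Xf x i j k)"])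
    fix i j k :: "'a pathclass \<times> bool"
    assume "i \<in> carrier G \<times> {b}" "j \<in> carrier G \<times> {b}" "k \<in> carrier G \<times> {b}"
    then show "Xf x i j k \<in> T i j k" using XT by (cases i, cases j, cases k) simp
  next
    show "i \<in> carrier G \<times> UNIV" if "i \<in> carrier G \<times> {b}" for i :: "'a pathclass \<times> bool" using that by (cases i) simp
  qed (use V C in simp_all)
  ultimately show ?thesis unfolding e by simp
qed

lemma alpha_ZS3: "alpha_cochain M m0 x \<in> carrier (ZS3 G (pi2 M m0) (pi1_action M m0))"
proof -
  have "alpha_cochain M m0 x \<in> carrier (C3 G (pi2 M m0))"
    unfolding C3_def using alpha_closed by (auto simp: alpha_cochain_def PiE_iff)
  then have "alpha_cochain M m0 x \<in> CS3 G (pi2 M m0) (pi1_action M m0)"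
    unfolding CS3_def by (intro CollectI conjI ballI) (assumption | rule alpha_symmetric; assumption)+
  moreover have "coboundary3 G (pi2 M m0) (pi1_action M m0) (alpha_cochain M m0 x) = \<one>\<^bsub>C4 G (pi2 M m0)\<^esub>"
    unfolding coboundary3_def C4_def one_product_group
  proof (rule restrict_ext)
    fix z assume "z \<in> carrier G \<times> carrier G \<times> carrier G \<times> carrier G"
    then obtain p q r t where z: "z = (p, q, r, t)" and V: "p \<in> carrier G" "q \<in> carrier G" "r \<in> carrier G" "t \<in> carrier G"
      by (cases z) simp
    show "(case z of (x1, x2, x3, x4) \<Rightarrow>
      pi1_action M m0 x1 (alpha_cochain M m0 x (x2, x3, x4)) \<otimes>\<^bsub>pi2 M m0\<^esub>
      inv\<^bsub>pi2 M m0\<^esub> alpha_cochain M m0 x (x1 \<otimes>\<^bsub>G\<^esub> x2, x3, x4) \<otimes>\<^bsub>pi2 M m0\<^esub>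
      alpha_cochain M m0 x (x1, x2 \<otimes>\<^bsub>G\<^esub> x3, x4) \<otimes>\<^bsub>pi2 M m0\<^esub>
      inv\<^bsub>pi2 M m0\<^esub> alpha_cochain M m0 x (x1, x2, x3 \<otimes>\<^bsub>G\<^esub> x4) \<otimes>\<^bsub>pi2 M m0\<^esub>
      alpha_cochain M m0 x (x1, x2, x3)) = \<one>\<^bsub>pi2 M m0\<^esub>"
      unfolding z prod.case by (rule alpha_cocycle[OF V])
  qed
  ultimately show ?thesis unfolding ZS3_def by simp
qed

end

end

subsection \<open>Changing the section\<close>

context two_sections
begin

definition lo :: "'a pathclass \<Rightarrow> 'a pathclass \<times> bool" where "lo g = (g, False)"
definition hi :: "'a pathclass \<Rightarrow> 'a pathclass \<times> bool" where "hi g = (g, True)"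

lemma lohi_simps [simp]: "fst (lo g) = g" "fst (hi g) = g" "snd (lo g) = False" "snd (hi g) = True"
  by (simp_all add: lo_def hi_def)

lemma lohi_V [simp]: "lo g \<in> carrier G \<times> UNIV \<longleftrightarrow> g \<in> carrier G" "hi g \<in> carrier G \<times> UNIV \<longleftrightarrow> g \<in> carrier G"
  by (simp_all add: lo_def hi_def)

definition tr :: "'a pathclass \<Rightarrow> 'a pathclass \<times> bool \<Rightarrow> 'a pathclass \<times> bool" where
  "tr u v = (u \<otimes>\<^bsub>G\<^esub> fst v, snd v)"

lemma tr_lohi [simp]: "tr u (lo g) = lo (u \<otimes>\<^bsub>G\<^esub> g)" "tr u (hi g) = hi (u \<otimes>\<^bsub>G\<^esub> g)"
  by (simp_all add: tr_def lo_def hi_def)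

lemma lp_tr: "u \<in> carrier G \<Longrightarrow> i \<in> carrier G \<times> UNIV \<Longrightarrow> j \<in> carrier G \<times> UNIV \<Longrightarrow> lp (tr u i) (tr u j) = lp i j"
  by (auto simp: lp_def tr_def gsimps)

lemma T_tr: assumes "u \<in> carrier G" "i \<in> carrier G \<times> UNIV" "j \<in> carrier G \<times> UNIV" "k \<in> carrier G \<times> UNIV"
  shows "T (tr u i) (tr u j) (tr u k) = T i j k"
  by (rule T_cong) (use assms lp_tr in \<open>auto simp: tr_def\<close>)

text \<open>The degenerate triangle with vertices i, j, j. An edge from a lower vertex to an upper
  one carries the same loop as the edge between the lower copies, so the triangle also fits with the
  last vertex in the upper copy.\<close>

definition NN :: "'a pathclass \<times> bool \<Rightarrow> 'a pathclass \<times> bool \<Rightarrow> 'a triangleclass" where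
  "NN i j = Q_op M (sbG M (D j i))"

lemma NN_tr: "u \<in> carrier G \<Longrightarrow> i \<in> carrier G \<times> UNIV \<Longrightarrow> j \<in> carrier G \<times> UNIV \<Longrightarrow> NN (tr u i) (tr u j) = NN i j"
  by (simp only: NN_def D_def lp_tr)

lemma NN_T: assumes "g \<in> carrier G" "h \<in> carrier G" shows "NN (lo g) (lo h) \<in> T (lo g) (lo h) (hi h)"
proof -
  have "NN (lo g) (lo h) \<in> T (lo g) (lo h) (lo h)" unfolding NN_def
    by (rule T_Q[OF T_sb[OF D_T]]) (use assms in auto)
  also have "T (lo g) (lo h) (lo h) = T (lo g) (lo h) (hi h)"
    by (rule T_cong) (use assms in \<open>simp_all add: lp_def\<close>)
  finally show ?thesis .
qed

abbreviation "hT g \<equiv> T (lo \<one>\<^bsub>G\<^esub>) (hi \<one>\<^bsub>G\<^esub>) (hi g)"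

lemma hT_ex: assumes g: "g \<in> carrier G" shows "\<exists>z. z \<in> hT g"
proof -
  have "s g \<in> g" "s' g \<in> g" using loop_sectionD(1)[OF s g] loop_sectionD(1)[OF s' g] .
  then have h: "homotopic_paths M (s g) (s' g)" using pi1_mem(1)[OF _ g] pc_mem by blast
  obtain a where a: "tri M a" "\<And>x y. 0 \<le> x \<Longrightarrow> 0 \<le> y \<Longrightarrow> x + y = 1 \<Longrightarrow>
    a (x, y, 0) = m0 \<and> a (x, 0, y) = s g y \<and> a (0, x, y) = s' g y"
    by (rule homotopy_triangle[OF h loop_sectionD(2)[OF s g]]) (rule that, assumption, blast)
  have "lab (lo \<one>\<^bsub>G\<^esub>) (hi \<one>\<^bsub>G\<^esub>) (hi g) a"
  proof (rule labI[OF a(1)])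
    fix x y :: real assume x: "0 \<le> x" "0 \<le> y" "x + y = 1"
    show "a (x, y, 0) = lp (lo \<one>\<^bsub>G\<^esub>) (hi \<one>\<^bsub>G\<^esub>) y \<and> a (x, 0, y) = lp (lo \<one>\<^bsub>G\<^esub>) (hi g) y \<and> a (0, x, y) = lp (hi \<one>\<^bsub>G\<^esub>) (hi g) y"
      using a(2)[OF x] loop_sectionD(4)[OF s G.one_closed, of y] x g by (simp add: lp_def sec_def)
  qed
  then have "cls M a \<in> hT g" unfolding lo_def hi_def by (rule T_I) (use g in simp_all)
  then show ?thesis by blast
qed

text \<open>The condition \<open>square\<close> for the wall over the edge from 1 to g:
  \<open>z\<close> is the homotopy chosen for g, and \<open>w\<close> the one for its inverse,
  translated by g.\<close>

definition sq :: "'a pathclass \<Rightarrow> 'a triangleclass \<Rightarrow> 'a triangleclass \<Rightarrow> bool" where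
  "sq g z w \<longleftrightarrow> TetG M m0 (sbG M w) z (NN (lo \<one>\<^bsub>G\<^esub>) (lo g)) (Q_op M (NN (lo g) (lo \<one>\<^bsub>G\<^esub>)))"

lemma sq_ex: assumes g: "g \<in> carrier G" and z: "z \<in> hT g" shows "\<exists>w. w \<in> hT (inv\<^bsub>G\<^esub> g) \<and> sq g z w"
proof -
  have n: "NN (lo \<one>\<^bsub>G\<^esub>) (lo g) \<in> T (lo \<one>\<^bsub>G\<^esub>) (lo g) (hi g)" "Q_op M (NN (lo g) (lo \<one>\<^bsub>G\<^esub>)) \<in> T (lo \<one>\<^bsub>G\<^esub>) (lo g) (hi \<one>\<^bsub>G\<^esub>)"
    using NN_T[OF G.one_closed g] T_Q[OF NN_T[OF g G.one_closed]] .
  obtain a0 where a0: "a0 \<in> T (lo g) (hi \<one>\<^bsub>G\<^esub>) (hi g)"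
    "TetG M m0 a0 z (NN (lo \<one>\<^bsub>G\<^esub>) (lo g)) (Q_op M (NN (lo g) (lo \<one>\<^bsub>G\<^esub>)))"
    using TetG_ex[OF z n] by blast
  have "sbG M a0 \<in> T (lo g) (hi g) (hi \<one>\<^bsub>G\<^esub>)" by (rule T_sb[OF a0(1)])
  also have "T (lo g) (hi g) (hi \<one>\<^bsub>G\<^esub>) = T (tr g (lo \<one>\<^bsub>G\<^esub>)) (tr g (hi \<one>\<^bsub>G\<^esub>)) (tr g (hi (inv\<^bsub>G\<^esub> g)))" using g by simp
  also have "\<dots> = hT (inv\<^bsub>G\<^esub> g)" by (rule T_tr) (use g in simp_all)
  finally show ?thesis unfolding sq_def using a0(2) sb_sb[OF T_U[OF a0(1)]] by (intro exI[of _ "sbG M a0"]) simp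
qed

text \<open>Turning the wall around exchanges both the two lower and the two upper vertices.\<close>

lemma sq_sym: assumes g: "g \<in> carrier G" and q: "sq g z w" and w: "w \<in> based M m0" shows "sq (inv\<^bsub>G\<^esub> g) w z"
proof -
  have U: "NN (lo g) (lo \<one>\<^bsub>G\<^esub>) \<in> based M m0" by (rule T_U[OF NN_T[OF g G.one_closed]])
  have "TetG M m0 (sbG M z) w (NN (lo g) (lo \<one>\<^bsub>G\<^esub>)) (Q_op M (NN (lo \<one>\<^bsub>G\<^esub>) (lo g)))"
    using TetG_swap(3)[OF TetG_swap(1)[OF q[unfolded sq_def]]] unfolding sa_sa[OF U] sb_sb[OF w] .
  moreover have "NN (lo g) (lo \<one>\<^bsub>G\<^esub>) = NN (lo \<one>\<^bsub>G\<^esub>) (lo (inv\<^bsub>G\<^esub> g))" "NN (lo \<one>\<^bsub>G\<^esub>) (lo g) = NN (lo (inv\<^bsub>G\<^esub> g)) (lo \<one>\<^bsub>G\<^esub>)"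
    using NN_tr[of g "lo \<one>\<^bsub>G\<^esub>" "lo (inv\<^bsub>G\<^esub> g)"] NN_tr[of g "lo (inv\<^bsub>G\<^esub> g)" "lo \<one>\<^bsub>G\<^esub>"] g by simp_all
  ultimately show ?thesis unfolding sq_def by simp
qed

lemma no_involution: assumes "g \<in> carrier G" "g \<noteq> \<one>\<^bsub>G\<^esub>" shows "inv\<^bsub>G\<^esub> g \<noteq> g"
proof
  assume e: "inv\<^bsub>G\<^esub> g = g"
  have "g \<otimes>\<^bsub>G\<^esub> g = \<one>\<^bsub>G\<^esub>" using G.l_inv[OF assms(1)] e by simp
  then have "g [^]\<^bsub>G\<^esub> (2::nat) = \<one>\<^bsub>G\<^esub>" using assms(1) by (simp add: numeral_2_eq_2)
  then have "G.ord g dvd 2" using G.pow_eq_id[OF assms(1)] by simp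
  then have "G.ord g = 1 \<or> G.ord g = 2" using prime_nat_iff[of 2] two_is_prime_nat by blast
  then show False using G.ord_eq_1[OF assms(1)] ord2[OF assms(1)] assms(2) by simp
qed

text \<open>For the trivial element a single triangle must play both roles. The degenerate one can,
  because both transpositions fix it.\<close>

lemma base_square: "D (lo \<one>\<^bsub>G\<^esub>) (lo \<one>\<^bsub>G\<^esub>) \<in> hT \<one>\<^bsub>G\<^esub>" "sq \<one>\<^bsub>G\<^esub> (D (lo \<one>\<^bsub>G\<^esub>) (lo \<one>\<^bsub>G\<^esub>)) (D (lo \<one>\<^bsub>G\<^esub>) (lo \<one>\<^bsub>G\<^esub>))"
proof -
  have V: "lo \<one>\<^bsub>G\<^esub> \<in> carrier G \<times> UNIV" by simp
  have d: "D (lo \<one>\<^bsub>G\<^esub>) (lo \<one>\<^bsub>G\<^esub>) \<in> T (lo \<one>\<^bsub>G\<^esub>) (lo \<one>\<^bsub>G\<^esub>) (lo \<one>\<^bsub>G\<^esub>)" by (rule D_T[OF V V])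
  also have "T (lo \<one>\<^bsub>G\<^esub>) (lo \<one>\<^bsub>G\<^esub>) (lo \<one>\<^bsub>G\<^esub>) = hT \<one>\<^bsub>G\<^esub>"
    by (rule T_cong) (use loop_sectionD(4)[OF s G.one_closed] loop_sectionD(4)[OF s' G.one_closed] in \<open>auto simp: lp_def sec_def\<close>)
  finally show "D (lo \<one>\<^bsub>G\<^esub>) (lo \<one>\<^bsub>G\<^esub>) \<in> hT \<one>\<^bsub>G\<^esub>" .
  show "sq \<one>\<^bsub>G\<^esub> (D (lo \<one>\<^bsub>G\<^esub>) (lo \<one>\<^bsub>G\<^esub>)) (D (lo \<one>\<^bsub>G\<^esub>) (lo \<one>\<^bsub>G\<^esub>))"
    unfolding sq_def NN_def sb_D[OF V] sa_D[OF V] by (rule D_tet[OF d V V V])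
qed

text \<open>The homotopies over g and its inverse have to be chosen together; this is possible
  because they are different elements unless g is trivial.\<close>

lemma square_choice:
  obtains h where "\<And>g. g \<in> carrier G \<Longrightarrow> h g \<in> hT g" "\<And>g. g \<in> carrier G \<Longrightarrow> sq g (h g) (h (inv\<^bsub>G\<^esub> g))"
proof -
  obtain z0 where z0: "\<And>g. g \<in> carrier G \<Longrightarrow> z0 g \<in> hT g" using hT_ex by metis
  have "\<forall>g\<in>carrier G. \<exists>w. w \<in> hT (inv\<^bsub>G\<^esub> g) \<and> sq g (z0 g) w" using sq_ex z0 by blast
  then obtain w0 where w0: "\<And>g. g \<in> carrier G \<Longrightarrow> w0 g \<in> hT (inv\<^bsub>G\<^esub> g)" "\<And>g. g \<in> carrier G \<Longrightarrow> sq g (z0 g) (w0 g)" by metis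
  \<comment> \<open>The choice is made from the unordered pair, so g and its inverse get the same
    representative. The homotopy is chosen freely over the representative and is then forced over
    the inverse.\<close>
  define rep where "rep g = (SOME u. u \<in> {g, inv\<^bsub>G\<^esub> g})" for g
  have rep: "rep g = g \<or> rep g = inv\<^bsub>G\<^esub> g" for g
    using someI[of "\<lambda>u. u \<in> {g, inv\<^bsub>G\<^esub> g}" g] unfolding rep_def by blast
  have rep_inv: "rep (inv\<^bsub>G\<^esub> g) = rep g" if "g \<in> carrier G" for g
    using that by (simp add: rep_def insert_commute)
  define h where "h g = (if g = \<one>\<^bsub>G\<^esub> then D (lo \<one>\<^bsub>G\<^esub>) (lo \<one>\<^bsub>G\<^esub>) else if rep g = g then z0 g else w0 (inv\<^bsub>G\<^esub> g))" for g
  have hT: "h g \<in> hT g" if g: "g \<in> carrier G" for g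
    using base_square(1) z0[OF g] w0(1)[of "inv\<^bsub>G\<^esub> g"] g by (simp add: h_def)
  have sq1: "sq g (h g) (h (inv\<^bsub>G\<^esub> g))" if g: "g \<in> carrier G" "g \<noteq> \<one>\<^bsub>G\<^esub>" "rep g = g" for g
  proof -
    have i: "inv\<^bsub>G\<^esub> g \<noteq> \<one>\<^bsub>G\<^esub>" using g G.inv_eq_1_iff by simp
    have "rep (inv\<^bsub>G\<^esub> g) \<noteq> inv\<^bsub>G\<^esub> g" using rep_inv[OF g(1)] no_involution[OF g(1,2)] g(3) by simp
    then have "h (inv\<^bsub>G\<^esub> g) = w0 g" using i g by (simp add: h_def)
    moreover have "h g = z0 g" using g by (simp add: h_def)
    ultimately show ?thesis using w0(2)[OF g(1)] by simp
  qed
  have "sq g (h g) (h (inv\<^bsub>G\<^esub> g))" if g: "g \<in> carrier G" for g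
  proof (cases "g = \<one>\<^bsub>G\<^esub>")
    case True
    then show ?thesis using base_square(2) by (simp add: h_def)
  next
    case False
    show ?thesis
    proof (cases "rep g = g")
      case True
      then show ?thesis using sq1 g False by blast
    next
      case F: False
      have i: "inv\<^bsub>G\<^esub> g \<in> carrier G" "inv\<^bsub>G\<^esub> g \<noteq> \<one>\<^bsub>G\<^esub>" using g False by simp_all
      have "rep (inv\<^bsub>G\<^esub> g) = inv\<^bsub>G\<^esub> g" using rep[of g] F rep_inv[OF g] by simp
      from sq_sym[OF i(1) sq1[OF i this]] show ?thesis using T_U[OF hT[OF g]] g by simp
    qed
  qed
  with hT show thesis by (rule that)
qed

section \<open>Symmetric 2-cochains and their coboundaries\<close>

lemma pi1_action_closed: assumes "g \<in> carrier G" "v \<in> carrier (pi2 M m0)" shows "pi1_action M m0 g v \<in> carrier (pi2 M m0)"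
  using act_closed[of "lo \<one>\<^bsub>G\<^esub>" "lo g" v] act_pi1_action[OF G.one_closed assms] assms by (simp add: lo_def)

lemma pi1_action_mult:
  assumes "g \<in> carrier G" "v \<in> carrier (pi2 M m0)" "w \<in> carrier (pi2 M m0)"
  shows "pi1_action M m0 g (v \<otimes>\<^bsub>pi2 M m0\<^esub> w) = pi1_action M m0 g v \<otimes>\<^bsub>pi2 M m0\<^esub> pi1_action M m0 g w"
proof -
  have "act (\<one>\<^bsub>G\<^esub>, False) (g, False) u = pi1_action M m0 g u" if "u \<in> carrier (pi2 M m0)" for u
    using act_pi1_action[OF G.one_closed assms(1) that] assms(1) by simp
  then show ?thesis using act_mult[of "(\<one>\<^bsub>G\<^esub>, False)" "(g, False)" v w] assms by simp
qed

lemma CS2_closed: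
  assumes \<sigma>: "\<sigma> \<in> CS2 G (pi2 M m0) (pi1_action M m0)" and V: "p \<in> carrier G" "q \<in> carrier G"
  shows "\<sigma> (p, q) \<in> carrier (pi2 M m0)"
proof -
  have "\<sigma> \<in> (\<Pi>\<^sub>E p\<in>carrier G \<times> carrier G. carrier (pi2 M m0))"
    using \<sigma> unfolding CS2_def C2_def mem_Collect_eq carrier_product_group by (rule conjunct1)
  then show ?thesis by (rule PiE_mem) (use V in simp)
qed

lemma C2_restrict:
  assumes "\<And>p q. p \<in> carrier G \<Longrightarrow> q \<in> carrier G \<Longrightarrow> f (p, q) \<in> carrier (pi2 M m0)"
  shows "restrict f (carrier G \<times> carrier G) \<in> carrier (C2 G (pi2 M m0))"
  using assms unfolding C2_def carrier_product_group restrict_PiE_iff by auto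

lemma CS2_mult:
  assumes "\<sigma> \<in> CS2 G (pi2 M m0) (pi1_action M m0)" "\<tau> \<in> CS2 G (pi2 M m0) (pi1_action M m0)"
  shows "(\<lambda>p\<in>carrier G \<times> carrier G. \<sigma> p \<otimes>\<^bsub>pi2 M m0\<^esub> \<tau> p) \<in> CS2 G (pi2 M m0) (pi1_action M m0)"
proof -
  note c = CS2_closed[OF assms(1)] CS2_closed[OF assms(2)]
  let ?e = "\<lambda>\<rho> x y. \<rho> (x, y) = inv\<^bsub>pi2 M m0\<^esub> pi1_action M m0 x (\<rho> (inv\<^bsub>G\<^esub> x, x \<otimes>\<^bsub>G\<^esub> y)) \<and> \<rho> (x, y) = inv\<^bsub>pi2 M m0\<^esub> \<rho> (x \<otimes>\<^bsub>G\<^esub> y, inv\<^bsub>G\<^esub> y)"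
  define \<rho> where "\<rho> = (\<lambda>p\<in>carrier G \<times> carrier G. \<sigma> p \<otimes>\<^bsub>pi2 M m0\<^esub> \<tau> p)"
  have "?e \<rho> x y" if x: "x \<in> carrier G" "y \<in> carrier G" for x y
  proof -
    have e: "?e \<sigma> x y" "?e \<tau> x y" using assms x unfolding CS2_def by blast+
    have m: "inv\<^bsub>G\<^esub> x \<in> carrier G" "x \<otimes>\<^bsub>G\<^esub> y \<in> carrier G" "inv\<^bsub>G\<^esub> y \<in> carrier G" using x by simp_all
    have r: "\<rho> (p, q) = \<sigma> (p, q) \<otimes>\<^bsub>pi2 M m0\<^esub> \<tau> (p, q)" if "p \<in> carrier G" "q \<in> carrier G" for p q using that by (simp add: \<rho>_def)
    show ?thesis unfolding r[OF x] r[OF m(1,2)] r[OF m(2,3)]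
      pi1_action_mult[OF x(1) c(1)[OF m(1,2)] c(2)[OF m(1,2)]]
      A.inv_mult[OF pi1_action_closed[OF x(1) c(1)[OF m(1,2)]] pi1_action_closed[OF x(1) c(2)[OF m(1,2)]]]
      A.inv_mult[OF c(1)[OF m(2,3)] c(2)[OF m(2,3)]]
      by (intro conjI arg_cong2[where f="mult (pi2 M m0)"] e[THEN conjunct1] e[THEN conjunct2])
  qed
  moreover have "\<rho> \<in> carrier (C2 G (pi2 M m0))" unfolding \<rho>_def by (intro C2_restrict A.m_closed c)
  ultimately show ?thesis unfolding CS2_def \<rho>_def[symmetric] by blast
qed

lemma coboundary2_apply:
  assumes "p \<in> carrier G" "q \<in> carrier G" "r \<in> carrier G"
  shows "coboundary2 G (pi2 M m0) (pi1_action M m0) \<sigma> (p, q, r) =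
    pi1_action M m0 p (\<sigma> (q, r)) \<otimes>\<^bsub>pi2 M m0\<^esub> inv\<^bsub>pi2 M m0\<^esub> \<sigma> (p \<otimes>\<^bsub>G\<^esub> q, r)
      \<otimes>\<^bsub>pi2 M m0\<^esub> \<sigma> (p, q \<otimes>\<^bsub>G\<^esub> r) \<otimes>\<^bsub>pi2 M m0\<^esub> inv\<^bsub>pi2 M m0\<^esub> \<sigma> (p, q)"
  using assms by (simp add: coboundary2_def)

lemma coboundary2_closed:
  assumes "\<sigma> \<in> CS2 G (pi2 M m0) (pi1_action M m0)" "p \<in> carrier G" "q \<in> carrier G" "r \<in> carrier G"
  shows "coboundary2 G (pi2 M m0) (pi1_action M m0) \<sigma> (p, q, r) \<in> carrier (pi2 M m0)"
  unfolding coboundary2_apply[OF assms(2-4)]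
  by (intro A.m_closed A.inv_closed pi1_action_closed CS2_closed[OF assms(1)] G.m_closed assms(2-4))

lemma mult_interchange:
  assumes "a \<in> carrier (pi2 M m0)" "b \<in> carrier (pi2 M m0)" "c \<in> carrier (pi2 M m0)" "d \<in> carrier (pi2 M m0)"
  shows "(a \<otimes>\<^bsub>pi2 M m0\<^esub> b) \<otimes>\<^bsub>pi2 M m0\<^esub> (c \<otimes>\<^bsub>pi2 M m0\<^esub> d) = (a \<otimes>\<^bsub>pi2 M m0\<^esub> c) \<otimes>\<^bsub>pi2 M m0\<^esub> (b \<otimes>\<^bsub>pi2 M m0\<^esub> d)"
  using assms by (simp add: A.m_ac)

lemma coboundary2_mult:
  assumes "\<sigma> \<in> CS2 G (pi2 M m0) (pi1_action M m0)" "\<tau> \<in> CS2 G (pi2 M m0) (pi1_action M m0)"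
    and V: "p \<in> carrier G" "q \<in> carrier G" "r \<in> carrier G"
  shows "coboundary2 G (pi2 M m0) (pi1_action M m0) (\<lambda>p\<in>carrier G \<times> carrier G. \<sigma> p \<otimes>\<^bsub>pi2 M m0\<^esub> \<tau> p) (p, q, r) =
    coboundary2 G (pi2 M m0) (pi1_action M m0) \<sigma> (p, q, r) \<otimes>\<^bsub>pi2 M m0\<^esub> coboundary2 G (pi2 M m0) (pi1_action M m0) \<tau> (p, q, r)"
proof -
  note c = CS2_closed[OF assms(1)] CS2_closed[OF assms(2)]
  have m: "p \<otimes>\<^bsub>G\<^esub> q \<in> carrier G" "q \<otimes>\<^bsub>G\<^esub> r \<in> carrier G" using V by simp_all
  have e: "(\<lambda>p\<in>carrier G \<times> carrier G. \<sigma> p \<otimes>\<^bsub>pi2 M m0\<^esub> \<tau> p) (x, y) = \<sigma> (x, y) \<otimes>\<^bsub>pi2 M m0\<^esub> \<tau> (x, y)"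
    if "x \<in> carrier G" "y \<in> carrier G" for x y using that by simp
  note t = pi1_action_closed[OF V(1) c(1)[OF V(2,3)]] pi1_action_closed[OF V(1) c(2)[OF V(2,3)]]
    A.inv_closed[OF c(1)[OF m(1) V(3)]] A.inv_closed[OF c(2)[OF m(1) V(3)]]
    c(1)[OF V(1) m(2)] c(2)[OF V(1) m(2)] A.inv_closed[OF c(1)[OF V(1,2)]] A.inv_closed[OF c(2)[OF V(1,2)]]
  show ?thesis
    unfolding coboundary2_apply[OF V] e[OF V(2,3)] e[OF m(1) V(3)] e[OF V(1) m(2)] e[OF V(1,2)]
      pi1_action_mult[OF V(1) c(1)[OF V(2,3)] c(2)[OF V(2,3)]]
      A.inv_mult[OF c(1)[OF m(1) V(3)] c(2)[OF m(1) V(3)]] A.inv_mult[OF c(1)[OF V(1,2)] c(2)[OF V(1,2)]]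
      mult_interchange[OF t(1-4)]
      mult_interchange[OF A.m_closed[OF t(1,3)] A.m_closed[OF t(2,4)] t(5,6)]
      mult_interchange[OF A.m_closed[OF A.m_closed[OF t(1,3)] t(5)] A.m_closed[OF A.m_closed[OF t(2,4)] t(6)] t(7,8)] ..
qed

lemma alpha_cohomologous:
  assumes x: "triangle_choice M m0 s x" and x': "triangle_choice M m0 s' x'"
  obtains \<sigma> where "\<sigma> \<in> CS2 G (pi2 M m0) (pi1_action M m0)"
    "\<And>p q r. p \<in> carrier G \<Longrightarrow> q \<in> carrier G \<Longrightarrow> r \<in> carrier G \<Longrightarrow>
      alpha_cochain M m0 x (p, q, r) = alpha_cochain M m0 x' (p, q, r) \<otimes>\<^bsub>pi2 M m0\<^esub> coboundary2 G (pi2 M m0) (pi1_action M m0) \<sigma> (p, q, r)"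
proof -
  obtain h where hT: "\<And>g. g \<in> carrier G \<Longrightarrow> h g \<in> hT g" and hq: "\<And>g. g \<in> carrier G \<Longrightarrow> sq g (h g) (h (inv\<^bsub>G\<^esub> g))"
    by (rule square_choice) blast
  \<comment> \<open>Depending only on the quotient of the two labels, \<open>H\<close> is invariant
    under translation; the shifts inherit this invariance.\<close>
  define H where "H i j = h (inv\<^bsub>G\<^esub> fst i \<otimes>\<^bsub>G\<^esub> fst j)" for i j :: "'a pathclass \<times> bool"
  define W where "W = carrier G \<times> {False}"
  define pr where "pr v = (fst v, True)" for v :: "'a pathclass \<times> bool"
  have WE: "\<exists>g\<in>carrier G. i = lo g" if "i \<in> W" for i using that by (auto simp: W_def lo_def)
  have loW: "lo g \<in> W" if "g \<in> carrier G" for g using that by (simp add: W_def lo_def)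
  have prlo: "pr (lo g) = hi g" for g by (simp add: pr_def lo_def hi_def)
  interpret P: prism_comparison "carrier G \<times> UNIV" T "based M m0" "Q_op M" "sbG M" "TetG M m0" D "pi2 M m0" "add_sphere M" "flipG M m0" act W pr NN H
  proof (unfold_locales, goal_cases)
    case (1 i) then show ?case by (auto simp: W_def)
  next
    case (2 i) then show ?case by (auto simp: W_def pr_def)
  next
    case (3 i j)
    then obtain g k where "g \<in> carrier G" "k \<in> carrier G" "i = lo g" "j = lo k" using WE by blast
    then show ?case using NN_T prlo by simp
  next
    case (4 i j)
    then obtain g k where g: "g \<in> carrier G" "k \<in> carrier G" "i = lo g" "j = lo k" using WE by blast
    then have "H i j \<in> hT (inv\<^bsub>G\<^esub> g \<otimes>\<^bsub>G\<^esub> k)" using hT by (simp add: H_def)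
    also have "\<dots> = T (tr g (lo \<one>\<^bsub>G\<^esub>)) (tr g (hi \<one>\<^bsub>G\<^esub>)) (tr g (hi (inv\<^bsub>G\<^esub> g \<otimes>\<^bsub>G\<^esub> k)))"
      by (rule T_tr[symmetric]) (use g in simp_all)
    also have "\<dots> = T i (pr i) (pr j)" using g by (simp add: prlo)
    finally show ?case .
  next
    case (5 i j)
    then obtain g k where g: "g \<in> carrier G" "k \<in> carrier G" "i = lo g" "j = lo k" using WE by blast
    define u where "u = inv\<^bsub>G\<^esub> g \<otimes>\<^bsub>G\<^esub> k"
    have u: "u \<in> carrier G" "g \<otimes>\<^bsub>G\<^esub> u = k" "inv\<^bsub>G\<^esub> u = inv\<^bsub>G\<^esub> k \<otimes>\<^bsub>G\<^esub> g" using g by (simp_all add: u_def gsimps)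
    have "NN (lo \<one>\<^bsub>G\<^esub>) (lo u) = NN i j" "NN (lo u) (lo \<one>\<^bsub>G\<^esub>) = NN j i"
      using NN_tr[of g "lo \<one>\<^bsub>G\<^esub>" "lo u"] NN_tr[of g "lo u" "lo \<one>\<^bsub>G\<^esub>"] g u by simp_all
    moreover have "H i j = h u" "H j i = h (inv\<^bsub>G\<^esub> u)" using g u(3) by (simp_all add: H_def u_def)
    ultimately show ?case using hq[OF u(1)] unfolding sq_def by simp
  next
    case (6 i v)
    then obtain g where g: "g \<in> carrier G" "i = lo g" using WE by blast
    \<comment> \<open>The vertical edge carries the loop of the trivial class, so moving a sphere
      along it changes nothing.\<close>
    have "act (hi g) (lo g) v = act (lo g) (lo g) v" unfolding lo_def hi_def
      using act_pi1_action[OF g(1) g(1) 6(2)] by simp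
    then show ?case using act_id[of "lo g" v] g 6(2) by (simp add: prlo)
  qed
  have xF: "triangle_choice M m0 (sec False) x" and xT: "triangle_choice M m0 (sec True) x'" using x x' by (simp_all add: sec_def)
  have fW: "fst i \<in> carrier G" "i = (fst i, False)" if "i \<in> W" for i using that by (auto simp: W_def)
  have X: "Xf x i j k \<in> T i j k" if W: "i \<in> W" "j \<in> W" "k \<in> W" for i j k
    by (subst (1 2) fW(2)[OF W(1)], subst (1 2) fW(2)[OF W(2)], subst (1 2) fW(2)[OF W(3)])
      (rule Xf_props(1)[OF xF fW(1)[OF W(1)] fW(1)[OF W(2)] fW(1)[OF W(3)]])
  have X': "Xf x' (pr i) (pr j) (pr k) \<in> T (pr i) (pr j) (pr k)" if W: "i \<in> W" "j \<in> W" "k \<in> W" for i j k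
    unfolding pr_def by (rule Xf_props(1)[OF xT fW(1)[OF W(1)] fW(1)[OF W(2)] fW(1)[OF W(3)]])
  define sh where "sh g1 g2 g3 = P.shift (Xf x) (Xf x') (lo g1) (lo g2) (lo g3)" for g1 g2 g3
  have shc: "sh g1 g2 g3 \<in> carrier (pi2 M m0)" if "g1 \<in> carrier G" "g2 \<in> carrier G" "g3 \<in> carrier G" for g1 g2 g3
    unfolding sh_def by (rule P.shift(1)[of "Xf x" "Xf x'", OF X X' loW[OF that(1)] loW[OF that(2)] loW[OF that(3)]])
  have sh_tr: "sh (u \<otimes>\<^bsub>G\<^esub> g1) (u \<otimes>\<^bsub>G\<^esub> g2) (u \<otimes>\<^bsub>G\<^esub> g3) = sh g1 g2 g3"
    if u: "u \<in> carrier G" and g: "g1 \<in> carrier G" "g2 \<in> carrier G" "g3 \<in> carrier G" for u g1 g2 g3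
  proof -
    have Ttr: "T (lo (u \<otimes>\<^bsub>G\<^esub> g1)) (lo (u \<otimes>\<^bsub>G\<^esub> g2)) (hi (u \<otimes>\<^bsub>G\<^esub> g3)) = T (lo g1) (lo g2) (hi g3)"
      "T (lo (u \<otimes>\<^bsub>G\<^esub> g1)) (hi (u \<otimes>\<^bsub>G\<^esub> g2)) (hi (u \<otimes>\<^bsub>G\<^esub> g3)) = T (lo g1) (hi g2) (hi g3)"
      using T_tr[OF u, of "lo g1" "lo g2" "hi g3"] T_tr[OF u, of "lo g1" "hi g2" "hi g3"] g by simp_all
    have Ntr: "NN (lo (u \<otimes>\<^bsub>G\<^esub> a)) (lo (u \<otimes>\<^bsub>G\<^esub> b)) = NN (lo a) (lo b)" if "a \<in> carrier G" "b \<in> carrier G" for a b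
      using NN_tr[OF u, of "lo a" "lo b"] that by simp
    have Htr: "H (lo (u \<otimes>\<^bsub>G\<^esub> a)) (lo (u \<otimes>\<^bsub>G\<^esub> b)) = H (lo a) (lo b)" if "a \<in> carrier G" "b \<in> carrier G" for a b
      unfolding H_def using that u by (simp add: gsimps)
    have Xtr: "Xf x (lo (u \<otimes>\<^bsub>G\<^esub> g1)) (lo (u \<otimes>\<^bsub>G\<^esub> g2)) (lo (u \<otimes>\<^bsub>G\<^esub> g3)) = Xf x (lo g1) (lo g2) (lo g3)"
      "Xf x' (hi (u \<otimes>\<^bsub>G\<^esub> g1)) (hi (u \<otimes>\<^bsub>G\<^esub> g2)) (hi (u \<otimes>\<^bsub>G\<^esub> g3)) = Xf x' (hi g1) (hi g2) (hi g3)"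
      unfolding lo_def hi_def by (rule Xf_translate[OF u g])+
    show ?thesis unfolding sh_def P.shift_def P.push_def prlo Xtr Ttr Ntr[OF g(2,3)] Ntr[OF g(1,3)] Ntr[OF g(1,2)]
        Htr[OF g(2,3)] Htr[OF g(1,3)] Htr[OF g(1,2)] ..
  qed
  have sh_sb: "sh g1 g3 g2 = inv\<^bsub>pi2 M m0\<^esub> sh g1 g2 g3" if g: "g1 \<in> carrier G" "g2 \<in> carrier G" "g3 \<in> carrier G" for g1 g2 g3
    unfolding sh_def
    by (rule P.shift_sb[of "Xf x" "Xf x'", OF X X' loW[OF g(1)] loW[OF g(2)] loW[OF g(3)]])
      (simp_all add: Xf_sb[OF xF g] Xf_sb[OF xT g] lo_def pr_def)
  have sh_sa: "sh g2 g1 g3 = inv\<^bsub>pi2 M m0\<^esub> pi1_action M m0 (inv\<^bsub>G\<^esub> g2 \<otimes>\<^bsub>G\<^esub> g1) (sh g1 g2 g3)"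
    if g: "g1 \<in> carrier G" "g2 \<in> carrier G" "g3 \<in> carrier G" for g1 g2 g3
  proof -
    have "sh g2 g1 g3 = inv\<^bsub>pi2 M m0\<^esub> act (pr (lo g2)) (pr (lo g1)) (sh g1 g2 g3)" unfolding sh_def
      by (rule P.shift_sa[of "Xf x" "Xf x'", OF X X' loW[OF g(1)] loW[OF g(2)] loW[OF g(3)]])
        (simp_all add: Xf_props(2)[OF xF g] Xf_props(2)[OF xT g] lo_def pr_def)
    then show ?thesis using act_pi1_action[OF g(2,1) shc[OF g]] by (simp add: pr_def)
  qed
  \<comment> \<open>The shift on the vertices 1, p, pq. The relations of \<open>CS2\<close> are its
    behaviour under the two transpositions, the first one followed by a translation.\<close>
  define \<sigma> where "\<sigma> = (\<lambda>(p, q)\<in>carrier G \<times> carrier G. sh \<one>\<^bsub>G\<^esub> p (p \<otimes>\<^bsub>G\<^esub> q))"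
  have \<sigma>: "\<sigma> (p, q) = sh \<one>\<^bsub>G\<^esub> p (p \<otimes>\<^bsub>G\<^esub> q)" if "p \<in> carrier G" "q \<in> carrier G" for p q using that by (simp add: \<sigma>_def)
  have \<sigma>u: "\<sigma> (p, q) = sh u (u \<otimes>\<^bsub>G\<^esub> p) (u \<otimes>\<^bsub>G\<^esub> p \<otimes>\<^bsub>G\<^esub> q)" if "u \<in> carrier G" "p \<in> carrier G" "q \<in> carrier G" for u p q
    using sh_tr[OF that(1) G.one_closed that(2), of "p \<otimes>\<^bsub>G\<^esub> q"] \<sigma>[OF that(2,3)] that by (simp add: gsimps)
  have "\<sigma> \<in> CS2 G (pi2 M m0) (pi1_action M m0)"
    unfolding CS2_def
  proof (intro CollectI conjI ballI)
    show "\<sigma> \<in> carrier (C2 G (pi2 M m0))" unfolding \<sigma>_def by (intro C2_restrict) (simp add: shc)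
    fix p q assume V: "p \<in> carrier G" "q \<in> carrier G"
    have "\<sigma> (inv\<^bsub>G\<^esub> p, p \<otimes>\<^bsub>G\<^esub> q) = sh p \<one>\<^bsub>G\<^esub> (p \<otimes>\<^bsub>G\<^esub> q)" using \<sigma>u[OF V(1), of "inv\<^bsub>G\<^esub> p" "p \<otimes>\<^bsub>G\<^esub> q"] V by (simp add: gsimps)
    then show "\<sigma> (p, q) = inv\<^bsub>pi2 M m0\<^esub> pi1_action M m0 p (\<sigma> (inv\<^bsub>G\<^esub> p, p \<otimes>\<^bsub>G\<^esub> q))"
      using sh_sa[OF V(1) G.one_closed, of "p \<otimes>\<^bsub>G\<^esub> q"] V unfolding \<sigma>[OF V] by simp
    have "\<sigma> (p \<otimes>\<^bsub>G\<^esub> q, inv\<^bsub>G\<^esub> q) = sh \<one>\<^bsub>G\<^esub> (p \<otimes>\<^bsub>G\<^esub> q) p" using \<sigma>[of "p \<otimes>\<^bsub>G\<^esub> q" "inv\<^bsub>G\<^esub> q"] V by (simp add: gsimps)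
    then show "\<sigma> (p, q) = inv\<^bsub>pi2 M m0\<^esub> \<sigma> (p \<otimes>\<^bsub>G\<^esub> q, inv\<^bsub>G\<^esub> q)"
      using sh_sb[OF G.one_closed, of "p \<otimes>\<^bsub>G\<^esub> q" p] V unfolding \<sigma>[OF V] by simp
  qed
  moreover have "alpha_cochain M m0 x (p, q, r) = alpha_cochain M m0 x' (p, q, r) \<otimes>\<^bsub>pi2 M m0\<^esub> coboundary2 G (pi2 M m0) (pi1_action M m0) \<sigma> (p, q, r)"
    if V: "p \<in> carrier G" "q \<in> carrier G" "r \<in> carrier G" for p q r
  proof -
    define q' r' where "q' = p \<otimes>\<^bsub>G\<^esub> q" and "r' = q' \<otimes>\<^bsub>G\<^esub> r"
    have C: "q' \<in> carrier G" "r' \<in> carrier G" using V by (simp_all add: q'_def r'_def)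
    have d: "cf x False \<one>\<^bsub>G\<^esub> p q' r' = cf x' True \<one>\<^bsub>G\<^esub> p q' r' \<otimes>\<^bsub>pi2 M m0\<^esub>
       (act (pr (lo \<one>\<^bsub>G\<^esub>)) (pr (lo p)) (sh p q' r') \<otimes>\<^bsub>pi2 M m0\<^esub> inv\<^bsub>pi2 M m0\<^esub> sh \<one>\<^bsub>G\<^esub> q' r' \<otimes>\<^bsub>pi2 M m0\<^esub> sh \<one>\<^bsub>G\<^esub> p r' \<otimes>\<^bsub>pi2 M m0\<^esub> inv\<^bsub>pi2 M m0\<^esub> sh \<one>\<^bsub>G\<^esub> p q')"
      using P.defect_shift[of "Xf x" "Xf x'", OF X X' loW[OF G.one_closed] loW[OF V(1)] loW[OF C(1)] loW[OF C(2)]]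
      unfolding cf_def sh_def[symmetric] by (simp add: lo_def pr_def)
    have "act (pr (lo \<one>\<^bsub>G\<^esub>)) (pr (lo p)) (sh p q' r') = pi1_action M m0 p (sh p q' r')"
      using act_pi1_action[OF G.one_closed V(1) shc[OF V(1) C], of True True] V by (simp add: pr_def)
    moreover have "coboundary2 G (pi2 M m0) (pi1_action M m0) \<sigma> (p, q, r) = pi1_action M m0 p (sh p q' r') \<otimes>\<^bsub>pi2 M m0\<^esub> inv\<^bsub>pi2 M m0\<^esub> sh \<one>\<^bsub>G\<^esub> q' r'
      \<otimes>\<^bsub>pi2 M m0\<^esub> sh \<one>\<^bsub>G\<^esub> p r' \<otimes>\<^bsub>pi2 M m0\<^esub> inv\<^bsub>pi2 M m0\<^esub> sh \<one>\<^bsub>G\<^esub> p q'"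
      using \<sigma>u[OF V] \<sigma>[of q' r] \<sigma>[of p "q \<otimes>\<^bsub>G\<^esub> r"] \<sigma>[of p q] V by (simp add: coboundary2_def q'_def r'_def gsimps)
    ultimately show ?thesis using d unfolding alpha_cf[OF xF V] alpha_cf[OF xT V] q'_def[symmetric] r'_def[symmetric] by simp
  qed
  ultimately show thesis by (rule that)
qed

text \<open>One inclusion of cosets needs only that coboundaries multiply; the other is the same
  statement with the two choices exchanged.\<close>

lemma HS3_class_subset:
  assumes x: "triangle_choice M m0 s x" and x': "triangle_choice M m0 s' x'"
  shows "HS3_class G (pi2 M m0) (pi1_action M m0) (alpha_cochain M m0 x) \<subseteq> HS3_class G (pi2 M m0) (pi1_action M m0) (alpha_cochain M m0 x')"
proof
  let ?d = "coboundary2 G (pi2 M m0) (pi1_action M m0)"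
  have mZ: "a \<otimes>\<^bsub>ZS3 G (pi2 M m0) (pi1_action M m0)\<^esub> b = (\<lambda>p\<in>carrier G \<times> carrier G \<times> carrier G. a p \<otimes>\<^bsub>pi2 M m0\<^esub> b p)" for a b
    by (simp add: ZS3_def C3_def)
  have xT: "triangle_choice M m0 (sec True) x'" using x' by (simp add: sec_def)
  obtain \<sigma> where \<sigma>: "\<sigma> \<in> CS2 G (pi2 M m0) (pi1_action M m0)"
    and e: "\<And>p q r. p \<in> carrier G \<Longrightarrow> q \<in> carrier G \<Longrightarrow> r \<in> carrier G \<Longrightarrow>
      alpha_cochain M m0 x (p, q, r) = alpha_cochain M m0 x' (p, q, r) \<otimes>\<^bsub>pi2 M m0\<^esub> ?d \<sigma> (p, q, r)"
    by (rule alpha_cohomologous[OF x x']) blast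
  fix \<beta> assume "\<beta> \<in> HS3_class G (pi2 M m0) (pi1_action M m0) (alpha_cochain M m0 x)"
  then obtain \<tau> where \<tau>: "\<tau> \<in> CS2 G (pi2 M m0) (pi1_action M m0)"
    and \<beta>: "\<beta> = ?d \<tau> \<otimes>\<^bsub>ZS3 G (pi2 M m0) (pi1_action M m0)\<^esub> alpha_cochain M m0 x"
    unfolding HS3_class_def r_coset_def BS3_def by blast
  define \<rho> where "\<rho> = (\<lambda>p\<in>carrier G \<times> carrier G. \<tau> p \<otimes>\<^bsub>pi2 M m0\<^esub> \<sigma> p)"
  have "\<beta> = ?d \<rho> \<otimes>\<^bsub>ZS3 G (pi2 M m0) (pi1_action M m0)\<^esub> alpha_cochain M m0 x'"
    unfolding \<beta> mZ
  proof (rule restrict_ext, clarify)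
    fix p q r assume V: "p \<in> carrier G" "q \<in> carrier G" "r \<in> carrier G"
    show "?d \<tau> (p, q, r) \<otimes>\<^bsub>pi2 M m0\<^esub> alpha_cochain M m0 x (p, q, r) = ?d \<rho> (p, q, r) \<otimes>\<^bsub>pi2 M m0\<^esub> alpha_cochain M m0 x' (p, q, r)"
      unfolding e[OF V] \<rho>_def coboundary2_mult[OF \<tau> \<sigma> V]
      using coboundary2_closed[OF \<tau> V] coboundary2_closed[OF \<sigma> V] alpha_closed[OF xT V] by (simp add: A.m_ac)
  qed
  moreover have "\<rho> \<in> CS2 G (pi2 M m0) (pi1_action M m0)" unfolding \<rho>_def by (rule CS2_mult[OF \<tau> \<sigma>])
  ultimately show "\<beta> \<in> HS3_class G (pi2 M m0) (pi1_action M m0) (alpha_cochain M m0 x')"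
    unfolding HS3_class_def r_coset_def BS3_def by blast
qed

end

theorem corollary4p4:
  fixes M :: "'a::topological_space set" and m0 :: 'a
  assumes "topological_manifold (top_of_set M)"
    and "m0 \<in> M"
    and "\<forall>g\<in>carrier (pi1 M m0). group.ord (pi1 M m0) g \<noteq> 2 \<and> group.ord (pi1 M m0) g \<noteq> 3"
  shows "(\<forall>s x. loop_section M m0 s \<and> triangle_choice M m0 s x \<longrightarrow>
            alpha_cochain M m0 x \<in> carrier (ZS3 (pi1 M m0) (pi2 M m0) (pi1_action M m0)) \<and>
            HS3_class (pi1 M m0) (pi2 M m0) (pi1_action M m0) (alpha_cochain M m0 x)
              \<in> carrier (HS3 (pi1 M m0) (pi2 M m0) (pi1_action M m0))) \<and>
         (\<forall>s x s' x'. loop_section M m0 s \<and> triangle_choice M m0 s x \<and>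
                      loop_section M m0 s' \<and> triangle_choice M m0 s' x' \<longrightarrow>
            HS3_class (pi1 M m0) (pi2 M m0) (pi1_action M m0) (alpha_cochain M m0 x) =
            HS3_class (pi1 M m0) (pi2 M m0) (pi1_action M m0) (alpha_cochain M m0 x'))"
proof (intro conjI allI impI; elim conjE)
  fix s x assume s: "loop_section M m0 s" and x: "triangle_choice M m0 s x"
  \<comment> \<open>A single choice is the case of two equal sections.\<close>
  interpret two_sections M m0 s s by unfold_locales (use assms s in auto)
  have xs: "triangle_choice M m0 (sec False) x" using x by (simp add: sec_def)
  show *: "alpha_cochain M m0 x \<in> carrier (ZS3 (pi1 M m0) (pi2 M m0) (pi1_action M m0))"
    by (rule alpha_ZS3[OF xs])
  then show "HS3_class (pi1 M m0) (pi2 M m0) (pi1_action M m0) (alpha_cochain M m0 x)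
              \<in> carrier (HS3 (pi1 M m0) (pi2 M m0) (pi1_action M m0))"
    unfolding HS3_def FactGroup_def HS3_class_def RCOSETS_def by auto
next
  fix s x s' x' assume s: "loop_section M m0 s" and x: "triangle_choice M m0 s x"
    and s': "loop_section M m0 s'" and x': "triangle_choice M m0 s' x'"
  interpret A: two_sections M m0 s s' by unfold_locales (use assms s s' in auto)
  interpret B: two_sections M m0 s' s by unfold_locales (use assms s s' in auto)
  show "HS3_class (pi1 M m0) (pi2 M m0) (pi1_action M m0) (alpha_cochain M m0 x) =
            HS3_class (pi1 M m0) (pi2 M m0) (pi1_action M m0) (alpha_cochain M m0 x')"
    using A.HS3_class_subset[OF x x'] B.HS3_class_subset[OF x' x] by (rule subset_antisym)
qed

end
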